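(* Let $f:S^n\to S^m$ be an LOMSE of $(n,p,k)$-type with $(n,p)=(3,2)$, $k\ge4$ or $(n,p)=(5,4)$, $k\ge6$. Then there exist infinitely many analytic solutions to the Dirichlet problem (for the minimal surface system over the unit disk $\mathbb D^{n+1}$) with boundary data $f_{\varphi_0}:=\varphi_0\cdot f$, where $\varphi_0=\sqrt{\frac{p-n\lambda^{-2}}{n-p}}$ and $\lambda=\sqrt{\frac{k(k+n-1)}{p}}$.
   Context: $S^d\subset\mathbb R^{d+1}$ is the unit sphere with canonical metric $g_d$; $\mathbb D^{n+1}\subset\mathbb R^{n+1}$ is the unit Euclidean disk, with boundary $S^n$. Singular values of $(f_* )_x:(T_xS^n,g_n)\to(T_{f(x)}S^m,g_m)$ are counted with multiplicity. A smooth map $f:S^n\to S^m$ is a Lawson-Osserman map (LOM) if there is $\theta\in(0,\pi/2)$ such that $M_{f,\theta}:=\{(\cos\theta\cdot x,\sin\theta\cdot f(x)):x\in S^n\}$ is a minimal submanifold of $S^{n+m+1}$. An LOMSE is an LOM that is not totally geodesic (as a map $(S^n,g_n)\to(S^m,g_m)$) and such that, for each $x$, all nonzero singular values of $(f_* )_x$ are equal. It is of $(n,p,k)$-type if its nonzero singular value $\lambda$ is constant with constant multiplicity $p$ and all components $f_1,\dots,f_{m+1}$ of $f$ in $\mathbb R^{m+1}$ are spherical harmonics of degree $k\ge2$ (every LOMSE is of such a type); then $\lambda=\sqrt{k(k+n-1)/p}$. The number $\varphi_0$ equals $\tan\theta$ for the unique $\theta\in(0,\pi/2)$ with $M_{f,\theta}$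 minimal. Dirichlet problem over $\Omega=\mathbb D^{d_1}$ with boundary data $\phi:\partial\Omega\to\mathbb R^{d_2}$ (here $d_1=n+1$, $d_2=m+1$, $\phi=\varphi_0 f$): find $F=(F^1,\dots,F^{d_2})\in C^0(\overline\Omega;\mathbb R^{d_2})\cap \mathrm{Lip}(\Omega;\mathbb R^{d_2})$ that is a weak solution of the minimal surface system $$\sum_{i=1}^{d_1}\frac{\partial}{\partial x^i}(\sqrt g\,g^{ij})=0\ (1\le j\le d_1),\qquad \sum_{i,j=1}^{d_1}\frac{\partial}{\partial x^i}\Big(\sqrt g\,g^{ij}\frac{\partial F^\alpha}{\partial x^j}\Big)=0\ (1\le\alpha\le d_2),$$ where $g_{ij}=\delta_{ij}+\sum_\alpha\frac{\partial F^\alpha}{\partial x^i}\frac{\partial F^\alpha}{\partial x^j}$, $(g^{ij})=(g_{ij})^{-1}$, $g=\det(g_{ij})$, with $F|_{\partial\Omega}=\phi$. A solution is analytic if $F$ is real analytic in $\Omega$. *)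

theory Defs
  imports "HOL-Analysis.Analysis"
begin

section \<open>Smooth and real analytic functions\<close>

text \<open>Only used with a finite-dimensional domain and \<open>S\<close> open, where this is the usual \<open>C\<^sup>k\<close>:
  all directional derivatives up to order \<open>k\<close> exist and are continuous.\<close>

primrec Ck_on :: "nat \<Rightarrow> 'a::euclidean_space set \<Rightarrow> ('a \<Rightarrow> 'b::real_normed_vector) \<Rightarrow> bool" where
  "Ck_on 0 S f \<longleftrightarrow> continuous_on S f"
| "Ck_on (Suc k) S f \<longleftrightarrow>
     (\<forall>x\<in>S. f differentiable (at x)) \<and>
     (\<forall>v. Ck_on k S (\<lambda>x. frechet_derivative f (at x) v))"

definition smooth_on :: "'a::euclidean_space set \<Rightarrow> ('a \<Rightarrow> 'b::real_normed_vector) \<Rightarrow> bool" where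
  "smooth_on S f \<longleftrightarrow> (\<forall>k. Ck_on k S f)"

text \<open>Local expansion in a power series; a multi-index is a function \<open>\<nu> :: 'a \<Rightarrow> nat\<close>.\<close>

definition real_analytic_on :: "(real^'a::finite) set \<Rightarrow> (real^'a \<Rightarrow> real^'b::finite) \<Rightarrow> bool" where
  "real_analytic_on S F \<longleftrightarrow>
     (\<forall>x0\<in>S. \<exists>r>0. \<exists>c :: ('a \<Rightarrow> nat) \<Rightarrow> real^'b. \<forall>x\<in>ball x0 r.
        ((\<lambda>\<nu>. (\<Prod>i\<in>UNIV. (x $ i - x0 $ i) ^ \<nu> i) *\<^sub>R c \<nu>) has_sum F x) UNIV)"


section \<open>Minimal submanifolds of the unit sphere\<close>

text \<open>Embedded submanifolds of Euclidean space, described by slice charts.\<close>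

definition submanifold :: "nat \<Rightarrow> 'c::euclidean_space set \<Rightarrow> bool" where
  "submanifold d M \<longleftrightarrow>
     (\<forall>q\<in>M. \<exists>W (\<Phi> :: 'c \<Rightarrow> 'c) \<Psi> L.
        open W \<and> q \<in> W \<and> open (\<Phi> ` W) \<and> smooth_on W \<Phi> \<and> smooth_on (\<Phi> ` W) \<Psi> \<and>
        (\<forall>y\<in>W. \<Psi> (\<Phi> y) = y) \<and>
        subspace L \<and> dim L = d \<and> \<Phi> ` (W \<inter> M) = \<Phi> ` W \<inter> L)"

definition smooth_curve_at :: "'c::euclidean_space set \<Rightarrow> 'c \<Rightarrow> (real \<Rightarrow> 'c) \<Rightarrow> bool" where
  "smooth_curve_at M q \<gamma> \<longleftrightarrow>
     \<gamma> 0 = q \<and> (\<exists>e>0. smooth_on {-e<..<e} \<gamma> \<and> \<gamma> ` {-e<..<e} \<subseteq> M)"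

definition tangent_space :: "'c::euclidean_space set \<Rightarrow> 'c \<Rightarrow> 'c set" where
  "tangent_space M q = {vector_derivative \<gamma> (at 0) | \<gamma>. smooth_curve_at M q \<gamma>}"

text \<open>The normal space of \<open>M\<close> at \<open>q\<close> inside the tangent space of the unit sphere at \<open>q\<close>.\<close>

definition normal_space :: "'c::euclidean_space set \<Rightarrow> 'c \<Rightarrow> 'c set" where
  "normal_space M q = {\<nu>. \<nu> \<bullet> q = 0 \<and> (\<forall>v\<in>tangent_space M q. \<nu> \<bullet> v = 0)}"

text \<open>The second fundamental form \<open>B(v, v)\<close> of \<open>M\<close> in the unit sphere: the normal part of the
  acceleration of any curve in \<open>M\<close> with velocity \<open>v\<close>. (The nearest point of the subspace
  \<open>normal_space M q\<close> is the orthogonal projection.) By tensoriality the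
  value does not depend on the curve, whence the definite description.\<close>

definition second_fundamental_form :: "'c::euclidean_space set \<Rightarrow> 'c \<Rightarrow> 'c \<Rightarrow> 'c" where
  "second_fundamental_form M q v =
     (THE h. \<exists>\<gamma>. smooth_curve_at M q \<gamma> \<and> vector_derivative \<gamma> (at 0) = v \<and>
        h = closest_point (normal_space M q)
              (vector_derivative (\<lambda>s. vector_derivative \<gamma> (at s)) (at 0)))"

text \<open>The trace of the second fundamental form (not divided by the dimension), which is the same
  for every orthonormal basis of the tangent space.\<close>

definition mean_curvature :: "'c::euclidean_space set \<Rightarrow> 'c \<Rightarrow> 'c" where
  "mean_curvature M q =
     (THE H. \<exists>B. B \<subseteq> tangent_space M q \<and> pairwise orthogonal B \<and> (\<forall>e\<in>B. norm e = 1) \<and>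
        span B = tangent_space M q \<and> H = (\<Sum>e\<in>B. second_fundamental_form M q e))"

definition minimal_submanifold_of_sphere :: "nat \<Rightarrow> 'c::euclidean_space set \<Rightarrow> bool" where
  "minimal_submanifold_of_sphere d M \<longleftrightarrow>
     M \<subseteq> sphere 0 1 \<and> submanifold d M \<and> (\<forall>q\<in>M. mean_curvature M q = 0)"


section \<open>Maps between unit spheres\<close>

text \<open>A map of spheres is a function \<open>f\<close> between the ambient spaces of which only the values on
  \<open>sphere 0 1\<close> matter. Smoothness and the differential are expressed through the extension of
  degree zero, \<open>y \<mapsto> f (y / norm y)\<close>, where \<open>sgn y = y / norm y\<close>. On vectors orthogonal to \<open>x\<close> the
  derivative of the extension at \<open>x\<close> is the differential of \<open>f\<close> at \<open>x\<close>.\<close>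

definition smooth_sphere_map :: "(real^'a::finite \<Rightarrow> real^'b::finite) \<Rightarrow> bool" where
  "smooth_sphere_map f \<longleftrightarrow>
     f ` sphere 0 1 \<subseteq> sphere 0 1 \<and> smooth_on (- {0}) (\<lambda>y. f (sgn y))"

definition sphere_differential ::
    "(real^'a::finite \<Rightarrow> real^'b::finite) \<Rightarrow> real^'a \<Rightarrow> real^'a \<Rightarrow> real^'b" where
  "sphere_differential f x = frechet_derivative (\<lambda>y. f (sgn y)) (at x)"

definition sphere_tangent :: "real^'a::finite \<Rightarrow> (real^'a) set" where
  "sphere_tangent x = {v. v \<bullet> x = 0}"

text \<open>The space of \<open>v\<close> in \<open>T\<^sub>x\<close> with \<open>A\<^sup>* A v = \<sigma>\<^sup>2 v\<close>, where \<open>A\<close> is the differential of \<open>f\<close> at \<open>x\<close>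
  restricted to \<open>T\<^sub>x\<close>. Its dimension is the multiplicity of \<open>\<sigma>\<close> as a singular value.\<close>

definition singular_space ::
    "(real^'a::finite \<Rightarrow> real^'b::finite) \<Rightarrow> real^'a \<Rightarrow> real \<Rightarrow> (real^'a) set" where
  "singular_space f x \<sigma> =
     {v \<in> sphere_tangent x. \<forall>w\<in>sphere_tangent x.
        sphere_differential f x v \<bullet> sphere_differential f x w = \<sigma>\<^sup>2 * (v \<bullet> w)}"

definition singular_values :: "(real^'a::finite \<Rightarrow> real^'b::finite) \<Rightarrow> real^'a \<Rightarrow> real set" where
  "singular_values f x = {\<sigma>. \<sigma> \<ge> 0 \<and> singular_space f x \<sigma> \<noteq> {0}}"

text \<open>Levi-Civita derivative on the unit sphere of a tangent field \<open>V\<close> along the curve \<open>c\<close>.\<close>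

definition sphere_covariant_derivative ::
    "(real \<Rightarrow> real^'a::finite) \<Rightarrow> (real \<Rightarrow> real^'a) \<Rightarrow> real \<Rightarrow> real^'a" where
  "sphere_covariant_derivative c V t =
     vector_derivative V (at t) - (vector_derivative V (at t) \<bullet> c t) *\<^sub>R c t"

text \<open>\<open>\<nabla>(df) = 0\<close>: the differential commutes with covariant differentiation along curves.\<close>

definition totally_geodesic_map :: "(real^'a::finite \<Rightarrow> real^'b::finite) \<Rightarrow> bool" where
  "totally_geodesic_map f \<longleftrightarrow>
     (\<forall>c V. smooth_on UNIV c \<and> smooth_on UNIV V \<and>
        (\<forall>t. c t \<in> sphere 0 1 \<and> V t \<in> sphere_tangent (c t)) \<longrightarrow>
        (\<forall>t. sphere_covariant_derivative (f \<circ> c) (\<lambda>s. sphere_differential f (c s) (V s)) t =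
             sphere_differential f (c t) (sphere_covariant_derivative c V t)))"

definition laplacian :: "(real^'a::finite \<Rightarrow> real) \<Rightarrow> real^'a \<Rightarrow> real" where
  "laplacian P x =
     (\<Sum>b\<in>Basis. frechet_derivative (\<lambda>y. frechet_derivative P (at y) b) (at x) b)"

text \<open>The zero function counts as a spherical harmonic of every degree, so that some (not all)
  components of a map into a sphere may vanish identically.\<close>

definition spherical_harmonic :: "nat \<Rightarrow> (real^'a::finite \<Rightarrow> real) \<Rightarrow> bool" where
  "spherical_harmonic k h \<longleftrightarrow>
     (\<exists>P. real_polynomial_function P \<and> (\<forall>s x. P (s *\<^sub>R x) = s ^ k * P x) \<and>
        (\<forall>x. laplacian P x = 0) \<and> (\<forall>x\<in>sphere 0 1. h x = P x))"


section \<open>Lawson-Osserman maps\<close>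

text \<open>The norm on a product of Euclidean spaces is the Euclidean one, so \<open>(real^'a) \<times> (real^'b)\<close> with
  \<open>CARD('a) = n + 1\<close> and \<open>CARD('b) = m + 1\<close> is Euclidean space of dimension \<open>n + m + 2\<close>.\<close>

definition LO_submanifold ::
    "(real^'a::finite \<Rightarrow> real^'b::finite) \<Rightarrow> real \<Rightarrow> ((real^'a) \<times> (real^'b)) set" where
  "LO_submanifold f \<theta> = (\<lambda>x. (cos \<theta> *\<^sub>R x, sin \<theta> *\<^sub>R f x)) ` sphere 0 1"

definition LOM :: "nat \<Rightarrow> (real^'a::finite \<Rightarrow> real^'b::finite) \<Rightarrow> bool" where
  "LOM n f \<longleftrightarrow>
     smooth_sphere_map f \<and>
     (\<exists>\<theta>\<in>{0<..<pi/2}. minimal_submanifold_of_sphere n (LO_submanifold f \<theta>))"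

definition LOMSE :: "nat \<Rightarrow> (real^'a::finite \<Rightarrow> real^'b::finite) \<Rightarrow> bool" where
  "LOMSE n f \<longleftrightarrow>
     LOM n f \<and> \<not> totally_geodesic_map f \<and>
     (\<forall>x\<in>sphere 0 1. \<forall>\<sigma>\<in>singular_values f x - {0}. \<forall>\<tau>\<in>singular_values f x - {0}. \<sigma> = \<tau>)"

definition LOMSE_of_type :: "nat \<Rightarrow> nat \<Rightarrow> nat \<Rightarrow> (real^'a::finite \<Rightarrow> real^'b::finite) \<Rightarrow> bool" where
  "LOMSE_of_type n p k f \<longleftrightarrow>
     LOMSE n f \<and>
     (\<exists>\<sigma>. \<forall>x\<in>sphere 0 1.
        singular_values f x - {0} = {\<sigma>} \<and> dim (singular_space f x \<sigma>) = p) \<and>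
     k \<ge> 2 \<and> (\<forall>i. spherical_harmonic k (\<lambda>x. f x $ i))"


section \<open>The Dirichlet problem for the minimal surface system\<close>

definition partial_deriv :: "'a::finite \<Rightarrow> (real^'a \<Rightarrow> 'b::real_normed_vector) \<Rightarrow> real^'a \<Rightarrow> 'b" where
  "partial_deriv i F x = frechet_derivative F (at x) (axis i 1)"

definition graph_metric :: "(real^'a::finite \<Rightarrow> real^'b::finite) \<Rightarrow> real^'a \<Rightarrow> real^'a^'a" where
  "graph_metric F x =
     (\<chi> i j. (if i = j then 1 else 0) + partial_deriv i F x \<bullet> partial_deriv j F x)"

definition metric_coeff :: "(real^'a::finite \<Rightarrow> real^'b::finite) \<Rightarrow> 'a \<Rightarrow> 'a \<Rightarrow> real^'a \<Rightarrow> real" where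
  "metric_coeff F i j x =
     sqrt (det (graph_metric F x)) * matrix_inv (graph_metric F x) $ i $ j"

definition test_function :: "(real^'a::finite) set \<Rightarrow> (real^'a \<Rightarrow> real) \<Rightarrow> bool" where
  "test_function \<Omega> \<eta> \<longleftrightarrow>
     smooth_on UNIV \<eta> \<and> compact (closure {x. \<eta> x \<noteq> 0}) \<and> closure {x. \<eta> x \<noteq> 0} \<subseteq> \<Omega>"

text \<open>For Lipschitz \<open>F\<close> the derivatives exist almost everywhere, which is enough for the integrals.
  \<open>has_bochner_integral\<close> asserts integrability together with the value of the integral.\<close>

definition weak_minimal_surface_system ::
    "(real^'a::finite) set \<Rightarrow> (real^'a \<Rightarrow> real^'b::finite) \<Rightarrow> bool" where
  "weak_minimal_surface_system \<Omega> F \<longleftrightarrow>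
     (\<forall>\<eta>. test_function \<Omega> \<eta> \<longrightarrow>
        (\<forall>j. has_bochner_integral (lebesgue_on \<Omega>)
               (\<lambda>x. \<Sum>i\<in>UNIV. metric_coeff F i j x * partial_deriv i \<eta> x) 0) \<and>
        (\<forall>\<alpha>. has_bochner_integral (lebesgue_on \<Omega>)
               (\<lambda>x. \<Sum>i\<in>UNIV. \<Sum>j\<in>UNIV.
                  metric_coeff F i j x * (partial_deriv j F x $ \<alpha>) * partial_deriv i \<eta> x) 0))"

text \<open>Membership in \<open>extensional (closure \<Omega>)\<close> fixes the irrelevant values outside the closure of \<open>\<Omega>\<close>,
  so that distinct HOL functions are distinct solutions and counting them is meaningful.\<close>

definition dirichlet_solution ::
    "(real^'a::finite) set \<Rightarrow> (real^'a \<Rightarrow> real^'b::finite) \<Rightarrow> (real^'a \<Rightarrow> real^'b) \<Rightarrow> bool" where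
  "dirichlet_solution \<Omega> \<phi> F \<longleftrightarrow>
     F \<in> extensional (closure \<Omega>) \<and>
     continuous_on (closure \<Omega>) F \<and> (\<exists>L. L-lipschitz_on \<Omega> F) \<and>
     weak_minimal_surface_system \<Omega> F \<and>
     (\<forall>x\<in>frontier \<Omega>. F x = \<phi> x)"

end

theory Submission
  imports Defs "HOL-Complex_Analysis.Complex_Analysis"
begin

text \<open>Write \<open>f = P\<close> on the sphere with \<open>P\<close> homogeneous harmonic of degree \<open>k\<close> and look for solutions of the form
  \<open>F x = a (x \<bullet> x) P x\<close>. With \<open>L = lam\<^sup>2\<close>, \<open>b = k a + 2 z a'\<close> and \<open>z = x \<bullet> x\<close>, the minimal surface system becomes an
  ODE for \<open>(a, b)\<close> that is singular at \<open>z = 0\<close>. In the variables \<open>\<phi> = e\<^bsup>(k-1)t\<^esup> a (e\<^bsup>2t\<^esup>)\<close>,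
  \<open>\<eta> = e\<^bsup>(k-1)t\<^esup> b (e\<^bsup>2t\<^esup>)\<close> it is autonomous. A power series gives the solution with \<open>a 0 = 1\<close>, a Lyapunov function
  makes it global and convergent to the rest point \<open>(phi0, phi0)\<close>, which corresponds to the cone over the
  Lawson-Osserman submanifold. The hypotheses on \<open>(n, p, k)\<close> ensure that this rest point is a spiral
  focus, so \<open>\<phi>\<close> takes the value \<open>phi0\<close> infinitely often; rescaling at each of these times gives a
  different solution with boundary values \<open>phi0 f\<close>.\<close>

unbundle no vec_syntax
unbundle fps_syntax

section \<open>Formal power series systems\<close>

text \<open>With \<open>r = norm x\<close> the ansatz is \<open>F x = rho r f (x / r)\<close>; the
  two autonomous variables are \<open>rho / r\<close> and the derivative of \<open>rho\<close>, and
  \<open>t = ln r\<close>. Working with \<open>z\<close> instead of \<open>r\<close> is what makes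
  \<open>F\<close> analytic at the origin: a power series in \<open>x \<bullet> x\<close> is a power
  series in the coordinates. The reduction to an ODE rests on the spectrum of the Gram matrix of the
  gradients of \<open>P\<close>: the radial line, a \<open>p\<close>-dimensional singular space and
  a kernel. Hence metric, inverse and determinant of the graph are explicit in the identity, the
  Gram matrix and \<open>x x^T\<close>. The relation \<open>p L = k (k + p)\<close> is read off from
  the trace; it also cancels the pole of the ODE at \<open>z = 0\<close>. The obstacle is global:
  linearising at the rest point says nothing about an orbit that starts far away. Barbalat's lemma
  applied to the Lyapunov function gives convergence; then an exact second order equation for the
  deviation turns the absence of zeros into a Riccati equation without global solutions. The spiral
  condition amounts to \<open>k (k + 2) > 9\<close> for \<open>p = 2\<close> and to
  \<open>k (k + 4) > 50\<close> for \<open>p = 4\<close>.\<close>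

definition l1_bound :: "real \<Rightarrow> real \<Rightarrow> real fps \<Rightarrow> bool" where
  "l1_bound R K A \<longleftrightarrow> (\<forall>N. (\<Sum>j\<le>N. \<bar>A $ j\<bar> * R ^ j) \<le> K)"

definition fps_agree :: "nat \<Rightarrow> real fps \<Rightarrow> real fps \<Rightarrow> bool" where
  "fps_agree N A B \<longleftrightarrow> (\<forall>j\<le>N. A $ j = B $ j)"

lemma l1_bound_nonneg: "l1_bound R K A \<Longrightarrow> 0 \<le> K"
  unfolding l1_bound_def by (drule spec[of _ 0]) (auto intro: order_trans[OF abs_ge_zero])

lemma l1_bound_mono: "l1_bound R K A \<Longrightarrow> K \<le> K' \<Longrightarrow> l1_bound R K' A"
  unfolding l1_bound_def by (meson order_trans)

lemma l1_bound_add: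
  assumes "l1_bound R K A" "l1_bound R K' B" "0 \<le> R" shows "l1_bound R (K + K') (A + B)"
  unfolding l1_bound_def
proof
  fix N
  have "(\<Sum>j\<le>N. \<bar>(A + B) $ j\<bar> * R ^ j) \<le> (\<Sum>j\<le>N. \<bar>A $ j\<bar> * R ^ j + \<bar>B $ j\<bar> * R ^ j)"
    by (intro sum_mono) (use assms(3) in \<open>auto simp: distrib_right[symmetric] intro!: mult_right_mono\<close>)
  also have "\<dots> \<le> K + K'" using assms(1,2) by (auto simp: sum.distrib l1_bound_def intro: add_mono)
  finally show "(\<Sum>j\<le>N. \<bar>(A + B) $ j\<bar> * R ^ j) \<le> K + K'" .
qed

lemma l1_bound_uminus: "l1_bound R K A \<Longrightarrow> l1_bound R K (- A)"
  by (simp add: l1_bound_def)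

lemma l1_bound_diff:
  assumes "l1_bound R K A" "l1_bound R K' B" "0 \<le> R" shows "l1_bound R (K + K') (A - B)"
  using l1_bound_add[OF assms(1) l1_bound_uminus[OF assms(2)] assms(3)] by simp

text \<open>The triangle of index pairs with \<open>i + l \<le> N\<close> lies inside the square
  \<open>{..N} \<times> {..N}\<close>, on which the double sum factors. So the weighted l1 norm is
  submultiplicative.\<close>

lemma l1_bound_mult:
  assumes A: "l1_bound R K A" and B: "l1_bound R K' B" and R: "0 \<le> R"
  shows "l1_bound R (K * K') (A * B)"
  unfolding l1_bound_def
proof
  fix N
  have "(\<Sum>j\<le>N. \<bar>(A * B) $ j\<bar> * R ^ j) \<le> (\<Sum>j\<le>N. \<Sum>i\<le>j. (\<bar>A $ i\<bar> * R ^ i) * (\<bar>B $ (j - i)\<bar> * R ^ (j - i)))"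
  proof (intro sum_mono)
    fix j
    have "\<bar>(A * B) $ j\<bar> * R ^ j \<le> (\<Sum>i\<le>j. \<bar>A $ i * B $ (j - i)\<bar>) * R ^ j"
      using R by (intro mult_right_mono) (auto simp: fps_mult_nth atLeast0AtMost)
    also have "\<dots> = (\<Sum>i\<le>j. (\<bar>A $ i\<bar> * R ^ i) * (\<bar>B $ (j - i)\<bar> * R ^ (j - i)))"
      unfolding sum_distrib_right
    proof (intro sum.cong refl)
      fix i assume "i \<in> {..j}"
      then have "R ^ j = R ^ i * R ^ (j - i)" by (simp flip: power_add)
      then show "\<bar>A $ i * B $ (j - i)\<bar> * R ^ j = (\<bar>A $ i\<bar> * R ^ i) * (\<bar>B $ (j - i)\<bar> * R ^ (j - i))"
        by (simp add: abs_mult)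
    qed
    finally show "\<bar>(A * B) $ j\<bar> * R ^ j \<le> (\<Sum>i\<le>j. (\<bar>A $ i\<bar> * R ^ i) * (\<bar>B $ (j - i)\<bar> * R ^ (j - i)))" .
  qed
  also have "\<dots> = (\<Sum>(i,l)\<in>{(i,l). i + l \<le> N}. (\<bar>A $ i\<bar> * R ^ i) * (\<bar>B $ l\<bar> * R ^ l))"
    using sum.triangle_reindex_eq[of "\<lambda>i l. (\<bar>A $ i\<bar> * R ^ i) * (\<bar>B $ l\<bar> * R ^ l)" N] by simp
  also have "\<dots> \<le> (\<Sum>(i,l)\<in>{..N}\<times>{..N}. (\<bar>A $ i\<bar> * R ^ i) * (\<bar>B $ l\<bar> * R ^ l))"
    by (intro sum_mono2) (use R in auto)
  also have "\<dots> = (\<Sum>i\<le>N. \<bar>A $ i\<bar> * R ^ i) * (\<Sum>l\<le>N. \<bar>B $ l\<bar> * R ^ l)"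
    by (simp add: sum_product sum.cartesian_product)
  also have "\<dots> \<le> K * K'"
    using A B R l1_bound_nonneg[OF A]
    by (intro mult_mono) (auto simp: l1_bound_def intro!: sum_nonneg)
  finally show "(\<Sum>j\<le>N. \<bar>(A * B) $ j\<bar> * R ^ j) \<le> K * K'" .
qed

lemma l1_bound_const: "\<bar>c\<bar> \<le> K \<Longrightarrow> l1_bound R K (fps_const c)"
proof -
  assume c: "\<bar>c\<bar> \<le> K"
  have "(\<Sum>j\<le>N. \<bar>fps_const c $ j\<bar> * R ^ j) = (\<Sum>j\<le>N. if j = 0 then \<bar>c\<bar> else 0)" for N
    by (intro sum.cong) auto
  then show ?thesis using c by (simp add: l1_bound_def)
qed

lemma l1_bound_1: "l1_bound R 1 1"
  using l1_bound_const[of 1 1 R] by simp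

lemma l1_bound_X:
  assumes "0 \<le> R" "R \<le> 1" shows "l1_bound R 1 fps_X"
proof -
  have "(\<Sum>j\<le>N. \<bar>fps_X $ j\<bar> * R ^ j) = (\<Sum>j\<le>N. if j = 1 then R else 0)" for N
    by (intro sum.cong) (auto simp: fps_X_def)
  then show ?thesis using assms by (simp add: l1_bound_def)
qed

lemma l1_bound_conv_radius:
  assumes "l1_bound R K A" "0 < R" shows "fps_conv_radius A \<ge> ereal R"
proof -
  have "summable (\<lambda>n. \<bar>A $ n\<bar> * R ^ n)"
  proof (rule bounded_imp_summable)
    show "(\<Sum>j\<le>n. \<bar>A $ j\<bar> * R ^ j) \<le> K" for n using assms(1) by (simp add: l1_bound_def)
  qed (use assms in auto)
  then have "summable (\<lambda>n. norm (A $ n * R ^ n))" using assms by (simp add: abs_mult)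
  then have "summable (\<lambda>n. A $ n * R ^ n)" by (rule summable_norm_cancel)
  then show ?thesis using conv_radius_geI[of "fps_nth A" R] assms by (simp add: fps_conv_radius_def)
qed

lemma fps_agree_refl: "fps_agree N A A" by (simp add: fps_agree_def)
lemma fps_agree_add: "fps_agree N A A' \<Longrightarrow> fps_agree N B B' \<Longrightarrow> fps_agree N (A + B) (A' + B')"
  by (simp add: fps_agree_def)
lemma fps_agree_diff: "fps_agree N A A' \<Longrightarrow> fps_agree N B B' \<Longrightarrow> fps_agree N (A - B) (A' - B')"
  by (simp add: fps_agree_def)
lemma fps_agree_uminus: "fps_agree N A A' \<Longrightarrow> fps_agree N (- A) (- A')"
  by (simp add: fps_agree_def)
lemma fps_agree_mult: "fps_agree N A A' \<Longrightarrow> fps_agree N B B' \<Longrightarrow> fps_agree N (A * B) (A' * B')"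
  by (auto simp: fps_agree_def fps_mult_nth intro!: sum.cong)
lemma fps_agree_power: "fps_agree N A A' \<Longrightarrow> fps_agree N (A ^ m) (A' ^ m)"
  by (induction m) (auto intro: fps_agree_mult fps_agree_refl)

lemmas fps_agree_intros = fps_agree_add fps_agree_diff fps_agree_uminus fps_agree_mult fps_agree_power fps_agree_refl

text \<open>Causality means that coefficient \<open>N\<close> of \<open>G Y\<close> involves only
  coefficients of \<open>Y\<close> up to \<open>N\<close>, so the recursion computes each new
  coefficient from the old ones. The shift \<open>\<delta>\<close> covers singular equations
  \<open>X * Y' + \<delta> * Y = X * G Y\<close>, for which the factor
  \<open>real j + 1 + \<delta> i\<close> stays positive.\<close>

lemma fps_system_unique:
  fixes G :: "('i \<Rightarrow> real fps) \<Rightarrow> 'i \<Rightarrow> real fps"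
  assumes causal: "\<And>Y Z N i. (\<And>i. fps_agree N (Y i) (Z i)) \<Longrightarrow> fps_agree N (G Y i) (G Z i)"
    and del: "\<And>i. 0 \<le> \<delta> i"
    and init: "\<And>i. Y i $ 0 = Z i $ 0"
    and Y: "\<And>i j. (real j + 1 + \<delta> i) * Y i $ Suc j = G Y i $ j"
    and Z: "\<And>i j. (real j + 1 + \<delta> i) * Z i $ Suc j = G Z i $ j"
  shows "Y i = Z i"
proof -
  have "\<forall>i. fps_agree N (Y i) (Z i)" for N
  proof (induction N)
    case 0 then show ?case using init by (simp add: fps_agree_def)
  next
    case (Suc N)
    have "Y i $ Suc N = Z i $ Suc N" for i
    proof -
      have "G Y i $ N = G Z i $ N" using causal[of N Y Z i] Suc by (simp add: fps_agree_def)
      then have "(real N + 1 + \<delta> i) * Y i $ Suc N = (real N + 1 + \<delta> i) * Z i $ Suc N" by (simp add: Y Z)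
      then show ?thesis using del[of i] by (simp add: add_nonneg_eq_0_iff)
    qed
    then show ?case using Suc by (auto simp: fps_agree_def le_Suc_eq)
  qed
  then show ?thesis by (auto simp: fps_agree_def fps_eq_iff)
qed

text \<open>Picard iteration. Integration gains a factor \<open>R\<close> in the weighted l1 norm,
  so the ball of radius \<open>K\<close> is invariant once
  \<open>\<bar>y0 i\<bar> + R * C \<le> K\<close>. Convergence comes without a contraction estimate,
  because each iteration fixes one more coefficient for good.\<close>

lemma fps_system_exists:
  fixes G :: "('i \<Rightarrow> real fps) \<Rightarrow> 'i \<Rightarrow> real fps"
  assumes causal: "\<And>Y Z N i. (\<And>i. fps_agree N (Y i) (Z i)) \<Longrightarrow> fps_agree N (G Y i) (G Z i)"
    and bound: "\<And>Y i. (\<And>i. l1_bound R K (Y i)) \<Longrightarrow> l1_bound R C (G Y i)"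
    and R: "0 \<le> R" and del: "\<And>i. 0 \<le> \<delta> i"
    and K: "\<And>i. \<bar>y0 i\<bar> + R * C \<le> K" and C0: "0 \<le> C"
  obtains Y where "\<And>i. Y i $ 0 = y0 i" "\<And>i j. (real j + 1 + \<delta> i) * Y i $ Suc j = G Y i $ j"
    "\<And>i. l1_bound R K (Y i)"
proof -
  define T where "T Y i = Abs_fps (\<lambda>n. case n of 0 \<Rightarrow> y0 i | Suc j \<Rightarrow> G Y i $ j / (real j + 1 + \<delta> i))" for Y i
  have T0: "T Y i $ 0 = y0 i" and TS: "T Y i $ Suc j = G Y i $ j / (real j + 1 + \<delta> i)" for Y i j
    by (simp_all add: T_def)
  define S where "S m = (T ^^ m) (\<lambda>i. 0)" for m
  have SS: "S (Suc m) = T (S m)" for m by (simp add: S_def)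
  have Kpos: "0 \<le> K" for i :: 'i using K[of undefined] R C0
    by (meson abs_ge_zero add_nonneg_nonneg mult_nonneg_nonneg order_trans)
  have bd: "l1_bound R K (S m i)" for m i
  proof (induction m arbitrary: i)
    case 0 then show ?case using Kpos l1_bound_const[of 0 K R] by (simp add: S_def)
  next
    case (Suc m)
    have g: "l1_bound R C (G (S m) i)" by (rule bound) (rule Suc)
    show ?case unfolding SS l1_bound_def
    proof
      fix N
      have "(\<Sum>j\<le>N. \<bar>T (S m) i $ j\<bar> * R ^ j) \<le> (\<Sum>j\<le>Suc N. \<bar>T (S m) i $ j\<bar> * R ^ j)"
        using R by simp
      also have "\<dots> = \<bar>y0 i\<bar> + (\<Sum>j\<le>N. \<bar>G (S m) i $ j / (real j + 1 + \<delta> i)\<bar> * R ^ Suc j)"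
        unfolding sum.atMost_Suc_shift by (simp add: T0 TS)
      also have "\<dots> \<le> \<bar>y0 i\<bar> + (\<Sum>j\<le>N. R * (\<bar>G (S m) i $ j\<bar> * R ^ j))"
      proof (intro add_left_mono sum_mono)
        fix j
        have "\<bar>G (S m) i $ j / (real j + 1 + \<delta> i)\<bar> \<le> \<bar>G (S m) i $ j\<bar>"
        proof -
          have x: "1 \<le> real j + 1 + \<delta> i" using del[of i] by simp
          have "\<bar>G (S m) i $ j\<bar> / (real j + 1 + \<delta> i) \<le> \<bar>G (S m) i $ j\<bar> / 1"
            by (rule divide_left_mono) (use x in auto)
          then show ?thesis using x by (simp add: abs_divide)
        qed
        then show "\<bar>G (S m) i $ j / (real j + 1 + \<delta> i)\<bar> * R ^ Suc j \<le> R * (\<bar>G (S m) i $ j\<bar> * R ^ j)"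
          using R mult_right_mono[of "\<bar>G (S m) i $ j / (real j + 1 + \<delta> i)\<bar>" "\<bar>G (S m) i $ j\<bar>" "R ^ Suc j"]
          by (simp add: mult.left_commute)
      qed
      also have "\<dots> \<le> \<bar>y0 i\<bar> + R * C"
        using g R unfolding sum_distrib_left[symmetric] l1_bound_def
        by (intro add_left_mono mult_left_mono) auto
      also have "\<dots> \<le> K" by (rule K)
      finally show "(\<Sum>j\<le>N. \<bar>T (S m) i $ j\<bar> * R ^ j) \<le> K" .
    qed
  qed
  have stable: "fps_agree m (S (Suc m) i) (S (Suc (Suc m)) i)" for m i
  proof (induction m arbitrary: i)
    case 0 then show ?case by (simp add: fps_agree_def SS T0)
  next
    case (Suc m)
    have "fps_agree m (G (S (Suc m)) i) (G (S (Suc (Suc m))) i)" by (rule causal) (rule Suc)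
    then have "T (S (Suc m)) i $ j = T (S (Suc (Suc m))) i $ j" if "j \<le> Suc m" for j
      using that by (cases j) (auto simp: fps_agree_def T0 TS)
    then show ?case by (simp add: fps_agree_def SS)
  qed
  \<comment> \<open>Coefficient \<open>j\<close> no longer changes after step \<open>j + 1\<close>,
    so this diagonal is the coefficientwise limit.\<close>
  define Y where "Y i = Abs_fps (\<lambda>j. S (Suc j) i $ j)" for i
  have lim: "fps_agree m (Y i) (S (Suc m) i)" for m i
  proof (induction m)
    case 0 then show ?case by (simp add: fps_agree_def Y_def)
  next
    case (Suc m)
    show ?case using Suc stable[of m i] by (auto simp: fps_agree_def le_Suc_eq) (simp add: Y_def)
  qed
  have "l1_bound R K (Y i)" for i unfolding l1_bound_def
  proof
    fix N
    have "(\<Sum>j\<le>N. \<bar>Y i $ j\<bar> * R ^ j) = (\<Sum>j\<le>N. \<bar>S (Suc N) i $ j\<bar> * R ^ j)"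
      using lim[of N i] by (intro sum.cong) (auto simp: fps_agree_def)
    then show "(\<Sum>j\<le>N. \<bar>Y i $ j\<bar> * R ^ j) \<le> K" using bd[of "Suc N" i] by (simp add: l1_bound_def)
  qed
  moreover have "Y i $ 0 = y0 i" for i by (simp add: Y_def SS T0)
  moreover have "(real j + 1 + \<delta> i) * Y i $ Suc j = G Y i $ j" for i j
  proof -
    have "G Y i $ j = G (S (Suc j)) i $ j"
      using causal[of j Y "S (Suc j)" i] lim by (auto simp: fps_agree_def)
    then show ?thesis using del[of i] by (simp add: Y_def SS[of "Suc j"] TS)
  qed
  ultimately show ?thesis using that by blast
qed

lemma fps_linear_unique:
  fixes u g :: "real fps"
  assumes "fps_deriv u = g * u" "u $ 0 = 0"
  shows "u = 0"
proof -
  show ?thesis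
  proof (rule fps_system_unique[where G = "\<lambda>Y i. g * Y i" and \<delta> = "\<lambda>_. 0" and Y = "\<lambda>_::unit. u" and Z = "\<lambda>_. 0" and i = "()"])
    fix j :: nat
    have "fps_deriv u $ j = (g * u) $ j" using assms by simp
    then show "(real j + 1 + 0) * u $ Suc j = (g * u) $ j" by (simp add: add.commute)
  qed (auto intro: fps_agree_intros simp: assms)
qed

text \<open>A nonzero difference, divided by its lowest power of \<open>X\<close>, would be
  continuous at 0 with a nonzero value there and yet vanish on a punctured neighbourhood.\<close>

lemma real_fps_expansion_unique:
  fixes f :: "real \<Rightarrow> real"
  assumes "f has_fps_expansion A" "f has_fps_expansion B"
  shows "A = B"
proof (rule ccontr)
  assume ne: "A \<noteq> B"
  define D where "D = A - B"
  have D: "(\<lambda>x. 0) has_fps_expansion D"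
    using has_fps_expansion_diff[OF assms] by (simp add: D_def)
  define n where "n = subdegree D"
  define E where "E = fps_shift n D"
  have E0: "E $ 0 \<noteq> 0" using ne nth_subdegree_nonzero[of D] by (simp add: E_def n_def D_def)
  have rad: "fps_conv_radius D > 0" using D by (simp add: has_fps_expansion_def)
  have radE: "fps_conv_radius E > 0" using rad by (simp add: E_def)
  have "isCont (eval_fps E) 0" by (rule continuous_eval_fps) (use radE in \<open>simp add: zero_ereal_def\<close>)
  then have lim: "eval_fps E \<midarrow>0\<rightarrow> E $ 0" by (simp add: isCont_def eval_fps_at_0)
  have "\<forall>\<^sub>F x in nhds 0. x \<in> eball 0 (fps_conv_radius D)"
    using rad by (intro eventually_nhds_in_open) (auto simp: zero_ereal_def)
  moreover have "\<forall>\<^sub>F x in nhds 0. eval_fps D x = 0" using D by (auto simp: has_fps_expansion_def)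
  ultimately have "\<forall>\<^sub>F x in nhds 0. x \<noteq> 0 \<longrightarrow> eval_fps E x = 0"
  proof eventually_elim
    case (elim x)
    then show ?case using eval_fps_shift[of n D x] by (simp add: E_def n_def)
  qed
  then have "\<forall>\<^sub>F x in at 0. eval_fps E x = 0" by (simp add: eventually_at_filter)
  then have "eval_fps E \<midarrow>0\<rightarrow> 0" by (rule tendsto_eventually)
  with lim E0 show False using LIM_unique by blast
qed

text \<open>Re-expansion is borrowed from complex analysis: the complexified series is holomorphic
  on the disc of radius \<open>r - \<bar>x1\<bar>\<close> about \<open>x1\<close>, so its Taylor
  series converges there, and the real parts of the coefficients form the real series.\<close>

lemma eval_fps_recenter:
  fixes A :: "real fps"
  assumes r: "ereal r \<le> fps_conv_radius A" and x1: "\<bar>x1\<bar> < r"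
  obtains B where "fps_conv_radius B \<ge> ereal (r - \<bar>x1\<bar>)"
    "\<And>y. \<bar>y\<bar> < r - \<bar>x1\<bar> \<Longrightarrow> eval_fps A (x1 + y) = eval_fps B y"
proof -
  define C where "C = Abs_fps (\<lambda>n. complex_of_real (A $ n))"
  have radC: "fps_conv_radius C = fps_conv_radius A"
    unfolding fps_conv_radius_def by (subst (1 2) conv_radius_norm[symmetric]) (simp add: C_def)
  have CA: "eval_fps C (of_real x) = of_real (eval_fps A x)" if "\<bar>x\<bar> < r" for x
  proof -
    have "(\<lambda>n. A $ n * x ^ n) sums eval_fps A x"
      by (rule sums_eval_fps) (use that r in \<open>auto intro: less_le_trans[of _ "ereal r"]\<close>)
    then have "(\<lambda>n. complex_of_real (A $ n * x ^ n)) sums of_real (eval_fps A x)"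
      by (rule sums_of_real)
    then show ?thesis by (simp add: eval_fps_def C_def sums_iff)
  qed
  define d where "d = r - \<bar>x1\<bar>"
  have d: "d > 0" using x1 by (simp add: d_def)
  have hol: "eval_fps C holomorphic_on ball (of_real x1) d"
  proof (rule holomorphic_on_eval_fps, rule subsetI)
    fix z :: complex assume "z \<in> ball (of_real x1) d"
    then have "norm z < r" using norm_triangle_ineq[of "z - of_real x1" "of_real x1"]
      by (simp add: d_def dist_norm norm_minus_commute)
    then show "z \<in> eball 0 (fps_conv_radius C)" using r by (auto simp: radC intro: less_le_trans[of _ "ereal r"])
  qed
  define c where "c n = (deriv ^^ n) (eval_fps C) (of_real x1) / fact n" for n
  define B where "B = Abs_fps (\<lambda>n. Re (c n))"
  have B: "(\<lambda>n. B $ n * y ^ n) sums eval_fps A (x1 + y)" if y: "\<bar>y\<bar> < d" for y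
  proof -
    have "(\<lambda>n. c n * (of_real (x1 + y) - of_real x1) ^ n) sums eval_fps C (of_real (x1 + y))"
      unfolding c_def by (rule holomorphic_power_series[OF hol]) (use y in \<open>simp add: dist_norm\<close>)
    moreover have "\<bar>x1 + y\<bar> < r" using y by (simp add: d_def)
    moreover have "complex_of_real (x1 + y) - of_real x1 = of_real y" by simp
    ultimately have "(\<lambda>n. c n * of_real (y ^ n)) sums of_real (eval_fps A (x1 + y))"
      using CA[of "x1 + y"] by (simp only: of_real_power)
    then have "(\<lambda>n. Re (c n * of_real (y ^ n))) sums Re (of_real (eval_fps A (x1 + y)))"
      by (rule sums_Re)
    moreover have "Re (c n * of_real (y ^ n)) = B $ n * y ^ n" for n
      by (simp only: B_def times_complex.sel Re_complex_of_real Im_complex_of_real fps_nth_Abs_fps)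
    ultimately show ?thesis by (simp only: Re_complex_of_real)
  qed
  show thesis
  proof (rule that[of B])
    show "fps_conv_radius B \<ge> ereal (r - \<bar>x1\<bar>)" unfolding fps_conv_radius_def
    proof (rule conv_radius_geI_ex)
      fix s assume s: "0 < s" "ereal s < ereal (r - \<bar>x1\<bar>)"
      then have "summable (\<lambda>n. B $ n * s ^ n)" by (intro sums_summable[OF B]) (simp add: d_def)
      then show "\<exists>z. norm z = s \<and> summable (\<lambda>n. B $ n * z ^ n)" by (intro exI[of _ s] conjI) (use s in simp_all)
    qed
    show "eval_fps A (x1 + y) = eval_fps B y" if "\<bar>y\<bar> < r - \<bar>x1\<bar>" for y
      using sums_unique[OF B[of y]] that unfolding eval_fps_def[of B] d_def by blast
  qed
qed

text \<open>The bound \<open>C\<close> depends on \<open>K\<close> but not on \<open>R\<close>;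
  radii are capped at \<open>1/2\<close> so that both \<open>fps_X\<close> and
  \<open>1 / (1 + X)\<close> have bounded norm. Closure under the ring operations then settles every
  polynomial right-hand side.\<close>

definition causal_bounded :: "(('i \<Rightarrow> real fps) \<Rightarrow> real fps) \<Rightarrow> bool" where
  "causal_bounded F \<longleftrightarrow>
     (\<forall>Y Z N. (\<forall>i. fps_agree N (Y i) (Z i)) \<longrightarrow> fps_agree N (F Y) (F Z)) \<and>
     (\<forall>K. \<exists>C. \<forall>R Y. 0 \<le> R \<longrightarrow> R \<le> 1/2 \<longrightarrow> (\<forall>i. l1_bound R K (Y i)) \<longrightarrow> l1_bound R C (F Y))"

lemma causal_bounded_var: "causal_bounded (\<lambda>Y. Y i)"
  unfolding causal_bounded_def by blast

lemma causal_bounded_known: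
  assumes "\<And>R. 0 \<le> R \<Longrightarrow> R \<le> 1/2 \<Longrightarrow> l1_bound R C U" shows "causal_bounded (\<lambda>Y. U)"
  unfolding causal_bounded_def using assms fps_agree_refl by blast

lemma causal_bounded_const: "causal_bounded (\<lambda>Y. fps_const c)"
  by (rule causal_bounded_known[where C = "\<bar>c\<bar>"]) (rule l1_bound_const, simp)

lemma causal_bounded_X: "causal_bounded (\<lambda>Y. fps_X)"
  by (rule causal_bounded_known[where C = 1]) (rule l1_bound_X, auto)

lemma causal_bounded_1: "causal_bounded (\<lambda>Y. 1)"
  by (rule causal_bounded_known[where C = 1]) (rule l1_bound_1)

lemma causal_bounded_add:
  assumes "causal_bounded F" "causal_bounded G" shows "causal_bounded (\<lambda>Y. F Y + G Y)"
  using assms unfolding causal_bounded_def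
  by (safe; (blast intro: fps_agree_add | meson l1_bound_add))

lemma causal_bounded_diff:
  assumes "causal_bounded F" "causal_bounded G" shows "causal_bounded (\<lambda>Y. F Y - G Y)"
  using assms unfolding causal_bounded_def
  by (safe; (blast intro: fps_agree_diff | meson l1_bound_diff))

lemma causal_bounded_mult:
  assumes "causal_bounded F" "causal_bounded G" shows "causal_bounded (\<lambda>Y. F Y * G Y)"
  using assms unfolding causal_bounded_def
  by (safe; (blast intro: fps_agree_mult | meson l1_bound_mult))

lemma causal_bounded_uminus:
  assumes "causal_bounded F" shows "causal_bounded (\<lambda>Y. - F Y)"
  using assms unfolding causal_bounded_def
  by (safe; (blast intro: fps_agree_uminus | meson l1_bound_uminus))

lemma causal_bounded_power:
  assumes "causal_bounded F" shows "causal_bounded (\<lambda>Y. F Y ^ m)"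
  by (induction m) (simp_all add: causal_bounded_1 causal_bounded_mult assms)

lemmas causal_bounded_intros = causal_bounded_var causal_bounded_const causal_bounded_X causal_bounded_1
  causal_bounded_add causal_bounded_diff causal_bounded_mult causal_bounded_uminus causal_bounded_power

text \<open>For a given system the radius \<open>R\<close> depends only on the size
  \<open>K0\<close> of the data. The continuation argument lives on this uniformity.\<close>

lemma fps_system_exists_uniform:
  fixes G :: "('i::finite \<Rightarrow> real fps) \<Rightarrow> 'i \<Rightarrow> real fps"
  assumes G: "\<And>i. causal_bounded (\<lambda>Y. G Y i)" and del: "\<And>i. 0 \<le> \<delta> i" and K0: "0 \<le> K0"
  shows "\<exists>R>0. \<forall>y0. (\<forall>i. \<bar>y0 i\<bar> \<le> K0) \<longrightarrow>
     (\<exists>Y. (\<forall>i. Y i $ 0 = y0 i) \<and> (\<forall>i j. (real j + 1 + \<delta> i) * Y i $ Suc j = G Y i $ j) \<and>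
          (\<forall>i. fps_conv_radius (Y i) \<ge> ereal R))"
proof -
  have "\<forall>i. \<exists>C. \<forall>R Y. 0 \<le> R \<longrightarrow> R \<le> 1/2 \<longrightarrow> (\<forall>i. l1_bound R (K0 + 1) (Y i)) \<longrightarrow> l1_bound R C (G Y i)"
    using G unfolding causal_bounded_def by blast
  then obtain C where C: "\<And>i R Y. 0 \<le> R \<Longrightarrow> R \<le> 1/2 \<Longrightarrow> (\<forall>i. l1_bound R (K0 + 1) (Y i)) \<Longrightarrow> l1_bound R (C i) (G Y i)"
    by metis
  define D where "D = (\<Sum>i\<in>UNIV. \<bar>C i\<bar>)"
  have D: "C i \<le> D" for i
    unfolding D_def using member_le_sum[of i UNIV "\<lambda>i. \<bar>C i\<bar>"] by (auto intro: order_trans[OF abs_ge_self])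
  have D0: "0 \<le> D" by (simp add: D_def sum_nonneg)
  \<comment> \<open>Data bounded by \<open>K0\<close> have to stay in the ball of radius
    \<open>K0 + 1\<close>; the unit of room between the two asks for
    \<open>R * D \<le> 1\<close>.\<close>
  define R where "R = min (1/2) (1 / (D + 1))"
  have R: "0 < R" "R \<le> 1/2" using D0 by (auto simp: R_def)
  have RD: "R * D \<le> 1"
  proof -
    have "R * D \<le> 1 / (D + 1) * D" using D0 by (intro mult_right_mono) (auto simp: R_def)
    also have "\<dots> \<le> 1" using D0 by (simp add: divide_le_eq)
    finally show ?thesis .
  qed
  show ?thesis
  proof (intro exI[of _ R] conjI allI impI)
    fix y0 :: "'i \<Rightarrow> real" assume y0: "\<forall>i. \<bar>y0 i\<bar> \<le> K0"
    obtain Y where "\<And>i. Y i $ 0 = y0 i" "\<And>i j. (real j + 1 + \<delta> i) * Y i $ Suc j = G Y i $ j"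
      "\<And>i. l1_bound R (K0 + 1) (Y i)"
    proof (rule fps_system_exists[of G R "K0 + 1" D \<delta> y0])
      show "fps_agree N (G Y i) (G Z i)" if "\<And>i. fps_agree N (Y i) (Z i)" for N Y Z i
        using G[of i] that unfolding causal_bounded_def by blast
      show "l1_bound R D (G Y i)" if "\<And>i. l1_bound R (K0 + 1) (Y i)" for Y i
        using C[of R Y i] R that D by (auto intro: l1_bound_mono)
      show "\<bar>y0 i\<bar> + R * D \<le> K0 + 1" for i using y0 RD by (auto intro: add_mono)
    qed (use R del D0 in auto)
    then show "\<exists>Y. (\<forall>i. Y i $ 0 = y0 i) \<and> (\<forall>i j. (real j + 1 + \<delta> i) * Y i $ Suc j = G Y i $ j) \<and>
          (\<forall>i. fps_conv_radius (Y i) \<ge> ereal R)"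
      using l1_bound_conv_radius[OF _ R(1)] by blast
  qed (rule R)
qed

lemma fps_deriv_eqI:
  assumes "\<And>j. (real j + 1 + 0) * A $ Suc j = G $ j" shows "fps_deriv A = G"
  by (rule fps_ext) (use assms in \<open>simp add: add.commute\<close>)

lemma fps_singular_deriv_eqI:
  assumes "\<And>j. (real j + 1 + \<delta>) * A $ Suc j = G $ j" "A $ 0 = 0"
  shows "fps_X * fps_deriv A + fps_const \<delta> * A = fps_X * G"
proof (rule fps_ext)
  fix j show "(fps_X * fps_deriv A + fps_const \<delta> * A) $ j = (fps_X * G) $ j"
    using assms(1)[of "j - 1"] assms(2) by (cases j) (auto simp: algebra_simps)
qed

lemma l1_bound_geometric:
  assumes R: "0 \<le> R" "R \<le> 1/2" shows "l1_bound R 2 (inverse (1 + fps_X))"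
  unfolding l1_bound_def
proof
  fix N
  have "(inverse (1 + fps_X) :: real fps) = Abs_fps (\<lambda>n. (- 1) ^ n)"
  proof (rule fps_inverse_unique, rule fps_ext)
    fix n show "((1 + fps_X) * Abs_fps (\<lambda>n. (- 1 :: real) ^ n)) $ n = 1 $ n"
      by (cases n) (auto simp: distrib_right)
  qed
  then have "(\<Sum>j\<le>N. \<bar>inverse (1 + fps_X) $ j\<bar> * R ^ j) = (\<Sum>j<Suc N. R ^ j)"
    by (simp add: lessThan_Suc_atMost)
  also have "\<dots> = (1 - R ^ Suc N) / (1 - R)" using R by (subst sum_gp_strict) auto
  also have "\<dots> \<le> 2" using R by (simp add: divide_le_eq) (smt (verit) zero_le_power mult_nonneg_nonneg)
  finally show "(\<Sum>j\<le>N. \<bar>inverse (1 + fps_X) $ j\<bar> * R ^ j) \<le> 2" .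
qed

lemma eval_fps_conv:
  fixes A B :: "real fps"
  assumes "\<bar>x\<bar> < R"
  shows "ereal R \<le> fps_conv_radius A \<Longrightarrow> ereal R \<le> fps_conv_radius B \<Longrightarrow> eval_fps (A + B) x = eval_fps A x + eval_fps B x"
    "ereal R \<le> fps_conv_radius A \<Longrightarrow> ereal R \<le> fps_conv_radius B \<Longrightarrow> eval_fps (A - B) x = eval_fps A x - eval_fps B x"
    "ereal R \<le> fps_conv_radius A \<Longrightarrow> ereal R \<le> fps_conv_radius B \<Longrightarrow> eval_fps (A * B) x = eval_fps A x * eval_fps B x"
    "ereal R \<le> fps_conv_radius A \<Longrightarrow> eval_fps (A ^ m) x = eval_fps A x ^ m"
    "ereal R \<le> fps_conv_radius A \<Longrightarrow> eval_fps (- A) x = - eval_fps A x"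
  using assms
  by (auto intro!: eval_fps_add eval_fps_diff eval_fps_mult eval_fps_power eval_fps_minus intro: less_le_trans[of _ "ereal R"])

lemma fps_conv_radius_ge:
  fixes A B :: "real fps"
  shows "r \<le> fps_conv_radius A \<Longrightarrow> r \<le> fps_conv_radius B \<Longrightarrow> r \<le> fps_conv_radius (A + B)"
    "r \<le> fps_conv_radius A \<Longrightarrow> r \<le> fps_conv_radius B \<Longrightarrow> r \<le> fps_conv_radius (A - B)"
    "r \<le> fps_conv_radius A \<Longrightarrow> r \<le> fps_conv_radius B \<Longrightarrow> r \<le> fps_conv_radius (A * B)"
    "r \<le> fps_conv_radius A \<Longrightarrow> r \<le> fps_conv_radius (A ^ m)"
    "r \<le> fps_conv_radius A \<Longrightarrow> r \<le> fps_conv_radius (fps_deriv A)"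
  by (meson fps_conv_radius_add fps_conv_radius_diff fps_conv_radius_mult fps_conv_radius_power
      fps_conv_radius_deriv min.boundedI order_trans)+

section \<open>Functions given near a point by a power series\<close>

definition power_series_at :: "(real \<Rightarrow> real) \<Rightarrow> real \<Rightarrow> (nat \<Rightarrow> real) \<Rightarrow> real \<Rightarrow> bool" where
  "power_series_at u x0 c r \<longleftrightarrow> 0 < r \<and> (\<forall>y. \<bar>y\<bar> < r \<longrightarrow> (\<lambda>n. c n * y ^ n) sums u (x0 + y))"

lemma power_series_at_radius:
  assumes "power_series_at u x0 c r" shows "fps_conv_radius (Abs_fps c) \<ge> ereal r"
  unfolding fps_conv_radius_def
proof (rule conv_radius_geI_ex)
  fix s assume s: "0 < s" "ereal s < ereal r"
  then have "summable (\<lambda>n. Abs_fps c $ n * s ^ n)"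
    using assms sums_summable[of _ "u (x0 + s)"] by (auto simp: power_series_at_def)
  then show "\<exists>z. norm z = s \<and> summable (\<lambda>n. Abs_fps c $ n * z ^ n)"
    by (intro exI[of _ s] conjI) (use s in simp_all)
qed

lemma power_series_at_eval:
  assumes "power_series_at u x0 c r" "\<bar>y\<bar> < r" shows "u (x0 + y) = eval_fps (Abs_fps c) y"
  using assms sums_unique unfolding power_series_at_def eval_fps_def by fastforce

lemma power_series_at_iff_eval:
  "power_series_at u x0 c r \<longleftrightarrow> 0 < r \<and> fps_conv_radius (Abs_fps c) \<ge> ereal r \<and>
     (\<forall>y. \<bar>y\<bar> < r \<longrightarrow> u (x0 + y) = eval_fps (Abs_fps c) y)"
proof
  assume "power_series_at u x0 c r"
  then show "0 < r \<and> fps_conv_radius (Abs_fps c) \<ge> ereal r \<and>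
     (\<forall>y. \<bar>y\<bar> < r \<longrightarrow> u (x0 + y) = eval_fps (Abs_fps c) y)"
    using power_series_at_radius power_series_at_eval by (auto simp: power_series_at_def)
next
  assume r: "0 < r \<and> fps_conv_radius (Abs_fps c) \<ge> ereal r \<and>
     (\<forall>y. \<bar>y\<bar> < r \<longrightarrow> u (x0 + y) = eval_fps (Abs_fps c) y)"
  have "(\<lambda>n. c n * y ^ n) sums u (x0 + y)" if "\<bar>y\<bar> < r" for y
  proof -
    have "ereal (norm y) < ereal r" using that by simp
    also have "\<dots> \<le> fps_conv_radius (Abs_fps c)" using r by simp
    finally show ?thesis using sums_eval_fps[of y "Abs_fps c"] r that by simp
  qed
  with r show "power_series_at u x0 c r" by (simp add: power_series_at_def)
qed

lemma power_series_at_expansion: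
  assumes "power_series_at u x0 c r" shows "(\<lambda>y. u (x0 + y)) has_fps_expansion Abs_fps c"
  unfolding has_fps_expansion_def
proof
  have r: "0 < r" using assms by (simp add: power_series_at_def)
  then show "0 < fps_conv_radius (Abs_fps c)"
    using power_series_at_radius[OF assms] by (auto intro: less_le_trans[of _ "ereal r"])
  have "\<forall>\<^sub>F y in nhds 0. y \<in> ball 0 r" using r by (intro eventually_nhds_in_open) auto
  then show "\<forall>\<^sub>F y in nhds 0. eval_fps (Abs_fps c) y = u (x0 + y)"
    by eventually_elim (simp add: power_series_at_eval[OF assms])
qed

lemma power_series_at_recenter:
  assumes u: "power_series_at u x0 c r" and x1: "\<bar>x1 - x0\<bar> < r"
  obtains c' where "power_series_at u x1 c' (r - \<bar>x1 - x0\<bar>)"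
proof -
  obtain B where B: "fps_conv_radius B \<ge> ereal (r - \<bar>x1 - x0\<bar>)"
    "\<And>y. \<bar>y\<bar> < r - \<bar>x1 - x0\<bar> \<Longrightarrow> eval_fps (Abs_fps c) (x1 - x0 + y) = eval_fps B y"
    using eval_fps_recenter[OF power_series_at_radius[OF u] x1] by blast
  have "power_series_at u x1 (fps_nth B) (r - \<bar>x1 - x0\<bar>)"
    unfolding power_series_at_iff_eval
  proof (intro conjI allI impI)
    fix y assume y: "\<bar>y\<bar> < r - \<bar>x1 - x0\<bar>"
    then have "\<bar>x1 - x0 + y\<bar> < r" by linarith
    from power_series_at_eval[OF u this] B(2)[OF y] show "u (x1 + y) = eval_fps (Abs_fps (fps_nth B)) y"
      by (simp add: add.commute fps_nth_inverse)
  qed (use x1 B in \<open>simp_all add: fps_nth_inverse\<close>)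
  then show thesis by (rule that)
qed

lemma power_series_at_affine:
  assumes u: "power_series_at u x0 c r" and m: "m > 0"
  shows "power_series_at (\<lambda>x. C * u (x0 + (x - x1) * m)) x1 (\<lambda>n. C * c n * m ^ n) (r / m)"
  unfolding power_series_at_def
proof (intro conjI allI impI)
  show "0 < r / m" using u m by (simp add: power_series_at_def)
  fix y assume "\<bar>y\<bar> < r / m"
  then have "\<bar>y * m\<bar> < r" using m by (simp add: abs_mult pos_less_divide_eq)
  then have "(\<lambda>n. C * (c n * (y * m) ^ n)) sums (C * u (x0 + y * m))"
    using u by (intro sums_mult) (simp add: power_series_at_def)
  then show "(\<lambda>n. C * c n * m ^ n * y ^ n) sums (C * u (x0 + (x1 + y - x1) * m))"
    by (simp add: power_mult_distrib mult_ac)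
qed

lemma power_series_at_cong:
  assumes "power_series_at u x0 c r" "0 < r'" "r' \<le> r" "\<And>x. \<bar>x - x0\<bar> < r' \<Longrightarrow> v x = u x"
  shows "power_series_at v x0 c r'"
  using assms by (auto simp: power_series_at_def)

section \<open>The profile equation\<close>

text \<open>\<open>L\<close> is the squared singular value. \<open>pL\<close> is
  \<open>lam^2 = k (k + n - 1) / p\<close> for \<open>n = p + 1\<close>, and \<open>disc\<close>
  says that the linearisation at the rest point has non-real eigenvalues.\<close>

locale lo_ode =
  fixes p k :: nat and L :: real
  assumes p: "p = 2 \<or> p = 4" and k: "4 \<le> k" and pL: "real p * L = real k * (real k + real p)"
    and disc: "(real p + 2)\<^sup>2 < 8 * (real p + 1) * (1 - (real p + 1) / (real p * L))"
begin

lemma p_pos: "0 < real p" using p by auto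

lemma L_ge: "L \<ge> 8"
proof -
  have "real p * L \<ge> 4 * (4 + real p)" unfolding pL using k by (intro mult_mono) auto
  then show ?thesis using p by auto
qed

text \<open>The reciprocal of the eigenvalue of the induced metric on the
  \<open>p\<close>-dimensional singular space.\<close>

definition wgt :: "real \<Rightarrow> real \<Rightarrow> real" where "wgt z a = 1 / (1 + L * z ^ (k - 1) * a\<^sup>2)"

definition arhs :: "real \<Rightarrow> real \<Rightarrow> real \<Rightarrow> real" where
  "arhs z a b = (b - real k * a) / (2 * z)"

text \<open>Chosen so that \<open>sqrt z ^ (k - 1) * b\<close> obeys the autonomous equation with
  right-hand side \<open>eta_rhs\<close> in the time \<open>ln z / 2\<close>; differentiating the
  power absorbs the term \<open>- (real k - 1) * b\<close>.\<close>

definition brhs :: "real \<Rightarrow> real \<Rightarrow> real \<Rightarrow> real" where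
  "brhs z a b = (- (real k - 1) * b - (1 + z ^ (k - 1) * b\<^sup>2) * (b + real p * (b - L * a) * wgt z a)) / (2 * z)"

definition ode_at :: "(real \<Rightarrow> real) \<Rightarrow> (real \<Rightarrow> real) \<Rightarrow> real \<Rightarrow> bool" where
  "ode_at a b z \<longleftrightarrow> (a has_real_derivative arhs z (a z) (b z)) (at z) \<and>
     (b has_real_derivative brhs z (a z) (b z)) (at z)"

definition analytic_at_point :: "(real \<Rightarrow> real) \<Rightarrow> real \<Rightarrow> bool" where
  "analytic_at_point u x0 \<longleftrightarrow> (\<exists>c r. power_series_at u x0 c r)"

text \<open>Analyticity is demanded at \<open>z = 0\<close> as well, whereas the equation is stated
  for positive \<open>z\<close> only, where division by \<open>2 * z\<close> makes sense.\<close>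

definition solution_upto :: "real \<Rightarrow> (real \<Rightarrow> real) \<Rightarrow> (real \<Rightarrow> real) \<Rightarrow> bool" where
  "solution_upto Z a b \<longleftrightarrow> a 0 = 1 \<and> b 0 = real k \<and>
     (\<forall>z\<in>{0..<Z}. analytic_at_point a z \<and> analytic_at_point b z) \<and> (\<forall>z\<in>{0<..<Z}. ode_at a b z)"

text \<open>The series \<open>1 - w * D\<close> solves a homogeneous linear equation with zero
  initial value. Thus the weight can be an unknown of a polynomial system and still be recovered in
  closed form afterwards.\<close>

lemma weight_unique:
  fixes w D :: "real fps"
  assumes "fps_deriv w = - (w\<^sup>2 * fps_deriv D)" "w $ 0 * D $ 0 = 1"
  shows "w * D = 1"
proof -
  have "1 - w * D = 0"
  proof (rule fps_linear_unique[where g = "- (w * fps_deriv D)"])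
    show "fps_deriv (1 - w * D) = - (w * fps_deriv D) * (1 - w * D)"
      by (simp add: assms(1) algebra_simps power2_eq_square)
  qed (use assms in simp)
  then show ?thesis by simp
qed

lemma k_pred: "fps_X ^ (k - 1) = fps_X * (fps_X * fps_X ^ (k - 3) :: real fps)"
  "fps_X ^ (k - 2) = fps_X * (fps_X ^ (k - 3) :: real fps)"
  using k by (simp_all flip: power_Suc add: Suc_diff_Suc numeral_eq_Suc)

lemma has_derivative_eval:
  fixes A :: "real fps"
  assumes "\<bar>x\<bar> < R" "ereal R \<le> fps_conv_radius A"
  shows "(eval_fps A has_real_derivative eval_fps (fps_deriv A) x) (at x)"
proof (rule has_field_derivative_eval_fps)
  have "ereal (norm x) < ereal R" using assms by simp
  also note assms(2)
  finally show "ereal (norm x) < fps_conv_radius A" .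
qed

text \<open>The unknowns are \<open>a\<close>, \<open>d = (b - k a) / z\<close>, which removes the pole at \<open>z = 0\<close>, and the weight
  \<open>w = wgt z a\<close>, which makes the right-hand side polynomial.\<close>

definition singular_field :: "(3 \<Rightarrow> real fps) \<Rightarrow> 3 \<Rightarrow> real fps" where
  "singular_field Y i = (let a = Y 1; d = Y 2; w = Y 3; b = fps_const (real k) * a + fps_X * d in
     if i = 1 then fps_const (1/2) * d
     else if i = 2 then - (fps_const (1/2) * (fps_X ^ (k - 3) *
        (b\<^sup>2 * (b + fps_const (real p) * ((b - fps_const L * a) * w))
         - fps_const (real p * L) * ((b - fps_const L * a) * (a\<^sup>2 * w)))))
     else - (w\<^sup>2 * (fps_const L * (fps_X ^ (k - 2) * (fps_const (real k - 1) * a\<^sup>2 + a * (d * fps_X))))))"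

lemma singular_field_causal_bounded: "causal_bounded (\<lambda>Y. singular_field Y i)"
  unfolding singular_field_def Let_def
  by (cases "i = 1"; cases "i = 2"; simp) (intro causal_bounded_intros)+

text \<open>At \<open>z = 0\<close> and \<open>b = k * a\<close> the numerator of
  \<open>brhs\<close> is \<open>(p * L - k * (k + p)) * a\<close>, which vanishes by
  \<open>pL\<close>. This removes the pole and leaves for \<open>d\<close> a singular equation with
  a positive shift, which the formal theory solves.\<close>

lemma solution_near_zero: "\<exists>R a b. 0 < R \<and> solution_upto R a b"
proof -
  \<comment> \<open>These are \<open>a 0 = 1\<close>, \<open>d 0 = 0\<close> and weight 1. The value
    of \<open>d\<close> is forced, since at \<open>z = 0\<close> its singular equation reads
    \<open>\<delta> * d = 0\<close>.\<close>
  define y0 where "y0 i = (if i = (2::3) then 0 else 1 :: real)" for i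
  \<comment> \<open>The shift collects the multiples of \<open>d\<close> after inserting
    \<open>b = k * a + z * d\<close> and \<open>a' = d / 2\<close> into the equation for
    \<open>b\<close>: \<open>k / 2 + 1\<close> from the derivative of \<open>b\<close> and
    \<open>(k + p) / 2\<close> from the right-hand side.\<close>
  define \<delta> where "\<delta> i = (if i = (2::3) then (2 * real k + real p + 2) / 2 else 0)" for i
  have del: "0 \<le> \<delta> i" for i by (simp add: \<delta>_def)
  obtain R where R: "R > 0" and "\<forall>y0. (\<forall>i. \<bar>y0 i\<bar> \<le> 1) \<longrightarrow>
     (\<exists>Y. (\<forall>i. Y i $ 0 = y0 i) \<and> (\<forall>i j. (real j + 1 + \<delta> i) * Y i $ Suc j = singular_field Y i $ j) \<and>
          (\<forall>i. fps_conv_radius (Y i) \<ge> ereal R))"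
    using fps_system_exists_uniform[of singular_field \<delta> 1, OF singular_field_causal_bounded del] by auto
  then obtain Y where Y0: "\<And>i. Y i $ 0 = y0 i"
    and YS: "\<And>i j. (real j + 1 + \<delta> i) * Y i $ Suc j = singular_field Y i $ j"
    and rad: "\<And>i. ereal R \<le> fps_conv_radius (Y i)"
    by (metis (mono_tags, opaque_lifting) y0_def abs_0 abs_1 order.refl zero_le_one)
  define a where "a = Y 1"
  define d where "d = Y 2"
  define w where "w = Y 3"
  define b where "b = fps_const (real k) * a + fps_X * d"
  define D where "D = 1 + fps_const L * (fps_X ^ (k - 1) * a\<^sup>2)"
  define M where "M = b\<^sup>2 * (b + fps_const (real p) * ((b - fps_const L * a) * w))
         - fps_const (real p * L) * ((b - fps_const L * a) * (a\<^sup>2 * w))"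
  have rads: "ereal R \<le> fps_conv_radius a" "ereal R \<le> fps_conv_radius d" "ereal R \<le> fps_conv_radius w"
    using rad by (auto simp: a_def d_def w_def)
  have radb: "ereal R \<le> fps_conv_radius b" unfolding b_def
    by (intro fps_conv_radius_ge rads) auto
  have ad: "fps_deriv a = fps_const (1/2) * d"
    by (rule fps_deriv_eqI) (use YS[of _ 1] in \<open>simp add: \<delta>_def singular_field_def a_def d_def\<close>)
  have dd: "fps_X * fps_deriv d + fps_const ((2 * real k + real p + 2) / 2) * d =
      fps_X * (- (fps_const (1/2) * (fps_X ^ (k - 3) * M)))"
    by (rule fps_singular_deriv_eqI) (use YS[of _ 2] Y0[of 2] in
      \<open>simp_all add: \<delta>_def y0_def singular_field_def Let_def a_def d_def w_def b_def M_def\<close>)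
  have wd: "fps_deriv w = - (w\<^sup>2 * (fps_const L * (fps_X ^ (k - 2) * (fps_const (real k - 1) * a\<^sup>2 + a * (d * fps_X)))))"
    by (rule fps_deriv_eqI) (use YS[of _ 3] in \<open>simp add: \<delta>_def singular_field_def Let_def a_def d_def w_def\<close>)
  have Dd: "fps_deriv D = fps_const L * (fps_X ^ (k - 2) * (fps_const (real k - 1) * a\<^sup>2 + a * (d * fps_X)))"
  proof -
    have "fps_deriv (fps_X ^ (k - 1)) = fps_const (real k - 1) * (fps_X ^ (k - 2) :: real fps)"
      using k by (simp add: fps_deriv_power' of_nat_diff numeral_2_eq_2 fps_of_nat[symmetric])
    moreover have "fps_X ^ (k - 1) = fps_X * (fps_X ^ (k - 2) :: real fps)" using k_pred by simp
    moreover have "2 * fps_const (1/2) = (1 :: real fps)" by (simp add: numeral_fps_const)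
    ultimately show ?thesis
      unfolding D_def by (simp add: ad power2_eq_square algebra_simps)
  qed
  have "w * D = 1"
  proof (rule weight_unique)
    show "fps_deriv w = - (w\<^sup>2 * fps_deriv D)" by (simp only: wd Dd)
    show "w $ 0 * D $ 0 = 1" using Y0[of 3] k by (simp add: w_def D_def y0_def)
  qed
  have ev: "eval_fps w x = wgt x (eval_fps a x)" if x: "\<bar>x\<bar> < R" for x
  proof -
    have "eval_fps (w * D) x = 1" using \<open>w * D = 1\<close> by simp
    moreover have "eval_fps (w * D) x = eval_fps w x * (1 + L * x ^ (k - 1) * (eval_fps a x)\<^sup>2)"
      unfolding D_def using rads
      by (simp add: eval_fps_conv[where R = R] x fps_conv_radius_ge)
    ultimately show ?thesis unfolding wgt_def by (metis mult_zero_right nonzero_eq_divide_eq zero_neq_one)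
  qed
  define A where "A = eval_fps a"
  define B where "B = eval_fps b"
  have psA: "power_series_at A 0 (fps_nth a) R"
    unfolding power_series_at_iff_eval A_def using R rads by (simp add: fps_nth_inverse)
  have psB: "power_series_at B 0 (fps_nth b) R"
    unfolding power_series_at_iff_eval B_def using R radb by (simp add: fps_nth_inverse)
  have "analytic_at_point A z \<and> analytic_at_point B z" if "z \<in> {0..<R}" for z
    using power_series_at_recenter[OF psA, of z] power_series_at_recenter[OF psB, of z] that
    unfolding analytic_at_point_def by (metis abs_of_nonneg atLeastLessThan_iff diff_zero)
  moreover have "A 0 = 1" "B 0 = real k"
    unfolding A_def B_def using Y0[of 1] by (simp_all add: eval_fps_at_0 a_def b_def y0_def)
  moreover have "ode_at A B z" if z: "z \<in> {0<..<R}" for z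
  proof -
    have zR: "\<bar>z\<bar> < R" using z by simp
    define e where "e = eval_fps d z"
    define u where "u = wgt z (A z)"
    have Bz: "B z = real k * A z + z * e" unfolding A_def B_def e_def b_def using rads
      by (simp add: eval_fps_conv[where R = R] zR fps_conv_radius_ge)
    have da: "eval_fps (fps_deriv a) z = e / 2"
      unfolding ad e_def using rads by (simp add: eval_fps_conv[where R = R] zR)
    have "eval_fps (fps_X * fps_deriv d + fps_const ((2 * real k + real p + 2) / 2) * d) z =
      eval_fps (fps_X * (- (fps_const (1/2) * (fps_X ^ (k - 3) * M)))) z" by (simp only: dd)
    then have de: "z * eval_fps (fps_deriv d) z + (2 * real k + real p + 2) / 2 * e =
      - z * (1/2 * (z ^ (k - 3) * ((B z)\<^sup>2 * (B z + real p * ((B z - L * A z) * u)) - real p * L * ((B z - L * A z) * ((A z)\<^sup>2 * u)))))"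
      unfolding M_def e_def A_def B_def u_def ev[OF zR, symmetric] using rads radb
      by (simp add: eval_fps_conv[where R = R] zR fps_conv_radius_ge)
    have db: "eval_fps (fps_deriv b) z = real k * (e / 2) + e + z * eval_fps (fps_deriv d) z"
      unfolding b_def e_def da[symmetric, unfolded e_def] using rads
      by (simp add: eval_fps_conv[where R = R] zR fps_conv_radius_ge)
    have "(A has_real_derivative eval_fps (fps_deriv a) z) (at z)"
      unfolding A_def by (rule has_derivative_eval[OF zR rads(1)])
    moreover have "arhs z (A z) (B z) = eval_fps (fps_deriv a) z" using z by (simp add: arhs_def Bz da)
    ultimately have 1: "(A has_real_derivative arhs z (A z) (B z)) (at z)" by simp
    have zpos: "z > 0" using z by simp
    have zk: "z ^ (k - 1) = z * (z * z ^ (k - 3))" using k by (simp flip: power_Suc add: Suc_diff_Suc numeral_eq_Suc)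
    have u: "u * (1 + L * z ^ (k - 1) * (A z)\<^sup>2) = 1"
    proof -
      have "0 \<le> L * z ^ (k - 1) * (A z)\<^sup>2" using L_ge zpos by simp
      then show ?thesis by (simp add: u_def wgt_def)
    qed
    define q where "q = z ^ (k - 3)"
    \<comment> \<open>The relation \<open>pL\<close> in the shape in which the terms linear in
      \<open>a\<close> cancel.\<close>
    have lin: "real k * (real k - 1) + real k * (1 + real p) = real p * L" using pL by (simp add: algebra_simps)
    have "2 * z * (real k * (e / 2) + e + z * eval_fps (fps_deriv d) z) =
       - (real k - 1) * B z - (1 + z ^ (k - 1) * (B z)\<^sup>2) * (B z + real p * (B z - L * A z) * u)"
    proof -
      have "z * eval_fps (fps_deriv d) z = - ((2 * real k + real p + 2) / 2 * e)
          - z * (1/2 * (q * ((B z)\<^sup>2 * (B z + real p * ((B z - L * A z) * u)) - real p * L * ((B z - L * A z) * ((A z)\<^sup>2 * u)))))"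
        using de unfolding q_def by linarith
      note zE = this
      have "2 * z * (real k * (e / 2) + e + z * eval_fps (fps_deriv d) z) =
          z * e * (real k + 2) + 2 * z * (z * eval_fps (fps_deriv d) z)" by (simp add: algebra_simps)
      also have "\<dots> =
          - (real k + real p) * (z * e) - z * z * q * ((B z)\<^sup>2 * (B z + real p * ((B z - L * A z) * u)))
          + real p * (B z - L * A z) * (L * (z * (z * q)) * (A z)\<^sup>2 * u)"
        unfolding zE by (simp add: field_simps)
      finally have "2 * z * (real k * (e / 2) + e + z * eval_fps (fps_deriv d) z) =
          - (real k + real p) * (z * e) - z * z * q * ((B z)\<^sup>2 * (B z + real p * ((B z - L * A z) * u)))
          + real p * (B z - L * A z) * (L * (z * (z * q)) * (A z)\<^sup>2 * u)" .
      moreover have "L * (z * (z * q)) * (A z)\<^sup>2 * u = 1 - u"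
        using u unfolding zk q_def[symmetric] by (simp add: algebra_simps)
      ultimately have "2 * z * (real k * (e / 2) + e + z * eval_fps (fps_deriv d) z) =
          - (real k + real p) * (z * e) - z ^ (k - 1) * ((B z)\<^sup>2 * (B z + real p * ((B z - L * A z) * u)))
          + real p * (B z - L * A z) * (1 - u)"
        unfolding zk q_def[symmetric] by (simp add: mult.assoc)
      also have "\<dots> = - (real k - 1) * B z - (1 + z ^ (k - 1) * (B z)\<^sup>2) * (B z + real p * (B z - L * A z) * u)"
      proof -
        define G where "G = real p * (B z - L * A z)"
        have "G = real p * B z - (real p * L) * A z" by (simp add: G_def algebra_simps)
        then have "(real k + real p) * (z * e) = G + real k * B z"
          unfolding lin[symmetric] Bz by (simp add: algebra_simps)
        then show ?thesis
          unfolding mult.assoc[of "real p", symmetric] G_def[symmetric] by (simp add: algebra_simps)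
      qed
      finally show ?thesis .
    qed
    then have "brhs z (A z) (B z) = eval_fps (fps_deriv b) z"
      using zpos unfolding db brhs_def u_def[symmetric] by (metis divide_eq_eq less_irrefl mult.commute mult_pos_pos zero_less_numeral)
    moreover have "(B has_real_derivative eval_fps (fps_deriv b) z) (at z)"
      unfolding B_def by (rule has_derivative_eval[OF zR radb])
    ultimately have 2: "(B has_real_derivative brhs z (A z) (B z)) (at z)" by simp
    from 1 2 show ?thesis by (simp add: ode_at_def)
  qed
  ultimately show ?thesis using R unfolding solution_upto_def by blast
qed

text \<open>Away from \<open>0\<close> the system is expanded at \<open>z\<^sub>0\<close> in the variable \<open>z / z\<^sub>0 = 1 + X\<close>; after rescaling to \<open>z\<^sub>0 = 1\<close> the radius
  of convergence depends only on a bound for the data, which allows continuation.\<close>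

abbreviation "one_plus_X \<equiv> 1 + fps_X :: real fps"

definition fps_weight :: "real fps \<Rightarrow> real fps" where
  "fps_weight a = inverse (1 + fps_const L * (one_plus_X ^ (k - 1) * a\<^sup>2))"

definition regular_a :: "real fps \<Rightarrow> real fps \<Rightarrow> real fps" where
  "regular_a a b = fps_const (1/2) * (inverse one_plus_X * (b - fps_const (real k) * a))"

definition regular_b :: "real fps \<Rightarrow> real fps \<Rightarrow> real fps \<Rightarrow> real fps" where
  "regular_b a b w = fps_const (1/2) * (inverse one_plus_X * (- (fps_const (real k - 1) * b)
      - (1 + one_plus_X ^ (k - 1) * b\<^sup>2) * (b + fps_const (real p) * ((b - fps_const L * a) * w))))"

definition regular_w :: "real fps \<Rightarrow> real fps \<Rightarrow> real fps \<Rightarrow> real fps" where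
  "regular_w a b w = - (w\<^sup>2 * (fps_const L * (fps_const (real k - 1) * (one_plus_X ^ (k - 2) * a\<^sup>2)
      + one_plus_X ^ (k - 1) * (a * (inverse one_plus_X * (b - fps_const (real k) * a))))))"

definition regular_field :: "(3 \<Rightarrow> real fps) \<Rightarrow> 3 \<Rightarrow> real fps" where
  "regular_field Y i = (if i = 1 then regular_a (Y 1) (Y 2)
     else if i = 2 then regular_b (Y 1) (Y 2) (Y 3) else regular_w (Y 1) (Y 2) (Y 3))"

lemma regular_field_causal_bounded: "causal_bounded (\<lambda>Y. regular_field Y i)"
proof -
  have "causal_bounded (\<lambda>Y. inverse one_plus_X)"
    by (rule causal_bounded_known) (rule l1_bound_geometric)
  then show ?thesis
    unfolding regular_field_def regular_a_def regular_b_def regular_w_def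
    by (cases "i = 1"; cases "i = 2"; simp) (intro causal_bounded_intros | assumption)+
qed

lemma regular_w_eq:
  assumes "fps_deriv a = regular_a a b"
  shows "regular_w a b w = - (w\<^sup>2 * fps_deriv (1 + fps_const L * (one_plus_X ^ (k - 1) * a\<^sup>2)))"
proof -
  have "fps_deriv (one_plus_X ^ (k - 1)) = fps_const (real k - 1) * one_plus_X ^ (k - 2)"
    using k by (simp add: fps_deriv_power' of_nat_diff numeral_2_eq_2 fps_of_nat[symmetric])
  moreover have "fps_deriv (a\<^sup>2) = a * (inverse one_plus_X * (b - fps_const (real k) * a))"
  proof -
    have "fps_deriv (a\<^sup>2) = (2 * fps_const (1/2)) * (a * (inverse one_plus_X * (b - fps_const (real k) * a)))"
      by (simp add: power2_eq_square assms regular_a_def algebra_simps)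
    moreover have "2 * fps_const (1/2) = (1 :: real fps)" by (simp add: numeral_fps_const)
    ultimately show ?thesis by simp
  qed
  ultimately have "fps_deriv (1 + fps_const L * (one_plus_X ^ (k - 1) * a\<^sup>2)) =
     fps_const L * (one_plus_X ^ (k - 1) * (a * (inverse one_plus_X * (b - fps_const (real k) * a)))
       + fps_const (real k - 1) * one_plus_X ^ (k - 2) * a\<^sup>2)"
    by (simp only: fps_deriv_add fps_deriv_mult fps_deriv_1 fps_deriv_const) simp
  then show ?thesis by (simp only: regular_w_def mult.assoc add.commute)
qed

lemma one_plus_X_power_nth_0: "(one_plus_X ^ m) $ 0 = 1"
  by (induction m) auto

lemma weight_const_pos: "(1 + fps_const L * (one_plus_X ^ (k - 1) * a\<^sup>2)) $ 0 \<noteq> (0 :: real)"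
proof -
  have "0 \<le> L * (a $ 0)\<^sup>2" using L_ge by simp
  then show ?thesis using one_plus_X_power_nth_0[of "k - 1"] by (simp add: power2_eq_square)
qed

text \<open>With the weight as a third component each pair solves the polynomial system, to which
  uniqueness of formal solutions applies.\<close>

lemma regular_unique:
  assumes "fps_deriv a = regular_a a b" "fps_deriv b = regular_b a b (fps_weight a)"
    and "fps_deriv a' = regular_a a' b'" "fps_deriv b' = regular_b a' b' (fps_weight a')"
    and "a $ 0 = a' $ 0" "b $ 0 = b' $ 0"
  shows "a = a' \<and> b = b'"
proof -
  define tr where "tr a b i = (if i = (1::3) then a else if i = 2 then b else fps_weight a)" for a b :: "real fps" and i
  have eq: "(real j + 1 + 0) * tr a b i $ Suc j = regular_field (tr a b) i $ j"
    if ab: "fps_deriv a = regular_a a b" "fps_deriv b = regular_b a b (fps_weight a)" for a b i j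
  proof -
    have "fps_deriv (fps_weight a) = regular_w a b (fps_weight a)"
      unfolding regular_w_eq[OF ab(1)] unfolding fps_weight_def
      by (subst fps_inverse_deriv) (use weight_const_pos[of a] in \<open>auto simp: mult.commute\<close>)
    then have "fps_deriv (tr a b i) = regular_field (tr a b) i"
      using ab by (simp add: tr_def regular_field_def)
    then have "fps_deriv (tr a b i) $ j = regular_field (tr a b) i $ j" by simp
    then show ?thesis by (simp add: add.commute)
  qed
  have w0: "fps_weight a $ 0 = fps_weight a' $ 0" using assms(5) by (simp add: fps_weight_def power2_eq_square)
  have "tr a b i = tr a' b' i" for i
  proof (rule fps_system_unique[where G = regular_field and \<delta> = "\<lambda>_. 0"])
    show "fps_agree N (regular_field Y i) (regular_field Z i)" if "\<And>i. fps_agree N (Y i) (Z i)" for Y Z N i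
      using regular_field_causal_bounded[of i] that unfolding causal_bounded_def by blast
    show "tr a b i $ 0 = tr a' b' i $ 0" for i using assms w0 by (simp add: tr_def)
  qed (use eq assms in auto)
  from this[of 1] this[of 2] show ?thesis by (simp add: tr_def)
qed

lemma regular_exists:
  assumes K0: "0 \<le> K0"
  shows "\<exists>R>0. R \<le> 1/2 \<and> (\<forall>a0 b0. \<bar>a0\<bar> \<le> K0 \<longrightarrow> \<bar>b0\<bar> \<le> K0 \<longrightarrow>
     (\<exists>a b. a $ 0 = a0 \<and> b $ 0 = b0 \<and> ereal R \<le> fps_conv_radius a \<and> ereal R \<le> fps_conv_radius b \<and>
        fps_deriv a = regular_a a b \<and> fps_deriv b = regular_b a b (fps_weight a) \<and>
        (\<forall>x. \<bar>x\<bar> < R \<longrightarrow>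
           eval_fps (fps_deriv a) x = arhs (1 + x) (eval_fps a x) (eval_fps b x) \<and>
           eval_fps (fps_deriv b) x = brhs (1 + x) (eval_fps a x) (eval_fps b x))))"
proof -
  obtain R0 where R0: "R0 > 0" and ex: "\<And>y0. (\<forall>i. \<bar>y0 i\<bar> \<le> K0 + 1) \<Longrightarrow>
     (\<exists>Y. (\<forall>i. Y i $ 0 = y0 i) \<and> (\<forall>i j. (real j + 1 + 0) * Y i $ Suc j = regular_field Y i $ j) \<and>
          (\<forall>i. fps_conv_radius (Y i) \<ge> ereal R0))"
    using fps_system_exists_uniform[of regular_field "\<lambda>_. 0" "K0 + 1", OF regular_field_causal_bounded] K0 by auto
  define R where "R = min R0 (1/2)"
  have R: "0 < R" "R \<le> 1/2" "R \<le> R0" using R0 by (auto simp: R_def)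
  show ?thesis
  proof (intro exI[of _ R] conjI allI impI)
    fix a0 b0 assume ab: "\<bar>a0\<bar> \<le> K0" "\<bar>b0\<bar> \<le> K0"
    \<comment> \<open>The initial weight is forced by \<open>a0\<close> and at most 1, so all three
      data are bounded by \<open>K0 + 1\<close>.\<close>
    define y0 where "y0 i = (if i = (1::3) then a0 else if i = 2 then b0 else 1 / (1 + L * a0\<^sup>2))" for i
    have La: "0 \<le> L * a0\<^sup>2" using L_ge by simp
    have "\<bar>y0 i\<bar> \<le> K0 + 1" for i
    proof -
      have "\<bar>1 / (1 + L * a0\<^sup>2)\<bar> \<le> 1" using La by simp
      then show ?thesis using ab K0 by (simp add: y0_def)
    qed
    with ex obtain Y where Y0: "\<And>i. Y i $ 0 = y0 i"
      and YS: "\<And>i j. (real j + 1 + 0) * Y i $ Suc j = regular_field Y i $ j"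
      and rad: "\<And>i. ereal R0 \<le> fps_conv_radius (Y i)" by blast
    define a where "a = Y 1"
    define b where "b = Y 2"
    define w where "w = Y 3"
    define D where "D = 1 + fps_const L * (one_plus_X ^ (k - 1) * a\<^sup>2)"
    have "ereal R \<le> fps_conv_radius (Y i)" for i using rad[of i] R by (meson ereal_less_eq(3) order_trans)
    then have rads: "ereal R \<le> fps_conv_radius a" "ereal R \<le> fps_conv_radius b" "ereal R \<le> fps_conv_radius w"
      by (auto simp: a_def b_def w_def)
    have da: "fps_deriv a = regular_a a b"
      by (rule fps_deriv_eqI) (use YS[of _ 1] in \<open>simp add: regular_field_def a_def b_def\<close>)
    have db: "fps_deriv b = regular_b a b w"
      by (rule fps_deriv_eqI) (use YS[of _ 2] in \<open>simp add: regular_field_def a_def b_def w_def\<close>)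
    have dw: "fps_deriv w = regular_w a b w"
      by (rule fps_deriv_eqI) (use YS[of _ 3] in \<open>simp add: regular_field_def a_def b_def w_def\<close>)
    have wD: "w * D = 1"
    proof (rule weight_unique)
      show "fps_deriv w = - (w\<^sup>2 * fps_deriv D)" unfolding D_def dw by (rule regular_w_eq[OF da])
      show "w $ 0 * D $ 0 = 1" using Y0[of 1] Y0[of 3] La
        using one_plus_X_power_nth_0[of "k - 1"] by (simp add: w_def D_def y0_def a_def power2_eq_square)
    qed
    then have "D * w = 1" by (simp add: mult.commute)
    then have weq: "fps_weight a = w" unfolding fps_weight_def D_def[symmetric] by (rule fps_inverse_unique)
    have ev: "eval_fps (fps_deriv a) x = arhs (1 + x) (eval_fps a x) (eval_fps b x) \<and>
           eval_fps (fps_deriv b) x = brhs (1 + x) (eval_fps a x) (eval_fps b x)" if x: "\<bar>x\<bar> < R" for x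
    proof -
      have x1: "1 + x > 0" using x R by linarith
      have radv: "ereal R \<le> fps_conv_radius (inverse one_plus_X)"
        using l1_bound_conv_radius[OF l1_bound_geometric] R by simp
      have "eval_fps (inverse one_plus_X * one_plus_X) x = 1" by (simp add: inverse_mult_eq_1)
      moreover have "eval_fps (inverse one_plus_X * one_plus_X) x = eval_fps (inverse one_plus_X) x * (1 + x)"
        using radv by (simp add: eval_fps_conv[where R = R] x fps_conv_radius_ge)
      ultimately have v: "eval_fps (inverse one_plus_X) x = 1 / (1 + x)"
        using x1 by (simp add: nonzero_eq_divide_eq)
      have "eval_fps (w * D) x = 1" using wD by simp
      moreover have "eval_fps (w * D) x = eval_fps w x * (1 + L * (1 + x) ^ (k - 1) * (eval_fps a x)\<^sup>2)"
        unfolding D_def using rads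
        by (simp add: eval_fps_conv[where R = R] x fps_conv_radius_ge)
      ultimately have w: "eval_fps w x = wgt (1 + x) (eval_fps a x)"
        unfolding wgt_def by (metis mult_zero_right nonzero_eq_divide_eq zero_neq_one)
      have "eval_fps (fps_deriv a) x = 1/2 * (1 / (1 + x) * (eval_fps b x - real k * eval_fps a x))"
        unfolding da regular_a_def v[symmetric] using rads radv
        by (simp add: eval_fps_conv[where R = R] x fps_conv_radius_ge)
      moreover have "eval_fps (fps_deriv b) x = 1/2 * (1 / (1 + x) * (- ((real k - 1) * eval_fps b x)
        - (1 + (1 + x) ^ (k - 1) * (eval_fps b x)\<^sup>2) * (eval_fps b x + real p * ((eval_fps b x - L * eval_fps a x) * wgt (1 + x) (eval_fps a x)))))"
        unfolding db regular_b_def v[symmetric] w[symmetric] using rads radv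
        by (simp add: eval_fps_conv[where R = R] x fps_conv_radius_ge)
      ultimately show ?thesis by (simp add: arhs_def brhs_def mult.assoc left_diff_distrib)
    qed
    show "\<exists>a b. a $ 0 = a0 \<and> b $ 0 = b0 \<and> ereal R \<le> fps_conv_radius a \<and> ereal R \<le> fps_conv_radius b \<and>
        fps_deriv a = regular_a a b \<and> fps_deriv b = regular_b a b (fps_weight a) \<and>
        (\<forall>x. \<bar>x\<bar> < R \<longrightarrow>
           eval_fps (fps_deriv a) x = arhs (1 + x) (eval_fps a x) (eval_fps b x) \<and>
           eval_fps (fps_deriv b) x = brhs (1 + x) (eval_fps a x) (eval_fps b x))"
      by (rule exI[of _ a], rule exI[of _ b])
         (use Y0[of 1] Y0[of 2] rads da db weq ev in \<open>simp add: a_def b_def y0_def\<close>)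
  qed (use R in auto)
qed

text \<open>Both sides of each equation are expanded at 1 and compared by uniqueness of expansions.
  In this way an existing solution is recognised as the formal one with the same initial
  data.\<close>

lemma regular_of_solution:
  assumes A: "power_series_at u 1 a r" and B: "power_series_at v 1 b r"
    and ode: "\<And>s. \<bar>s - 1\<bar> < r \<Longrightarrow> ode_at u v s" and r1: "r \<le> 1"
  shows "fps_deriv (Abs_fps a) = regular_a (Abs_fps a) (Abs_fps b) \<and>
    fps_deriv (Abs_fps b) = regular_b (Abs_fps a) (Abs_fps b) (fps_weight (Abs_fps a))"
proof -
  have r: "r > 0" using A by (simp add: power_series_at_def)
  note eA = power_series_at_expansion[OF A] and eB = power_series_at_expansion[OF B]
  have eX: "(\<lambda>x. 1 + x) has_fps_expansion one_plus_X"
    by (intro fps_expansion_intros)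
  have pw: "(\<lambda>x. f x ^ m) has_fps_expansion F ^ m" if "f has_fps_expansion F" for f :: "real \<Rightarrow> real" and F m
    by (induction m) (auto intro!: fps_expansion_intros that)
  have eW: "(\<lambda>x. inverse (1 + L * ((1 + x) ^ (k - 1) * (u (1 + x))\<^sup>2))) has_fps_expansion fps_weight (Abs_fps a)"
    unfolding fps_weight_def
    by (intro fps_expansion_intros pw eA eX) (rule weight_const_pos)
  have eI: "(\<lambda>x. inverse (1 + x)) has_fps_expansion inverse one_plus_X"
    by (intro fps_expansion_intros eX) simp
  have da: "(\<lambda>x. 1/2 * (inverse (1 + x) * (v (1 + x) - real k * u (1 + x)))) has_fps_expansion
      regular_a (Abs_fps a) (Abs_fps b)"
    unfolding regular_a_def by (intro fps_expansion_intros eA eB eI)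
  have db: "(\<lambda>x. 1/2 * (inverse (1 + x) * (- ((real k - 1) * v (1 + x))
      - (1 + (1 + x) ^ (k - 1) * (v (1 + x))\<^sup>2) * (v (1 + x) + real p * ((v (1 + x) - L * u (1 + x)) *
        inverse (1 + L * ((1 + x) ^ (k - 1) * (u (1 + x))\<^sup>2))))))) has_fps_expansion
      regular_b (Abs_fps a) (Abs_fps b) (fps_weight (Abs_fps a))"
    unfolding regular_b_def by (intro fps_expansion_intros eA eB eI pw eX eW)
  have ev: "\<forall>\<^sub>F x in nhds 0. x \<in> ball 0 r" using r by (intro eventually_nhds_in_open) auto
  have shift: "deriv (\<lambda>x. f (1 + x)) x = D" if "(f has_real_derivative D) (at (1 + x))" for f D and x :: real
    by (rule DERIV_imp_deriv) (use that DERIV_shift[of f D x 1] in \<open>simp add: add.commute\<close>)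
  have cong: "f has_fps_expansion F \<Longrightarrow> \<forall>\<^sub>F x in nhds 0. f x = g x \<Longrightarrow> g has_fps_expansion F" for f g :: "real \<Rightarrow> real" and F
    unfolding has_fps_expansion_def by (auto elim: eventually_elim2)
  have "\<forall>\<^sub>F x in nhds 0. 1/2 * (inverse (1 + x) * (v (1 + x) - real k * u (1 + x))) = deriv (\<lambda>x. u (1 + x)) x"
    using ev
  proof eventually_elim
    case (elim x)
    then have "ode_at u v (1 + x)" using ode by simp
    then have "deriv (\<lambda>x. u (1 + x)) x = arhs (1 + x) (u (1 + x)) (v (1 + x))"
      by (intro shift) (simp add: ode_at_def)
    then show ?case by (simp add: arhs_def field_simps)
  qed
  from cong[OF da this] have 1: "regular_a (Abs_fps a) (Abs_fps b) = fps_deriv (Abs_fps a)"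
    using has_fps_expansion_deriv[OF eA] real_fps_expansion_unique by blast
  have "\<forall>\<^sub>F x in nhds 0. 1/2 * (inverse (1 + x) * (- ((real k - 1) * v (1 + x))
      - (1 + (1 + x) ^ (k - 1) * (v (1 + x))\<^sup>2) * (v (1 + x) + real p * ((v (1 + x) - L * u (1 + x)) *
        inverse (1 + L * ((1 + x) ^ (k - 1) * (u (1 + x))\<^sup>2)))))) = deriv (\<lambda>x. v (1 + x)) x"
    using ev
  proof eventually_elim
    case (elim x)
    then have "ode_at u v (1 + x)" using ode by simp
    then have "deriv (\<lambda>x. v (1 + x)) x = brhs (1 + x) (u (1 + x)) (v (1 + x))"
      by (intro shift) (simp add: ode_at_def)
    then show ?case by (simp add: brhs_def wgt_def inverse_eq_divide mult.assoc left_diff_distrib)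
  qed
  from cong[OF db this] have 2: "regular_b (Abs_fps a) (Abs_fps b) (fps_weight (Abs_fps a)) = fps_deriv (Abs_fps b)"
    using has_fps_expansion_deriv[OF eB] real_fps_expansion_unique by blast
  from 1 2 show ?thesis by simp
qed

section \<open>Dilation, gluing and continuation of solutions\<close>

lemma analytic_at_point_cong:
  assumes "analytic_at_point u x" "d > 0" "\<And>y. \<bar>y - x\<bar> < d \<Longrightarrow> v y = u y"
  shows "analytic_at_point v x"
proof -
  obtain c r where c: "power_series_at u x c r" using assms(1) by (auto simp: analytic_at_point_def)
  then have "0 < r" by (simp add: power_series_at_def)
  then have "power_series_at v x c (min r d)"
    using assms by (intro power_series_at_cong[OF c]) auto
  then show ?thesis by (auto simp: analytic_at_point_def)
qed

lemma ode_at_cong: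
  assumes "ode_at a b x" "d > 0" "\<And>y. \<bar>y - x\<bar> < d \<Longrightarrow> a' y = a y \<and> b' y = b y"
  shows "ode_at a' b' x"
proof -
  have ev: "\<forall>\<^sub>F y in nhds x. y \<in> ball x d" using assms(2) by (intro eventually_nhds_in_open) auto
  have 1: "\<forall>\<^sub>F y in nhds x. a y = a' y" and 2: "\<forall>\<^sub>F y in nhds x. b y = b' y"
    using ev by (eventually_elim; use assms(3) in \<open>force simp: dist_real_def abs_minus_commute\<close>)+
  have eq: "a' x = a x" "b' x = b x" using assms(2,3) by auto
  show ?thesis using assms(1) unfolding ode_at_def eq
    using DERIV_cong_ev[OF refl 1 refl] DERIV_cong_ev[OF refl 2 refl] by blast
qed

text \<open>Apart from being homogeneous of degree one, the right-hand sides involve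
  \<open>a\<close> and \<open>b\<close> only through \<open>z ^ (k - 1) * a\<^sup>2\<close> and
  \<open>z ^ (k - 1) * b\<^sup>2\<close>, and the choice of \<open>C\<close> keeps these invariant.
  This is the dilation symmetry of the minimal surface system.\<close>

lemma ode_scale:
  assumes ode: "ode_at a b (m * s)" and m: "m > 0" and C: "C\<^sup>2 = m ^ (k - 1)" and s: "s > 0"
  shows "ode_at (\<lambda>s. C * a (m * s)) (\<lambda>s. C * b (m * s)) s"
proof -
  have sq: "s ^ (k - 1) * (C * x)\<^sup>2 = (m * s) ^ (k - 1) * x\<^sup>2" for x
    by (simp add: power_mult_distrib C mult_ac)
  have w: "wgt s (C * a (m * s)) = wgt (m * s) (a (m * s))"
    unfolding wgt_def using sq[of "a (m * s)"] by (simp add: mult.assoc)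
  have 1: "arhs s (C * a (m * s)) (C * b (m * s)) = C * (arhs (m * s) (a (m * s)) (b (m * s)) * m)"
    using m s by (simp add: arhs_def field_simps)
  have 2: "brhs s (C * a (m * s)) (C * b (m * s)) = C * (brhs (m * s) (a (m * s)) (b (m * s)) * m)"
    using m s unfolding brhs_def w sq by (simp add: field_simps)
  have d: "((\<lambda>s. C * f (m * s)) has_real_derivative C * (D * m)) (at s)"
    if "(f has_real_derivative D) (at (m * s))" for f D
    by (rule DERIV_cmult, rule DERIV_chain2[where f = f and g = "\<lambda>s. m * s", OF that])
       (auto intro!: derivative_eq_intros)
  from ode show ?thesis unfolding ode_at_def 1 2 by (auto intro: d)
qed

lemma sqrt_power_sq: "z \<ge> 0 \<Longrightarrow> (sqrt z ^ m)\<^sup>2 = z ^ m"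
  by (metis power2_eq_square power_mult_distrib real_sqrt_pow2)

text \<open>The gain \<open>\<epsilon>\<close> depends on the bound \<open>K\<close> alone: a
  dilation moves the expansion point to 1, where the radius of convergence is controlled by the
  data, so the domain grows by a fixed factor however large \<open>Z\<close> is.\<close>

lemma solution_extend:
  assumes K: "0 \<le> K"
  shows "\<exists>\<epsilon>>0. \<forall>Z a b. 0 < Z \<longrightarrow> solution_upto Z a b \<longrightarrow>
    (\<forall>z\<in>{0<..<Z}. \<bar>sqrt z ^ (k - 1) * a z\<bar> \<le> K \<and> \<bar>sqrt z ^ (k - 1) * b z\<bar> \<le> K) \<longrightarrow>
    (\<exists>a' b'. solution_upto (Z * (1 + \<epsilon>)) a' b' \<and> (\<forall>z \<le> Z / (1 + \<epsilon>). a' z = a z \<and> b' z = b z))"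
proof -
  obtain R where R: "0 < R" "R \<le> 1/2" and ex: "\<And>a0 b0. \<bar>a0\<bar> \<le> K \<Longrightarrow> \<bar>b0\<bar> \<le> K \<Longrightarrow>
     (\<exists>a b. a $ 0 = a0 \<and> b $ 0 = b0 \<and> ereal R \<le> fps_conv_radius a \<and> ereal R \<le> fps_conv_radius b \<and>
        fps_deriv a = regular_a a b \<and> fps_deriv b = regular_b a b (fps_weight a) \<and>
        (\<forall>x. \<bar>x\<bar> < R \<longrightarrow>
           eval_fps (fps_deriv a) x = arhs (1 + x) (eval_fps a x) (eval_fps b x) \<and>
           eval_fps (fps_deriv b) x = brhs (1 + x) (eval_fps a x) (eval_fps b x)))"
    using regular_exists[OF K] by blast
  \<comment> \<open>Expanding at \<open>Z / (1 + \<epsilon>)\<close> with relative radius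
    \<open>R\<close> covers everything below \<open>Z * (1 + \<epsilon>)\<close> as soon as
    \<open>(1 + \<epsilon>)\<^sup>2 \<le> 1 + R\<close>, which this choice ensures.\<close>
  define \<epsilon> where "\<epsilon> = R / 4"
  have \<epsilon>: "0 < \<epsilon>" using R by (simp add: \<epsilon>_def)
  have \<epsilon>R: "(1 + \<epsilon>)\<^sup>2 \<le> 1 + R"
  proof -
    have "R * R \<le> R * 1" using R by (intro mult_left_mono) auto
    moreover have "(1 + \<epsilon>)\<^sup>2 = 1 + R / 2 + R * R / 16" by (simp add: \<epsilon>_def power2_eq_square field_simps)
    ultimately show ?thesis using R by linarith
  qed
  show ?thesis
  proof (rule exI[of _ \<epsilon>], rule conjI[OF \<epsilon>], intro allI impI)
    fix Z a b assume Z: "0 < Z" and sol: "solution_upto Z a b"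
      and bd: "\<forall>z\<in>{0<..<Z}. \<bar>sqrt z ^ (k - 1) * a z\<bar> \<le> K \<and> \<bar>sqrt z ^ (k - 1) * b z\<bar> \<le> K"
    define z0 where "z0 = Z / (1 + \<epsilon>)"
    have z0: "0 < z0" "z0 < Z" using Z \<epsilon> by (auto simp: z0_def field_simps)
    have Z1: "Z * (1 + \<epsilon>) \<le> z0 * (1 + R)"
    proof -
      have "Z * (1 + \<epsilon>) = z0 * (1 + \<epsilon>)\<^sup>2" using \<epsilon> by (simp add: z0_def power2_eq_square)
      also have "\<dots> \<le> z0 * (1 + R)" using \<epsilon>R z0 by (intro mult_left_mono) auto
      finally show ?thesis .
    qed
    \<comment> \<open>This factor turns \<open>a z0\<close> and \<open>b z0\<close> into the
      autonomous variables, which are the ones bounded by \<open>K\<close>; it is also the constant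
      of the dilation by \<open>z0\<close>.\<close>
    define c where "c = sqrt z0 ^ (k - 1)"
    have c: "c > 0" "c\<^sup>2 = z0 ^ (k - 1)" using z0 by (simp_all add: c_def sqrt_power_sq)
    have "\<bar>c * a z0\<bar> \<le> K" "\<bar>c * b z0\<bar> \<le> K" using bd z0 by (auto simp: c_def)
    from ex[OF this] obtain A B where AB: "A $ 0 = c * a z0" "B $ 0 = c * b z0"
      and rads: "ereal R \<le> fps_conv_radius A" "ereal R \<le> fps_conv_radius B"
      and reg: "fps_deriv A = regular_a A B" "fps_deriv B = regular_b A B (fps_weight A)"
      and ev: "\<And>x. \<bar>x\<bar> < R \<Longrightarrow>
           eval_fps (fps_deriv A) x = arhs (1 + x) (eval_fps A x) (eval_fps B x) \<and>
           eval_fps (fps_deriv B) x = brhs (1 + x) (eval_fps A x) (eval_fps B x)" by blast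
    have psA: "power_series_at (eval_fps A) 0 (fps_nth A) R"
      unfolding power_series_at_iff_eval using R rads by (simp add: fps_nth_inverse)
    have psB: "power_series_at (eval_fps B) 0 (fps_nth B) R"
      unfolding power_series_at_iff_eval using R rads by (simp add: fps_nth_inverse)
    define a2 where "a2 z = 1 / c * eval_fps A (0 + (z - z0) * (1 / z0))" for z
    define b2 where "b2 z = 1 / c * eval_fps B (0 + (z - z0) * (1 / z0))" for z
    have ps2: "\<exists>c. power_series_at a2 z0 c (R * z0)" "\<exists>c. power_series_at b2 z0 c (R * z0)"
      using power_series_at_affine[OF psA, of "1 / z0" "1 / c" z0] power_series_at_affine[OF psB, of "1 / z0" "1 / c" z0] z0
      unfolding a2_def[abs_def] b2_def[abs_def] by auto
    have ana2: "analytic_at_point a2 z \<and> analytic_at_point b2 z" if "\<bar>z - z0\<bar> < R * z0" for z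
      using ps2 power_series_at_recenter that unfolding analytic_at_point_def by metis
    have shift: "((\<lambda>s. eval_fps C (s - 1)) has_real_derivative eval_fps (fps_deriv C) (s - 1)) (at s)"
      if "\<bar>s - 1\<bar> < R" "ereal R \<le> fps_conv_radius C" for C s
    proof -
      have "((\<lambda>s. eval_fps C (s - 1)) has_real_derivative eval_fps (fps_deriv C) (s - 1) * 1) (at s)"
        by (rule DERIV_chain2[where f = "eval_fps C" and g = "\<lambda>s. s - 1", OF has_derivative_eval[OF that]]) (auto intro!: derivative_eq_intros)
      then show ?thesis by simp
    qed
    have ode2: "ode_at a2 b2 z" if z: "\<bar>z - z0\<bar> < R * z0" for z
    proof -
      have zz: "\<bar>1 / z0 * z - 1\<bar> < R"
      proof -
        have "1 / z0 * z - 1 = (z - z0) / z0" using z0 by (simp add: field_simps)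
        then have "\<bar>1 / z0 * z - 1\<bar> = \<bar>z - z0\<bar> / z0" using z0 by (simp add: abs_divide)
        also have "\<dots> < R" using z z0 by (simp add: pos_divide_less_eq)
        finally show ?thesis .
      qed
      have "z > 0"
      proof -
        have "R * z0 \<le> 1/2 * z0" using R z0 by (intro mult_right_mono) auto
        then show ?thesis using z z0 by linarith
      qed
      have "ode_at (\<lambda>s. eval_fps A (s - 1)) (\<lambda>s. eval_fps B (s - 1)) (1 / z0 * z)"
        unfolding ode_at_def using shift[OF zz rads(1)] shift[OF zz rads(2)] ev[OF zz] by simp
      moreover have "(1 / c)\<^sup>2 = (1 / z0) ^ (k - 1)" by (simp add: power_one_over c)
      moreover have "1 / z0 > 0" using z0 by simp
      ultimately have "ode_at (\<lambda>z. 1 / c * eval_fps A (1 / z0 * z - 1)) (\<lambda>z. 1 / c * eval_fps B (1 / z0 * z - 1)) z"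
        using ode_scale[of "\<lambda>s. eval_fps A (s - 1)" "\<lambda>s. eval_fps B (s - 1)" "1 / z0" z "1 / c"] \<open>z > 0\<close>
        by blast
      moreover have "1 / z0 * z - 1 = 0 + (z - z0) * (1 / z0)" for z using z0 by (simp add: field_simps)
      ultimately show ?thesis unfolding a2_def[abs_def] b2_def[abs_def] by simp
    qed
    \<comment> \<open>Old and new solution agree near \<open>z0\<close>: moved to the point 1, both
      are power series that solve the same formal system with the same initial coefficients.\<close>
    obtain d where d: "d > 0" "\<And>z. \<bar>z - z0\<bar> < d \<Longrightarrow> a z = a2 z \<and> b z = b2 z"
    proof -
      from sol z0 obtain ca ra cb rb where pa: "power_series_at a z0 ca ra" and pb: "power_series_at b z0 cb rb"
        unfolding solution_upto_def analytic_at_point_def by fastforce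
      have rr: "ra > 0" "rb > 0" using pa pb by (auto simp: power_series_at_def)
      \<comment> \<open>The four bounds keep both series convergent, \<open>s\<close> positive, and
        \<open>z0 * s\<close> below \<open>Z\<close>, where the old solution is known.\<close>
      define r where "r = Min {ra / z0, rb / z0, 1, (Z - z0) / z0}"
      have r: "r > 0" using rr z0 by (simp add: r_def)
      have rle: "r \<le> ra / z0" "r \<le> rb / z0" "r \<le> 1" "r \<le> (Z - z0) / z0" by (simp_all add: r_def)
      define u where "u s = c * a (z0 * s)" for s
      define v where "v s = c * b (z0 * s)" for s
      have ue: "u = (\<lambda>x. c * a (z0 + (x - 1) * z0))" "v = (\<lambda>x. c * b (z0 + (x - 1) * z0))"
        by (auto simp: u_def v_def algebra_simps)
      have pu: "power_series_at u 1 (\<lambda>n. c * ca n * z0 ^ n) r" unfolding ue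
        by (rule power_series_at_cong[OF power_series_at_affine[OF pa z0(1)]]) (use r rle in auto)
      have pv: "power_series_at v 1 (\<lambda>n. c * cb n * z0 ^ n) r" unfolding ue
        by (rule power_series_at_cong[OF power_series_at_affine[OF pb z0(1)]]) (use r rle in auto)
      have odeuv: "ode_at u v s" if s: "\<bar>s - 1\<bar> < r" for s
      proof -
        have s0: "s > 0" using s rle by linarith
        have "s < 1 + (Z - z0) / z0" using s rle by linarith
        then have "z0 * s < Z" using z0 by (simp add: field_simps)
        then have "ode_at a b (z0 * s)" using sol s0 z0 by (simp add: solution_upto_def)
        then show ?thesis unfolding u_def[abs_def] v_def[abs_def] by (rule ode_scale) (use z0 c s0 in auto)
      qed
      have "Abs_fps (\<lambda>n. c * ca n * z0 ^ n) = A \<and> Abs_fps (\<lambda>n. c * cb n * z0 ^ n) = B"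
      proof (rule regular_unique)
        show "fps_deriv A = regular_a A B" "fps_deriv B = regular_b A B (fps_weight A)" by fact+
        have "ca 0 = a z0" "cb 0 = b z0"
          using power_series_at_eval[OF pa, of 0] power_series_at_eval[OF pb, of 0] rr by (simp_all add: eval_fps_at_0)
        then show "Abs_fps (\<lambda>n. c * ca n * z0 ^ n) $ 0 = A $ 0" "Abs_fps (\<lambda>n. c * cb n * z0 ^ n) $ 0 = B $ 0"
          using AB by simp_all
      qed (use regular_of_solution[OF pu pv odeuv rle(3)] in simp_all)
      then have "u (1 + y) = eval_fps A y \<and> v (1 + y) = eval_fps B y" if "\<bar>y\<bar> < r" for y
        using power_series_at_eval[OF pu that] power_series_at_eval[OF pv that] by simp
      note uv = this
      have "a z = a2 z \<and> b z = b2 z" if z: "\<bar>z - z0\<bar> < r * z0" for z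
      proof -
        have "\<bar>(z - z0) * (1 / z0)\<bar> < r" using z z0 by (simp add: abs_mult pos_divide_less_eq)
        from uv[OF this] show ?thesis using z0 c unfolding u_def v_def a2_def b2_def by (simp add: field_simps)
      qed
      moreover have "r * z0 > 0" using r z0 by simp
      ultimately show ?thesis using that by blast
    qed
    \<comment> \<open>The cut is at \<open>z0\<close>, where both functions agree on a
      neighbourhood, so every point has a neighbourhood on which a single piece is in force.\<close>
    define a' where "a' z = (if z \<le> z0 then a z else a2 z)" for z
    define b' where "b' z = (if z \<le> z0 then b z else b2 z)" for z
    have left: "a' y = a y \<and> b' y = b y" if "\<bar>y - z\<bar> < z0 - z" for y z using that by (auto simp: a'_def b'_def)
    have right: "a' y = a2 y \<and> b' y = b2 y" if "\<bar>y - z\<bar> < z - z0 + d" "z0 \<le> z" for y z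
      using that d(2)[of y] by (auto simp: a'_def b'_def)
    have near: "\<bar>z - z0\<bar> < R * z0" if "z0 \<le> z" "z < Z * (1 + \<epsilon>)" for z
    proof -
      have "z < z0 * (1 + R)" using that Z1 by linarith
      then show ?thesis using that by (simp add: algebra_simps)
    qed
    have "analytic_at_point a' z \<and> analytic_at_point b' z" if z: "0 \<le> z" "z < Z * (1 + \<epsilon>)" for z
    proof (cases "z < z0")
      case True
      then have "analytic_at_point a z \<and> analytic_at_point b z" using sol z z0 by (auto simp: solution_upto_def)
      moreover have "0 < z0 - z" using True by simp
      ultimately show ?thesis using analytic_at_point_cong left by meson
    next
      case False
      then have "analytic_at_point a2 z \<and> analytic_at_point b2 z" using ana2 near z by simp
      moreover have "0 < z - z0 + d" using False d by simp
      moreover have "z0 \<le> z" using False by simp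
      ultimately show ?thesis using analytic_at_point_cong right by meson
    qed
    moreover have "ode_at a' b' z" if z: "0 < z" "z < Z * (1 + \<epsilon>)" for z
    proof (cases "z < z0")
      case True
      then have "ode_at a b z" using sol z z0 by (auto simp: solution_upto_def)
      moreover have "0 < z0 - z" using True by simp
      ultimately show ?thesis using ode_at_cong left by meson
    next
      case False
      then have "ode_at a2 b2 z" using ode2 near z by simp
      moreover have "0 < z - z0 + d" using False d by simp
      moreover have "z0 \<le> z" using False by simp
      ultimately show ?thesis using ode_at_cong right by meson
    qed
    moreover have "a' 0 = 1" "b' 0 = real k" using sol z0 by (auto simp: a'_def b'_def solution_upto_def)
    ultimately have "solution_upto (Z * (1 + \<epsilon>)) a' b'" by (simp add: solution_upto_def)
    moreover have "\<forall>z \<le> Z / (1 + \<epsilon>). a' z = a z \<and> b' z = b z" by (simp add: a'_def b'_def z0_def)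
    ultimately show "\<exists>a' b'. solution_upto (Z * (1 + \<epsilon>)) a' b' \<and> (\<forall>z \<le> Z / (1 + \<epsilon>). a' z = a z \<and> b' z = b z)"
      by blast
  qed
qed

text \<open>Repeating a fixed relative gain reaches every \<open>Z\<close>. Each extension alters
  the functions only beyond \<open>Z / (1 + \<epsilon>)\<close>, so the values stabilise and a limit
  can be defined pointwise.\<close>

lemma global_solution:
  assumes K: "0 \<le> K"
    and apriori: "\<And>Z a b z. solution_upto Z a b \<Longrightarrow> z \<in> {0<..<Z} \<Longrightarrow>
        \<bar>sqrt z ^ (k - 1) * a z\<bar> \<le> K \<and> \<bar>sqrt z ^ (k - 1) * b z\<bar> \<le> K"
  shows "\<exists>a b. \<forall>Z. solution_upto Z a b"
proof -
  obtain \<epsilon> where \<epsilon>: "0 < \<epsilon>" and ext0: "\<forall>Z a b. 0 < Z \<longrightarrow> solution_upto Z a b \<longrightarrow>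
    (\<forall>z\<in>{0<..<Z}. \<bar>sqrt z ^ (k - 1) * a z\<bar> \<le> K \<and> \<bar>sqrt z ^ (k - 1) * b z\<bar> \<le> K) \<longrightarrow>
    (\<exists>a' b'. solution_upto (Z * (1 + \<epsilon>)) a' b' \<and> (\<forall>z \<le> Z / (1 + \<epsilon>). a' z = a z \<and> b' z = b z))"
    using solution_extend[OF K] by (elim exE conjE)
  have ext: "\<exists>a' b'. solution_upto (Z * (1 + \<epsilon>)) a' b' \<and> (\<forall>z \<le> Z / (1 + \<epsilon>). a' z = a z \<and> b' z = b z)"
    if "0 < Z" "solution_upto Z a b" for Z a b
    using ext0[rule_format, OF that] apriori[OF that(2)] by simp
  obtain Z0 a0 b0 where Z0: "0 < Z0" "solution_upto Z0 a0 b0" using solution_near_zero by blast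
  define P where "P n x = (case x of (Z, a, b) \<Rightarrow> Z = Z0 * (1 + \<epsilon>) ^ n \<and> solution_upto Z a b)"
    for n :: nat and x :: "real \<times> (real \<Rightarrow> real) \<times> (real \<Rightarrow> real)"
  define Q where "Q n x y = (case x of (Z, a, b) \<Rightarrow> case y of (Z', a', b') \<Rightarrow> (\<forall>z \<le> Z / (1 + \<epsilon>). a' z = a z \<and> b' z = b z))"
    for n :: nat and x y :: "real \<times> (real \<Rightarrow> real) \<times> (real \<Rightarrow> real)"
  have "\<exists>f. \<forall>n. P n (f n) \<and> Q n (f n) (f (Suc n))"
  proof (rule dependent_nat_choice)
    show "\<exists>x. P 0 x" using Z0 by (intro exI[of _ "(Z0, a0, b0)"]) (simp add: P_def)
    fix x n assume "P n x"
    then obtain Z a b where x: "x = (Z, a, b)" "Z = Z0 * (1 + \<epsilon>) ^ n" "solution_upto Z a b"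
      by (cases x) (auto simp: P_def)
    then have "0 < Z" using Z0 \<epsilon> by simp
    from ext[OF this x(3)] obtain a' b' where "solution_upto (Z * (1 + \<epsilon>)) a' b'"
      "\<forall>z \<le> Z / (1 + \<epsilon>). a' z = a z \<and> b' z = b z" by blast
    then show "\<exists>y. P (Suc n) y \<and> Q n x y"
      using x by (intro exI[of _ "(Z * (1 + \<epsilon>), a', b')"]) (simp add: P_def Q_def mult_ac)
  qed
  then obtain f where f: "\<And>n. P n (f n)" "\<And>n. Q n (f n) (f (Suc n))" by blast
  define Zs where "Zs n = Z0 * (1 + \<epsilon>) ^ n" for n
  define as where "as n = fst (snd (f n))" for n
  define bs where "bs n = snd (snd (f n))" for n
  have sol: "solution_upto (Zs n) (as n) (bs n)" for n
    using f(1)[of n] by (auto simp: P_def Zs_def as_def bs_def split: prod.splits)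
  \<comment> \<open>From index \<open>n\<close> on the functions no longer change on
    \<open>z \<le> Y n\<close>, and \<open>Y n\<close> tends to infinity.\<close>
  define Y where "Y n = Zs n / (1 + \<epsilon>)" for n
  have Ymono: "Y m \<le> Y n" if "m \<le> n" for m n
    using that Z0 \<epsilon> unfolding Y_def Zs_def by (intro divide_right_mono mult_left_mono power_increasing) auto
  have YZ: "Y n < Zs n" for n using Z0 \<epsilon> by (simp add: Y_def Zs_def divide_less_eq)
  have succ: "as (Suc n) z = as n z \<and> bs (Suc n) z = bs n z" if "z \<le> Y n" for n z
    using f(1)[of n] f(2)[of n] that by (auto simp: P_def Q_def Y_def Zs_def as_def bs_def split: prod.splits)
  have stable: "as n z = as m z \<and> bs n z = bs m z" if "m \<le> n" "z \<le> Y m" for m n z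
    using that(1)
  proof (induction n rule: dec_induct)
    case (step n)
    then show ?case using Ymono[of m n] \<open>z \<le> Y m\<close> succ[of z n] by auto
  qed simp
  have ex: "\<exists>n. z < Y n" for z
  proof -
    obtain n where "(z + 1) * (1 + \<epsilon>) / Z0 < (1 + \<epsilon>) ^ n"
      using real_arch_pow[of "1 + \<epsilon>" "(z + 1) * (1 + \<epsilon>) / Z0"] \<epsilon> by auto
    then have "(z + 1) * (1 + \<epsilon>) < Zs n" using Z0 by (simp add: Zs_def divide_less_eq mult.commute)
    then have "z + 1 < Y n" using \<epsilon> by (simp add: Y_def pos_less_divide_eq)
    then show ?thesis by (intro exI[of _ n]) simp
  qed
  define N where "N z = (SOME n. z < Y n)" for z
  have N: "z < Y (N z)" for z unfolding N_def using ex by (rule someI_ex)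
  define a where "a z = as (N z) z" for z
  define b where "b z = bs (N z) z" for z
  have ab: "a z = as n z \<and> b z = bs n z" if "z < Y n" for z n
    using stable[of n "N z" z] stable[of "N z" n z] N[of z] that unfolding a_def b_def
    by (cases "n \<le> N z") auto
  have loc: "a y = as n y \<and> b y = bs n y" if "\<bar>y - z\<bar> < Y n - z" for y z n using ab that by auto
  have "solution_upto Z a b" for Z
    unfolding solution_upto_def
  proof (intro conjI ballI)
    have "a 0 = as (N 0) 0 \<and> b 0 = bs (N 0) 0" using ab N by blast
    then show "a 0 = 1" "b 0 = real k" using sol[of "N 0"] by (auto simp: solution_upto_def)
    fix z assume z: "z \<in> {0..<Z}"
    have d: "0 < Y (N z) - z" using N[of z] by simp
    have "z \<in> {0..<Zs (N z)}" using z N[of z] YZ[of "N z"] by auto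
    then have "analytic_at_point (as (N z)) z \<and> analytic_at_point (bs (N z)) z"
      using sol[of "N z"] by (auto simp: solution_upto_def)
    then show "analytic_at_point a z" "analytic_at_point b z"
      using analytic_at_point_cong[OF _ d] loc by blast+
  next
    fix z assume z: "z \<in> {0<..<Z}"
    have d: "0 < Y (N z) - z" using N[of z] by simp
    have "z \<in> {0<..<Zs (N z)}" using z N[of z] YZ[of "N z"] by auto
    then have "ode_at (as (N z)) (bs (N z)) z"
      using sol[of "N z"] by (auto simp: solution_upto_def)
    then show "ode_at a b z" using ode_at_cong[OF _ d] loc by blast
  qed
  then show ?thesis by blast
qed

end

unbundle no fps_syntax
unbundle vec_syntax
no_notation fps_nth (infixl "$" 75)

section \<open>Convergence to the cone and spiralling\<close>

text \<open>By the mean value theorem on an interval of length \<open>d / 2\<close>, a small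
  increment of \<open>f\<close> forces a small value of \<open>g\<close> close to \<open>t\<close>;
  uniform continuity carries the smallness over to \<open>t\<close> itself.\<close>

lemma barbalat:
  fixes f g :: "real \<Rightarrow> real"
  assumes der: "\<And>t. t \<ge> t0 \<Longrightarrow> (f has_real_derivative g t) (at t)"
    and uc: "uniformly_continuous_on {t0..} g" and lim: "(f \<longlongrightarrow> l) at_top"
  shows "(g \<longlongrightarrow> 0) at_top"
proof (rule tendstoI)
  fix e :: real assume e: "e > 0"
  obtain d where d: "d > 0" "\<And>s t. s \<ge> t0 \<Longrightarrow> t \<ge> t0 \<Longrightarrow> dist s t < d \<Longrightarrow> dist (g s) (g t) < e / 2"
    using uc e unfolding uniformly_continuous_on_def by (metis atLeast_iff half_gt_zero)
  have "\<forall>\<^sub>F t in at_top. dist (f t) l < e * d / 8" using lim e d by (intro tendstoD) auto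
  then obtain T where T: "\<And>t. t \<ge> T \<Longrightarrow> dist (f t) l < e * d / 8" by (auto simp: eventually_at_top_linorder)
  show "\<forall>\<^sub>F t in at_top. dist (g t) 0 < e"
    using eventually_ge_at_top[of "max T t0"]
  proof eventually_elim
    case (elim t)
    obtain \<xi> where \<xi>: "t < \<xi>" "\<xi> < t + d / 2" "f (t + d / 2) - f t = (t + d / 2 - t) * g \<xi>"
      using MVT2[of t "t + d / 2" f g] der elim d by auto
    have "\<bar>f (t + d / 2) - f t\<bar> < e * d / 4"
      using T[of t] T[of "t + d / 2"] elim d unfolding dist_real_def by linarith
    then have "d / 2 * \<bar>g \<xi>\<bar> < d / 2 * (e / 2)" using \<xi>(3) d by (simp add: abs_mult mult.commute)
    then have "\<bar>g \<xi>\<bar> < e / 2" using d by (simp only: mult_less_cancel_left_pos half_gt_zero)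
    moreover have "dist (g t) (g \<xi>) < e / 2" using d(2)[of t \<xi>] elim \<xi> d by (simp add: dist_real_def)
    ultimately show ?case unfolding dist_real_def by linarith
  qed
qed

text \<open>A LaSalle type argument: on the compact set where \<open>\<bar>g\<bar> \<ge> e\<close>
  the function \<open>\<bar>h\<bar>\<close> has a positive minimum, and
  \<open>\<bar>h (X t)\<bar>\<close> eventually falls below it.\<close>

lemma compact_zero_tendsto:
  fixes h g :: "'a::t2_space \<Rightarrow> real"
  assumes K: "compact K" and h: "continuous_on K h" and g: "continuous_on K g"
    and z: "\<And>x. x \<in> K \<Longrightarrow> h x = 0 \<Longrightarrow> g x = 0"
    and X: "\<And>t. t \<ge> t0 \<Longrightarrow> X t \<in> K" and lim: "((\<lambda>t. h (X t)) \<longlongrightarrow> 0) at_top"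
  shows "((\<lambda>t. g (X t)) \<longlongrightarrow> 0) (at_top :: real filter)"
proof (rule tendstoI)
  fix e :: real assume e: "e > 0"
  define K' where "K' = K \<inter> g -` {x. \<bar>x\<bar> \<ge> e}"
  have K': "compact K'" unfolding K'_def
  proof (rule closedin_compact[OF K])
    have "closed {x :: real. \<bar>x\<bar> \<ge> e}" by (intro closed_Collect_le continuous_intros)
    then show "closedin (top_of_set K) (K \<inter> g -` {x. e \<le> \<bar>x\<bar>})"
      using continuous_closedin_preimage[OF g] by blast
  qed
  show "\<forall>\<^sub>F t in at_top. dist (g (X t)) 0 < e"
  proof (cases "K' = {}")
    case True
    show ?thesis using eventually_ge_at_top[of t0]
      by eventually_elim (use X True in \<open>force simp: K'_def\<close>)
  next
    case False
    have "continuous_on K' (\<lambda>x. \<bar>h x\<bar>)"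
      using h by (intro continuous_intros) (auto simp: K'_def intro: continuous_on_subset)
    from continuous_attains_inf[OF K' False this]
    obtain y where y: "y \<in> K'" "\<And>x. x \<in> K' \<Longrightarrow> \<bar>h y\<bar> \<le> \<bar>h x\<bar>" by blast
    have "\<bar>h y\<bar> > 0" using y(1) z e by (force simp: K'_def)
    then have "\<forall>\<^sub>F t in at_top. dist (h (X t)) 0 < \<bar>h y\<bar>" using lim by (intro tendstoD)
    then show ?thesis using eventually_ge_at_top[of t0]
    proof eventually_elim
      case (elim t)
      then have "X t \<notin> K'" using y(2)[of "X t"] by (auto simp: dist_real_def)
      then show ?case using X[OF elim(2)] by (auto simp: K'_def dist_real_def)
    qed
  qed
qed

lemma nonincreasing_bounded_tendsto:
  fixes f :: "real \<Rightarrow> real"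
  assumes mono: "\<And>s t. t0 \<le> s \<Longrightarrow> s \<le> t \<Longrightarrow> f t \<le> f s" and bd: "\<And>t. t0 \<le> t \<Longrightarrow> m \<le> f t"
  shows "\<exists>l. (f \<longlongrightarrow> l) at_top"
proof -
  define l where "l = Inf (f ` {t0..})"
  have bb: "bdd_below (f ` {t0..})" using bd by (auto simp: bdd_below_def)
  have "(f \<longlongrightarrow> l) at_top"
  proof (rule tendstoI)
    fix e :: real assume "e > 0"
    then obtain s where s: "s \<ge> t0" "f s < l + e"
      using cInf_lessD[of "f ` {t0..}" "l + e"] by (auto simp: l_def)
    show "\<forall>\<^sub>F t in at_top. dist (f t) l < e" using eventually_ge_at_top[of s]
    proof eventually_elim
      case (elim t)
      have "l \<le> f t" unfolding l_def using elim s bb by (intro cInf_lower) auto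
      moreover have "f t \<le> f s" using elim s by (intro mono) auto
      ultimately show ?case using s by (simp add: dist_real_def)
    qed
  qed
  then show ?thesis by blast
qed

text \<open>The logarithmic derivative of a non-vanishing solution of an oscillatory second order
  equation would satisfy such a Riccati equation. Eventually the quadratic dominates
  \<open>\<kappa> * (1 + q\<^sup>2)\<close> for some \<open>\<kappa> > 0\<close>, so
  \<open>arctan q\<close> decreases at rate at least \<open>\<kappa>\<close>, and over a time
  \<open>4 / \<kappa>\<close> it would drop by more than \<open>pi\<close>.\<close>

lemma riccati_contradiction:
  fixes q b c :: "real \<Rightarrow> real"
  assumes der: "\<And>t. t \<ge> t1 \<Longrightarrow> (q has_real_derivative - ((q t)\<^sup>2 + b t * q t + c t)) (at t)"
    and b: "(b \<longlongrightarrow> b0) at_top" and c: "(c \<longlongrightarrow> c0) at_top" and disc: "b0\<^sup>2 < 4 * c0"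
  shows False
proof -
  \<comment> \<open>The condition on \<open>\<kappa>\<close> is that
    \<open>(1 - \<kappa>) * q\<^sup>2 + b0 * q + (c0 - \<kappa>)\<close> has negative discriminant.
    It holds for \<open>\<kappa> = 0\<close> by \<open>disc\<close>, hence for small positive
    \<open>\<kappa>\<close> by continuity.\<close>
  have "((\<lambda>\<kappa>. 4 * (1 - \<kappa>) * (c0 - \<kappa>) - b0\<^sup>2) \<longlongrightarrow> 4 * (1 - 0) * (c0 - 0) - b0\<^sup>2) (at_right 0)"
    by (intro tendsto_intros)
  then have "\<forall>\<^sub>F \<kappa> in at_right 0. 4 * (1 - \<kappa>) * (c0 - \<kappa>) - b0\<^sup>2 > 0"
    by (rule order_tendstoD) (use disc in simp)
  moreover have "\<forall>\<^sub>F \<kappa> in at_right 0. (0::real) < \<kappa> \<and> \<kappa> < 1"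
    by (auto simp: eventually_at_right_field intro: exI[of _ 1])
  ultimately have "\<forall>\<^sub>F \<kappa> in at_right 0. 4 * (1 - \<kappa>) * (c0 - \<kappa>) - b0\<^sup>2 > 0 \<and> 0 < \<kappa> \<and> \<kappa> < 1"
    by eventually_elim auto
  then obtain \<kappa> where \<kappa>: "4 * (1 - \<kappa>) * (c0 - \<kappa>) - b0\<^sup>2 > 0" "0 < \<kappa>" "\<kappa> < 1"
    using eventually_happens[of _ "at_right (0::real)"] by (auto simp: trivial_limit_at_right_real)
  have "((\<lambda>t. 4 * (1 - \<kappa>) * (c t - \<kappa>) - (b t)\<^sup>2) \<longlongrightarrow> 4 * (1 - \<kappa>) * (c0 - \<kappa>) - b0\<^sup>2) at_top"
    by (intro tendsto_intros b c)
  then have "\<forall>\<^sub>F t in at_top. 4 * (1 - \<kappa>) * (c t - \<kappa>) - (b t)\<^sup>2 > 0"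
    by (rule order_tendstoD) (use \<kappa> in simp)
  then obtain t2 where t2: "\<And>t. t \<ge> t2 \<Longrightarrow> 4 * (1 - \<kappa>) * (c t - \<kappa>) - (b t)\<^sup>2 > 0"
    by (auto simp: eventually_at_top_linorder)
  define t3 where "t3 = max t1 t2"
  have low: "\<kappa> * (1 + (q t)\<^sup>2) \<le> (q t)\<^sup>2 + b t * q t + c t" if "t \<ge> t3" for t
  proof -
    \<comment> \<open>Completing the square after multiplication by
      \<open>4 * (1 - \<kappa>)\<close>.\<close>
    have "0 \<le> (2 * (1 - \<kappa>) * q t + b t)\<^sup>2" by simp
    then have "0 \<le> 4 * (1 - \<kappa>) * ((1 - \<kappa>) * (q t)\<^sup>2 + b t * q t) + (b t)\<^sup>2"
      by (simp add: power2_eq_square algebra_simps)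
    also have "\<dots> \<le> 4 * (1 - \<kappa>) * ((1 - \<kappa>) * (q t)\<^sup>2 + b t * q t) + 4 * (1 - \<kappa>) * (c t - \<kappa>)"
      using t2[of t] that by (simp add: t3_def)
    also have "\<dots> = 4 * (1 - \<kappa>) * ((1 - \<kappa>) * (q t)\<^sup>2 + b t * q t + (c t - \<kappa>))" by (simp add: algebra_simps)
    finally have "0 \<le> (1 - \<kappa>) * (q t)\<^sup>2 + b t * q t + (c t - \<kappa>)"
      using \<kappa> by (simp add: zero_le_mult_iff)
    then show ?thesis by (simp add: algebra_simps)
  qed
  define g where "g t = arctan (q t) + \<kappa> * t" for t
  have "g (t3 + 4 / \<kappa>) \<le> g t3"
  proof (rule DERIV_nonpos_imp_nonincreasing[of t3 "t3 + 4 / \<kappa>" g])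
    show "t3 \<le> t3 + 4 / \<kappa>" using \<kappa> by simp
    show "\<exists>y. (g has_real_derivative y) (at t) \<and> y \<le> 0" if t: "t3 \<le> t" "t \<le> t3 + 4 / \<kappa>" for t
    proof -
      have "(g has_real_derivative - ((q t)\<^sup>2 + b t * q t + c t) / (1 + (q t)\<^sup>2) + \<kappa>) (at t)"
        unfolding g_def[abs_def] using t
        by (auto intro!: derivative_eq_intros der simp: t3_def inverse_eq_divide)
      moreover have "- ((q t)\<^sup>2 + b t * q t + c t) / (1 + (q t)\<^sup>2) + \<kappa> \<le> 0"
      proof -
        have "0 < 1 + (q t)\<^sup>2" by (simp add: add_pos_nonneg)
        then have "\<kappa> \<le> ((q t)\<^sup>2 + b t * q t + c t) / (1 + (q t)\<^sup>2)"
          using low[OF t(1)] by (simp add: pos_le_divide_eq)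
        then show ?thesis unfolding minus_divide_left[symmetric] by linarith
      qed
      ultimately show ?thesis by blast
    qed
  qed
  then have "arctan (q (t3 + 4 / \<kappa>)) + 4 \<le> arctan (q t3)"
    using \<kappa> by (simp add: g_def distrib_left)
  then show False using arctan_bounded[of "q t3"] arctan_bounded[of "q (t3 + 4 / \<kappa>)"] pi_less_4 by linarith
qed

text \<open>At the first time with \<open>y \<ge> c\<close> the value equals \<open>c\<close> and
  the derivative is negative, so \<open>y\<close> was even larger just before, against
  minimality.\<close>

lemma barrier:
  fixes y y' :: "real \<Rightarrow> real"
  assumes der: "\<And>t. t0 \<le> t \<Longrightarrow> t \<le> t1 \<Longrightarrow> (y has_real_derivative y' t) (at t)"
    and t01: "t0 \<le> t1" and init: "y t0 < c" and neg: "\<And>t. t0 \<le> t \<Longrightarrow> t \<le> t1 \<Longrightarrow> y t = c \<Longrightarrow> y' t < 0"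
  shows "y t1 < c"
proof (rule ccontr)
  assume "\<not> y t1 < c"
  define S where "S = {t0..t1} \<inter> y -` {c..}"
  have cont: "continuous_on {t0..t1} y"
    using der by (intro continuous_at_imp_continuous_on ballI) (auto intro: DERIV_isCont)
  have "closed S" unfolding S_def by (rule continuous_closed_preimage[OF cont closed_atLeastAtMost closed_atLeast])
  moreover have "t1 \<in> S" using t01 \<open>\<not> y t1 < c\<close> by (simp add: S_def)
  moreover have "bdd_below S" by (auto simp: S_def bdd_below_def)
  ultimately have s: "Inf S \<in> S" using closed_contains_Inf by blast
  define s where "s = Inf S"
  have smin: "s \<le> t" if "t \<in> S" for t unfolding s_def using that \<open>bdd_below S\<close> by (rule cInf_lower)
  have sS: "t0 \<le> s" "s \<le> t1" "y s \<ge> c" using s by (auto simp: s_def S_def)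
  then obtain s' where s': "t0 \<le> s'" "s' \<le> s" "y s' = c"
    using IVT'[of y t0 c s] init continuous_on_subset[OF cont, of "{t0..s}"] by force
  then have "s' \<in> S" using sS by (simp add: S_def)
  then have "s' = s" using smin s' by force
  then have "y s = c" using s' by simp
  then have "s \<noteq> t0" using init by auto
  then have "t0 < s" using sS by simp
  obtain d where d: "d > 0" "\<And>h. 0 < h \<Longrightarrow> h < d \<Longrightarrow> y s < y (s - h)"
    using DERIV_neg_dec_left[OF der[OF sS(1,2)] neg[OF sS(1,2) \<open>y s = c\<close>]] by blast
  define h where "h = min (d / 2) (s - t0)"
  have h: "0 < h" "h < d" "h \<le> s - t0" using d \<open>t0 < s\<close> by (auto simp: h_def)
  then have "s - h \<in> S" using d(2)[of h] sS \<open>y s = c\<close> by (simp add: S_def)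
  then show False using smin h by force
qed

section \<open>The autonomous system and its Lyapunov function\<close>

context lo_ode begin

text \<open>For the radial profile \<open>rho\<close> put \<open>x = rho / r\<close>,
  \<open>y = rho'\<close> and \<open>t = ln r\<close>. Then \<open>x' = y - x\<close>,
  \<open>y' = eta_rhs x y\<close> is the Euler-Lagrange equation of the integral of
  \<open>r ^ (p + 1) * vol (rho / r) * sqrt (1 + rho'\<^sup>2)\<close>, which is the volume of the
  graph up to a constant.\<close>

definition eta_rhs :: "real \<Rightarrow> real \<Rightarrow> real" where
  "eta_rhs x y = - (1 + y\<^sup>2) * (y + real p * (y - L * x) / (1 + L * x\<^sup>2))"

text \<open>The product of the length factors \<open>sqrt (1 + L * x\<^sup>2)\<close> of the
  \<open>p\<close> singular directions.\<close>

definition vol :: "real \<Rightarrow> real" where "vol x = (1 + L * x\<^sup>2) ^ (p div 2)"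

text \<open>The sine of the angle with tangent \<open>x\<close>, and the derivative of
  \<open>sqrt (1 + x\<^sup>2)\<close>. That it increases strictly decides the sign in the energy
  law.\<close>

definition slope :: "real \<Rightarrow> real" where "slope x = x / sqrt (1 + x\<^sup>2)"

text \<open>In terms of \<open>w = sqrt (1 + x\<^sup>2)\<close> the integrand \<open>vol x * slope x\<close> is a polynomial in \<open>w\<close>, since \<open>p\<close> is even.\<close>

definition vol_poly :: "real poly" where
  "vol_poly = (if p = 2 then [:0, 1 - L, 0, L / 3:] else [:0, (1 - L)\<^sup>2, 0, 2 * (1 - L) * L / 3, 0, L\<^sup>2 / 5:])"

definition vol_int :: "real \<Rightarrow> real" where
  "vol_int x = poly vol_poly (sqrt (1 + x\<^sup>2)) - poly vol_poly 1"

text \<open>The first term is \<open>x' * dLag/dx' - Lag\<close> for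
  \<open>Lag = vol x * sqrt (1 + (x + x')\<^sup>2)\<close> with \<open>y = x + x'\<close>. The
  factor \<open>exp ((p + 2) * t)\<close> in front of \<open>Lag\<close> destroys its conservation,
  which explains the weight \<open>p + 2\<close> of the second term.\<close>

definition energy :: "real \<Rightarrow> real \<Rightarrow> real" where
  "energy x y = - vol x * ((1 + x * y) / sqrt (1 + y\<^sup>2)) + (real p + 2) * vol_int x"

lemma sqrt_pos: "0 < sqrt (1 + x\<^sup>2)" by (simp add: add_pos_nonneg)
lemma sq1_pos: "0 < 1 + (x::real)\<^sup>2" by (simp add: add_pos_nonneg)
lemma Lx_pos: "0 < 1 + L * x\<^sup>2" using L_ge by (simp add: add_pos_nonneg)

lemma vol_pos: "0 < vol x" unfolding vol_def using Lx_pos by simp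

lemma vol_deriv: "(vol has_real_derivative real p * L * x * vol x / (1 + L * x\<^sup>2)) (at x)"
proof (cases "p = 2")
  case True
  then show ?thesis unfolding vol_def[abs_def] using Lx_pos[of x]
    by (auto intro!: derivative_eq_intros simp: field_simps)
next
  case False
  then have "p = 4" using p by simp
  then show ?thesis unfolding vol_def[abs_def] using Lx_pos[of x]
    by (auto intro!: derivative_eq_intros simp: field_simps power2_eq_square)
qed

lemma poly_vol: "poly (pderiv vol_poly) w = (1 - L + L * w\<^sup>2) ^ (p div 2)"
  using p by (auto simp: vol_poly_def pderiv_pCons field_simps power2_eq_square)

lemma sqrt_deriv: "((\<lambda>x. sqrt (1 + x\<^sup>2)) has_real_derivative slope x) (at x)"
  unfolding slope_def using sq1_pos[of x]
  by (auto intro!: derivative_eq_intros simp: field_simps)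

lemma vol_int_deriv: "(vol_int has_real_derivative vol x * slope x) (at x)"
proof -
  have "((\<lambda>x. poly vol_poly (sqrt (1 + x\<^sup>2))) has_real_derivative
      poly (pderiv vol_poly) (sqrt (1 + x\<^sup>2)) * slope x) (at x)"
    by (rule DERIV_chain2[OF poly_DERIV sqrt_deriv])
  moreover have "poly (pderiv vol_poly) (sqrt (1 + x\<^sup>2)) = vol x"
    unfolding poly_vol vol_def by (simp add: algebra_simps)
  ultimately show ?thesis unfolding vol_int_def[abs_def] using DERIV_diff[OF _ DERIV_const] by fastforce
qed

lemma slope_deriv: "(slope has_real_derivative 1 / ((1 + x\<^sup>2) * sqrt (1 + x\<^sup>2))) (at x)"
proof -
  have "(slope has_real_derivative (1 * sqrt (1 + x\<^sup>2) - x * slope x) / (sqrt (1 + x\<^sup>2) * sqrt (1 + x\<^sup>2))) (at x)"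
    unfolding slope_def[abs_def] using sqrt_pos[of x]
    by (rule_tac DERIV_divide[OF DERIV_ident sqrt_deriv[unfolded slope_def]]) simp
  moreover have "(1 * sqrt (1 + x\<^sup>2) - x * slope x) / (sqrt (1 + x\<^sup>2) * sqrt (1 + x\<^sup>2)) = 1 / ((1 + x\<^sup>2) * sqrt (1 + x\<^sup>2))"
  proof -
    have "sqrt (1 + x\<^sup>2) - x * slope x = (sqrt (1 + x\<^sup>2) * sqrt (1 + x\<^sup>2) - x * x) / sqrt (1 + x\<^sup>2)"
      unfolding slope_def using sqrt_pos[of x] by (simp add: field_simps)
    also have "sqrt (1 + x\<^sup>2) * sqrt (1 + x\<^sup>2) - x * x = 1" using sq1_pos[of x] by (simp add: power2_eq_square)
    finally show ?thesis using sq1_pos[of x] by (simp add: mult.commute)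
  qed
  ultimately show ?thesis by simp
qed

lemma slope_strict_mono: "x < y \<Longrightarrow> slope x < slope y"
proof (rule DERIV_pos_imp_increasing[of x y slope])
  fix t show "\<exists>d. (slope has_real_derivative d) (at t) \<and> 0 < d"
    by (rule exI, rule conjI[OF slope_deriv]) (intro divide_pos_pos mult_pos_pos zero_less_one sq1_pos sqrt_pos)
qed

text \<open>The quantity \<open>energy\<close> is the Jacobi energy of the volume functional of the cone coordinates, corrected by
  a total derivative so that its derivative along the flow becomes a product of two factors of equal sign.\<close>

lemma energy_deriv:
  assumes "(x has_real_derivative y t - x t) (at t)" "(y has_real_derivative eta_rhs (x t) (y t)) (at t)"
  shows "((\<lambda>t. energy (x t) (y t)) has_real_derivative
     - (real p + 2) * vol (x t) * ((y t - x t) * (slope (y t) - slope (x t)))) (at t)"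
proof -
  define X where "X = x t"
  define Y where "Y = y t"
  define S where "S = sqrt (1 + Y\<^sup>2)"
  define D where "D = 1 + L * X\<^sup>2"
  have S: "0 < S" "S * S = 1 + Y\<^sup>2" "0 < D" using sqrt_pos sq1_pos[of Y] Lx_pos by (simp_all add: S_def D_def)
  have d1: "((\<lambda>t. vol (x t)) has_real_derivative (real p * L * X * vol X / D) * (Y - X)) (at t)"
    using DERIV_chain2[OF vol_deriv assms(1)] by (simp add: X_def Y_def D_def)
  have d2: "((\<lambda>t. vol_int (x t)) has_real_derivative (vol X * slope X) * (Y - X)) (at t)"
    using DERIV_chain2[OF vol_int_deriv assms(1)] by (simp add: X_def Y_def)
  have d3: "((\<lambda>t. sqrt (1 + (y t)\<^sup>2)) has_real_derivative slope Y * eta_rhs X Y) (at t)"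
    using DERIV_chain2[OF sqrt_deriv assms(2)] by (simp add: X_def Y_def)
  have d4: "((\<lambda>t. (1 + x t * y t) / sqrt (1 + (y t)\<^sup>2)) has_real_derivative
      ((0 + ((Y - X) * Y + eta_rhs X Y * X)) * S - (1 + X * Y) * (slope Y * eta_rhs X Y)) / (S * S)) (at t)"
    unfolding S_def X_def Y_def using sqrt_pos[of "y t"]
    by (intro DERIV_divide DERIV_add DERIV_const DERIV_mult assms d3[unfolded X_def Y_def]) simp
  have "((\<lambda>t. energy (x t) (y t)) has_real_derivative
    - ((real p * L * X * vol X / D) * (Y - X) * ((1 + X * Y) / S) +
     (((0 + ((Y - X) * Y + eta_rhs X Y * X)) * S - (1 + X * Y) * (slope Y * eta_rhs X Y)) / (S * S)) * vol X)
     + (real p + 2) * ((vol X * slope X) * (Y - X))) (at t)"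
    using DERIV_add[OF DERIV_minus[OF DERIV_mult[OF d1 d4]] DERIV_cmult[OF d2, of "real p + 2"]]
    unfolding energy_def X_def Y_def S_def by simp
  moreover have "- ((real p * L * X * vol X / D) * (Y - X) * ((1 + X * Y) / S) +
     (((0 + ((Y - X) * Y + eta_rhs X Y * X)) * S - (1 + X * Y) * (slope Y * eta_rhs X Y)) / (S * S)) * vol X)
     + (real p + 2) * ((vol X * slope X) * (Y - X)) =
     - (real p + 2) * vol X * ((Y - X) * (slope Y - slope X))"
  proof -
    define r where "r = real p / D"
    define i where "i = 1 / S"
    define Q where "Q = Y + r * (Y - L * X)"
    have r: "r * D = real p" and i: "i * S = 1" using S by (simp_all add: r_def i_def)
    have e: "eta_rhs X Y = - (S * S) * Q" by (simp add: eta_rhs_def S D_def Q_def r_def)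
    have sY: "slope Y = Y * i" by (simp add: slope_def S_def i_def)
    have n1: "X * S - (1 + X * Y) * (Y * i) = (X - Y) * i"
    proof -
      have "X * S - (1 + X * Y) * (Y * i) = (X * (S * S) - (1 + X * Y) * Y) * i" using S(1) by (simp add: i_def field_simps)
      also have "X * (S * S) - (1 + X * Y) * Y = X - Y" unfolding S(2) by (simp add: algebra_simps power2_eq_square)
      finally show ?thesis .
    qed
    have "(0 + ((Y - X) * Y + eta_rhs X Y * X)) * S - (1 + X * Y) * (slope Y * eta_rhs X Y)
        = (Y - X) * Y * S + eta_rhs X Y * (X * S - (1 + X * Y) * (Y * i))"
      unfolding sY by (simp add: algebra_simps)
    then have n2: "(0 + ((Y - X) * Y + eta_rhs X Y * X)) * S - (1 + X * Y) * (slope Y * eta_rhs X Y)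
        = (Y - X) * Y * S + eta_rhs X Y * ((X - Y) * i)" by (simp only: n1)
    have n3: "((Y - X) * Y * S + eta_rhs X Y * ((X - Y) * i)) / (S * S) = (Y - X) * i * (Y + Q)"
      unfolding e using S(1) by (simp add: i_def field_simps)
    \<comment> \<open>The denominator \<open>D\<close> cancels here, so that altogether
      \<open>(2 + p) * Y\<close> remains, matching the weight of \<open>vol_int\<close>.\<close>
    have n4: "r * (L * X * (1 + X * Y) + (Y - L * X)) = real p * Y"
    proof -
      have "L * X * (1 + X * Y) + (Y - L * X) = Y * D" by (simp add: D_def algebra_simps power2_eq_square)
      then show ?thesis using r by (simp add: mult.left_commute mult.commute)
    qed
    have "(real p * L * X * vol X / D) * (Y - X) * ((1 + X * Y) / S) + (Y - X) * i * (Y + Q) * vol X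
       = vol X * (Y - X) * i * (2 * Y + r * (L * X * (1 + X * Y) + (Y - L * X)))"
    proof -
      have "(real p * L * X * vol X / D) * (Y - X) * ((1 + X * Y) / S) = r * L * X * vol X * (Y - X) * (1 + X * Y) * i"
        by (simp add: r_def i_def)
      then show ?thesis by (simp add: Q_def algebra_simps)
    qed
    also have "\<dots> = (real p + 2) * vol X * (Y - X) * slope Y" unfolding n4 sY by (simp add: algebra_simps)
    finally show ?thesis unfolding n2 n3 by (simp add: algebra_simps)
  qed
  ultimately show ?thesis by (simp add: X_def Y_def)
qed

text \<open>The value of \<open>energy x\<close> at \<open>y = x\<close>, which is its minimum in
  \<open>y\<close>.\<close>

definition energy0 :: "real \<Rightarrow> real" where
  "energy0 x = - vol x * sqrt (1 + x\<^sup>2) + (real p + 2) * vol_int x"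

text \<open>Cauchy-Schwarz for the vectors \<open>(1, x)\<close> and \<open>(1, y)\<close>.\<close>

lemma energy_ge: "energy0 x \<le> energy x y"
proof -
  have "(1 + x * y)\<^sup>2 \<le> (1 + x\<^sup>2) * (1 + y\<^sup>2)"
  proof -
    have "(1 + x\<^sup>2) * (1 + y\<^sup>2) - (1 + x * y)\<^sup>2 = (x - y)\<^sup>2" by (simp add: power2_eq_square algebra_simps)
    then show ?thesis by (metis diff_ge_0_iff_ge zero_le_power2)
  qed
  then have "1 + x * y \<le> sqrt (1 + x\<^sup>2) * sqrt (1 + y\<^sup>2)"
    by (simp add: real_le_rsqrt real_sqrt_mult[symmetric])
  then have "(1 + x * y) / sqrt (1 + y\<^sup>2) \<le> sqrt (1 + x\<^sup>2)" using sqrt_pos[of y] by (simp add: pos_divide_le_eq)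
  then have "vol x * ((1 + x * y) / sqrt (1 + y\<^sup>2)) \<le> vol x * sqrt (1 + x\<^sup>2)"
    using vol_pos[of x] by (intro mult_left_mono) auto
  then show ?thesis by (simp add: energy_def energy0_def)
qed

text \<open>In \<open>w = sqrt (1 + x\<^sup>2)\<close> the function is a polynomial with leading
  coefficient \<open>L / 3\<close> for \<open>p = 2\<close> and \<open>L\<^sup>2 / 5\<close> for
  \<open>p = 4\<close>: weighted by \<open>p + 2\<close>, the integral term outgrows the volume
  term.\<close>

lemma energy0_large: "\<exists>B>0. \<forall>x>B. energy0 x > - 1"
proof -
  define P where "P = - [:0, 1:] * [:1 - L, 0, L:] ^ (p div 2) + [:real p + 2:] * (vol_poly - [:poly vol_poly 1:])"
  have E: "energy0 x = poly P (sqrt (1 + x\<^sup>2))" for x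
    unfolding energy0_def P_def vol_def vol_int_def using sq1_pos[of x]
    by (simp add: power2_eq_square algebra_simps poly_power)
  define c where "c = poly vol_poly 1"
  have "lead_coeff P > 0 \<and> degree P \<noteq> 0"
  proof (cases "p = 2")
    case True
    have "vol_poly = [:0, 1 - L, 0, L / 3:]" unfolding vol_poly_def using True by simp
    then have "P = [:- 4 * c, 3 * (1 - L), 0, L / 3:]"
      unfolding P_def c_def[symmetric] using True by (simp add: field_simps)
    then show ?thesis using L_ge by simp
  next
    case False
    then have p4: "p = 4" using p by simp
    have "vol_poly = [:0, (1 - L)\<^sup>2, 0, 2 * (1 - L) * L / 3, 0, L\<^sup>2 / 5:]" unfolding vol_poly_def using p4 by simp
    then have "P = [:- 6 * c, 5 * (1 - L)\<^sup>2, 0, 2 * (1 - L) * L, 0, L\<^sup>2 / 5:]"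
      unfolding P_def c_def[symmetric] using p4 by (simp add: field_simps power2_eq_square)
    then show ?thesis using L_ge by simp
  qed
  then obtain n where n: "\<And>x. x \<ge> n \<Longrightarrow> poly P x \<ge> lead_coeff P" using poly_pinfty_gt_lc[of P] by blast
  have lc: "lead_coeff P > 0" using \<open>lead_coeff P > 0 \<and> degree P \<noteq> 0\<close> by simp
  show ?thesis
  proof (intro exI[of _ "\<bar>n\<bar> + 1"] conjI allI impI)
    fix x assume x: "x > \<bar>n\<bar> + 1"
    have "x \<le> sqrt (1 + x\<^sup>2)" by (rule real_le_rsqrt) simp
    then have "sqrt (1 + x\<^sup>2) \<ge> n" using x by linarith
    then show "- 1 < energy0 x" using n[of "sqrt (1 + x\<^sup>2)"] lc by (simp add: E)
  qed auto
qed

lemma energy_0: "energy 0 y \<ge> - 1"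
  using sq1_pos[of y] by (simp add: energy_def vol_int_def vol_def divide_le_eq)

lemma energy0_0: "energy0 0 = - 1"
  by (simp add: energy0_def vol_int_def vol_def)

lemma isCont_vol: "isCont vol x" using vol_deriv by (rule DERIV_isCont)
lemma isCont_vol_int: "isCont vol_int x" using vol_int_deriv by (rule DERIV_isCont)
lemma isCont_slope: "isCont slope x" using slope_deriv by (rule DERIV_isCont)

lemma isCont_energy0: "isCont energy0 x"
  unfolding energy0_def[abs_def] by (intro continuous_intros isCont_vol isCont_vol_int)

lemma continuous_on_vol: "continuous_on A vol" "continuous_on A vol_int" "continuous_on A slope"
  using isCont_vol isCont_vol_int isCont_slope by (auto intro: continuous_at_imp_continuous_on)

lemma continuous_on_energy: "continuous_on A (\<lambda>v. energy (fst v) (snd v))"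
  unfolding energy_def using sq1_pos
  by (intro continuous_intros continuous_on_compose2[OF continuous_on_vol(1)] continuous_on_compose2[OF continuous_on_vol(2)])
     (auto simp: less_imp_neq[THEN not_sym])

text \<open>An orbit that leaves the rest point at the origin as \<open>t\<close> comes from minus
  infinity, on the side \<open>0 < x < y\<close>. The horizon \<open>T\<close> is kept because the
  bounds are needed before the solution is known to be global.\<close>

definition trajectory_upto :: "real \<Rightarrow> (real \<Rightarrow> real) \<Rightarrow> (real \<Rightarrow> real) \<Rightarrow> bool" where
  "trajectory_upto T x y \<longleftrightarrow>
     (\<forall>t<T. (x has_real_derivative y t - x t) (at t) \<and> (y has_real_derivative eta_rhs (x t) (y t)) (at t)) \<and>
     (x \<longlongrightarrow> 0) at_bot \<and> (y \<longlongrightarrow> 0) at_bot \<and> (\<forall>\<^sub>F t in at_bot. 0 < x t \<and> x t < y t)"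

lemma energy_decreasing:
  assumes "trajectory_upto T x y" "s \<le> t" "t < T"
  shows "energy (x t) (y t) \<le> energy (x s) (y s)"
proof (rule DERIV_nonpos_imp_nonincreasing[of s t "\<lambda>t. energy (x t) (y t)", OF assms(2)])
  fix u assume u: "s \<le> u" "u \<le> t"
  have "0 \<le> (y u - x u) * (slope (y u) - slope (x u))"
    using slope_strict_mono[of "x u" "y u"] slope_strict_mono[of "y u" "x u"]
    by (cases "x u" "y u" rule: linorder_cases) (auto simp: zero_le_mult_iff)
  then have "0 \<le> (real p + 2) * vol (x u) * ((y u - x u) * (slope (y u) - slope (x u)))"
    using vol_pos[of "x u"] by (intro mult_nonneg_nonneg[of "(real p + 2) * vol (x u)"]) auto
  then have "- (real p + 2) * vol (x u) * ((y u - x u) * (slope (y u) - slope (x u))) \<le> 0"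
    by (simp only: mult_minus_left neg_le_0_iff_le)
  then show "\<exists>z. ((\<lambda>t. energy (x t) (y t)) has_real_derivative z) (at u) \<and> z \<le> 0"
    using energy_deriv[of x y u] assms u unfolding trajectory_upto_def by (meson order.strict_trans1)
qed

text \<open>Towards minus infinity the energy tends to its value \<open>- 1\<close> at the origin,
  and it decreases strictly as long as \<open>x < y\<close>, which holds at the start of the
  orbit.\<close>

lemma energy_less:
  assumes tr: "trajectory_upto T x y" and t: "t < T"
  shows "energy (x t) (y t) < - 1"
proof -
  have "\<forall>\<^sub>F s in at_bot. 0 < x s \<and> x s < y s" using tr by (simp add: trajectory_upto_def)
  then obtain t0 where t0: "\<And>s. s \<le> t0 \<Longrightarrow> 0 < x s \<and> x s < y s" by (auto simp: eventually_at_bot_linorder)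
  define u where "u = min t0 t"
  have "energy (x u) (y u) < energy (x (u - 1)) (y (u - 1))"
  proof (rule DERIV_neg_imp_decreasing[of "u - 1" u "\<lambda>t. energy (x t) (y t)"])
    fix s assume s: "u - 1 \<le> s" "s \<le> u"
    then have "x s < y s" using t0[of s] by (simp add: u_def)
    then have "0 < (real p + 2) * vol (x s) * ((y s - x s) * (slope (y s) - slope (x s)))"
      using slope_strict_mono[of "x s" "y s"] vol_pos[of "x s"] p_pos by (intro mult_pos_pos) auto
    then have "- (real p + 2) * vol (x s) * ((y s - x s) * (slope (y s) - slope (x s))) < 0"
      by (simp only: mult_minus_left neg_less_0_iff_less)
    moreover have "s < T" using s t by (simp add: u_def)
    ultimately show "\<exists>z. ((\<lambda>t. energy (x t) (y t)) has_real_derivative z) (at s) \<and> z < 0"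
      using energy_deriv[of x y s] tr unfolding trajectory_upto_def by blast
  qed simp
  moreover have "energy (x (u - 1)) (y (u - 1)) \<le> - 1"
  proof (rule tendsto_lowerbound)
    have "isCont (\<lambda>v. energy (fst v) (snd v)) (0, 0)"
      using continuous_on_energy[of UNIV] by (simp add: continuous_on_eq_continuous_at)
    moreover have "((\<lambda>t. (x t, y t)) \<longlongrightarrow> (0, 0)) at_bot"
      using tr by (intro tendsto_Pair) (auto simp: trajectory_upto_def)
    ultimately have "((\<lambda>t. energy (fst (x t, y t)) (snd (x t, y t))) \<longlongrightarrow> energy (fst (0, 0)) (snd (0, 0))) at_bot"
      using isCont_tendsto_compose[of "(0, 0)" "\<lambda>v. energy (fst v) (snd v)" "\<lambda>t. (x t, y t)" at_bot] by simp
    then show "((\<lambda>t. energy (x t) (y t)) \<longlongrightarrow> - 1) at_bot" by (simp add: energy_def vol_def vol_int_def)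
    show "\<forall>\<^sub>F s in at_bot. energy (x (u - 1)) (y (u - 1)) \<le> energy (x s) (y s)"
      using eventually_le_at_bot[of "u - 1"]
      by eventually_elim (use t in \<open>auto intro!: energy_decreasing[OF tr] simp: u_def\<close>)
  qed simp
  moreover have "energy (x t) (y t) \<le> energy (x u) (y u)"
    by (rule energy_decreasing[OF tr]) (use t in \<open>auto simp: u_def\<close>)
  ultimately show ?thesis by linarith
qed

text \<open>Energy below \<open>- 1\<close> keeps the orbit off the line \<open>x = 0\<close>, where
  the energy is at least \<open>- 1\<close>, and out of \<open>x > B\<close>. Then \<open>y\<close>
  is confined by the sign of its derivative on \<open>y = 0\<close> and on \<open>y = H\<close>. The
  bounds are common to all orbits and horizons, as continuation requires.\<close>

lemma trajectory_bounds:
  "\<exists>B>0. \<exists>H>0. \<forall>T x y. trajectory_upto T x y \<longrightarrow> (\<forall>t<T. 0 < x t \<and> x t \<le> B \<and> 0 < y t \<and> y t \<le> H)"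
proof -
  obtain B where B: "B > 0" "\<And>x. x > B \<Longrightarrow> energy0 x > - 1" using energy0_large by blast
  \<comment> \<open>On \<open>y = H\<close> with \<open>x \<le> B\<close> one has
    \<open>y > L * x\<close>, so both summands of \<open>eta_rhs\<close> push downwards.\<close>
  define H where "H = L * B + 1"
  have H: "H > 0" using B L_ge by (simp add: H_def add_pos_pos)
  have main: "0 < x t \<and> x t \<le> B \<and> 0 < y t \<and> y t \<le> H" if tr: "trajectory_upto T x y" and t: "t < T" for T x y t
  proof -
    have "\<forall>\<^sub>F s in at_bot. 0 < x s \<and> x s < y s" using tr by (simp add: trajectory_upto_def)
    moreover have "\<forall>\<^sub>F s in at_bot. y s < 1" using tr
      by (intro order_tendstoD(2)[where y = 0]) (auto simp: trajectory_upto_def)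
    ultimately have "\<forall>\<^sub>F s in at_bot. 0 < x s \<and> x s < y s \<and> y s < 1" by eventually_elim auto
    then obtain t0 where t0: "\<And>s. s \<le> t0 \<Longrightarrow> 0 < x s \<and> x s < y s \<and> y s < 1" by (auto simp: eventually_at_bot_linorder)
    define u where "u = min t0 t"
    have u: "u \<le> t" "0 < x u" "x u < y u" "y u < 1" using t0[of u] by (auto simp: u_def)
    have der: "(x has_real_derivative y s - x s) (at s)" "(y has_real_derivative eta_rhs (x s) (y s)) (at s)"
      if "s < T" for s using tr that by (auto simp: trajectory_upto_def)
    have nz: "x s \<noteq> 0" if "s < T" for s
      using energy_less[OF tr that] energy_0[of "y s"] by auto
    have xpos: "0 < x s" if s: "u \<le> s" "s \<le> t" for s
    proof (rule ccontr)
      assume "\<not> 0 < x s"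
      moreover have "\<forall>r. u \<le> r \<and> r \<le> s \<longrightarrow> isCont x r" using der(1) s t by (meson DERIV_isCont le_less_trans)
      ultimately obtain r where "u \<le> r" "r \<le> s" "x r = 0"
        using IVT2[of x s 0 u] u s by auto
      then show False using nz[of r] s t by simp
    qed
    have xB: "x s \<le> B" if s: "s \<le> t" for s
      using energy_less[OF tr, of s] energy_ge[of "x s" "y s"] B(2)[of "x s"] s t by force
    have "y t < H"
    proof (rule barrier[of u t y "\<lambda>s. eta_rhs (x s) (y s)" H])
      show "u \<le> t" by fact
      have "0 \<le> L * B" using B L_ge by simp
      then show "y u < H" using u by (simp add: H_def)
      fix s assume s: "u \<le> s" "s \<le> t"
      show "(y has_real_derivative eta_rhs (x s) (y s)) (at s)" using der s t by simp
      assume y: "y s = H"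
      have "L * x s \<le> L * B" using xB[OF s(2)] L_ge by (intro mult_left_mono) auto
      then have "0 \<le> real p * (y s - L * x s) / (1 + L * (x s)\<^sup>2)"
        using Lx_pos[of "x s"] y by (intro divide_nonneg_pos mult_nonneg_nonneg) (auto simp: H_def)
      then have "0 < (1 + (y s)\<^sup>2) * (y s + real p * (y s - L * x s) / (1 + L * (x s)\<^sup>2))"
        using sq1_pos[of "y s"] y H by (intro mult_pos_pos add_pos_nonneg) auto
      then show "eta_rhs (x s) (y s) < 0"
        by (simp only: eta_rhs_def mult_minus_left neg_less_0_iff_less)
    qed
    moreover have "- y t < 0"
    proof (rule barrier[of u t "\<lambda>s. - y s" "\<lambda>s. - eta_rhs (x s) (y s)" 0])
      show "u \<le> t" "- y u < 0" using u by auto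
      fix s assume s: "u \<le> s" "s \<le> t"
      show "((\<lambda>s. - y s) has_real_derivative - eta_rhs (x s) (y s)) (at s)"
        using der s t by (auto intro!: derivative_intros)
      assume y: "- y s = 0"
      have "0 < real p * (L * x s) / (1 + L * (x s)\<^sup>2)"
        using Lx_pos[of "x s"] p_pos L_ge xpos[OF s] by (intro divide_pos_pos mult_pos_pos) auto
      then show "- eta_rhs (x s) (y s) < 0" using y by (simp add: eta_rhs_def)
    qed
    ultimately show ?thesis using xpos[of t] xB[of t] u by simp
  qed
  show ?thesis by (rule exI[of _ B], rule conjI[OF B(1)], rule exI[of _ H]) (use main H in blast)
qed

text \<open>The positive zero of \<open>eta_rhs x x\<close>: the profile
  \<open>rho = level * r\<close> is the Lawson-Osserman cone. For \<open>n = p + 1\<close> it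
  coincides with \<open>phi0\<close>.\<close>

definition level :: real where "level = sqrt (real p - (real p + 1) / L)"

lemma level_sq: "level\<^sup>2 = real p - (real p + 1) / L" "0 < level"
proof -
  have "(real p + 1) / L \<le> (real p + 1) / 8" using L_ge by (intro divide_left_mono) auto
  then have "0 < real p - (real p + 1) / L" using p by auto
  then show "level\<^sup>2 = real p - (real p + 1) / L" "0 < level" by (simp_all add: level_def)
qed

lemma L_level: "L * level\<^sup>2 = real p * L - real p - 1"
  using L_ge by (simp add: level_sq field_simps)

text \<open>\<open>x - level\<close> obeys a linear second order equation with these coefficients. In the limit \<open>x = y = level\<close> it
  oscillates because its discriminant is negative, which is the assumption \<open>disc\<close> of the locale.\<close>

definition damping :: "real \<Rightarrow> real \<Rightarrow> real" where
  "damping x y = 1 + (1 + y\<^sup>2) * (1 + real p / (1 + L * x\<^sup>2))"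

definition stiffness :: "real \<Rightarrow> real \<Rightarrow> real" where
  "stiffness x y = (1 + y\<^sup>2) * (L * x * (x + level)) / (1 + L * x\<^sup>2)"

text \<open>An exact identity rather than a Taylor expansion: by \<open>L_level\<close> the value of
  the second factor of \<open>eta_rhs\<close> on the diagonal is divisible by
  \<open>x - level\<close>. Since \<open>x' = y - x\<close>, the deviation
  \<open>u = x - level\<close> satisfies
  \<open>u'' + damping * u' + stiffness * u = 0\<close>.\<close>

lemma eta_rhs_linearised:
  "eta_rhs x y - (y - x) = - damping x y * (y - x) - stiffness x y * (x - level)"
proof -
  define w where "w = 1 / (1 + L * x\<^sup>2)"
  have w: "w * (1 + L * x\<^sup>2) = 1" using Lx_pos[of x] by (simp add: w_def)
  have "x + real p * (x - L * x) * w = x * (w * (1 + L * x\<^sup>2)) + real p * (x - L * x) * w" unfolding w by simp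
  also have "\<dots> = w * x * (L * x\<^sup>2 - (real p * L - real p - 1))" by (simp add: algebra_simps)
  also have "\<dots> = w * (L * x * (x + level)) * (x - level)"
    unfolding L_level[symmetric] by (simp add: algebra_simps power2_eq_square)
  finally have key: "x + real p * (x - L * x) * w = w * (L * x * (x + level)) * (x - level)" .
  have "y + real p * (y - L * x) * w = (1 + real p * w) * (y - x) + (x + real p * (x - L * x) * w)"
    by (simp add: algebra_simps)
  then have "y + real p * (y - L * x) * w = (1 + real p * w) * (y - x) + w * (L * x * (x + level)) * (x - level)"
    unfolding key .
  then have "eta_rhs x y = - (1 + y\<^sup>2) * ((1 + real p * w) * (y - x) + w * (L * x * (x + level)) * (x - level))"
    by (simp add: eta_rhs_def w_def)
  moreover have "damping x y = 1 + (1 + y\<^sup>2) * (1 + real p * w)" by (simp add: damping_def w_def)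
  moreover have "stiffness x y = (1 + y\<^sup>2) * (w * (L * x * (x + level)))" by (simp add: stiffness_def w_def)
  ultimately show ?thesis by (simp add: algebra_simps)
qed

lemma damping_level: "damping level level = real p + 2"
  and stiffness_level: "stiffness level level = 2 * (real p + 1) * (1 - (real p + 1) / (real p * L))"
proof -
  have L1: "L > 1" using L_ge by simp
  have D: "1 + L * level\<^sup>2 = real p * (L - 1)" unfolding L_level by (simp add: algebra_simps)
  have s: "1 + level\<^sup>2 = (real p + 1) * (L - 1) / L" using L1 by (simp add: level_sq field_simps)
  show "damping level level = real p + 2"
    unfolding damping_def D s using L1 p_pos by (simp add: field_simps)
  have "stiffness level level = (1 + level\<^sup>2) * (2 * (L * level\<^sup>2)) / (1 + L * level\<^sup>2)"
    by (simp add: stiffness_def power2_eq_square)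
  also have "\<dots> = 2 * (real p + 1) * (1 - (real p + 1) / (real p * L))"
    unfolding D s unfolding L_level using L1 p_pos by (simp add: field_simps)
  finally show "stiffness level level = 2 * (real p + 1) * (1 - (real p + 1) / (real p * L))" .
qed

lemma isCont_coeffs:
  "isCont (\<lambda>v. damping (fst v) (snd v)) z" "isCont (\<lambda>v. stiffness (fst v) (snd v)) z"
  "isCont (\<lambda>v. eta_rhs (fst v) (snd v)) z"
  unfolding damping_def stiffness_def eta_rhs_def using Lx_pos[of "fst z"]
  by (intro continuous_intros; simp)+

text \<open>Barbalat's lemma is used twice. The energy converges, so its dissipation tends to 0,
  which forces \<open>y - x\<close> to 0; then the derivative of \<open>y - x\<close> tends to 0 as
  well. For positive \<open>x\<close> both vanish together only at the rest point.\<close>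

lemma trajectory_converges:
  assumes tr: "\<And>T. trajectory_upto T x y"
  shows "((\<lambda>t. (x t, y t)) \<longlongrightarrow> (level, level)) at_top"
proof -
  obtain B H where bd: "\<And>t. 0 < x t \<and> x t \<le> B \<and> 0 < y t \<and> y t \<le> H"
    using trajectory_bounds tr by (metis lt_ex gt_ex)
  have der: "(x has_real_derivative y t - x t) (at t)" "(y has_real_derivative eta_rhs (x t) (y t)) (at t)" for t
    using tr[of "t + 1"] by (auto simp: trajectory_upto_def)
  have dec: "energy (x t) (y t) \<le> energy (x s) (y s)" if "s \<le> t" for s t
    using energy_decreasing[OF tr[of "t + 1"] that] by simp
  define e0 where "e0 = energy (x 0) (y 0)"
  \<comment> \<open>The origin is excluded as a limit point: by continuity \<open>energy0\<close>
    exceeds the energy of the orbit near 0, so \<open>x\<close> stays at least \<open>d\<close> for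
    \<open>t \<ge> 0\<close>.\<close>
  have e0: "e0 < energy0 0" using energy_less[OF tr[of 1], of 0] by (simp add: e0_def energy0_0)
  have "\<forall>\<^sub>F v in at 0. energy0 v > e0"
    using isCont_energy0[of 0] e0 unfolding isCont_def by (rule order_tendstoD)
  then obtain d where d: "d > 0" "\<And>v. v \<noteq> 0 \<Longrightarrow> dist v 0 < d \<Longrightarrow> energy0 v > e0"
    by (auto simp: eventually_at)
  have xd: "d \<le> x t" if "t \<ge> 0" for t
  proof (rule ccontr)
    assume "\<not> d \<le> x t"
    then have "energy0 (x t) > e0" using d(2)[of "x t"] bd[of t] by simp
    moreover have "energy0 (x t) \<le> e0" using energy_ge[of "x t" "y t"] dec[OF that] by (simp add: e0_def)
    ultimately show False by simp
  qed
  define K where "K = {d..B} \<times> {0..H}"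
  have K: "compact K" unfolding K_def by (intro compact_Times) auto
  have inK: "(x t, y t) \<in> K" if "t \<ge> 0" for t using xd[OF that] bd[of t] by (simp add: K_def)
  have contK: "continuous_on K (\<lambda>v. eta_rhs (fst v) (snd v))"
    using isCont_coeffs(3) by (intro continuous_at_imp_continuous_on) auto
  \<comment> \<open>The vector field is bounded on the compact set \<open>K\<close>, so the orbit is
    Lipschitz, and a continuous function on \<open>K\<close> composed with it is uniformly
    continuous.\<close>
  have uc: "uniformly_continuous_on {0..} (\<lambda>t. G (x t, y t))" if G: "continuous_on K G" for G :: "real \<times> real \<Rightarrow> real"
  proof -
    have lip: "\<exists>M. M-lipschitz_on {0..} u" if u: "\<And>t. (u has_real_derivative U (x t, y t)) (at t)" and U: "continuous_on K U"
      for u :: "real \<Rightarrow> real" and U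
    proof -
      have "bounded (U ` K)" using compact_imp_bounded[OF compact_continuous_image[OF U K]] .
      then obtain M where "\<forall>w\<in>U ` K. norm w \<le> M" unfolding bounded_iff by blast
      then have M: "\<bar>U v\<bar> \<le> M" if "v \<in> K" for v using that by simp
      have "\<bar>M\<bar>-lipschitz_on {0..} u"
      proof (rule lipschitz_onI)
        fix s t :: real assume st: "s \<in> {0..}" "t \<in> {0..}"
        have "norm (u s - u t) \<le> \<bar>M\<bar> * norm (s - t)"
        proof (rule field_differentiable_bound[of "{0..}" u "\<lambda>t. U (x t, y t)"])
          fix z :: real assume "z \<in> {0..}"
          then show "norm (U (x z, y z)) \<le> \<bar>M\<bar>" using M[OF inK[of z]] by simp
          show "(u has_real_derivative U (x z, y z)) (at z within {0..})"
            using u by (rule has_field_derivative_at_within)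
        qed (use st in auto)
        then show "dist (u s) (u t) \<le> \<bar>M\<bar> * dist s t" by (simp add: dist_norm)
      qed simp
      then show ?thesis by blast
    qed
    obtain M1 where "M1-lipschitz_on {0..} x"
    proof -
      have "continuous_on K (\<lambda>v. snd v - fst v)" by (intro continuous_intros)
      with that show thesis using lip[of x "\<lambda>v. snd v - fst v"] der(1) by auto
    qed
    moreover obtain M2 where "M2-lipschitz_on {0..} y"
      using lip[of y "\<lambda>v. eta_rhs (fst v) (snd v)"] der(2) contK by auto
    ultimately have "uniformly_continuous_on {0..} (\<lambda>t. (x t, y t))"
      using lipschitz_on_Pair lipschitz_on_uniformly_continuous by blast
    moreover have "uniformly_continuous_on ((\<lambda>t. (x t, y t)) ` {0..}) G"
    proof -
      have "(\<lambda>t. (x t, y t)) ` {0..} \<subseteq> K" using inK by auto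
      with compact_uniformly_continuous[OF G K] show ?thesis
        unfolding uniformly_continuous_on_def by (meson subsetD)
    qed
    ultimately show ?thesis by (rule uniformly_continuous_on_compose)
  qed
  define h where "h v = - (real p + 2) * vol (fst v) * ((snd v - fst v) * (slope (snd v) - slope (fst v)))" for v
  have h: "continuous_on K h" unfolding h_def
    by (intro continuous_intros continuous_on_compose2[OF continuous_on_vol(1)[of UNIV]] continuous_on_compose2[OF continuous_on_vol(3)[of UNIV]]) auto
  have "\<exists>l. ((\<lambda>t. energy (x t) (y t)) \<longlongrightarrow> l) at_top"
  proof -
    have "bounded ((\<lambda>v. energy (fst v) (snd v)) ` K)"
      using compact_imp_bounded[OF compact_continuous_image[OF continuous_on_energy K]] .
    then obtain M where "\<forall>w\<in>(\<lambda>v. energy (fst v) (snd v)) ` K. norm w \<le> M" unfolding bounded_iff by blast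
    then have M: "\<bar>energy (fst v) (snd v)\<bar> \<le> M" if "v \<in> K" for v using that by simp
    then have "- M \<le> energy (x t) (y t)" if "0 \<le> t" for t using M[OF inK[OF that]] by simp
    then show ?thesis using nonincreasing_bounded_tendsto[of 0 "\<lambda>t. energy (x t) (y t)" "- M"] dec by blast
  qed
  then obtain l where l: "((\<lambda>t. energy (x t) (y t)) \<longlongrightarrow> l) at_top" by blast
  have h0: "((\<lambda>t. h (x t, y t)) \<longlongrightarrow> 0) at_top"
    by (rule barbalat[OF _ uc[OF h] l]) (use energy_deriv[OF der] in \<open>simp add: h_def\<close>)
  have hz: "snd v = fst v" if "h v = 0" for v
    using that slope_strict_mono[of "fst v" "snd v"] slope_strict_mono[of "snd v" "fst v"] vol_pos[of "fst v"] p_pos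
    by (cases "fst v" "snd v" rule: linorder_cases) (auto simp: h_def)
  have g0: "((\<lambda>t. (\<lambda>v. snd v - fst v) (x t, y t)) \<longlongrightarrow> 0) at_top"
  proof (rule compact_zero_tendsto[OF K h _ _ inK h0])
    show "continuous_on K (\<lambda>v. snd v - fst v)" by (intro continuous_intros)
  qed (simp_all add: hz)
  define G where "G v = eta_rhs (fst v) (snd v) - (snd v - fst v)" for v
  have G: "continuous_on K G" unfolding G_def by (intro continuous_intros contK)
  have G0: "((\<lambda>t. G (x t, y t)) \<longlongrightarrow> 0) at_top"
    by (rule barbalat[where f = "\<lambda>t. y t - x t", OF _ uc[OF G]])
       (use g0 in \<open>auto simp: G_def intro!: derivative_eq_intros der\<close>)
  \<comment> \<open>Its zeros are the common zeros of the two quantities, so one more compactness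
    argument exploits both limits at once.\<close>
  define h2 where "h2 v = \<bar>G v\<bar> + \<bar>snd v - fst v\<bar>" for v
  have "((\<lambda>t. \<bar>G (x t, y t)\<bar> + \<bar>y t - x t\<bar>) \<longlongrightarrow> \<bar>0\<bar> + \<bar>0\<bar>) at_top"
    using g0 G0 by (intro tendsto_intros) auto
  then have h20: "((\<lambda>t. h2 (x t, y t)) \<longlongrightarrow> 0) at_top" by (simp add: h2_def)
  have lev: "fst v = level" if "v \<in> K" "G v = 0" "snd v = fst v" for v
  proof -
    have pos: "0 < fst v" using that d by (auto simp: K_def)
    have "stiffness (fst v) (fst v) * (fst v - level) = 0"
      using that eta_rhs_linearised[of "fst v" "fst v"] by (simp add: G_def)
    moreover have "0 < stiffness (fst v) (fst v)"
      unfolding stiffness_def using pos L_ge level_sq(2) sq1_pos[of "fst v"] Lx_pos[of "fst v"]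
      by (intro divide_pos_pos mult_pos_pos add_pos_pos) auto
    ultimately show ?thesis by simp
  qed
  have h2: "continuous_on K h2" unfolding h2_def by (intro continuous_intros G)
  have h2z: "fst v - level = 0" if "v \<in> K" "h2 v = 0" for v
  proof -
    have "G v = 0" "snd v = fst v" using that(2) abs_ge_zero[of "G v"] abs_ge_zero[of "snd v - fst v"]
      unfolding h2_def by linarith+
    then show ?thesis using lev[OF that(1)] by simp
  qed
  have "((\<lambda>t. (\<lambda>v. fst v - level) (x t, y t)) \<longlongrightarrow> 0) at_top"
    by (rule compact_zero_tendsto[OF K h2 _ h2z inK h20]) (intro continuous_intros)
  then have "((\<lambda>t. x t - level) \<longlongrightarrow> 0) at_top" by simp
  then have xl: "(x \<longlongrightarrow> level) at_top" by (simp add: Lim_null[symmetric])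
  have "((\<lambda>t. (y t - x t) + x t) \<longlongrightarrow> 0 + level) at_top"
    using g0 xl by (intro tendsto_add) simp_all
  then have "(y \<longlongrightarrow> level) at_top" by simp
  with xl show ?thesis by (rule tendsto_Pair)
qed

text \<open>Otherwise the logarithmic derivative \<open>(y - x) / (x - level)\<close> would exist
  for all large \<open>t\<close> and solve a Riccati equation whose limiting quadratic has no real
  root.\<close>

lemma trajectory_crosses_level:
  assumes tr: "\<And>T. trajectory_upto T x y"
  shows "\<exists>t\<ge>t1. x t = level"
proof (rule ccontr)
  assume "\<not> (\<exists>t\<ge>t1. x t = level)"
  then have nz: "x t - level \<noteq> 0" if "t \<ge> t1" for t using that by auto
  have der: "(x has_real_derivative y t - x t) (at t)" "(y has_real_derivative eta_rhs (x t) (y t)) (at t)" for t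
    using tr[of "t + 1"] by (auto simp: trajectory_upto_def)
  define q where "q t = (y t - x t) / (x t - level)" for t
  define b where "b t = damping (x t) (y t)" for t
  define c where "c t = stiffness (x t) (y t)" for t
  show False
  proof (rule riccati_contradiction)
    fix t assume t: "t \<ge> t1"
    have "(q has_real_derivative ((eta_rhs (x t) (y t) - (y t - x t)) * (x t - level) - (y t - x t) * (y t - x t - 0)) /
        ((x t - level) * (x t - level))) (at t)"
      unfolding q_def[abs_def] by (intro DERIV_divide DERIV_diff der DERIV_const nz t)
    moreover have "((eta_rhs (x t) (y t) - (y t - x t)) * (x t - level) - (y t - x t) * (y t - x t - 0)) /
        ((x t - level) * (x t - level)) = - ((q t)\<^sup>2 + b t * q t + c t)"
      unfolding eta_rhs_linearised q_def b_def[symmetric] c_def[symmetric] using nz[OF t]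
      by (simp add: divide_simps) (simp add: power2_eq_square algebra_simps)
    ultimately show "(q has_real_derivative - ((q t)\<^sup>2 + b t * q t + c t)) (at t)" by simp
  next
    note conv = trajectory_converges[OF tr]
    show "(b \<longlongrightarrow> real p + 2) at_top"
      using isCont_tendsto_compose[OF isCont_coeffs(1) conv] by (simp add: b_def[abs_def] damping_level)
    show "(c \<longlongrightarrow> 2 * (real p + 1) * (1 - (real p + 1) / (real p * L))) at_top"
      using isCont_tendsto_compose[OF isCont_coeffs(2) conv] by (simp add: c_def[abs_def] stiffness_level)
    have "4 * (2 * (real p + 1) * r) = 8 * (real p + 1) * r" for r by (simp add: algebra_simps)
    then show "(real p + 2)\<^sup>2 < 4 * (2 * (real p + 1) * (1 - (real p + 1) / (real p * L)))" using disc by (simp only:)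
  qed
qed

end

section \<open>From trajectories back to analytic profiles\<close>

lemma analytic_at_point_has_derivative:
  assumes "power_series_at u x0 c r" "\<bar>x - x0\<bar> < r"
  shows "(u has_real_derivative eval_fps (fps_deriv (Abs_fps c)) (x - x0)) (at x)"
proof -
  define y where "y = x - x0"
  have y: "\<bar>y\<bar> < r" using assms(2) by (simp add: y_def)
  have "ereal (norm y) < ereal r" using y by simp
  also have "\<dots> \<le> fps_conv_radius (Abs_fps c)" by (rule power_series_at_radius[OF assms(1)])
  finally have "(eval_fps (Abs_fps c) has_real_derivative eval_fps (fps_deriv (Abs_fps c)) y) (at y)"
    by (rule has_field_derivative_eval_fps)
  then have "((\<lambda>z. eval_fps (Abs_fps c) (z - x0)) has_real_derivative eval_fps (fps_deriv (Abs_fps c)) y) (at x)"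
    using DERIV_shift[of "\<lambda>z. eval_fps (Abs_fps c) (z - x0)" _ y x0] by (simp add: y_def)
  moreover have "\<forall>\<^sub>F z in nhds x. z \<in> ball x (r - \<bar>y\<bar>)"
    using y by (intro eventually_nhds_in_open) auto
  then have ev: "\<forall>\<^sub>F z in nhds x. eval_fps (Abs_fps c) (z - x0) = u z"
  proof eventually_elim
    case (elim z)
    then have "\<bar>z - x0\<bar> < r" unfolding y_def by (simp add: dist_real_def)
    from power_series_at_eval[OF assms(1) this] show ?case by simp
  qed
  ultimately show ?thesis using DERIV_cong_ev[OF refl ev refl] by (simp add: y_def)
qed

context lo_ode begin

lemma analytic_at_point_deriv:
  assumes "analytic_at_point u x0"
  shows "(u has_real_derivative deriv u x0) (at x0)" "analytic_at_point (deriv u) x0"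
proof -
  obtain c r where c: "power_series_at u x0 c r" using assms by (auto simp: analytic_at_point_def)
  then have r: "r > 0" by (simp add: power_series_at_def)
  have der: "(u has_real_derivative eval_fps (fps_deriv (Abs_fps c)) (x - x0)) (at x)" if "\<bar>x - x0\<bar> < r" for x
    using analytic_at_point_has_derivative[OF c that] .
  then have "(u has_real_derivative eval_fps (fps_deriv (Abs_fps c)) (x0 - x0)) (at x0)" using der[of x0] r by auto
  then show "(u has_real_derivative deriv u x0) (at x0)" by (simp add: DERIV_imp_deriv)
  have "power_series_at (deriv u) x0 (fps_nth (fps_deriv (Abs_fps c))) r"
    unfolding power_series_at_iff_eval
  proof (intro conjI allI impI)
    show "ereal r \<le> fps_conv_radius (Abs_fps (fps_nth (fps_deriv (Abs_fps c))))"
      using fps_conv_radius_ge(5)[OF power_series_at_radius[OF c]] by (simp add: fps_nth_inverse)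
    fix y assume "\<bar>y\<bar> < r"
    then show "deriv u (x0 + y) = eval_fps (Abs_fps (fps_nth (fps_deriv (Abs_fps c)))) y"
      using der[of "x0 + y"] by (simp add: DERIV_imp_deriv fps_nth_inverse)
  qed (rule r)
  then show "analytic_at_point (deriv u) x0" by (auto simp: analytic_at_point_def)
qed

lemma analytic_at_point_isCont: "analytic_at_point u x \<Longrightarrow> isCont u x"
  using analytic_at_point_deriv(1) DERIV_isCont by blast

lemma exp_double_power: "exp (2 * t) ^ m = (exp t ^ m)\<^sup>2" for t :: real
proof -
  have "exp (2 * t) ^ m = ((exp t)\<^sup>2) ^ m" by (simp only: exp_double)
  also have "\<dots> = (exp t ^ m)\<^sup>2" by (simp only: power_mult[symmetric] mult.commute)
  finally show ?thesis .
qed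

text \<open>The substitution \<open>z = exp (2 * t)\<close> removes the explicit dependence on
  \<open>z\<close>. Towards minus infinity \<open>a\<close> tends to 1 and \<open>b\<close> to
  \<open>k\<close>, so the orbit starts on the side \<open>0 < x < y\<close>.\<close>

lemma trajectory_of_solution:
  assumes sol: "solution_upto (exp (2 * T)) a b"
  shows "trajectory_upto T (\<lambda>t. exp t ^ (k - 1) * a (exp (2 * t))) (\<lambda>t. exp t ^ (k - 1) * b (exp (2 * t)))"
    (is "trajectory_upto T ?x ?y")
proof -
  have km: "real (k - 1) = real k - 1" using k by simp
  have de: "((\<lambda>t. exp t ^ (k - 1)) has_real_derivative (real k - 1) * exp t ^ (k - 1)) (at t)" for t :: real
  proof -
    have "((\<lambda>t. exp (real (k - 1) * t)) has_real_derivative exp (real (k - 1) * t) * real (k - 1)) (at t)"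
      by (auto intro!: derivative_eq_intros)
    then have "((\<lambda>t. exp t ^ (k - 1)) has_real_derivative exp t ^ (k - 1) * real (k - 1)) (at t)"
      unfolding exp_of_nat_mult .
    then show ?thesis unfolding km by (simp add: mult.commute)
  qed
  have d2: "((\<lambda>t. f (exp (2 * t))) has_real_derivative D * (exp (2 * t) * 2)) (at t)"
    if "(f has_real_derivative D) (at (exp (2 * t)))" for f D and t :: real
    by (rule DERIV_chain2[where f = f and g = "\<lambda>t. exp (2 * t)", OF that]) (auto intro!: derivative_eq_intros)
  have e2: "exp (2 * t) ^ (k - 1) = (exp t ^ (k - 1))\<^sup>2" for t :: real
    by (rule exp_double_power)
  have der: "(?x has_real_derivative ?y t - ?x t) (at t) \<and> (?y has_real_derivative eta_rhs (?x t) (?y t)) (at t)"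
    if t: "t < T" for t
  proof -
    define z where "z = exp (2 * t)"
    define E where "E = exp t ^ (k - 1)"
    have z: "0 < z" "z < exp (2 * T)" using t by (simp_all add: z_def)
    have zE: "z ^ (k - 1) = E\<^sup>2" by (simp only: z_def E_def e2)
    have ode: "(a has_real_derivative arhs z (a z) (b z)) (at z)" "(b has_real_derivative brhs z (a z) (b z)) (at z)"
      using sol z by (auto simp: solution_upto_def ode_at_def)
    have "(?x has_real_derivative (real k - 1) * E * a z + (arhs z (a z) (b z) * (z * 2)) * E) (at t)"
      unfolding E_def z_def by (rule DERIV_mult[OF de d2]) (use ode in \<open>simp add: z_def\<close>)
    moreover have "(real k - 1) * E * a z + (arhs z (a z) (b z) * (z * 2)) * E = E * b z - E * a z"
      using z by (simp add: arhs_def field_simps)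
    moreover have "(?y has_real_derivative (real k - 1) * E * b z + (brhs z (a z) (b z) * (z * 2)) * E) (at t)"
      unfolding E_def z_def by (rule DERIV_mult[OF de d2]) (use ode in \<open>simp add: z_def\<close>)
    moreover have "(real k - 1) * E * b z + (brhs z (a z) (b z) * (z * 2)) * E = eta_rhs (E * a z) (E * b z)"
    proof -
      have "brhs z (a z) (b z) * (z * 2) =
        - (real k - 1) * b z - (1 + z ^ (k - 1) * (b z)\<^sup>2) * (b z + real p * (b z - L * a z) * wgt z (a z))"
        using z by (simp add: brhs_def)
      then have "(real k - 1) * E * b z + (brhs z (a z) (b z) * (z * 2)) * E =
        - (1 + z ^ (k - 1) * (b z)\<^sup>2) * (E * b z + real p * (E * b z - L * (E * a z)) * wgt z (a z))"
        by (simp only:) (simp add: algebra_simps)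
      then show ?thesis unfolding wgt_def zE by (simp add: eta_rhs_def power_mult_distrib mult.assoc)
    qed
    ultimately show ?thesis by (simp add: E_def z_def)
  qed
  have cont: "isCont a 0" "isCont b 0" "a 0 = 1" "b 0 = real k"
    using sol analytic_at_point_isCont by (auto simp: solution_upto_def)
  have e0: "((\<lambda>t::real. exp (2 * t)) \<longlongrightarrow> 0) at_bot"
    by (rule filterlim_compose[OF exp_at_bot]) (rule filterlim_tendsto_pos_mult_at_bot[OF tendsto_const _ filterlim_ident], simp)
  have E0: "((\<lambda>t::real. exp t ^ (k - 1)) \<longlongrightarrow> 0) at_bot"
    using tendsto_power[OF exp_at_bot, of "k - 1"] k by (simp add: power_0_left)
  have la: "((\<lambda>t. a (exp (2 * t))) \<longlongrightarrow> 1) at_bot" using isCont_tendsto_compose[OF cont(1) e0] cont(3) by simp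
  have lb: "((\<lambda>t. b (exp (2 * t))) \<longlongrightarrow> real k) at_bot" using isCont_tendsto_compose[OF cont(2) e0] cont(4) by simp
  have "(?x \<longlongrightarrow> 0) at_bot" "(?y \<longlongrightarrow> 0) at_bot"
    using tendsto_mult[OF E0 la] tendsto_mult[OF E0 lb] by simp_all
  moreover have "\<forall>\<^sub>F t in at_bot. 0 < ?x t \<and> ?x t < ?y t"
  proof -
    have "\<forall>\<^sub>F t in at_bot. a (exp (2 * t)) > 0" using la by (rule order_tendstoD) simp
    moreover have "\<forall>\<^sub>F t in at_bot. a (exp (2 * t)) < 2" using la by (rule order_tendstoD) simp
    moreover have "\<forall>\<^sub>F t in at_bot. b (exp (2 * t)) > 2" using lb by (rule order_tendstoD) (use k in simp)
    ultimately show ?thesis by eventually_elim simp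
  qed
  ultimately show ?thesis using der by (simp add: trajectory_upto_def)
qed

lemma sqrt_power_eq_exp: "z > 0 \<Longrightarrow> sqrt z ^ m = exp (ln z / 2) ^ m"
  by (simp add: ln_sqrt[symmetric])

text \<open>A global solution whose initial value \<open>a 0\<close> is left free. The condition on
  \<open>b 0\<close> is the relation \<open>b = k * a + 2 * z * a'\<close> at the point where the
  ODE is not imposed.\<close>

definition profile :: "(real \<Rightarrow> real) \<Rightarrow> (real \<Rightarrow> real) \<Rightarrow> bool" where
  "profile a b \<longleftrightarrow> (\<forall>z\<ge>0. analytic_at_point a z \<and> analytic_at_point b z) \<and> b 0 = real k * a 0 \<and>
     (\<forall>z>0. ode_at a b z)"

text \<open>Profiles are told apart by \<open>a 0\<close>: the dilation belonging to a crossing time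
  \<open>t\<close> moves the crossing to \<open>z = 1\<close> and changes the initial value from 1
  to \<open>exp t ^ (k - 1)\<close>, which is injective in \<open>t\<close>.\<close>

lemma infinitely_many_profiles:
  "infinite {c. \<exists>a b. profile a b \<and> a 0 = c \<and> a 1 = level}"
proof -
  obtain B H where BH: "B > 0" "H > 0" and bd: "\<And>T x y t. trajectory_upto T x y \<Longrightarrow> t < T \<Longrightarrow> 0 < x t \<and> x t \<le> B \<and> 0 < y t \<and> y t \<le> H"
    using trajectory_bounds by blast
  have "\<exists>a b. \<forall>Z. solution_upto Z a b"
  \<comment> \<open>A solution on \<open>{0..<Z}\<close> yields a trajectory up to the time
    \<open>ln Z / 2\<close>, so the bounds of the Lyapunov argument are the a priori bounds for
    continuation.\<close>
  proof (rule global_solution)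
    show "0 \<le> max B H" using BH by simp
    fix Z a b z assume sol: "solution_upto Z a b" and z: "z \<in> {0<..<Z}"
    have "exp (2 * (ln Z / 2)) = Z" using z by simp
    then have "trajectory_upto (ln Z / 2) (\<lambda>t. exp t ^ (k - 1) * a (exp (2 * t))) (\<lambda>t. exp t ^ (k - 1) * b (exp (2 * t)))"
      using sol by (intro trajectory_of_solution) simp
    from bd[OF this, of "ln z / 2"]
    show "\<bar>sqrt z ^ (k - 1) * a z\<bar> \<le> max B H \<and> \<bar>sqrt z ^ (k - 1) * b z\<bar> \<le> max B H"
      using z sqrt_power_eq_exp[of z "k - 1"] by (simp add: le_max_iff_disj)
  qed
  then obtain a b where sol: "\<And>Z. solution_upto Z a b" by blast
  define x where "x t = exp t ^ (k - 1) * a (exp (2 * t))" for t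
  define y where "y t = exp t ^ (k - 1) * b (exp (2 * t))" for t
  have tr: "trajectory_upto T x y" for T
    unfolding x_def[abs_def] y_def[abs_def] by (rule trajectory_of_solution[OF sol])
  have inf: "infinite {t. x t = level}"
  proof
    assume "finite {t. x t = level}"
    then have "bdd_above {t. x t = level}" by (rule bdd_above_finite)
    then obtain M where "\<And>t. x t = level \<Longrightarrow> t \<le> M" unfolding bdd_above_def by blast
    moreover obtain t where "t \<ge> M + 1" "x t = level" using trajectory_crosses_level[OF tr] by blast
    ultimately show False by force
  qed
  have "(\<lambda>t. exp t ^ (k - 1)) ` {t. x t = level} \<subseteq> {c. \<exists>a b. profile a b \<and> a 0 = c \<and> a 1 = level}"
  proof (rule image_subsetI, rule CollectI)
    fix t assume "t \<in> {t. x t = level}"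
    then have t: "x t = level" by simp
    define m where "m = exp (2 * t)"
    define C where "C = exp t ^ (k - 1)"
    have m: "m > 0" and C: "C\<^sup>2 = m ^ (k - 1)"
      by (simp_all only: m_def C_def exp_double_power exp_gt_zero)
    define a' where "a' z = C * a (m * z)" for z
    define b' where "b' z = C * b (m * z)" for z
    have ana: "analytic_at_point (\<lambda>z. C * u (m * z)) z" if "analytic_at_point u (m * z)" for u z
    proof -
      obtain c r where "power_series_at u (m * z) c r" using \<open>analytic_at_point u (m * z)\<close> by (auto simp: analytic_at_point_def)
      from power_series_at_affine[OF this m, of C z]
      have "power_series_at (\<lambda>x. C * u (m * z + (x - z) * m)) z (\<lambda>n. C * c n * m ^ n) (r / m)" .
      moreover have "m * z + (x - z) * m = m * x" for x by (simp add: algebra_simps)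
      ultimately show ?thesis by (auto simp: analytic_at_point_def)
    qed
    have "analytic_at_point a' z \<and> analytic_at_point b' z" if "z \<ge> 0" for z
    proof -
      have "m * z \<in> {0..<m * z + 1}" using m that by simp
      then have "analytic_at_point a (m * z)" "analytic_at_point b (m * z)"
        using sol[of "m * z + 1"] by (auto simp: solution_upto_def)
      then show ?thesis unfolding a'_def[abs_def] b'_def[abs_def] by (simp add: ana)
    qed
    moreover have "ode_at a' b' z" if "z > 0" for z
    proof -
      have "m * z \<in> {0<..<m * z + 1}" using m that by simp
      then have "ode_at a b (m * z)" using sol[of "m * z + 1"] by (auto simp: solution_upto_def)
      then show ?thesis unfolding a'_def[abs_def] b'_def[abs_def] by (rule ode_scale[OF _ m C that])
    qed
    moreover have "a 0 = 1" "b 0 = real k" using sol[of 1] by (auto simp: solution_upto_def)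
    ultimately have "profile a' b'" "a' 0 = C" by (simp_all add: profile_def a'_def b'_def)
    moreover have "a' 1 = level" using t by (simp add: a'_def m_def C_def x_def)
    ultimately show "\<exists>a b. profile a b \<and> a 0 = exp t ^ (k - 1) \<and> a 1 = level" unfolding C_def by blast
  qed
  moreover have "inj_on (\<lambda>t::real. exp t ^ (k - 1)) {t. x t = level}"
  proof (rule inj_onI)
    fix s t :: real assume "exp s ^ (k - 1) = exp t ^ (k - 1)"
    then show "s = t" using k power_eq_iff_eq_base[of "k - 1" "exp s" "exp t"] by simp
  qed
  ultimately show ?thesis using inf finite_imageD finite_subset by blast
qed

lemma profile_facts:
  assumes "profile a b"
  shows "\<And>z. z \<ge> 0 \<Longrightarrow> (a has_real_derivative deriv a z) (at z)"
    "\<And>z. z \<ge> 0 \<Longrightarrow> (b has_real_derivative deriv b z) (at z)"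
    "\<And>z. z \<ge> 0 \<Longrightarrow> (deriv a has_real_derivative deriv (deriv a) z) (at z)"
    "continuous_on {0..} (deriv b)" "continuous_on {0..} (deriv (deriv a))"
    "\<And>z. z \<ge> 0 \<Longrightarrow> b z = real k * a z + 2 * z * deriv a z"
    "\<And>z. z > 0 \<Longrightarrow> deriv b z = brhs z (a z) (b z)"
proof -
  have ana: "analytic_at_point a z" "analytic_at_point b z" if "z \<ge> 0" for z using assms that by (auto simp: profile_def)
  show "(a has_real_derivative deriv a z) (at z)" "(b has_real_derivative deriv b z) (at z)"
    "(deriv a has_real_derivative deriv (deriv a) z) (at z)" if "z \<ge> 0" for z
    by (rule analytic_at_point_deriv(1)[OF ana(1)[OF that]],
        rule analytic_at_point_deriv(1)[OF ana(2)[OF that]],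
        rule analytic_at_point_deriv(1)[OF analytic_at_point_deriv(2)[OF ana(1)[OF that]]])
  show "continuous_on {0..} (deriv b)" "continuous_on {0..} (deriv (deriv a))"
    by (rule continuous_at_imp_continuous_on, rule ballI, rule analytic_at_point_isCont,
        intro analytic_at_point_deriv(2) ana, simp)+
  have ode: "ode_at a b z" if "z > 0" for z using assms that by (simp add: profile_def)
  show "b z = real k * a z + 2 * z * deriv a z" if "z \<ge> 0" for z
  proof (cases "z = 0")
    case True
    have "b 0 = real k * a 0" using assms unfolding profile_def by (elim conjE)
    then show ?thesis using True by simp
  next
    case False
    then have "z > 0" using that by simp
    from ode[OF this] have "(a has_real_derivative arhs z (a z) (b z)) (at z)" unfolding ode_at_def by (rule conjunct1)
    then have "deriv a z = arhs z (a z) (b z)" by (rule DERIV_imp_deriv)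
    then show ?thesis using \<open>z > 0\<close> by (simp add: arhs_def)
  qed
  show "deriv b z = brhs z (a z) (b z)" if "z > 0" for z
    by (rule DERIV_imp_deriv, rule conjunct2[OF ode[OF that, unfolded ode_at_def]])
qed

end

section \<open>Divergence-free fields\<close>

text \<open>Difference quotients of \<open>g\<close> have integral zero because Lebesgue measure is
  translation invariant; dominated convergence passes to the derivative.\<close>

lemma integral_derivative_compact_support:
  fixes g :: "'a::euclidean_space \<Rightarrow> real"
  assumes K: "compact K" and supp: "\<And>x. x \<notin> K \<Longrightarrow> g x = 0"
    and der: "\<And>x. (g has_derivative g' x) (at x)"
    and cont: "continuous_on UNIV (\<lambda>x. g' x e)"
  shows "has_bochner_integral lborel (\<lambda>x. g' x e) 0"
proof -
  define D where "D x = g' x e" for x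
  have D0: "D x = 0" if "x \<notin> K" for x
  proof -
    have "open (- K)" using K by (simp add: compact_imp_closed open_Compl)
    then have "((\<lambda>_. 0) has_derivative g' x) (at x)"
      by (rule has_derivative_transform_within_open[OF der]) (use supp that in auto)
    then have "g' x = (\<lambda>_. 0)" using has_derivative_unique has_derivative_const by blast
    then show ?thesis by (simp add: D_def)
  qed
  \<comment> \<open>Difference quotients with steps in \<open>{0..1}\<close> vanish outside this
    compact set, which carries the dominating function.\<close>
  define K' where "K' = (\<lambda>(x, t). x - t *\<^sub>R e) ` (K \<times> {0..1})"
  have K': "compact K'" unfolding K'_def case_prod_beta
    by (intro compact_continuous_image compact_Times K continuous_intros) auto
  have KK': "K \<subseteq> K'" unfolding K'_def by (rule subsetI, rule image_eqI[of _ _ "(_, 0)"]) auto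
  have "bounded (D ` K)"
    using compact_imp_bounded[OF compact_continuous_image[OF _ K]] cont continuous_on_subset unfolding D_def[abs_def] by blast
  then obtain M where "\<forall>w\<in>D ` K. norm w \<le> M" unfolding bounded_iff by blast
  then have M: "\<bar>D x\<bar> \<le> \<bar>M\<bar>" for x using D0[of x] by (cases "x \<in> K") force+
  have gcont: "continuous_on UNIV g"
    using der by (intro continuous_at_imp_continuous_on) (auto intro: has_derivative_continuous)
  have meas: "g \<in> borel_measurable borel" using gcont by (rule borel_measurable_continuous_onI)
  have gint: "integrable lborel g"
  proof -
    have "integrable lborel (\<lambda>x. indicator K x *\<^sub>R g x)"
      by (rule borel_integrable_compact[OF K]) (rule continuous_on_subset[OF gcont], simp)
    moreover have "(\<lambda>x. indicator K x *\<^sub>R g x) = g" 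
    proof
      fix x show "indicator K x *\<^sub>R g x = g x" using supp[of x] by (cases "x \<in> K") auto
    qed
    ultimately show ?thesis by simp
  qed
  define h where "h n x = (g (x + (1 / real (Suc n)) *\<^sub>R e) - g x) * real (Suc n)" for n x
  have hbound: "\<bar>h n x\<bar> \<le> \<bar>M\<bar> * indicator K' x" for n x
  proof -
    define s where "s = 1 / real (Suc n)"
    have s: "0 < s" "s \<le> 1" by (simp_all add: s_def)
    show ?thesis
    proof (cases "x \<in> K'")
      case True
      have d: "((\<lambda>t. g (x + t *\<^sub>R e)) has_real_derivative D (x + t *\<^sub>R e)) (at t)" for t
      proof -
        have "((\<lambda>t. x + t *\<^sub>R e) has_derivative (\<lambda>h. h *\<^sub>R e)) (at t)"
          by (auto intro!: derivative_eq_intros)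
        from has_derivative_compose[OF this der]
        have "((\<lambda>t. g (x + t *\<^sub>R e)) has_derivative (\<lambda>h. g' (x + t *\<^sub>R e) (h *\<^sub>R e))) (at t)" .
        moreover have "g' (x + t *\<^sub>R e) (h *\<^sub>R e) = D (x + t *\<^sub>R e) * h" for h
          using has_derivative_linear[OF der] by (simp add: linear_cmul D_def)
        ultimately show ?thesis by (simp add: has_field_derivative_def)
      qed
      obtain \<xi> where "g (x + s *\<^sub>R e) - g (x + 0 *\<^sub>R e) = (s - 0) * D (x + \<xi> *\<^sub>R e)"
        using MVT2[of 0 s "\<lambda>t. g (x + t *\<^sub>R e)" "\<lambda>t. D (x + t *\<^sub>R e)"] d s by blast
      then have "h n x = D (x + \<xi> *\<^sub>R e)" unfolding h_def s_def by simp
      then show ?thesis using M True by simp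
    next
      case False
      then have "x \<notin> K" using KK' by blast
      moreover have "x + s *\<^sub>R e \<notin> K"
      proof
        assume "x + s *\<^sub>R e \<in> K"
        then have "x \<in> K'" unfolding K'_def using s by (intro image_eqI[of _ _ "(x + s *\<^sub>R e, s)"]) auto
        with False show False ..
      qed
      ultimately have "h n x = 0" by (simp add: h_def s_def supp)
      then show ?thesis by simp
    qed
  qed
  have hlim: "(\<lambda>n. h n x) \<longlonglongrightarrow> D x" for x
  proof -
    have "((\<lambda>t. g (x + t *\<^sub>R e)) has_real_derivative D x) (at 0)"
    proof -
      have "((\<lambda>t. x + t *\<^sub>R e) has_derivative (\<lambda>h. h *\<^sub>R e)) (at 0)"
        by (auto intro!: derivative_eq_intros)
      from has_derivative_compose[OF this der]
      have "((\<lambda>t. g (x + t *\<^sub>R e)) has_derivative (\<lambda>h. g' x (h *\<^sub>R e))) (at 0)" by simp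
      moreover have "g' x (h *\<^sub>R e) = D x * h" for h
        using has_derivative_linear[OF der] by (simp add: linear_cmul D_def)
      ultimately show ?thesis by (simp add: has_field_derivative_def)
    qed
    then have "((\<lambda>t. (g (x + t *\<^sub>R e) - g x) / t) \<longlongrightarrow> D x) (at 0)" by (simp add: DERIV_def)
    moreover have "filterlim (\<lambda>n. 1 / real (Suc n)) (at 0) sequentially"
      using LIMSEQ_inverse_real_of_nat by (auto simp: filterlim_at inverse_eq_divide)
    ultimately have "(\<lambda>n. (g (x + (1 / real (Suc n)) *\<^sub>R e) - g x) / (1 / real (Suc n))) \<longlonglongrightarrow> D x"
      by (rule filterlim_compose)
    then show ?thesis by (simp add: h_def)
  qed
  have Dmeas: "D \<in> borel_measurable lborel"
    using cont unfolding D_def[abs_def] by (simp add: borel_measurable_continuous_onI)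
  have hmeas: "h n \<in> borel_measurable lborel" for n
  proof -
    have "continuous_on UNIV (h n)" unfolding h_def
      by (intro continuous_intros continuous_on_compose2[OF gcont]) auto
    then show ?thesis by (simp add: borel_measurable_continuous_onI)
  qed
  have wint: "integrable lborel (\<lambda>x. \<bar>M\<bar> * indicator K' x :: real)"
    using borel_integrable_compact[OF K', of "\<lambda>_. \<bar>M\<bar>"] by (simp add: mult.commute)
  have lims: "AE x in lborel. (\<lambda>n. h n x) \<longlonglongrightarrow> D x"
    and bds: "\<And>n. AE x in lborel. norm (h n x) \<le> \<bar>M\<bar> * indicator K' x"
    using hlim hbound by auto
  have Dint: "integrable lborel D"
    by (rule integrable_dominated_convergence[OF Dmeas hmeas wint lims bds])
  have conv: "(\<lambda>n. integral\<^sup>L lborel (h n)) \<longlonglongrightarrow> integral\<^sup>L lborel D"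
    by (rule integral_dominated_convergence[OF Dmeas hmeas wint lims bds])
  have "integral\<^sup>L lborel (h n) = 0" for n
  proof -
    define c where "c = (1 / real (Suc n)) *\<^sub>R e"
    have dist: "distr lborel borel ((+) c) = (lborel :: 'a measure)" by (rule lborel_distr_plus)
    have m: "(+) c \<in> lborel \<rightarrow>\<^sub>M borel" by simp
    have "integral\<^sup>L lborel g = integral\<^sup>L (distr lborel borel ((+) c)) g" by (simp only: dist)
    also have "\<dots> = integral\<^sup>L lborel (\<lambda>x. g (c + x))" by (rule integral_distr[OF m meas])
    finally have eq: "integral\<^sup>L lborel (\<lambda>x. g (x + c)) = integral\<^sup>L lborel g" by (simp add: add.commute)
    have "integrable (distr lborel borel ((+) c)) g" using gint by (simp only: dist)
    then have "integrable lborel (\<lambda>x. g (c + x))" using integrable_distr_eq[OF m meas] by simp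
    then have "integrable lborel (\<lambda>x. g (x + c))" by (simp add: add.commute)
    then have "integral\<^sup>L lborel (\<lambda>x. (g (x + c) - g x) * real (Suc n)) =
        (integral\<^sup>L lborel (\<lambda>x. g (x + c)) - integral\<^sup>L lborel g) * real (Suc n)"
      using gint by (simp add: Bochner_Integration.integral_diff)
    then show ?thesis unfolding h_def c_def[symmetric] using eq by simp
  qed
  then have "integral\<^sup>L lborel D = 0" using conv LIMSEQ_unique[OF _ tendsto_const] by simp
  then show ?thesis using Dint unfolding D_def[abs_def] by (simp add: has_bochner_integral_iff)
qed

section \<open>First order calculus in coordinates\<close>

definition C1_on :: "(real^'a::finite) set \<Rightarrow> (real^'a \<Rightarrow> real) \<Rightarrow> bool" where
  "C1_on S f \<longleftrightarrow> (\<forall>x\<in>S. f differentiable (at x)) \<and> (\<forall>i. continuous_on S (partial_deriv i f))"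

lemma partial_deriv_eqI: "(f has_derivative f') (at x) \<Longrightarrow> partial_deriv i f x = f' (axis i 1)"
  unfolding partial_deriv_def by (simp add: frechet_derivative_at[symmetric])

lemma differentiable_has_derivative:
  "f differentiable (at x) \<Longrightarrow> (f has_derivative frechet_derivative f (at x)) (at x)"
  by (simp add: frechet_derivative_works)

lemma partial_deriv_add:
  fixes f g :: "real^'a::finite \<Rightarrow> 'b::real_normed_vector"
  assumes "f differentiable (at x)" "g differentiable (at x)"
  shows "partial_deriv i (\<lambda>x. f x + g x) x = partial_deriv i f x + partial_deriv i g x"
  by (subst partial_deriv_eqI[OF has_derivative_add[OF assms[THEN differentiable_has_derivative]]])
     (simp add: partial_deriv_def)

lemma partial_deriv_mult:
  fixes f g :: "real^'a::finite \<Rightarrow> real"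
  assumes "f differentiable (at x)" "g differentiable (at x)"
  shows "partial_deriv i (\<lambda>x. f x * g x) x = f x * partial_deriv i g x + partial_deriv i f x * g x"
  by (subst partial_deriv_eqI[OF has_derivative_mult[OF assms[THEN differentiable_has_derivative]]])
     (simp add: partial_deriv_def)

lemma partial_deriv_const: "partial_deriv i (\<lambda>x. c) x = 0"
  by (subst partial_deriv_eqI[OF has_derivative_const]) simp

lemma partial_deriv_sum:
  fixes f :: "'c \<Rightarrow> real^'a::finite \<Rightarrow> 'b::real_normed_vector"
  assumes "\<And>j. j \<in> I \<Longrightarrow> f j differentiable (at x)"
  shows "partial_deriv i (\<lambda>x. \<Sum>j\<in>I. f j x) x = (\<Sum>j\<in>I. partial_deriv i (f j) x)"
  by (subst partial_deriv_eqI[OF has_derivative_sum[OF assms[THEN differentiable_has_derivative]]])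
     (simp_all add: partial_deriv_def)

lemma partial_deriv_coord: "partial_deriv i (\<lambda>x. x $ j) x = (if i = j then 1 else 0 :: real)"
proof -
  have "((\<lambda>x::real^'a. x $ j) has_derivative (\<lambda>x. x $ j)) (at x)"
    by (rule bounded_linear_imp_has_derivative) (rule bounded_linear_vec_nth)
  then show ?thesis by (simp add: partial_deriv_eqI axis_def)
qed

lemma coord_differentiable: "(\<lambda>x::real^'a::finite. x $ j) differentiable (at x)"
  using bounded_linear_imp_has_derivative[OF bounded_linear_vec_nth] differentiable_def by blast

lemma radial_has_derivative:
  fixes x :: "real^'a::finite"
  assumes "(u has_real_derivative u') (at (x \<bullet> x))"
  shows "((\<lambda>x. u (x \<bullet> x)) has_derivative (\<lambda>h. u' * (2 * (x \<bullet> h)))) (at x)"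
proof -
  have "((\<lambda>x. x \<bullet> x) has_derivative (\<lambda>h. x \<bullet> h + h \<bullet> x)) (at x)"
    by (intro has_derivative_inner has_derivative_ident)
  then have "((\<lambda>x. x \<bullet> x) has_derivative (\<lambda>h. 2 * (x \<bullet> h))) (at x)" by (simp add: inner_commute)
  from has_derivative_compose[OF this, of u "(*) u'"] assms show ?thesis
    by (simp add: has_field_derivative_def)
qed

lemma partial_deriv_radial:
  fixes x :: "real^'a::finite"
  assumes "(u has_real_derivative u') (at (x \<bullet> x))"
  shows "partial_deriv i (\<lambda>x. u (x \<bullet> x)) x = 2 * u' * x $ i"
  by (subst partial_deriv_eqI[OF radial_has_derivative[OF assms]]) (simp add: inner_axis)

lemma C1_on_continuous: "C1_on S f \<Longrightarrow> continuous_on S f"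
  unfolding C1_on_def by (blast intro: continuous_at_imp_continuous_on differentiable_imp_continuous_within)

lemma continuous_on_eq_cong: "(\<And>x. x \<in> S \<Longrightarrow> f x = g x) \<Longrightarrow> continuous_on S g \<Longrightarrow> continuous_on S f"
  by (simp cong: continuous_on_cong)

lemma C1_on_const: "C1_on S (\<lambda>x. c)"
  by (simp add: C1_on_def partial_deriv_const[abs_def])

lemma C1_on_add: "C1_on S f \<Longrightarrow> C1_on S g \<Longrightarrow> C1_on S (\<lambda>x. f x + g x)"
  unfolding C1_on_def
  by (auto intro!: derivative_intros continuous_on_eq_cong[OF partial_deriv_add] continuous_intros)

lemma C1_on_mult: "C1_on S f \<Longrightarrow> C1_on S g \<Longrightarrow> C1_on S (\<lambda>x. f x * g x)"
  using C1_on_continuous[of S f] C1_on_continuous[of S g] unfolding C1_on_def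
  by (auto intro!: derivative_intros continuous_on_eq_cong[OF partial_deriv_mult] continuous_intros)

lemma C1_on_sum: "(\<And>j. j \<in> I \<Longrightarrow> C1_on S (f j)) \<Longrightarrow> C1_on S (\<lambda>x. \<Sum>j\<in>I. f j x)"
  by (induction I rule: infinite_finite_induct) (auto intro: C1_on_const C1_on_add)

lemma C1_on_coord: "C1_on S (\<lambda>x. x $ j)"
  by (simp add: C1_on_def coord_differentiable partial_deriv_coord[abs_def])

lemma C1_on_radial:
  assumes "\<And>z. z \<ge> 0 \<Longrightarrow> (u has_real_derivative u' z) (at z)" "continuous_on {0..} u'"
  shows "C1_on S (\<lambda>x. u (x \<bullet> x))"
  unfolding C1_on_def
proof (intro conjI ballI allI)
  have d: "(u has_real_derivative u' (x \<bullet> x)) (at (x \<bullet> x))" for x :: "real^'a" by (rule assms) simp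
  show "(\<lambda>x. u (x \<bullet> x)) differentiable (at x)" for x :: "real^'a"
    using radial_has_derivative[OF d] differentiable_def by blast
  show "continuous_on S (partial_deriv i (\<lambda>x. u (x \<bullet> x)))" for i
  proof (rule continuous_on_eq_cong[OF partial_deriv_radial[OF d]])
    show "continuous_on S (\<lambda>x. 2 * u' (x \<bullet> x) * x $ i)"
      by (intro continuous_intros continuous_on_compose2[OF assms(2)]) auto
  qed
qed

lemma test_function_facts:
  assumes "test_function \<Omega> \<eta>"
  shows "\<eta> differentiable (at x)" "continuous_on UNIV (partial_deriv i \<eta>)"
    "compact (closure {x. \<eta> x \<noteq> 0})" "closure {x. \<eta> x \<noteq> 0} \<subseteq> \<Omega>"
proof -
  have "Ck_on (Suc 0) UNIV \<eta>" using assms by (auto simp: test_function_def smooth_on_def)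
  then show "\<eta> differentiable (at x)" "continuous_on UNIV (partial_deriv i \<eta>)"
    by (auto simp: partial_deriv_def[abs_def])
qed (use assms in \<open>auto simp: test_function_def\<close>)

text \<open>Extended by zero, the fields \<open>W i * \<eta>\<close> are continuously differentiable
  on the whole space with compact support, so there is no boundary term. In the sum of their
  derivatives the terms with \<open>\<eta>\<close> itself cancel by \<open>div\<close>.\<close>

lemma weak_divergence_free:
  fixes W :: "'a::finite \<Rightarrow> real^'a \<Rightarrow> real"
  assumes \<Omega>: "open \<Omega>" and W: "\<And>i. C1_on \<Omega> (W i)"
    and div: "\<And>x. x \<in> \<Omega> \<Longrightarrow> (\<Sum>i\<in>UNIV. partial_deriv i (W i) x) = 0"
    and test: "test_function \<Omega> \<eta>"
  shows "has_bochner_integral (lebesgue_on \<Omega>) (\<lambda>x. \<Sum>i\<in>UNIV. W i x * partial_deriv i \<eta> x) 0"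
proof -
  note T = test_function_facts[OF test]
  define K where "K = closure {x. \<eta> x \<noteq> 0}"
  have K: "compact K" "K \<subseteq> \<Omega>" "closed K" using T by (auto simp: K_def)
  have \<eta>0: "\<eta> x = 0" if "x \<notin> K" for x using that closure_subset[of "{x. \<eta> x \<noteq> 0}"] by (auto simp: K_def)
  have d\<eta>0: "partial_deriv i \<eta> x = 0" if "x \<notin> K" for i x
  proof -
    have "((\<lambda>_. 0) has_derivative frechet_derivative \<eta> (at x)) (at x)"
      by (rule has_derivative_transform_within_open[OF differentiable_has_derivative[OF T(1)], where s = "- K"])
         (use \<eta>0 that K(3) in \<open>auto simp: open_Compl\<close>)
    then have "frechet_derivative \<eta> (at x) = (\<lambda>_. 0)" using has_derivative_unique has_derivative_const by blast
    then show ?thesis by (simp add: partial_deriv_def)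
  qed
  have "has_bochner_integral lborel
     (\<lambda>x. \<Sum>i\<in>UNIV. if x \<in> \<Omega> then W i x * partial_deriv i \<eta> x + partial_deriv i (W i) x * \<eta> x else 0) (\<Sum>i\<in>(UNIV::'a set). 0)"
  proof (rule has_bochner_integral_sum)
    fix i :: 'a
    define g where "g x = (if x \<in> \<Omega> then W i x * \<eta> x else 0)" for x
    define g' where "g' x = (\<lambda>h. if x \<in> \<Omega> then W i x * frechet_derivative \<eta> (at x) h + frechet_derivative (W i) (at x) h * \<eta> x else 0)" for x
    have "has_bochner_integral lborel (\<lambda>x. g' x (axis i 1)) 0"
    proof (rule integral_derivative_compact_support[OF K(1)])
      show "g x = 0" if "x \<notin> K" for x using \<eta>0[OF that] by (simp add: g_def)
      show "(g has_derivative g' x) (at x)" for x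
      proof (cases "x \<in> \<Omega>")
        case True
        have "((\<lambda>x. W i x * \<eta> x) has_derivative g' x) (at x)"
          using has_derivative_mult[OF differentiable_has_derivative differentiable_has_derivative, of "W i" x \<eta>] W[of i] T(1)[of x] True
          by (simp add: C1_on_def g'_def)
        then show ?thesis
          by (rule has_derivative_transform_within_open[OF _ \<Omega> True]) (simp add: g_def)
      next
        case False
        then have "x \<notin> K" using K by auto
        have "((\<lambda>_. 0) has_derivative (\<lambda>_. 0)) (at x)" by simp
        then have "(g has_derivative (\<lambda>_. 0)) (at x)"
          by (rule has_derivative_transform_within_open[where s = "- K"])
             (use K(3) \<open>x \<notin> K\<close> \<eta>0 in \<open>auto simp: g_def open_Compl\<close>)
        then show ?thesis using False by (simp add: g'_def)
      qed
      \<comment> \<open>\<open>\<Omega>\<close> and the complement of the support are two open sets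
        that cover the space, so continuity can be checked on each.\<close>
      have "continuous_on (\<Omega> \<union> - K) (\<lambda>x. g' x (axis i 1))"
      proof (rule continuous_on_open_Un)
        show "open \<Omega>" "open (- K)" using \<Omega> K by (auto simp: open_Compl)
        have "continuous_on \<Omega> \<eta>"
          using T(1) by (intro continuous_at_imp_continuous_on) (auto intro: differentiable_imp_continuous_within)
        then have "continuous_on \<Omega> (\<lambda>x. W i x * partial_deriv i \<eta> x + partial_deriv i (W i) x * \<eta> x)"
          using W[of i] C1_on_continuous[OF W[of i]] T(2)[of i]
          by (intro continuous_intros) (auto simp: C1_on_def intro: continuous_on_subset)
        then show "continuous_on \<Omega> (\<lambda>x. g' x (axis i 1))"
          by (rule continuous_on_eq_cong[rotated]) (simp add: g'_def partial_deriv_def)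
        show "continuous_on (- K) (\<lambda>x. g' x (axis i 1))"
          by (rule continuous_on_eq_cong[of _ _ "\<lambda>_. 0"]) (use \<eta>0 d\<eta>0 in \<open>auto simp: g'_def partial_deriv_def\<close>)
      qed
      moreover have "\<Omega> \<union> - K = UNIV" using K by auto
      ultimately show "continuous_on UNIV (\<lambda>x. g' x (axis i 1))" by simp
    qed
    then show "has_bochner_integral lborel (\<lambda>x. if x \<in> \<Omega> then W i x * partial_deriv i \<eta> x + partial_deriv i (W i) x * \<eta> x else 0) 0"
      by (simp add: g'_def partial_deriv_def cong: if_cong)
  qed
  moreover have "(\<Sum>i\<in>UNIV. if x \<in> \<Omega> then W i x * partial_deriv i \<eta> x + partial_deriv i (W i) x * \<eta> x else 0) =
      indicator \<Omega> x *\<^sub>R (\<Sum>i\<in>UNIV. W i x * partial_deriv i \<eta> x)" for x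
    using div[of x] by (cases "x \<in> \<Omega>") (simp_all add: sum.distrib sum_distrib_right[symmetric])
  ultimately have "has_bochner_integral lborel (\<lambda>x. indicator \<Omega> x *\<^sub>R (\<Sum>i\<in>UNIV. W i x * partial_deriv i \<eta> x)) 0"
    by simp
  then have "has_bochner_integral lebesgue (\<lambda>x. indicator \<Omega> x *\<^sub>R (\<Sum>i\<in>UNIV. W i x * partial_deriv i \<eta> x)) 0"
    by (auto simp: has_bochner_integral_iff integrable_completion integral_completion borel_measurable_integrable)
  then show ?thesis
    by (subst has_bochner_integral_restrict_space) (use \<Omega> in auto)
qed

section \<open>Harmonic maps of spheres\<close>

lemma polynomial_differentiable:
  fixes q :: "real^'a::finite \<Rightarrow> real"
  assumes "real_polynomial_function q" shows "q differentiable (at x)"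
  using assms
proof induction
  case (linear f)
  then show ?case using bounded_linear_imp_has_derivative differentiable_def by blast
qed (auto intro: derivative_intros)

lemma polynomial_partial_deriv:
  fixes q :: "real^'a::finite \<Rightarrow> real"
  assumes "real_polynomial_function q" shows "real_polynomial_function (partial_deriv i q)"
  using assms
proof induction
  case (linear f)
  have "partial_deriv i f = (\<lambda>x. f (axis i 1))"
    by (rule ext, rule partial_deriv_eqI, rule bounded_linear_imp_has_derivative[OF linear])
  then show ?case by (simp add: real_polynomial_function.intros(2))
next
  case (const c)
  then show ?case by (simp add: partial_deriv_const[abs_def] real_polynomial_function.intros(2))
next
  case (add f g)
  have "partial_deriv i (\<lambda>x. f x + g x) = (\<lambda>x. partial_deriv i f x + partial_deriv i g x)"
    by (rule ext, rule partial_deriv_add) (auto intro: polynomial_differentiable add)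
  then show ?case using add by (simp add: real_polynomial_function.intros(3))
next
  case (mult f g)
  have "partial_deriv i (\<lambda>x. f x * g x) = (\<lambda>x. f x * partial_deriv i g x + partial_deriv i f x * g x)"
    by (rule ext, rule partial_deriv_mult) (auto intro: polynomial_differentiable mult)
  then show ?case using mult by (simp add: real_polynomial_function.intros(3) real_polynomial_function.intros(4))
qed

lemma polynomial_partial_deriv_commute:
  fixes q :: "real^'a::finite \<Rightarrow> real"
  assumes "real_polynomial_function q"
  shows "partial_deriv i (partial_deriv j q) x = partial_deriv j (partial_deriv i q) x"
  using assms
proof (induction arbitrary: x)
  case (linear f)
  have "partial_deriv i f = (\<lambda>x. f (axis i 1))" for i
    by (rule ext, rule partial_deriv_eqI, rule bounded_linear_imp_has_derivative[OF linear])
  then show ?case by (simp add: partial_deriv_const)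
next
  case (const c)
  then show ?case by (simp add: partial_deriv_const[abs_def])
next
  case (add f g)
  have "partial_deriv i (\<lambda>x. f x + g x) = (\<lambda>x. partial_deriv i f x + partial_deriv i g x)" for i
    by (rule ext, rule partial_deriv_add) (auto intro: polynomial_differentiable add)
  then show ?case
    using add by (simp add: partial_deriv_add polynomial_differentiable polynomial_partial_deriv)
next
  case (mult f g)
  have "partial_deriv i (\<lambda>x. f x * g x) = (\<lambda>x. f x * partial_deriv i g x + partial_deriv i f x * g x)" for i
    by (rule ext, rule partial_deriv_mult) (auto intro: polynomial_differentiable mult)
  then show ?case
    using mult by (simp add: partial_deriv_add partial_deriv_mult polynomial_differentiable polynomial_partial_deriv
        differentiable_add differentiable_mult)
qed

lemma polynomial_C1_on:
  fixes q :: "real^'a::finite \<Rightarrow> real"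
  assumes "real_polynomial_function q" shows "C1_on S q"
  unfolding C1_on_def
  using polynomial_differentiable[OF assms] polynomial_differentiable[OF polynomial_partial_deriv[OF assms]]
  by (auto intro!: continuous_at_imp_continuous_on differentiable_imp_continuous_within)

lemma has_derivative_partial_sum:
  fixes q :: "real^'a::finite \<Rightarrow> real"
  assumes "q differentiable (at x)"
  shows "(q has_derivative (\<lambda>v. \<Sum>i\<in>UNIV. v $ i * partial_deriv i q x)) (at x)"
proof -
  note d = differentiable_has_derivative[OF assms]
  have "frechet_derivative q (at x) v = (\<Sum>i\<in>UNIV. v $ i * partial_deriv i q x)" for v
  proof -
    have lin: "linear (frechet_derivative q (at x))" using d by (rule has_derivative_linear)
    have "frechet_derivative q (at x) (\<Sum>i\<in>UNIV. v $ i *\<^sub>R axis i 1) = (\<Sum>i\<in>UNIV. v $ i * partial_deriv i q x)"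
      by (simp add: linear_sum[OF lin] linear_cmul[OF lin] partial_deriv_def)
    then show ?thesis using basis_expansion[of v] by (simp add: scalar_mult_eq_scaleR)
  qed
  then have "frechet_derivative q (at x) = (\<lambda>v. \<Sum>i\<in>UNIV. v $ i * partial_deriv i q x)" by auto
  then show ?thesis using d by simp
qed

text \<open>Two ways to differentiate \<open>s \<mapsto> q (s *\<^sub>R x)\<close> at
  \<open>s = 1\<close>: by the chain rule and by homogeneity.\<close>

lemma euler_homogeneous:
  fixes q :: "real^'a::finite \<Rightarrow> real"
  assumes d: "q differentiable (at x)" and hom: "\<And>s. s > 0 \<Longrightarrow> q (s *\<^sub>R x) = s ^ m * q x"
  shows "(\<Sum>i\<in>UNIV. x $ i * partial_deriv i q x) = real m * q x"
proof -
  have "((\<lambda>s. s *\<^sub>R x) has_derivative (\<lambda>h. h *\<^sub>R x)) (at 1)" by (auto intro!: derivative_eq_intros)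
  moreover have "(q has_derivative (\<lambda>v. \<Sum>i\<in>UNIV. v $ i * partial_deriv i q x)) (at (1 *\<^sub>R x))"
    using has_derivative_partial_sum[OF d] by simp
  ultimately have "((\<lambda>s. q (s *\<^sub>R x)) has_derivative (\<lambda>h. \<Sum>i\<in>UNIV. (h *\<^sub>R x) $ i * partial_deriv i q x)) (at 1)"
    by (rule has_derivative_compose)
  then have "((\<lambda>s. q (s *\<^sub>R x)) has_real_derivative (\<Sum>i\<in>UNIV. x $ i * partial_deriv i q x)) (at 1)"
    unfolding has_field_derivative_def
    by (rule has_derivative_eq_rhs) (auto simp: sum_distrib_left sum_distrib_right mult_ac)
  moreover have "\<forall>\<^sub>F s in nhds 1. s \<in> {0::real<..}" by (intro eventually_nhds_in_open) auto
  then have ev: "\<forall>\<^sub>F s in nhds 1. s ^ m * q x = q (s *\<^sub>R x)" by eventually_elim (simp add: hom)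
  have "((\<lambda>s. s ^ m * q x) has_real_derivative real m * q x) (at 1)" by (auto intro!: derivative_eq_intros)
  then have "((\<lambda>s. q (s *\<^sub>R x)) has_real_derivative real m * q x) (at 1)"
    using DERIV_cong_ev[OF refl ev refl] by simp
  ultimately show ?thesis by (rule DERIV_unique)
qed

lemma partial_deriv_homogeneous:
  fixes q :: "real^'a::finite \<Rightarrow> real"
  assumes d: "\<And>x. q differentiable (at x)" and hom: "\<And>s x. s > 0 \<Longrightarrow> q (s *\<^sub>R x) = s ^ Suc m * q x" and s: "s > 0"
  shows "partial_deriv i q (s *\<^sub>R x) = s ^ m * partial_deriv i q x"
proof -
  have "((\<lambda>x. s *\<^sub>R x) has_derivative (\<lambda>h. s *\<^sub>R h)) (at x)" by (auto intro!: derivative_eq_intros)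
  from has_derivative_compose[OF this differentiable_has_derivative[OF d]]
  have "partial_deriv i (\<lambda>x. q (s *\<^sub>R x)) x = frechet_derivative q (at (s *\<^sub>R x)) (s *\<^sub>R axis i 1)"
    by (rule partial_deriv_eqI)
  also have "\<dots> = s * partial_deriv i q (s *\<^sub>R x)"
    using has_derivative_linear[OF differentiable_has_derivative[OF d]] by (simp add: linear_cmul partial_deriv_def)
  also have "(\<lambda>x. q (s *\<^sub>R x)) = (\<lambda>x. s ^ Suc m * q x)" using hom s by auto
  also have "partial_deriv i (\<lambda>x. s ^ Suc m * q x) x = s ^ Suc m * partial_deriv i q x"
    by (simp add: partial_deriv_mult d partial_deriv_const)
  finally show ?thesis using s by simp
qed

lemma laplacian_partial: "laplacian q x = (\<Sum>i\<in>UNIV. partial_deriv i (partial_deriv i q) x)"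
proof -
  have B: "(Basis :: (real^'a) set) = range (\<lambda>i. axis i 1)" by (auto simp: Basis_vec_def)
  have inj: "inj (\<lambda>i::'a. axis i (1::real))" by (auto simp: inj_def axis_eq_axis)
  show ?thesis unfolding laplacian_def B sum.reindex[OF inj] by (simp add: partial_deriv_def[abs_def])
qed

locale harmonic_sphere_map =
  fixes P :: "'b::finite \<Rightarrow> real^'a::finite \<Rightarrow> real" and k :: nat
  assumes poly: "\<And>\<alpha>. real_polynomial_function (P \<alpha>)"
    and hom: "\<And>\<alpha> s x. P \<alpha> (s *\<^sub>R x) = s ^ k * P \<alpha> x"
    and harm: "\<And>\<alpha> x. (\<Sum>i\<in>UNIV. partial_deriv i (partial_deriv i (P \<alpha>)) x) = 0"
    and nrm: "\<And>x. (\<Sum>\<alpha>\<in>UNIV. (P \<alpha> x)\<^sup>2) = (x \<bullet> x) ^ k"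
    and k4: "4 \<le> k"
begin

abbreviation "dP i \<alpha> \<equiv> partial_deriv i (P \<alpha>)"

text \<open>Despite the name no second derivatives occur: this is the Gram matrix of the gradients,
  that is, the pull-back of the Euclidean metric under \<open>P\<close>.\<close>

definition hess :: "'a \<Rightarrow> 'a \<Rightarrow> real^'a \<Rightarrow> real" where
  "hess i j x = (\<Sum>\<alpha>\<in>UNIV. dP i \<alpha> x * dP j \<alpha> x)"

lemma diffs [simp]: "P \<alpha> differentiable (at x)" "dP i \<alpha> differentiable (at x)"
  "partial_deriv j (dP i \<alpha>) differentiable (at x)"
  by (intro polynomial_differentiable polynomial_partial_deriv poly)+

lemma euler: "(\<Sum>i\<in>UNIV. x $ i * dP i \<alpha> x) = real k * P \<alpha> x"
  by (rule euler_homogeneous) (auto simp: hom)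

lemma dP_hom: "s > 0 \<Longrightarrow> dP i \<alpha> (s *\<^sub>R x) = s ^ (k - 1) * dP i \<alpha> x"
  using partial_deriv_homogeneous[of "P \<alpha>" "k - 1" s i x] k4 by (simp add: hom)

lemma zero_at_0: "P \<alpha> 0 = 0" "dP i \<alpha> 0 = 0"
proof -
  show "P \<alpha> 0 = 0" using hom[of \<alpha> 0 0] k4 by (simp add: power_0_left)
  have "dP i \<alpha> (2 *\<^sub>R 0) = 2 ^ (k - 1) * dP i \<alpha> 0" by (rule dP_hom) simp
  moreover have "(2::real) ^ (k - 1) > 1" by (rule one_less_power) (use k4 in auto)
  ultimately show "dP i \<alpha> 0 = 0" by simp
qed

lemma hess_sym: "hess i j x = hess j i x" by (simp add: hess_def mult.commute)

lemma partial_deriv_norm_power: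
  fixes x :: "real^'a"
  shows "partial_deriv i (\<lambda>x. (x \<bullet> x) ^ m) x = 2 * (real m * (x \<bullet> x) ^ (m - 1)) * x $ i"
  by (rule partial_deriv_radial[where u = "\<lambda>z. z ^ m"]) (auto intro!: derivative_eq_intros)

text \<open>Half the gradient of the identity \<open>nrm\<close>.\<close>

lemma P_dP: "(\<Sum>\<alpha>\<in>UNIV. P \<alpha> x * dP i \<alpha> x) = real k * (x \<bullet> x) ^ (k - 1) * x $ i"
proof -
  have "partial_deriv i (\<lambda>x. \<Sum>\<alpha>\<in>UNIV. P \<alpha> x * P \<alpha> x) x = (\<Sum>\<alpha>\<in>UNIV. P \<alpha> x * dP i \<alpha> x + dP i \<alpha> x * P \<alpha> x)"
    by (subst partial_deriv_sum) (simp_all add: partial_deriv_mult differentiable_mult)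
  moreover have "(\<lambda>x. \<Sum>\<alpha>\<in>UNIV. P \<alpha> x * P \<alpha> x) = (\<lambda>x. (x \<bullet> x) ^ k)"
    using nrm by (simp add: power2_eq_square)
  ultimately show ?thesis
    by (simp add: partial_deriv_norm_power mult.commute sum_distrib_left[symmetric] flip: mult_2)
qed

text \<open>Euler's relation contracts one gradient to \<open>k * P\<close>, and \<open>P_dP\<close>
  evaluates the rest. So the radial direction is an eigenvector of the Gram matrix.\<close>

lemma hess_x: "(\<Sum>j\<in>UNIV. hess i j x * x $ j) = (real k)\<^sup>2 * (x \<bullet> x) ^ (k - 1) * x $ i"
proof -
  have "(\<Sum>j\<in>UNIV. hess i j x * x $ j) = (\<Sum>\<alpha>\<in>UNIV. dP i \<alpha> x * (\<Sum>j\<in>UNIV. x $ j * dP j \<alpha> x))"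
    unfolding hess_def sum_distrib_right sum_distrib_left by (subst sum.swap) (simp add: mult_ac)
  also have "\<dots> = real k * (\<Sum>\<alpha>\<in>UNIV. P \<alpha> x * dP i \<alpha> x)"
    by (simp add: euler sum_distrib_left mult_ac)
  finally show ?thesis by (simp add: P_dP power2_eq_square)
qed

lemma sum_x_partial_norm_power:
  fixes x :: "real^'a"
  shows "(\<Sum>i\<in>UNIV. partial_deriv i (\<lambda>x. (x \<bullet> x) ^ Suc m * x $ i) x) = (2 * real (Suc m) + real CARD('a)) * (x \<bullet> x) ^ Suc m"
proof -
  have d: "(\<lambda>x::real^'a. (x \<bullet> x) ^ Suc m) differentiable (at x)"
    using radial_has_derivative[of "\<lambda>z. z ^ Suc m" "real (Suc m) * (x \<bullet> x) ^ m" x] differentiable_def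
    by (force intro!: derivative_eq_intros)
  have "(\<Sum>i\<in>UNIV. partial_deriv i (\<lambda>x. (x \<bullet> x) ^ Suc m * x $ i) x) =
      (\<Sum>i\<in>UNIV. (x \<bullet> x) ^ Suc m + 2 * (real (Suc m) * (x \<bullet> x) ^ m) * (x $ i * x $ i))"
    using d by (simp add: partial_deriv_mult coord_differentiable partial_deriv_coord partial_deriv_norm_power mult.assoc del: power_Suc)
  also have "\<dots> = real CARD('a) * (x \<bullet> x) ^ Suc m + 2 * (real (Suc m) * (x \<bullet> x) ^ m) * (x \<bullet> x)"
    by (simp add: sum.distrib sum_distrib_left[symmetric] inner_vec_def)
  finally show ?thesis by (simp add: algebra_simps)
qed

text \<open>The divergence of \<open>P_dP\<close>: since the components are harmonic, only the
  squared gradients survive.\<close>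

lemma trace_hess: "(\<Sum>i\<in>UNIV. hess i i x) = real k * (2 * real k + real CARD('a) - 2) * (x \<bullet> x) ^ (k - 1)"
proof -
  define m where "m = k - 2"
  have m: "k - 1 = Suc m" using k4 by (simp add: m_def)
  have "(\<lambda>x. \<Sum>\<alpha>\<in>UNIV. P \<alpha> x * dP i \<alpha> x) = (\<lambda>x. real k * ((x \<bullet> x) ^ Suc m * x $ i))" for i
    by (simp only: P_dP m mult.assoc)
  then have "(\<Sum>i\<in>UNIV. partial_deriv i (\<lambda>x. \<Sum>\<alpha>\<in>UNIV. P \<alpha> x * dP i \<alpha> x) x) =
    (\<Sum>i\<in>UNIV. partial_deriv i (\<lambda>x. real k * ((x \<bullet> x) ^ Suc m * x $ i)) x)" by simp
  also have "\<dots> = (\<Sum>i\<in>UNIV. real k * partial_deriv i (\<lambda>x. (x \<bullet> x) ^ Suc m * x $ i) x)"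
  proof (intro sum.cong refl)
    fix i
    have "(\<lambda>x::real^'a. (x \<bullet> x) ^ Suc m * x $ i) differentiable (at x)"
    proof (rule differentiable_mult[OF _ coord_differentiable])
      show "(\<lambda>x::real^'a. (x \<bullet> x) ^ Suc m) differentiable (at x)"
        using radial_has_derivative[of "\<lambda>z. z ^ Suc m" "real (Suc m) * (x \<bullet> x) ^ m" x] differentiable_def
        by (force intro!: derivative_eq_intros)
    qed
    then show "partial_deriv i (\<lambda>x. real k * ((x \<bullet> x) ^ Suc m * x $ i)) x = real k * partial_deriv i (\<lambda>x. (x \<bullet> x) ^ Suc m * x $ i) x"
      by (subst partial_deriv_mult) (simp_all add: partial_deriv_const del: power_Suc)
  qed
  also have "\<dots> = real k * (2 * real k + real CARD('a) - 2) * (x \<bullet> x) ^ (k - 1)"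
    unfolding sum_distrib_left[symmetric] sum_x_partial_norm_power unfolding m[symmetric] using k4 by (simp add: of_nat_diff algebra_simps)
  also have "(\<Sum>i\<in>UNIV. partial_deriv i (\<lambda>x. \<Sum>\<alpha>\<in>UNIV. P \<alpha> x * dP i \<alpha> x) x) =
    (\<Sum>i\<in>UNIV. \<Sum>\<alpha>\<in>UNIV. P \<alpha> x * partial_deriv i (dP i \<alpha>) x + dP i \<alpha> x * dP i \<alpha> x)"
    by (subst partial_deriv_sum) (simp_all add: partial_deriv_mult differentiable_mult)
  also have "\<dots> = (\<Sum>\<alpha>\<in>UNIV. P \<alpha> x * (\<Sum>i\<in>UNIV. partial_deriv i (dP i \<alpha>) x)) + (\<Sum>i\<in>UNIV. hess i i x)"
    unfolding sum.distrib hess_def sum_distrib_left by (subst sum.swap) simp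
  finally show ?thesis by (simp add: harm)
qed

text \<open>Harmonicity removes one term of the product rule, and symmetry of second derivatives
  turns the other into half the gradient of the trace.\<close>

lemma div_hess:
  "(\<Sum>i\<in>UNIV. partial_deriv i (hess i j) x) =
    real k * (2 * real k + real CARD('a) - 2) * (real k - 1) * (x \<bullet> x) ^ (k - 2) * x $ j"
proof -
  have "(\<Sum>i\<in>UNIV. partial_deriv i (hess i j) x) =
     (\<Sum>i\<in>UNIV. \<Sum>\<alpha>\<in>UNIV. dP i \<alpha> x * partial_deriv i (dP j \<alpha>) x + partial_deriv i (dP i \<alpha>) x * dP j \<alpha> x)"
    unfolding hess_def[abs_def]
    by (subst partial_deriv_sum) (simp_all add: partial_deriv_mult differentiable_mult)
  also have "\<dots> = (\<Sum>i\<in>UNIV. \<Sum>\<alpha>\<in>UNIV. dP i \<alpha> x * partial_deriv j (dP i \<alpha>) x) +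
     (\<Sum>\<alpha>\<in>UNIV. (\<Sum>i\<in>UNIV. partial_deriv i (dP i \<alpha>) x) * dP j \<alpha> x)"
    unfolding sum.distrib sum_distrib_right
    by (subst (2) sum.swap) (simp add: polynomial_partial_deriv_commute[OF poly, of _ j])
  finally have 1: "(\<Sum>i\<in>UNIV. partial_deriv i (hess i j) x) = (\<Sum>i\<in>UNIV. \<Sum>\<alpha>\<in>UNIV. dP i \<alpha> x * partial_deriv j (dP i \<alpha>) x)"
    by (simp add: harm)
  have "partial_deriv j (\<lambda>x. \<Sum>i\<in>UNIV. hess i i x) x = (\<Sum>i\<in>UNIV. \<Sum>\<alpha>\<in>UNIV. dP i \<alpha> x * partial_deriv j (dP i \<alpha>) x + partial_deriv j (dP i \<alpha>) x * dP i \<alpha> x)"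
    unfolding hess_def
    by (subst partial_deriv_sum) (simp_all add: partial_deriv_sum partial_deriv_mult differentiable_mult differentiable_sum)
  also have "\<dots> = 2 * (\<Sum>i\<in>UNIV. \<Sum>\<alpha>\<in>UNIV. dP i \<alpha> x * partial_deriv j (dP i \<alpha>) x)"
    by (simp add: sum_distrib_left mult.commute flip: mult_2)
  also have "(\<lambda>x. \<Sum>i\<in>UNIV. hess i i x) = (\<lambda>x. (real k * (2 * real k + real CARD('a) - 2)) * (x \<bullet> x) ^ (k - 1))"
    by (simp add: trace_hess)
  also have "partial_deriv j (\<lambda>x. (real k * (2 * real k + real CARD('a) - 2)) * (x \<bullet> x) ^ (k - 1)) x =
     2 * ((real k * (2 * real k + real CARD('a) - 2)) * (real (k - 1) * (x \<bullet> x) ^ (k - 1 - 1))) * x $ j"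
    by (rule partial_deriv_radial[where u = "\<lambda>z. (real k * (2 * real k + real CARD('a) - 2)) * z ^ (k - 1)"])
       (auto intro!: derivative_eq_intros)
  finally have "(\<Sum>i\<in>UNIV. \<Sum>\<alpha>\<in>UNIV. dP i \<alpha> x * partial_deriv j (dP i \<alpha>) x) =
     (real k * (2 * real k + real CARD('a) - 2)) * (real (k - 1) * (x \<bullet> x) ^ (k - 1 - 1)) * x $ j" by simp
  moreover have "k - 1 - 1 = k - 2" by simp
  moreover have "real (k - 1) = real k - 1" using k4 by simp
  ultimately show ?thesis using 1 by (simp add: mult.assoc)
qed

end

section \<open>Singular values and adapted frames\<close>

lemma has_derivative_vec_lambda:
  fixes g :: "'b::finite \<Rightarrow> 'c::real_normed_vector \<Rightarrow> real"
  assumes "\<And>\<alpha>. (g \<alpha> has_derivative g' \<alpha>) (at x)"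
  shows "((\<lambda>y. \<chi> \<alpha>. g \<alpha> y) has_derivative (\<lambda>h. \<chi> \<alpha>. g' \<alpha> h)) (at x)"
proof -
  have eq: "(\<chi> \<alpha>. c \<alpha>) = (\<Sum>\<alpha>\<in>UNIV. c \<alpha> *\<^sub>R axis \<alpha> (1::real))" for c :: "'b \<Rightarrow> real"
    using basis_expansion[of "\<chi> \<alpha>. c \<alpha>"] by (simp add: scalar_mult_eq_scaleR)
  show ?thesis unfolding eq
    by (intro has_derivative_sum has_derivative_scaleR_left assms)
qed

text \<open>If \<open>A\<close> were nonzero at some vector of \<open>T\<close> orthogonal to
  \<open>E\<close>, a unit vector maximising \<open>norm (A w)\<close> among these vectors would be
  a singular vector with positive singular value. It would then lie in \<open>E\<close> and be
  orthogonal to \<open>E\<close>.\<close>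

lemma singular_complement_zero:
  fixes A :: "real^'a::finite \<Rightarrow> real^'b::finite"
  assumes lin: "linear A" and T: "subspace T"
    and E: "E = {v \<in> T. \<forall>w\<in>T. A v \<bullet> A w = \<sigma>\<^sup>2 * (v \<bullet> w)}"
    and only: "\<And>\<tau>. \<tau> > 0 \<Longrightarrow> {v \<in> T. \<forall>w\<in>T. A v \<bullet> A w = \<tau>\<^sup>2 * (v \<bullet> w)} \<noteq> {0} \<Longrightarrow> \<tau> = \<sigma>"
    and v: "v \<in> T" "\<And>e. e \<in> E \<Longrightarrow> v \<bullet> e = 0"
  shows "A v = 0"
proof (rule ccontr)
  assume Av: "A v \<noteq> 0"
  have Eb: "E \<subseteq> T" by (auto simp: E)
  have Es: "subspace E" unfolding E using T
    by (auto simp: subspace_def linear_add[OF lin] linear_cmul[OF lin] linear_0[OF lin] inner_add_left algebra_simps)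
  define T' where "T' = {w \<in> T. \<forall>e\<in>E. w \<bullet> e = 0}"
  have T's: "subspace T'" unfolding T'_def using T
    by (auto simp: subspace_def inner_add_left)
  define S where "S = T' \<inter> sphere 0 1"
  have Sc: "compact S" unfolding S_def by (intro closed_Int_compact closed_subspace T's) simp
  have Sn: "S \<noteq> {}"
  proof -
    have "v \<noteq> 0" using Av linear_0[OF lin] by auto
    moreover have "v \<in> T'" using v by (simp add: T'_def)
    ultimately have "(1 / norm v) *\<^sub>R v \<in> S" using T's by (simp add: S_def subspace_scale)
    then show ?thesis by blast
  qed
  have "continuous_on S (\<lambda>w. (norm (A w))\<^sup>2)"
  proof -
    have "bounded_linear A" using lin by (simp only: linear_conv_bounded_linear)
    then have "continuous_on S A" by (rule linear_continuous_on)
    then show ?thesis by (intro continuous_intros)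
  qed
  from continuous_attains_sup[OF Sc Sn this]
  obtain v0 where v0: "v0 \<in> S" "\<And>w. w \<in> S \<Longrightarrow> (norm (A w))\<^sup>2 \<le> (norm (A v0))\<^sup>2" by blast
  define M where "M = (norm (A v0))\<^sup>2"
  have v0T: "v0 \<in> T'" "norm v0 = 1" using v0 by (auto simp: S_def)
  have bd: "(norm (A w))\<^sup>2 \<le> M * (norm w)\<^sup>2" if "w \<in> T'" for w
  proof (cases "w = 0")
    case True then show ?thesis using linear_0[OF lin] by simp
  next
    case False
    then have "(1 / norm w) *\<^sub>R w \<in> S" using T's that by (simp add: S_def subspace_scale)
    from v0(2)[OF this] show ?thesis using False
      by (simp add: linear_cmul[OF lin] M_def power_divide pos_divide_le_eq)
  qed
  have M: "M > 0"
  proof -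
    have "v \<in> T'" using v by (simp add: T'_def)
    moreover have "0 < (norm (A v))\<^sup>2" using Av by simp
    ultimately have "0 < M * (norm v)\<^sup>2" using bd[of v] by linarith
    moreover have "M \<ge> 0" by (simp add: M_def)
    ultimately show ?thesis by (cases "M = 0") auto
  qed
  have bil: "A v0 \<bullet> A w = M * (v0 \<bullet> w)" if w: "w \<in> T'" for w
  proof -
    define B where "B = A v0 \<bullet> A w - M * (v0 \<bullet> w)"
    define q where "q = (norm (A w))\<^sup>2 - M * (norm w)\<^sup>2"
    \<comment> \<open>Maximality of \<open>v0\<close> under the variation
      \<open>v0 + t *\<^sub>R w\<close>; the first order coefficient \<open>B\<close> has to
      vanish.\<close>
    have ineq: "2 * t * B + t\<^sup>2 * q \<le> 0" for t
    proof -
      have "v0 + t *\<^sub>R w \<in> T'" using T's v0T w by (simp add: subspace_add subspace_scale)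
      from bd[OF this] have "A (v0 + t *\<^sub>R w) \<bullet> A (v0 + t *\<^sub>R w) \<le> M * ((v0 + t *\<^sub>R w) \<bullet> (v0 + t *\<^sub>R w))"
        by (simp add: power2_norm_eq_inner)
      then have "A v0 \<bullet> A v0 + 2 * t * (A v0 \<bullet> A w) + t\<^sup>2 * (A w \<bullet> A w) \<le>
          M * (v0 \<bullet> v0 + 2 * t * (v0 \<bullet> w) + t\<^sup>2 * (w \<bullet> w))"
        by (simp add: linear_add[OF lin] linear_cmul[OF lin] inner_add_left inner_add_right inner_commute power2_eq_square algebra_simps)
      moreover have "A v0 \<bullet> A v0 = M" "v0 \<bullet> v0 = 1"
        using v0T by (simp_all add: M_def power2_norm_eq_inner norm_eq_1)
      ultimately show ?thesis by (simp add: B_def q_def power2_norm_eq_inner algebra_simps)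
    qed
    have "B = 0"
    proof (rule ccontr)
      assume "B \<noteq> 0"
      \<comment> \<open>A step small enough for the linear term to outweigh the quadratic
        one.\<close>
      define t where "t = B / (\<bar>q\<bar> + 1)"
      have pos: "\<bar>q\<bar> + 1 > 0" by simp
      have "t\<^sup>2 * q \<ge> - (t\<^sup>2 * (\<bar>q\<bar> + 1))"
      proof -
        have "- (\<bar>q\<bar> + 1) \<le> q" by simp
        from mult_left_mono[OF this, of "t\<^sup>2"] show ?thesis by (simp only: mult_minus_right) simp
      qed
      moreover have "t\<^sup>2 * (\<bar>q\<bar> + 1) = t * B" using pos by (simp add: t_def power2_eq_square)
      ultimately have "t * B \<le> 0" using ineq[of t] by simp
      moreover have "0 < B * B" using \<open>B \<noteq> 0\<close> not_real_square_gt_zero by blast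
      then have "t * B > 0" using pos by (simp add: t_def)
      ultimately show False by simp
    qed
    then show ?thesis by (simp add: B_def)
  qed
  have "A v0 \<bullet> A w = (sqrt M)\<^sup>2 * (v0 \<bullet> w)" if w: "w \<in> T" for w
  proof -
    obtain e r where er: "e \<in> span E" "\<And>x. x \<in> span E \<Longrightarrow> orthogonal r x" "w = e + r"
      using orthogonal_subspace_decomp_exists[of E w] by blast
    have eE: "e \<in> E" using er(1) Es by (simp add: span_eq_iff[THEN iffD2])
    have "r = w - e" using er by simp
    then have "r \<in> T" using w eE Eb T by (auto intro: subspace_diff)
    then have "r \<in> T'" using er(2) span_base by (auto simp: T'_def orthogonal_def)
    have "A v0 \<bullet> A e = M * (v0 \<bullet> e)"
    proof -
      have "v0 \<in> T" "v0 \<bullet> e = 0" using v0T eE by (auto simp: T'_def)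
      moreover have "A e \<bullet> A v0 = \<sigma>\<^sup>2 * (e \<bullet> v0)" using eE \<open>v0 \<in> T\<close> by (simp add: E)
      ultimately show ?thesis by (simp add: inner_commute)
    qed
    then show ?thesis using bil[OF \<open>r \<in> T'\<close>] M er(3)
      by (simp add: linear_add[OF lin] inner_add_right distrib_left)
  qed
  then have mem: "v0 \<in> {v \<in> T. \<forall>w\<in>T. A v \<bullet> A w = (sqrt M)\<^sup>2 * (v \<bullet> w)}" using v0T by (simp add: T'_def)
  moreover have "v0 \<noteq> 0" using v0T by auto
  ultimately have "{v \<in> T. \<forall>w\<in>T. A v \<bullet> A w = (sqrt M)\<^sup>2 * (v \<bullet> w)} \<noteq> {0}" by blast
  then have "sqrt M = \<sigma>" using only[of "sqrt M"] M by simp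
  then have "v0 \<in> E" using mem by (simp add: E)
  then have "v0 \<bullet> v0 = 0" using v0T by (simp add: T'_def)
  then show False using \<open>v0 \<noteq> 0\<close> by simp
qed

text \<open>Frames are indexed by the coordinate type itself, so that the frame matrix is square and
  determinant and trace can be transported by it.\<close>

definition orthonormal_frame :: "('a::finite \<Rightarrow> real^'a) \<Rightarrow> bool" where
  "orthonormal_frame \<beta> \<longleftrightarrow> (\<forall>i j. \<beta> i \<bullet> \<beta> j = (if i = j then 1 else 0))"

definition frame_matrix :: "('a::finite \<Rightarrow> real^'a) \<Rightarrow> real^'a^'a" where
  "frame_matrix \<beta> = (\<chi> l j. \<beta> l $ j)"

lemma frame_matrix_orthogonal:
  assumes "orthonormal_frame \<beta>"
  shows "frame_matrix \<beta> ** transpose (frame_matrix \<beta>) = mat 1" "transpose (frame_matrix \<beta>) ** frame_matrix \<beta> = mat 1"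
proof -
  show 1: "frame_matrix \<beta> ** transpose (frame_matrix \<beta>) = mat 1"
    using assms by (simp add: frame_matrix_def vec_eq_iff matrix_matrix_mult_def transpose_def mat_def orthonormal_frame_def inner_vec_def)
  then show "transpose (frame_matrix \<beta>) ** frame_matrix \<beta> = mat 1" by (simp add: matrix_left_right_inverse)
qed

lemma frame_complete:
  assumes f: "orthonormal_frame \<beta>" and "\<And>l. X \<bullet> \<beta> l = 0" shows "X = 0"
proof -
  have "frame_matrix \<beta> *v X = 0"
    using assms(2) by (simp add: frame_matrix_def vec_eq_iff matrix_vector_mult_def inner_vec_def mult.commute)
  then have "transpose (frame_matrix \<beta>) *v (frame_matrix \<beta> *v X) = 0" by simp
  then show ?thesis using frame_matrix_orthogonal(2)[OF f] by (simp only: matrix_vector_mul_assoc matrix_vector_mul_lid)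
qed

lemma frame_sandwich:
  "(frame_matrix \<beta> ** G ** transpose (frame_matrix \<beta>)) $ l $ m = \<beta> l \<bullet> (G *v \<beta> m)"
proof -
  have "(frame_matrix \<beta> ** G ** transpose (frame_matrix \<beta>)) $ l $ m =
    (frame_matrix \<beta> ** (G ** transpose (frame_matrix \<beta>))) $ l $ m" by (simp only: matrix_mul_assoc)
  then show ?thesis
    by (simp add: frame_matrix_def matrix_matrix_mult_def matrix_vector_mult_def inner_vec_def transpose_def)
qed

lemma frame_trace:
  assumes f: "orthonormal_frame \<beta>" shows "trace G = (\<Sum>l\<in>UNIV. \<beta> l \<bullet> (G *v \<beta> l))"
proof -
  define Q where "Q = frame_matrix \<beta>"
  have "trace (Q ** G ** transpose Q) = trace (transpose Q ** (Q ** G))" by (rule trace_mul_sym)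
  also have "\<dots> = trace G" using frame_matrix_orthogonal(2)[OF f] by (simp add: matrix_mul_assoc Q_def)
  finally have "trace G = trace (Q ** G ** transpose Q)" by simp
  also have "trace (Q ** G ** transpose Q) = (\<Sum>l\<in>UNIV. \<beta> l \<bullet> (G *v \<beta> l))"
    unfolding trace_def Q_def frame_sandwich by (rule refl)
  finally show ?thesis .
qed

lemma frame_det:
  assumes f: "orthonormal_frame \<beta>" and ev: "\<And>l. G *v \<beta> l = \<mu> l *\<^sub>R \<beta> l" shows "det G = (\<Prod>l\<in>UNIV. \<mu> l)"
proof -
  define Q where "Q = frame_matrix \<beta>"
  have QQ: "det Q * det (transpose Q) = 1" using frame_matrix_orthogonal(1)[OF f] by (simp only: det_mul[symmetric] Q_def det_I)
  have entry: "(Q ** G ** transpose Q) $ l $ m = (if l = m then \<mu> l else 0)" for l m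
    unfolding Q_def frame_sandwich ev using f by (simp add: orthonormal_frame_def)
  have "det (Q ** G ** transpose Q) = det G * (det Q * det (transpose Q))" by (simp only: det_mul mult_ac)
  then have "det G = det (Q ** G ** transpose Q)" using QQ by simp
  also have "\<dots> = (\<Prod>l\<in>UNIV. (Q ** G ** transpose Q) $ l $ l)"
    by (rule det_diagonal) (simp add: entry)
  also have "\<dots> = (\<Prod>l\<in>UNIV. \<mu> l)" by (simp add: entry)
  finally show ?thesis .
qed

text \<open>The frame joins \<open>u\<close>, an orthonormal basis of \<open>E\<close> and one of
  the complement of both. Together they are a basis of the whole space, so their number matches the
  index type.\<close>

lemma adapted_orthonormal_frame:
  fixes u :: "real^'a::finite"
  assumes u: "norm u = 1" and E: "subspace E" "\<And>e. e \<in> E \<Longrightarrow> e \<bullet> u = 0"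
  obtains \<beta> i0 I where "orthonormal_frame \<beta>" "\<beta> i0 = u" "i0 \<notin> I" "card I = dim E" "\<And>i. i \<in> I \<Longrightarrow> \<beta> i \<in> E"
    "\<And>i e. i \<notin> I \<Longrightarrow> e \<in> E \<Longrightarrow> \<beta> i \<bullet> e = 0"
proof -
  obtain B1 where B1: "B1 \<subseteq> E" "pairwise orthogonal B1" "\<And>x. x \<in> B1 \<Longrightarrow> norm x = 1" "independent B1" "card B1 = dim E" "span B1 = E"
    using orthonormal_basis_subspace[OF E(1)] by blast
  define T where "T = {v. v \<bullet> u = 0 \<and> (\<forall>e\<in>E. v \<bullet> e = 0)}"
  have T: "subspace T" by (auto simp: T_def subspace_def inner_add_left)
  obtain B2 where B2: "B2 \<subseteq> T" "pairwise orthogonal B2" "\<And>x. x \<in> B2 \<Longrightarrow> norm x = 1" "independent B2" "card B2 = dim T" "span B2 = T"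
    using orthonormal_basis_subspace[OF T] by blast
  define B where "B = insert u (B1 \<union> B2)"
  have fin: "finite B1" "finite B2" using B1 B2 by (auto intro: independent_imp_finite)
  have n1: "norm b = 1" if "b \<in> B" for b using that u B1(3) B2(3) by (auto simp: B_def)
  have orth: "pairwise orthogonal B"
    unfolding pairwise_def
  proof (intro ballI impI)
    fix b c assume bc: "b \<in> B" "c \<in> B" "b \<noteq> c"
    have uE: "orthogonal u e" "orthogonal e u" if "e \<in> E" for e using E(2)[OF that] by (auto simp: orthogonal_def inner_commute)
    have uT: "orthogonal u t" "orthogonal t u" if "t \<in> T" for t using that by (auto simp: T_def orthogonal_def inner_commute)
    have ET: "orthogonal e t" "orthogonal t e" if "e \<in> E" "t \<in> T" for e t using that by (auto simp: T_def orthogonal_def inner_commute)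
    show "orthogonal b c"
    proof (cases "b = u \<or> c = u")
      case True
      then show ?thesis using bc B1(1) B2(1) uE uT unfolding B_def by auto
    next
      case False
      then have "b \<in> B1 \<or> b \<in> B2" "c \<in> B1 \<or> c \<in> B2" using bc by (auto simp: B_def)
      then show ?thesis
        using ET B1(1) B2(1) pairwiseD[OF B1(2) _ _ bc(3)] pairwiseD[OF B2(2) _ _ bc(3)] by (meson subsetD)
    qed
  qed
  have "0 \<notin> B" using n1 by force
  then have ind: "independent B" using orth pairwise_orthogonal_independent by blast
  have "span B = UNIV"
  proof -
    have "v \<in> span B" for v
    proof -
      obtain e r where er: "e \<in> span E" "\<And>x. x \<in> span E \<Longrightarrow> orthogonal r x" "v = e + r"
        using orthogonal_subspace_decomp_exists[of E v] by blast
      have eE: "e \<in> span B" using er(1) E(1) B1(6) span_mono[of B1 B] by (auto simp: B_def span_eq_iff[THEN iffD2])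
      have "r - (r \<bullet> u) *\<^sub>R u \<in> T"
        unfolding T_def
      proof (intro CollectI conjI ballI)
        show "(r - (r \<bullet> u) *\<^sub>R u) \<bullet> u = 0" using u by (simp add: inner_diff_left norm_eq_1)
        fix e assume e: "e \<in> E"
        have "r \<bullet> e = 0" using er(2)[OF span_base[OF e]] by (simp add: orthogonal_def)
        moreover have "u \<bullet> e = 0" using E(2)[OF e] by (simp add: inner_commute)
        ultimately show "(r - (r \<bullet> u) *\<^sub>R u) \<bullet> e = 0" by (simp add: inner_diff_left)
      qed
      then have "r - (r \<bullet> u) *\<^sub>R u \<in> span B" using B2(6) span_mono[of B2 B] by (auto simp: B_def)
      moreover have "(r \<bullet> u) *\<^sub>R u \<in> span B" by (intro span_scale span_base) (simp add: B_def)
      ultimately have "(r - (r \<bullet> u) *\<^sub>R u) + (r \<bullet> u) *\<^sub>R u \<in> span B" by (rule span_add)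
      then have "r \<in> span B" by simp
      with eE show ?thesis unfolding er(3) by (rule span_add)
    qed
    then show ?thesis by blast
  qed
  then have "card B = CARD('a)" using dim_span_eq_card_independent[OF ind] by simp
  then obtain \<beta> where \<beta>: "bij_betw \<beta> (UNIV :: 'a set) B"
  proof -
    have "finite B" using fin by (simp add: B_def)
    then show thesis using that finite_same_card_bij[of "UNIV :: 'a set" B] \<open>card B = CARD('a)\<close> by auto
  qed
  have inB: "\<beta> i \<in> B" for i using \<beta> by (auto simp: bij_betw_def)
  have inj: "\<beta> i = \<beta> j \<longleftrightarrow> i = j" for i j using \<beta> by (auto simp: bij_betw_def inj_def)
  define I where "I = \<beta> -` B1"
  have surj: "\<beta> ` UNIV = B" using \<beta> by (simp add: bij_betw_def)
  have "u \<in> B" by (simp add: B_def)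
  then obtain i0 where i0: "\<beta> i0 = u" unfolding surj[symmetric] by auto
  show thesis
  proof
    show "orthonormal_frame \<beta>" unfolding orthonormal_frame_def
    proof (intro allI)
      fix i j show "\<beta> i \<bullet> \<beta> j = (if i = j then 1 else 0)"
        using n1[OF inB[of i]] pairwiseD[OF orth inB[of i] inB[of j]] inj[of i j] by (auto simp: norm_eq_1 orthogonal_def)
    qed
    show "\<beta> i0 = u" by (rule i0)
    have "u \<notin> E" using E(2)[of u] u by (auto simp: norm_eq_1)
    then show "i0 \<notin> I" using i0 B1(1) by (auto simp: I_def)
    have "\<beta> ` I = B1 \<inter> range \<beta>" unfolding I_def by auto
    then have "\<beta> ` I = B1" unfolding surj by (auto simp: B_def)
    moreover have "inj_on \<beta> I" by (simp add: inj_on_def inj)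
    ultimately show "card I = dim E" using B1(5) card_image[of \<beta> I] by simp
    show "\<beta> i \<in> E" if "i \<in> I" for i using that B1(1) by (auto simp: I_def)
    show "\<beta> i \<bullet> e = 0" if "i \<notin> I" "e \<in> E" for i e
      using inB[of i] that E(2)[OF that(2)] B2(1) by (auto simp: I_def B_def T_def inner_commute)
  qed
qed

text \<open>This records the spectrum of the Gram matrix at \<open>u\<close>: the eigenvalue
  \<open>L\<close> on the \<open>p\<close> vectors indexed by \<open>I\<close>, and outside
  \<open>I\<close> and \<open>i0\<close> vectors that the differential itself kills. The radial
  eigenvalue \<open>k\<^sup>2\<close> is supplied by \<open>hess_x\<close>.\<close>

definition adapted_frame where
  "adapted_frame P L p u \<beta> i0 I \<longleftrightarrow> orthonormal_frame \<beta> \<and> \<beta> i0 = u \<and> i0 \<notin> I \<and> card I = p \<and>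
     (\<forall>l\<in>I. \<forall>i. (\<Sum>j\<in>UNIV. harmonic_sphere_map.hess P i j u * \<beta> l $ j) = L * \<beta> l $ i) \<and>
     (\<forall>l. l \<notin> I \<longrightarrow> l \<noteq> i0 \<longrightarrow> (\<forall>\<alpha>. (\<Sum>j\<in>UNIV. \<beta> l $ j * partial_deriv j (P \<alpha>) u) = 0))"
  for L :: real and p :: nat and u :: "real^'a::finite" and P :: "'b::finite \<Rightarrow> real^'a \<Rightarrow> real"

context harmonic_sphere_map begin

definition dmap :: "real^'a \<Rightarrow> real^'a \<Rightarrow> real^'b" where
  "dmap u v = (\<chi> \<alpha>. \<Sum>j\<in>UNIV. v $ j * dP j \<alpha> u)"

text \<open>The extension of degree zero is \<open>P y\<close> divided by \<open>norm y ^ k\<close>.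
  The radial factor has zero derivative in directions orthogonal to \<open>u\<close>, so the plain
  differential of \<open>P\<close> remains.\<close>

lemma sphere_differential_eq:
  assumes f: "\<And>x \<alpha>. norm x = 1 \<Longrightarrow> f x $ \<alpha> = P \<alpha> x" and u: "norm u = 1" and v: "v \<bullet> u = 0"
  shows "sphere_differential f u v = dmap u v"
proof -
  define g where "g z = inverse (sqrt z) ^ k" for z :: real
  obtain g1 where g1: "(g has_real_derivative g1) (at (u \<bullet> u))"
  proof -
    have "u \<bullet> u = 1" using u by (simp add: norm_eq_1)
    then show thesis using that unfolding g_def[abs_def] by (force intro!: derivative_eq_intros)
  qed
  have "((\<lambda>y. g (y \<bullet> y) * P \<alpha> y) has_derivative
     (\<lambda>h. g (u \<bullet> u) * (\<Sum>j\<in>UNIV. h $ j * dP j \<alpha> u) + g1 * (2 * (u \<bullet> h)) * P \<alpha> u)) (at u)" for \<alpha>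
    by (intro has_derivative_mult radial_has_derivative[OF g1] has_derivative_partial_sum diffs)
  then have "((\<lambda>y. \<chi> \<alpha>. g (y \<bullet> y) * P \<alpha> y) has_derivative
     (\<lambda>h. \<chi> \<alpha>. g (u \<bullet> u) * (\<Sum>j\<in>UNIV. h $ j * dP j \<alpha> u) + g1 * (2 * (u \<bullet> h)) * P \<alpha> u)) (at u)"
    by (rule has_derivative_vec_lambda)
  then have "((\<lambda>y. f (sgn y)) has_derivative
     (\<lambda>h. \<chi> \<alpha>. g (u \<bullet> u) * (\<Sum>j\<in>UNIV. h $ j * dP j \<alpha> u) + g1 * (2 * (u \<bullet> h)) * P \<alpha> u)) (at u)"
  proof (rule has_derivative_transform_within_open[where s = "- {0}"])
    fix y :: "real^'a" assume "y \<in> - {0}"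
    then have y: "y \<noteq> 0" by simp
    show "(\<chi> \<alpha>. g (y \<bullet> y) * P \<alpha> y) = f (sgn y)"
    proof (simp add: vec_eq_iff, intro allI)
      fix \<alpha>
      have "f (sgn y) $ \<alpha> = P \<alpha> (sgn y)" using y by (intro f) (simp add: norm_sgn)
      also have "\<dots> = inverse (norm y) ^ k * P \<alpha> y" unfolding sgn_div_norm by (rule hom)
      finally show "g (y \<bullet> y) * P \<alpha> y = f (sgn y) $ \<alpha>" by (simp add: g_def norm_eq_sqrt_inner)
    qed
  qed (use u in auto)
  then have "sphere_differential f u v = (\<chi> \<alpha>. g (u \<bullet> u) * (\<Sum>j\<in>UNIV. v $ j * dP j \<alpha> u) + g1 * (2 * (u \<bullet> v)) * P \<alpha> u)"
    unfolding sphere_differential_def by (simp add: frechet_derivative_at[symmetric])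
  moreover have "u \<bullet> u = 1" "u \<bullet> v = 0" using u v by (simp_all add: norm_eq_1 inner_commute)
  ultimately show ?thesis by (simp add: dmap_def g_def)
qed

lemma linear_dmap: "linear (dmap u)"
  by (rule linearI) (simp_all add: dmap_def vec_eq_iff sum.distrib distrib_right sum_distrib_left mult.assoc)

lemma dmap_inner_hess: "dmap u v \<bullet> dmap u w = (\<Sum>i\<in>UNIV. (\<Sum>j\<in>UNIV. hess i j u * v $ j) * w $ i)"
proof -
  have "dmap u v \<bullet> dmap u w = (\<Sum>\<alpha>\<in>UNIV. \<Sum>i\<in>UNIV. \<Sum>j\<in>UNIV. (v $ j * dP j \<alpha> u) * (w $ i * dP i \<alpha> u))"
    by (simp add: inner_vec_def dmap_def sum_product) (subst sum.swap, simp)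
  also have "\<dots> = (\<Sum>i\<in>UNIV. \<Sum>j\<in>UNIV. \<Sum>\<alpha>\<in>UNIV. (v $ j * dP j \<alpha> u) * (w $ i * dP i \<alpha> u))"
    by (subst sum.swap) (rule sum.cong, simp, rule sum.swap)
  finally show ?thesis by (simp add: hess_def sum_distrib_left sum_distrib_right mult_ac)
qed

text \<open>The singular value equation is tested on tangent vectors only. Because \<open>u\<close>
  is an eigenvector of the Gram matrix by \<open>hess_x\<close>, the test against \<open>u\<close>
  holds too, which gives an eigenvalue equation in the full space.\<close>

lemma adapted_frame_exists:
  assumes f: "\<And>x \<alpha>. norm x = 1 \<Longrightarrow> f x $ \<alpha> = P \<alpha> x" and u: "norm u = 1"
    and sv: "singular_values f u - {0} = {\<sigma>}"
  shows "\<exists>\<beta> i0 I. adapted_frame P (\<sigma>\<^sup>2) (dim (singular_space f u \<sigma>)) u \<beta> i0 I"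
proof -
  define T where "T = sphere_tangent u"
  define E where "E = singular_space f u \<sigma>"
  have Tm: "v \<in> T \<longleftrightarrow> v \<bullet> u = 0" for v by (simp add: T_def sphere_tangent_def)
  have T: "subspace T" by (auto simp: Tm subspace_def inner_add_left)
  have sd: "sphere_differential f u v = dmap u v" if "v \<in> T" for v
    using sphere_differential_eq[OF f u] that Tm by blast
  have ss: "singular_space f u \<tau> = {v \<in> T. \<forall>w\<in>T. dmap u v \<bullet> dmap u w = \<tau>\<^sup>2 * (v \<bullet> w)}" for \<tau>
    unfolding singular_space_def T_def[symmetric] by (auto simp: sd)
  have E: "E = {v \<in> T. \<forall>w\<in>T. dmap u v \<bullet> dmap u w = \<sigma>\<^sup>2 * (v \<bullet> w)}" by (simp add: E_def ss)
  have Es: "subspace E" unfolding E using T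
    by (auto simp: subspace_def linear_add[OF linear_dmap] linear_cmul[OF linear_dmap] linear_0[OF linear_dmap] inner_add_left algebra_simps)
  have only: "\<tau> = \<sigma>" if "\<tau> > 0" "{v \<in> T. \<forall>w\<in>T. dmap u v \<bullet> dmap u w = \<tau>\<^sup>2 * (v \<bullet> w)} \<noteq> {0}" for \<tau>
  proof -
    have "\<tau> \<in> singular_values f u - {0}" using that by (simp add: singular_values_def ss)
    then show ?thesis using sv by simp
  qed
  have eu: "e \<bullet> u = 0" if "e \<in> E" for e using that by (simp add: E Tm)
  obtain \<beta> i0 I where \<beta>: "orthonormal_frame \<beta>" "\<beta> i0 = u" "i0 \<notin> I" "card I = dim E" "\<And>i. i \<in> I \<Longrightarrow> \<beta> i \<in> E"
    "\<And>i e. i \<notin> I \<Longrightarrow> e \<in> E \<Longrightarrow> \<beta> i \<bullet> e = 0"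
  proof (rule adapted_orthonormal_frame[OF u Es eu])
    fix \<beta> i0 I
    assume "orthonormal_frame \<beta>" "\<beta> i0 = u" "i0 \<notin> I" "card I = dim E" "\<And>i. i \<in> I \<Longrightarrow> \<beta> i \<in> E"
      "\<And>i e. i \<notin> I \<Longrightarrow> e \<in> E \<Longrightarrow> \<beta> i \<bullet> e = 0"
    then show thesis by (rule that)
  qed
  have "(\<Sum>j\<in>UNIV. hess i j u * \<beta> l $ j) = \<sigma>\<^sup>2 * \<beta> l $ i" if l: "l \<in> I" for l i
  proof -
    define X where "X = (\<chi> i. (\<Sum>j\<in>UNIV. hess i j u * \<beta> l $ j) - \<sigma>\<^sup>2 * \<beta> l $ i)"
    have Xw: "X \<bullet> w = dmap u (\<beta> l) \<bullet> dmap u w - \<sigma>\<^sup>2 * (\<beta> l \<bullet> w)" for w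
    proof -
      have "X \<bullet> w = (\<Sum>i\<in>UNIV. (\<Sum>j\<in>UNIV. hess i j u * \<beta> l $ j) * w $ i) - \<sigma>\<^sup>2 * (\<beta> l \<bullet> w)"
        by (simp add: X_def inner_vec_def left_diff_distrib sum_subtractf sum_distrib_left mult.assoc)
      then show ?thesis by (simp only: dmap_inner_hess)
    qed
    have lE: "\<beta> l \<in> E" using \<beta>(5) l .
    have "X \<bullet> \<beta> m = 0" for m
    proof (cases "m = i0")
      case True
      have "dmap u (\<beta> l) \<bullet> dmap u u = (\<Sum>i\<in>UNIV. (\<Sum>j\<in>UNIV. hess i j u * u $ j) * \<beta> l $ i)"
        by (subst inner_commute) (rule dmap_inner_hess)
      also have "\<dots> = (real k)\<^sup>2 * (u \<bullet> u) ^ (k - 1) * (u \<bullet> \<beta> l)"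
        unfolding hess_x by (simp add: inner_vec_def sum_distrib_left mult.assoc)
      also have "u \<bullet> \<beta> l = 0" using lE Tm by (simp add: E inner_commute)
      finally show ?thesis using True \<beta>(2) lE Tm by (simp add: Xw E)
    next
      case False
      then have "\<beta> m \<bullet> u = 0" using \<beta>(1) unfolding orthonormal_frame_def \<beta>(2)[symmetric] by simp
      then have "\<beta> m \<in> T" by (simp add: Tm)
      then show ?thesis using lE by (simp add: Xw E)
    qed
    then have "X = 0" using frame_complete[OF \<beta>(1)] by blast
    then have "X $ i = 0" by simp
    then show ?thesis by (simp add: X_def)
  qed
  moreover have "(\<Sum>j\<in>UNIV. \<beta> l $ j * dP j \<alpha> u) = 0" if l: "l \<notin> I" "l \<noteq> i0" for l \<alpha>
  proof -
    have "\<beta> l \<bullet> u = 0" using \<beta>(1) l unfolding orthonormal_frame_def \<beta>(2)[symmetric] by simp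
    then have "\<beta> l \<in> T" by (simp add: Tm)
    then have "dmap u (\<beta> l) = 0"
      using singular_complement_zero[OF linear_dmap T E only] \<beta>(6)[OF l(1)] by blast
    then have "dmap u (\<beta> l) $ \<alpha> = 0" by simp
    then show ?thesis by (simp add: dmap_def)
  qed
  ultimately have "adapted_frame P (\<sigma>\<^sup>2) (dim E) u \<beta> i0 I"
    using \<beta> unfolding adapted_frame_def by blast
  then show ?thesis unfolding E_def by blast
qed

end

section \<open>The graph of a radial profile\<close>

text \<open>The derivative is two-sided even at \<open>z = 0\<close>, so that the chain rule for
  \<open>u (x \<bullet> x)\<close> is available at the origin.\<close>

definition C1_half :: "(real \<Rightarrow> real) \<Rightarrow> bool" where
  "C1_half u \<longleftrightarrow> (\<forall>z\<ge>0. (u has_real_derivative deriv u z) (at z)) \<and> continuous_on {0..} (deriv u)"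

lemma C1_halfI:
  assumes "\<And>z. z \<ge> 0 \<Longrightarrow> (u has_real_derivative u' z) (at z)" "continuous_on {0..} u'" shows "C1_half u"
proof -
  have "deriv u z = u' z" if "z \<ge> 0" for z using assms(1)[OF that] by (rule DERIV_imp_deriv)
  note eq = this
  have "continuous_on {0..} (deriv u)" by (rule continuous_on_eq_cong[OF _ assms(2)]) (simp add: eq)
  then show ?thesis unfolding C1_half_def using assms(1) eq by simp
qed

lemma C1_half_continuous: "C1_half u \<Longrightarrow> continuous_on {0..} u"
  unfolding C1_half_def by (auto intro!: continuous_at_imp_continuous_on dest: DERIV_isCont)

lemma C1_half_D: "C1_half u \<Longrightarrow> z \<ge> 0 \<Longrightarrow> (u has_real_derivative deriv u z) (at z)"
  by (simp add: C1_half_def)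

lemma C1_half_const: "C1_half (\<lambda>z. c)"
  by (rule C1_halfI[of _ "\<lambda>_. 0"]) (auto intro: continuous_intros)

lemma C1_half_ident: "C1_half (\<lambda>z. z)"
  by (rule C1_halfI[of _ "\<lambda>_. 1"]) (auto intro: continuous_intros)

lemma C1_half_deriv_continuous: "C1_half u \<Longrightarrow> continuous_on {0..} (deriv u)"
  by (simp add: C1_half_def)

lemma C1_half_add:
  assumes "C1_half u" "C1_half v" shows "C1_half (\<lambda>z. u z + v z)"
proof (rule C1_halfI)
  show "((\<lambda>z. u z + v z) has_real_derivative deriv u z + deriv v z) (at z)" if "z \<ge> 0" for z
    by (intro DERIV_add C1_half_D assms that)
  show "continuous_on {0..} (\<lambda>z. deriv u z + deriv v z)"
    by (rule continuous_on_add[OF assms[THEN C1_half_deriv_continuous]])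
qed

lemma C1_half_mult:
  assumes "C1_half u" "C1_half v" shows "C1_half (\<lambda>z. u z * v z)"
proof (rule C1_halfI)
  show "((\<lambda>z. u z * v z) has_real_derivative deriv u z * v z + deriv v z * u z) (at z)" if "z \<ge> 0" for z
    by (intro DERIV_mult C1_half_D assms that)
  show "continuous_on {0..} (\<lambda>z. deriv u z * v z + deriv v z * u z)"
    by (rule continuous_on_add[OF continuous_on_mult continuous_on_mult])
       (rule C1_half_deriv_continuous C1_half_continuous, rule assms)+
qed

lemma C1_half_power: "C1_half u \<Longrightarrow> C1_half (\<lambda>z. u z ^ m)"
  by (induction m) (auto intro: C1_half_const C1_half_mult)

lemma C1_half_minus: "C1_half u \<Longrightarrow> C1_half (\<lambda>z. - u z)"
  using C1_half_mult[OF C1_half_const[of "- 1"], of u] by simp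

lemma C1_half_diff: "C1_half u \<Longrightarrow> C1_half v \<Longrightarrow> C1_half (\<lambda>z. u z - v z)"
  using C1_half_add[OF _ C1_half_minus, of u v] by simp

lemma C1_half_divide:
  assumes "C1_half u" "C1_half v" "\<And>z. z \<ge> 0 \<Longrightarrow> v z \<noteq> 0" shows "C1_half (\<lambda>z. u z / v z)"
proof (rule C1_halfI)
  show "((\<lambda>z. u z / v z) has_real_derivative (deriv u z * v z - u z * deriv v z) / (v z * v z)) (at z)" if "z \<ge> 0" for z
    by (intro DERIV_divide C1_half_D assms that)
  note c = C1_half_continuous[OF assms(1)] C1_half_continuous[OF assms(2)]
    C1_half_deriv_continuous[OF assms(1)] C1_half_deriv_continuous[OF assms(2)]
  show "continuous_on {0..} (\<lambda>z. (deriv u z * v z - u z * deriv v z) / (v z * v z))"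
    by (intro continuous_on_divide continuous_on_diff continuous_on_mult c) (simp add: assms)
qed

lemma C1_half_sqrt:
  assumes "C1_half u" "\<And>z. z \<ge> 0 \<Longrightarrow> u z > 0" shows "C1_half (\<lambda>z. sqrt (u z))"
proof (rule C1_halfI)
  fix z :: real assume z: "z \<ge> 0"
  show "((\<lambda>z. sqrt (u z)) has_real_derivative inverse (sqrt (u z)) / 2 * deriv u z) (at z)"
    by (rule DERIV_chain2[OF DERIV_real_sqrt[OF assms(2)[OF z]] C1_half_D[OF assms(1) z]])
next
  have "continuous_on {0..} (\<lambda>z. inverse (sqrt (u z)))"
    using assms(2) by (intro continuous_on_inverse continuous_on_real_sqrt C1_half_continuous assms) force
  then show "continuous_on {0..} (\<lambda>z. inverse (sqrt (u z)) / 2 * deriv u z)"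
    by (intro continuous_on_mult continuous_on_divide continuous_on_const C1_half_deriv_continuous assms) simp_all
qed

lemmas C1_half_intros = C1_half_const C1_half_ident C1_half_add C1_half_mult C1_half_power C1_half_minus
  C1_half_diff C1_half_divide C1_half_sqrt

lemma C1_on_radial_half: "C1_half u \<Longrightarrow> C1_on S (\<lambda>x. u (x \<bullet> x))"
  by (rule C1_on_radial[of u "deriv u"]) (auto simp: C1_half_def)

lemma partial_deriv_radial_half:
  "C1_half u \<Longrightarrow> partial_deriv i (\<lambda>x. u (x \<bullet> x)) x = 2 * deriv u (x \<bullet> x) * x $ i"
  by (rule partial_deriv_radial) (simp add: C1_half_def)

lemma radial_differentiable:
  "C1_half u \<Longrightarrow> (\<lambda>x::real^'a::finite. u (x \<bullet> x)) differentiable (at x)"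
  using C1_on_radial_half[of u "UNIV :: (real^'a) set"] by (simp add: C1_on_def)

text \<open>By \<open>card\<close> an adapted frame consists of the radial vector, \<open>p\<close>
  singular vectors and a single kernel vector.\<close>

locale lawson_osserman = lo_ode p k L + harmonic_sphere_map P k
  for p k :: nat and L :: real and P :: "'b::finite \<Rightarrow> real^'a::finite \<Rightarrow> real" +
  assumes frame: "\<And>u. norm u = 1 \<Longrightarrow> \<exists>\<beta> i0 I. adapted_frame P L p u \<beta> i0 I"
    and card: "CARD('a) = p + 2"
begin

lemma adapted_frameD:
  assumes "adapted_frame P L p u \<beta> i0 I"
  shows "orthonormal_frame \<beta>" "\<beta> i0 = u" "i0 \<notin> I" "card I = p"
    "\<And>l i. l \<in> I \<Longrightarrow> (\<Sum>j\<in>UNIV. hess i j u * \<beta> l $ j) = L * \<beta> l $ i"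
    "\<And>l \<alpha>. l \<notin> I \<Longrightarrow> l \<noteq> i0 \<Longrightarrow> (\<Sum>j\<in>UNIV. \<beta> l $ j * dP j \<alpha> u) = 0"
  using assms by (simp_all add: adapted_frame_def)

text \<open>The gradient of \<open>P \<alpha>\<close> at \<open>u\<close> has radial component
  \<open>k * P \<alpha> u\<close> and no component along the kernel. The Gram matrix multiplies the
  singular part by \<open>L\<close> and the radial part by \<open>k\<^sup>2\<close>, whence the
  correction with the difference. The residual \<open>X\<close> is tested on the frame.\<close>

lemma hess_dP_unit:
  assumes u: "norm u = 1"
  shows "(\<Sum>j\<in>UNIV. hess i j u * dP j \<alpha> u) = L * dP i \<alpha> u + real k * ((real k)\<^sup>2 - L) * u $ i * P \<alpha> u"
proof -
  from frame[OF u] obtain \<beta> i0 I where af: "adapted_frame P L p u \<beta> i0 I" by blast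
  note fr = adapted_frameD(1,2)[OF af] and i0 = adapted_frameD(3)[OF af] and cI = adapted_frameD(4)[OF af]
    and I = adapted_frameD(5)[OF af] and J = adapted_frameD(6)[OF af]
  have uu: "u \<bullet> u = 1" using u by (simp add: norm_eq_1)
  define c where "c = real k * ((real k)\<^sup>2 - L)"
  define X where "X = (\<chi> i. (\<Sum>j\<in>UNIV. hess i j u * dP j \<alpha> u) - L * dP i \<alpha> u - c * u $ i * P \<alpha> u)"
  have Xv: "X \<bullet> v = (\<Sum>j\<in>UNIV. (\<Sum>i\<in>UNIV. hess j i u * v $ i) * dP j \<alpha> u) - L * (\<Sum>i\<in>UNIV. v $ i * dP i \<alpha> u)
      - c * P \<alpha> u * (u \<bullet> v)" for v
  proof -
    have 1: "(\<Sum>i\<in>UNIV. (\<Sum>j\<in>UNIV. hess i j u * dP j \<alpha> u) * v $ i) = (\<Sum>j\<in>UNIV. (\<Sum>i\<in>UNIV. hess j i u * v $ i) * dP j \<alpha> u)"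
      unfolding sum_distrib_right by (subst sum.swap) (simp add: hess_sym[of _ _ u] mult_ac)
    have "X \<bullet> v = (\<Sum>i\<in>UNIV. (\<Sum>j\<in>UNIV. hess i j u * dP j \<alpha> u) * v $ i - L * (v $ i * dP i \<alpha> u) - c * P \<alpha> u * (u $ i * v $ i))"
      by (simp add: X_def inner_vec_def algebra_simps)
    then show ?thesis by (simp only: sum_subtractf 1 sum_distrib_left[symmetric] inner_vec_def inner_real_def)
  qed
  have "X \<bullet> \<beta> l = 0" for l
  proof -
    consider "l = i0" | "l \<in> I" | "l \<noteq> i0" "l \<notin> I" by blast
    then show ?thesis
    proof cases
      case 1
      have "(\<Sum>j\<in>UNIV. (\<Sum>i\<in>UNIV. hess j i u * u $ i) * dP j \<alpha> u) = (real k)\<^sup>2 * (\<Sum>j\<in>UNIV. u $ j * dP j \<alpha> u)"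
        unfolding hess_x uu by (simp add: sum_distrib_left mult.assoc)
      then show ?thesis using 1 fr(2) unfolding Xv by (simp add: euler uu c_def algebra_simps power2_eq_square)
    next
      case 2
      then have "l \<noteq> i0" using i0 by blast
      then have "u \<bullet> \<beta> l = 0" using fr(1)[unfolded orthonormal_frame_def, rule_format, of i0 l] fr(2) by simp
      then show ?thesis unfolding Xv I[OF 2] by (simp add: sum_distrib_left mult.assoc)
    next
      case 3
      then have "u \<bullet> \<beta> l = 0" using fr(1)[unfolded orthonormal_frame_def, rule_format, of i0 l] fr(2) by simp
      moreover have "(\<Sum>i\<in>UNIV. hess j i u * \<beta> l $ i) = 0" for j
      proof -
        have "(\<Sum>i\<in>UNIV. hess j i u * \<beta> l $ i) = (\<Sum>\<alpha>\<in>UNIV. dP j \<alpha> u * (\<Sum>i\<in>UNIV. \<beta> l $ i * dP i \<alpha> u))"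
          unfolding hess_def sum_distrib_right sum_distrib_left by (subst sum.swap) (simp add: mult_ac)
        then show ?thesis using J[OF 3(2,1)] by simp
      qed
      ultimately show ?thesis unfolding Xv by (simp add: J[OF 3(2,1)])
    qed
  qed
  then have "X = 0" using frame_complete[OF fr(1)] by blast
  then have "X $ i = 0" by simp
  then show ?thesis by (simp add: X_def c_def)
qed

lemma hess_hom: "s > 0 \<Longrightarrow> hess i j (s *\<^sub>R x) = (s ^ (k - 1))\<^sup>2 * hess i j x"
  by (simp add: hess_def dP_hom sum_distrib_left power2_eq_square mult_ac)

lemma hess_dP:
  "(\<Sum>j\<in>UNIV. hess i j x * dP j \<alpha> x) =
     L * (x \<bullet> x) ^ (k - 1) * dP i \<alpha> x + real k * ((real k)\<^sup>2 - L) * (x \<bullet> x) ^ (k - 2) * x $ i * P \<alpha> x"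
proof (cases "x = 0")
  case True
  then show ?thesis by (simp add: zero_at_0)
next
  case False
  define r where "r = norm x"
  define u where "u = (1 / r) *\<^sub>R x"
  have r: "r > 0" using False by (simp add: r_def)
  have u: "norm u = 1" using r by (simp add: u_def r_def)
  have x: "x = r *\<^sub>R u" using r by (simp add: u_def)
  have z: "x \<bullet> x = r\<^sup>2" by (simp add: r_def power2_norm_eq_inner)
  define R where "R = r ^ (k - 1)"
  have e1: "(r\<^sup>2) ^ (k - 1) = R\<^sup>2" by (simp add: R_def power_mult[symmetric] mult.commute)
  have e2: "(r\<^sup>2) ^ (k - 2) * r * r ^ k = R\<^sup>2 * R"
  proof -
    \<comment> \<open>Both sides scale like a cubic expression in the gradients, which are
      homogeneous of degree \<open>k - 1\<close>.\<close>
    have "2 * (k - 2) + 1 + k = 3 * (k - 1)" using k4 by simp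
    moreover have "(r\<^sup>2) ^ (k - 2) * r * r ^ k = r ^ (2 * (k - 2) + 1 + k)" by (simp add: power_add power_mult)
    ultimately have "(r\<^sup>2) ^ (k - 2) * r * r ^ k = r ^ (3 * (k - 1))" by (simp only:)
    also have "\<dots> = R\<^sup>2 * R" by (simp add: R_def power_mult[symmetric] power_add[symmetric])
    finally show ?thesis .
  qed
  have "(\<Sum>j\<in>UNIV. hess i j x * dP j \<alpha> x) = R\<^sup>2 * R * (\<Sum>j\<in>UNIV. hess i j u * dP j \<alpha> u)"
    unfolding x using r by (simp add: hess_hom dP_hom R_def sum_distrib_left mult_ac)
  also have "\<dots> = L * R\<^sup>2 * (R * dP i \<alpha> u) + real k * ((real k)\<^sup>2 - L) * (R\<^sup>2 * R) * u $ i * P \<alpha> u"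
    unfolding hess_dP_unit[OF u] by (simp add: algebra_simps)
  also have "\<dots> = L * (r\<^sup>2) ^ (k - 1) * (R * dP i \<alpha> u) + real k * ((real k)\<^sup>2 - L) * (r\<^sup>2) ^ (k - 2) * (r * u $ i) * (r ^ k * P \<alpha> u)"
    unfolding e1 e2[symmetric] by (simp add: mult_ac)
  also have "R * dP i \<alpha> u = dP i \<alpha> x" unfolding x R_def using dP_hom[OF r] by simp
  also have "r ^ k * P \<alpha> u = P \<alpha> x" unfolding x by (simp add: hom)
  also have "r * u $ i = x $ i" unfolding x by simp
  finally show ?thesis by (simp add: z)
qed

text \<open>With this quadratic relation the span of the identity, the Gram matrix and
  \<open>x x^T\<close> is closed under multiplication, which is why the inverse of the induced
  metric can be sought in it.\<close>

lemma hess_hess: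
  "(\<Sum>j\<in>UNIV. hess i j x * hess j l x) =
     L * (x \<bullet> x) ^ (k - 1) * hess i l x + (real k)\<^sup>2 * ((real k)\<^sup>2 - L) * (x \<bullet> x) ^ (k - 2) * (x \<bullet> x) ^ (k - 1) * x $ i * x $ l"
proof -
  have "(\<Sum>j\<in>UNIV. hess i j x * hess j l x) = (\<Sum>\<alpha>\<in>UNIV. (\<Sum>j\<in>UNIV. hess i j x * dP j \<alpha> x) * dP l \<alpha> x)"
    unfolding hess_def[of _ l] sum_distrib_left sum_distrib_right by (subst sum.swap) (simp add: mult_ac)
  also have "\<dots> = (\<Sum>\<alpha>\<in>UNIV. L * (x \<bullet> x) ^ (k - 1) * (dP i \<alpha> x * dP l \<alpha> x) +
      real k * ((real k)\<^sup>2 - L) * (x \<bullet> x) ^ (k - 2) * x $ i * (P \<alpha> x * dP l \<alpha> x))"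
    unfolding hess_dP distrib_right by (simp only: mult.assoc)
  also have "\<dots> = L * (x \<bullet> x) ^ (k - 1) * hess i l x +
      real k * ((real k)\<^sup>2 - L) * (x \<bullet> x) ^ (k - 2) * x $ i * (\<Sum>\<alpha>\<in>UNIV. P \<alpha> x * dP l \<alpha> x)"
    unfolding sum.distrib sum_distrib_left[symmetric] hess_def[symmetric] ..
  finally show ?thesis unfolding P_dP by (simp add: power2_eq_square mult_ac)
qed

text \<open>An adapted frame at \<open>x / norm x\<close> diagonalises \<open>G\<close>; kernel
  vectors contribute the eigenvalue 1. At \<open>x = 0\<close> there is no such direction, and
  \<open>G\<close> is the identity.\<close>

lemma det_rank_structure:
  fixes G :: "real^'a^'a"
  assumes G: "G = (\<chi> i j. (if i = j then 1 else 0) + s * hess i j x + q * x $ i * x $ j)"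
  shows "det G = (1 + s * (real k)\<^sup>2 * (x \<bullet> x) ^ (k - 1) + q * (x \<bullet> x)) * (1 + s * L * (x \<bullet> x) ^ (k - 1)) ^ p"
proof (cases "x = 0")
  case True
  have "G = mat 1" unfolding G True by (simp add: vec_eq_iff mat_def hess_def zero_at_0)
  then show ?thesis using True k4 by (simp add: power_0_left)
next
  case False
  define r where "r = norm x"
  define u where "u = (1 / r) *\<^sub>R x"
  have r: "r > 0" using False by (simp add: r_def)
  have u1: "norm u = 1" using r by (simp add: u_def r_def)
  then have "u \<bullet> u = 1" by (simp add: norm_eq_1)
  note u = u1 this
  have x: "x = r *\<^sub>R u" using r by (simp add: u_def)
  have z: "x \<bullet> x = r\<^sup>2" by (simp add: r_def power2_norm_eq_inner)
  have e1: "(x \<bullet> x) ^ (k - 1) = (r ^ (k - 1))\<^sup>2" unfolding z by (simp add: power_mult[symmetric] mult.commute)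
  from frame[OF u(1)] obtain \<beta> i0 I where af: "adapted_frame P L p u \<beta> i0 I" by blast
  note fr = adapted_frameD(1,2)[OF af] and i0 = adapted_frameD(3)[OF af] and cI = adapted_frameD(4)[OF af]
    and I = adapted_frameD(5)[OF af] and J = adapted_frameD(6)[OF af]
  have Gv: "(G *v v) $ i = v $ i + s * (x \<bullet> x) ^ (k - 1) * (\<Sum>j\<in>UNIV. hess i j u * v $ j) + q * x $ i * (x \<bullet> v)" for v i
  proof -
    have "(G *v v) $ i = (\<Sum>j\<in>UNIV. (if i = j then v $ j else 0) + s * (hess i j x * v $ j) + q * x $ i * (x $ j * v $ j))"
    proof -
      have d: "((if i = j then 1 else 0) + s * hess i j x + q * x $ i * x $ j) * v $ j =
        (if i = j then v $ j else 0) + s * (hess i j x * v $ j) + q * x $ i * (x $ j * v $ j)" for j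
        by (simp add: distrib_right mult.assoc)
      show ?thesis unfolding G matrix_vector_mult_def by (simp add: d)
    qed
    also have "\<dots> = v $ i + s * (\<Sum>j\<in>UNIV. hess i j x * v $ j) + q * x $ i * (x \<bullet> v)"
      by (simp add: sum.distrib sum_distrib_left inner_vec_def)
    also have "(\<Sum>j\<in>UNIV. hess i j x * v $ j) = (x \<bullet> x) ^ (k - 1) * (\<Sum>j\<in>UNIV. hess i j u * v $ j)"
    proof -
      have "hess i j x = (x \<bullet> x) ^ (k - 1) * hess i j u" for j
        unfolding e1 using hess_hom[OF r, of i j u] x by simp
      then show ?thesis by (simp add: sum_distrib_left mult.assoc)
    qed
    finally show ?thesis by (simp add: mult.assoc)
  qed
  define \<mu> where "\<mu> l = (if l = i0 then 1 + s * (real k)\<^sup>2 * (x \<bullet> x) ^ (k - 1) + q * (x \<bullet> x)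
     else if l \<in> I then 1 + s * L * (x \<bullet> x) ^ (k - 1) else 1)" for l
  have ev: "G *v \<beta> l = \<mu> l *\<^sub>R \<beta> l" for l
  proof -
    consider "l = i0" | "l \<in> I" "l \<noteq> i0" | "l \<noteq> i0" "l \<notin> I" by blast
    then show ?thesis
    proof cases
      case 1
      have mu: "\<mu> l = 1 + s * (real k)\<^sup>2 * (x \<bullet> x) ^ (k - 1) + q * (x \<bullet> x)" using 1 by (simp add: \<mu>_def)
      have "(G *v u) $ i = (1 + s * (real k)\<^sup>2 * (x \<bullet> x) ^ (k - 1) + q * (x \<bullet> x)) * u $ i" for i
      proof -
        have xu: "x \<bullet> u = r" using u(2) by (subst x) simp
        have xi: "x $ i = r * u $ i" by (subst x) simp
        have "(\<Sum>j\<in>UNIV. hess i j u * u $ j) = (real k)\<^sup>2 * u $ i" using hess_x[of i u] u(2) by simp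
        then show ?thesis unfolding Gv xu xi z by (simp add: algebra_simps power2_eq_square)
      qed
      then have "(G *v \<beta> l) $ i = (\<mu> l *\<^sub>R \<beta> l) $ i" for i
        using mu by (simp add: 1 fr(2))
      then show ?thesis by (simp only: vec_eq_iff) blast
    next
      case 2
      then have "u \<bullet> \<beta> l = 0" using fr(1)[unfolded orthonormal_frame_def, rule_format, of i0 l] fr(2) by simp
      then have "x \<bullet> \<beta> l = 0" unfolding x by simp
      then have "(G *v \<beta> l) $ i = (\<mu> l *\<^sub>R \<beta> l) $ i" for i
        unfolding Gv I[OF 2(1)] using 2 by (simp add: \<mu>_def algebra_simps)
      then show ?thesis by (simp only: vec_eq_iff) blast
    next
      case 3
      then have "u \<bullet> \<beta> l = 0" using fr(1)[unfolded orthonormal_frame_def, rule_format, of i0 l] fr(2) by simp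
      then have 1: "x \<bullet> \<beta> l = 0" unfolding x by simp
      have "(\<Sum>i\<in>UNIV. hess j i u * \<beta> l $ i) = 0" for j
      proof -
        have "(\<Sum>i\<in>UNIV. hess j i u * \<beta> l $ i) = (\<Sum>\<alpha>\<in>UNIV. dP j \<alpha> u * (\<Sum>i\<in>UNIV. \<beta> l $ i * dP i \<alpha> u))"
          unfolding hess_def sum_distrib_right sum_distrib_left by (subst sum.swap) (simp add: mult_ac)
        then show ?thesis using J[OF 3(2,1)] by simp
      qed
      then show ?thesis using 3 1 by (simp add: vec_eq_iff Gv \<mu>_def)
    qed
  qed
  have "det G = (\<Prod>l\<in>UNIV. \<mu> l)" by (rule frame_det[OF fr(1) ev])
  also have "\<dots> = \<mu> i0 * (\<Prod>l\<in>UNIV - {i0}. \<mu> l)" by (rule prod.remove) auto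
  also have "(\<Prod>l\<in>UNIV - {i0}. \<mu> l) = (\<Prod>l\<in>I. \<mu> l)"
    by (rule prod.mono_neutral_right) (use i0 in \<open>auto simp: \<mu>_def\<close>)
  also have "\<dots> = (\<Prod>l\<in>I. 1 + s * L * (x \<bullet> x) ^ (k - 1))"
    by (rule prod.cong) (use i0 in \<open>auto simp: \<mu>_def\<close>)
  finally show ?thesis by (simp add: \<mu>_def cI)
qed

end

lemma matrix_inv_eqI: "A ** B = mat 1 \<Longrightarrow> matrix_inv A = B" for A B :: "real^'n^'n"
proof -
  assume AB: "A ** B = mat 1"
  then have BA: "B ** A = mat 1" by (simp add: matrix_left_right_inverse)
  from AB BA have "\<exists>A'. A ** A' = mat 1 \<and> A' ** A = mat 1" by blast
  then have "A ** matrix_inv A = mat 1" unfolding matrix_inv_def by (rule someI2_ex) blast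
  then have "B ** (A ** matrix_inv A) = B" by simp
  then show ?thesis by (simp add: matrix_mul_assoc BA)
qed

section \<open>The minimal surface system on the graph of a profile\<close>

locale lo_profile = lawson_osserman p k L P
  for p k :: nat and L :: real and P :: "'b::finite \<Rightarrow> real^'a::finite \<Rightarrow> real" +
  fixes a b :: "real \<Rightarrow> real"
  assumes prof: "profile a b"
begin

text \<open>The induced metric of the graph has the eigenvalue \<open>1 + mu\<close> with multiplicity \<open>p\<close>, the eigenvalue \<open>1 + en\<close> in the radial
  direction, and \<open>1\<close> otherwise. Hence \<open>sqrt g g\<^sup>i\<^sup>j = W \<delta>\<^sub>i\<^sub>j + B hess\<^sub>i\<^sub>j + C x\<^sub>i x\<^sub>j\<close>, and \<open>alp\<close>, \<open>gam\<close> are the coefficients of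
  \<open>\<partial>\<^sub>i P\<close> and \<open>x\<^sub>i P\<close> in \<open>sqrt g g\<^sup>i\<^sup>j \<partial>\<^sub>j F\<close>.\<close>

definition "mu z = L * z ^ (k - 1) * (a z)\<^sup>2"
definition "en z = z ^ (k - 1) * (b z)\<^sup>2"
definition "T z = (1 + mu z) ^ (p div 2) / sqrt (1 + en z)"
definition "W z = T z * (1 + en z)"
definition "s z = (a z)\<^sup>2 / (1 + mu z)"
definition "B z = - (W z * s z)"
definition "c z = z ^ (k - 2) * ((real k)\<^sup>2 * s z - (b z)\<^sup>2 / (1 + en z))"
definition "C z = W z * c z"
definition "alp z = a z * W z / (1 + mu z)"
definition "gam z = a z * real k * (B z * ((real k)\<^sup>2 - L) * z ^ (k - 2) + C z) + 2 * deriv a z * T z"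

lemma zk: "z ^ (k - 1) = z * z ^ (k - 2)" "z ^ k = z * z * z ^ (k - 2)" for z :: real
proof -
  have e: "k - 1 = Suc (k - 2)" "k = Suc (Suc (k - 2))" using k4 by auto
  show "z ^ (k - 1) = z * z ^ (k - 2)" unfolding e(1) by simp
  show "z ^ k = z * z * z ^ (k - 2)" by (subst e(2)) (simp add: mult.assoc)
qed

lemma mu_en: assumes "z \<ge> 0" shows "0 \<le> mu z" "0 \<le> en z" "0 < 1 + mu z" "0 < 1 + en z"
proof -
  show "0 \<le> mu z" "0 \<le> en z" using L_ge assms by (simp_all add: mu_def en_def)
  then show "0 < 1 + mu z" "0 < 1 + en z" by simp_all
qed

lemmas pf = profile_facts[OF prof]

lemma C1_a: "C1_half a" and C1_b: "C1_half b" and C1_da: "C1_half (deriv a)"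
proof -
  show da: "C1_half (deriv a)" by (rule C1_halfI[OF pf(3) pf(5)])
  show "C1_half a" by (rule C1_halfI[OF pf(1) C1_half_continuous[OF da]])
  show "C1_half b" by (rule C1_halfI[OF pf(2) pf(4)])
qed

lemma C1_mu: "C1_half mu" unfolding mu_def[abs_def] by (intro C1_half_intros C1_a)
lemma C1_en: "C1_half en" unfolding en_def[abs_def] by (intro C1_half_intros C1_b)

lemma C1_T: "C1_half T" unfolding T_def[abs_def]
proof (intro C1_half_divide C1_half_power C1_half_add C1_half_const C1_half_sqrt C1_mu C1_en)
  fix z :: real assume "z \<ge> 0"
  then show "0 < 1 + en z" "sqrt (1 + en z) \<noteq> 0" using mu_en[of z] by auto
qed

lemma C1_W: "C1_half W" unfolding W_def[abs_def] by (intro C1_half_intros C1_T C1_en)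

lemma C1_s: "C1_half s" unfolding s_def[abs_def]
proof (intro C1_half_divide C1_half_power C1_half_add C1_half_const C1_mu C1_a)
  fix z :: real assume "z \<ge> 0" then show "1 + mu z \<noteq> 0" using mu_en[of z] by auto
qed

lemma C1_B: "C1_half B" unfolding B_def[abs_def] by (intro C1_half_minus C1_half_mult C1_W C1_s)

lemma C1_c: "C1_half c" unfolding c_def[abs_def]
proof (intro C1_half_mult C1_half_diff C1_half_divide C1_half_power C1_half_add C1_half_const C1_half_ident C1_s C1_b C1_en)
  fix z :: real assume "z \<ge> 0" then show "1 + en z \<noteq> 0" using mu_en[of z] by auto
qed

lemma C1_C: "C1_half C" unfolding C_def[abs_def] by (intro C1_half_mult C1_W C1_c)

lemma C1_alp: "C1_half alp" unfolding alp_def[abs_def]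
proof (intro C1_half_divide C1_half_mult C1_half_add C1_half_const C1_mu C1_a C1_W)
  fix z :: real assume "z \<ge> 0" then show "1 + mu z \<noteq> 0" using mu_en[of z] by auto
qed

lemma C1_gam: "C1_half gam" unfolding gam_def[abs_def]
  by (intro C1_half_mult C1_half_add C1_half_const C1_half_power C1_half_ident C1_a C1_B C1_C C1_T C1_da)

lemma mu_s: "z \<ge> 0 \<Longrightarrow> L * z ^ (k - 1) * s z = mu z / (1 + mu z)"
  by (simp add: s_def mu_def)

text \<open>Both sides are the radial eigenvalue of \<open>sqrt g * g^ij\<close>: on the left
  \<open>W / (1 + en)\<close>, on the right the action of the three summands on
  \<open>x\<close>.\<close>

lemma T_split: assumes z: "z \<ge> 0" shows "T z = W z + (real k)\<^sup>2 * z ^ (k - 1) * B z + z * C z"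
proof -
  have "z * c z = (real k)\<^sup>2 * z ^ (k - 1) * s z - en z / (1 + en z)"
    unfolding c_def en_def zk by (simp add: algebra_simps)
  moreover have "z * C z = W z * (z * c z)" by (simp add: C_def)
  ultimately have "z * C z = W z * ((real k)\<^sup>2 * z ^ (k - 1) * s z) - W z * en z / (1 + en z)"
    by (simp add: right_diff_distrib)
  moreover have "W z * en z / (1 + en z) = T z * en z" using mu_en(4)[OF z] by (simp add: W_def)
  ultimately show ?thesis by (simp add: B_def W_def algebra_simps)
qed

text \<open>Contracting the flux with \<open>x\<close> gives \<open>(k * alp + z * gam) * P\<close>.
  It is also the radial eigenvalue \<open>T\<close> times the radial derivative of the map, which is
  \<open>b * P\<close>.\<close>

lemma gam_split: assumes z: "z \<ge> 0" shows "z * gam z = T z * b z - real k * alp z"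
proof -
  have "z * gam z = a z * real k * (((real k)\<^sup>2 * z ^ (k - 1) * B z + z * C z) - L * z ^ (k - 1) * B z) + (2 * z * deriv a z) * T z"
    unfolding gam_def zk by (simp add: algebra_simps)
  also have "(real k)\<^sup>2 * z ^ (k - 1) * B z + z * C z = T z - W z" using T_split[OF z] by simp
  also have "L * z ^ (k - 1) * B z = - (W z * (mu z / (1 + mu z)))" unfolding B_def mu_s[OF z, symmetric] by simp
  also have "2 * z * deriv a z = b z - real k * a z" using pf(6)[OF z] by simp
  finally have "z * gam z = a z * real k * (T z - W z * (1 - mu z / (1 + mu z))) + (b z - real k * a z) * T z"
    by (simp add: algebra_simps)
  moreover have "1 - mu z / (1 + mu z) = 1 / (1 + mu z)" using mu_en(3)[OF z] by (simp add: field_simps)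
  ultimately show ?thesis by (simp add: alp_def algebra_simps)
qed

lemma zk_deriv: "((\<lambda>z. z ^ (k - 1)) has_real_derivative (real k - 1) * z ^ (k - 2)) (at z)" for z :: real
proof -
  have "((\<lambda>z. z ^ (k - 1)) has_real_derivative real (k - 1) * z ^ (k - 1 - Suc 0)) (at z)" by (rule DERIV_pow)
  moreover have "real (k - 1) = real k - 1" "k - 1 - Suc 0 = k - 2" using k4 by auto
  ultimately show ?thesis by simp
qed

lemma b_deriv: assumes z: "z > 0"
  shows "2 * z * deriv b z = - (real k - 1) * b z - (1 + en z) * (b z + real p * (b z - L * a z) * (1 / (1 + mu z)))"
  using z by (simp add: pf(7) brhs_def wgt_def en_def mu_def)

text \<open>\<open>2 * z * d/dz\<close> is differentiation in the logarithmic time. For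
  \<open>mu\<close> the relation between \<open>a\<close> and \<open>b\<close> suffices; for
  \<open>en\<close> the profile equation enters.\<close>

lemma T_deriv:
  assumes z: "z > 0"
  shows "2 * z * deriv T z = T z * (en z + real p * en z * (1 / (1 + mu z)) - real p * mu z * (1 / (1 + mu z)))"
proof -
  have z0: "z \<ge> 0" using z by simp
  note pos = mu_en[OF z0]
  define w where "w = 1 / (1 + mu z)"
  define q where "q = p div 2"
  have q: "real p = 2 * real q" "q = Suc (q - 1)" using p by (auto simp: q_def)
  define M' where "M' = L * ((real k - 1) * z ^ (k - 2) * (a z)\<^sup>2 + 2 * a z * deriv a z * z ^ (k - 1))"
  define E' where "E' = (real k - 1) * z ^ (k - 2) * (b z)\<^sup>2 + 2 * b z * deriv b z * z ^ (k - 1)"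
  have sq: "((\<lambda>z. (f z)\<^sup>2) has_real_derivative 2 * f z * D) (at z)" if "(f has_real_derivative D) (at z)" for f D
    using that by (auto intro!: derivative_eq_intros)
  have dM: "(mu has_real_derivative M') (at z)"
    unfolding mu_def[abs_def] M'_def mult.assoc[of L]
    by (rule DERIV_cmult, rule DERIV_mult[OF zk_deriv sq[OF pf(1)[OF z0]]])
  have dE: "(en has_real_derivative E') (at z)"
    unfolding en_def[abs_def] E'_def by (rule DERIV_mult[OF zk_deriv sq[OF pf(2)[OF z0]]])
  have zM: "z * M' = L * z ^ (k - 1) * (a z * b z - (a z)\<^sup>2)"
  proof -
    have "z * M' = L * z ^ (k - 1) * ((real k - 1) * (a z)\<^sup>2 + a z * (2 * z * deriv a z))"
      unfolding M'_def zk by (simp add: algebra_simps)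
    then show ?thesis unfolding pf(6)[OF z0] by (simp add: power2_eq_square algebra_simps)
  qed
  have zE: "z * E' = - (z ^ (k - 1) * b z * (1 + en z) * (b z + real p * (b z - L * a z) * w))"
  proof -
    have "z * E' = z ^ (k - 1) * b z * ((real k - 1) * b z + 2 * z * deriv b z)"
      unfolding E'_def zk by (simp add: power2_eq_square algebra_simps)
    then show ?thesis unfolding b_deriv[OF z, folded w_def] by (simp add: algebra_simps)
  qed
  define X where "X = (1 + mu z) ^ q"
  define Y where "Y = sqrt (1 + en z)"
  have Y: "Y > 0" "Y * Y = 1 + en z" using pos by (simp_all add: Y_def)
  have X: "(1 + mu z) ^ (q - 1) = X * w"
    using pos(3) q(2) unfolding X_def w_def by (metis nonzero_mult_div_cancel_left power_Suc less_irrefl mult.right_neutral times_divide_eq_right)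
  have dX: "((\<lambda>z. (1 + mu z) ^ q) has_real_derivative real q * M' * (X * w)) (at z)"
    unfolding X[symmetric]
    by (rule derivative_eq_intros dM refl)+ simp
  have dY: "((\<lambda>z. sqrt (1 + en z)) has_real_derivative inverse Y / 2 * E') (at z)"
    unfolding Y_def by (rule DERIV_chain2[OF DERIV_real_sqrt]) (use pos in \<open>auto intro!: derivative_eq_intros dE\<close>)
  have "(T has_real_derivative (real q * M' * (X * w) * Y - X * (inverse Y / 2 * E')) / (Y * Y)) (at z)"
    unfolding T_def[abs_def] q_def[symmetric]
    using DERIV_divide[OF dX dY] Y by (simp add: X_def Y_def)
  then have "deriv T z = (real q * M' * (X * w) * Y - X * (inverse Y / 2 * E')) / (Y * Y)" by (rule DERIV_imp_deriv)
  also have "\<dots> = T z * (real q * M' * w - E' / (2 * (1 + en z)))"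
  proof -
    have TX: "T z = X / Y" by (simp add: T_def X_def Y_def q_def)
    show ?thesis unfolding TX Y(2)[symmetric] using Y(1) by (simp add: field_simps)
  qed
  finally have d: "deriv T z = T z * (real q * M' * w - E' / (2 * (1 + en z)))" .
  define e where "e = E' / (1 + en z)"
  have e: "E' / (2 * (1 + en z)) = e / 2" "(z * E') / (1 + en z) = z * e" by (simp_all add: e_def)
  have "2 * z * deriv T z = T z * (real p * w * (z * M') - (z * E') / (1 + en z))"
    unfolding d q(1) e by (simp add: algebra_simps)
  also have "(z * E') / (1 + en z) = - (z ^ (k - 1) * b z * (b z + real p * (b z - L * a z) * w))"
    unfolding zE using pos(4) by simp
  also have "real p * w * (z * M') - - (z ^ (k - 1) * b z * (b z + real p * (b z - L * a z) * w)) =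
      en z + real p * en z * w - real p * mu z * w"
    unfolding zM en_def mu_def by (simp add: power2_eq_square algebra_simps)
  finally show ?thesis by (simp only: w_def)
qed

lemma w_eq: "z \<ge> 0 \<Longrightarrow> 1 / (1 + mu z) + mu z * (1 / (1 + mu z)) = 1"
  using mu_en(3)[of z] by (simp add: add_divide_distrib[symmetric])

text \<open>Differentiating \<open>T_split\<close> trades the derivatives of \<open>W\<close>,
  \<open>B\<close> and \<open>C\<close> for that of \<open>T\<close>. After multiplication by
  \<open>z\<close>, \<open>pL\<close> and \<open>T_deriv\<close> reduce everything to the identity
  \<open>w + mu * w = 1\<close>.\<close>

lemma div_S_coeff:
  assumes z: "z > 0"
  shows "2 * deriv W z + 2 * (real k)\<^sup>2 * z ^ (k - 1) * deriv B z + 2 * z * deriv C z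
     + B z * real k * (2 * real k + real p) * (real k - 1) * z ^ (k - 2) + (real p + 3) * C z = 0" (is "?R = 0")
proof -
  have z0: "z \<ge> 0" using z by simp
  define w where "w = 1 / (1 + mu z)"
  have w: "w + mu z * w = 1" using w_eq[OF z0] by (simp add: w_def)
  note D = C1_half_D[OF _ z0]
  have "((\<lambda>z. W z + ((real k)\<^sup>2 * z ^ (k - 1)) * B z + z * C z) has_real_derivative
     deriv W z + ((real k)\<^sup>2 * ((real k - 1) * z ^ (k - 2)) * B z + deriv B z * ((real k)\<^sup>2 * z ^ (k - 1))) + (1 * C z + deriv C z * z)) (at z)"
    by (intro DERIV_add DERIV_mult DERIV_cmult DERIV_ident zk_deriv D C1_W C1_B C1_C)
  then have "(T has_real_derivative
     deriv W z + ((real k)\<^sup>2 * ((real k - 1) * z ^ (k - 2)) * B z + deriv B z * ((real k)\<^sup>2 * z ^ (k - 1))) + (1 * C z + deriv C z * z)) (at z)"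
    by (rule has_field_derivative_transform_within_open[where S = "{0<..}"]) (use z T_split in auto)
  then have T': "deriv T z = deriv W z + ((real k)\<^sup>2 * ((real k - 1) * z ^ (k - 2)) * B z + deriv B z * ((real k)\<^sup>2 * z ^ (k - 1))) + (C z + deriv C z * z)"
    by (simp add: DERIV_imp_deriv)
  have "z * ?R = 2 * z * deriv T z + (real p + 1) * (z * C z) + B z * z ^ (k - 1) * (real k * (real k - 1) * real p)"
    unfolding T' zk by (simp add: algebra_simps power2_eq_square)
  also have "z * C z = T z - W z - (real k)\<^sup>2 * z ^ (k - 1) * B z" using T_split[OF z0] by simp
  also have "2 * z * deriv T z + (real p + 1) * (T z - W z - (real k)\<^sup>2 * z ^ (k - 1) * B z) + B z * z ^ (k - 1) * (real k * (real k - 1) * real p)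
     = 2 * z * deriv T z + (real p + 1) * (T z - W z) - (real k * (real k + real p)) * (z ^ (k - 1) * B z)"
    by (simp add: algebra_simps power2_eq_square)
  also have "\<dots> = 2 * z * deriv T z + (real p + 1) * (T z - W z) - real p * (L * z ^ (k - 1) * B z)"
    unfolding pL[symmetric] by (simp add: mult.assoc)
  also have "L * z ^ (k - 1) * B z = - (W z * (mu z * w))"
    using mu_s[OF z0] unfolding B_def w_def by (simp add: mult.left_commute)
  also have "2 * z * deriv T z = T z * (en z + real p * en z * w - real p * mu z * w)" using T_deriv[OF z] by (simp add: w_def)
  also have "T z * (en z + real p * en z * w - real p * mu z * w) + (real p + 1) * (T z - W z) - real p * - (W z * (mu z * w))
     = T z * real p * en z * ((w + mu z * w) - 1)"
    unfolding W_def by (simp add: algebra_simps)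
  finally show ?thesis using w z by simp
qed

text \<open>The same scheme based on \<open>gam_split\<close>, where the derivatives of
  \<open>T\<close> and \<open>b\<close> are both known from the profile equation.\<close>

lemma div_V_coeff:
  assumes z: "z > 0"
  shows "2 * real k * deriv alp z + 2 * z * deriv gam z + (real p + 2 + real k) * gam z = 0" (is "?R = 0")
proof -
  have z0: "z \<ge> 0" using z by simp
  define w where "w = 1 / (1 + mu z)"
  have w: "w + mu z * w = 1" using w_eq[OF z0] by (simp add: w_def)
  note D = C1_half_D[OF _ z0]
  have "((\<lambda>z. T z * b z - real k * alp z) has_real_derivative (deriv T z * b z + deriv b z * T z) - real k * deriv alp z) (at z)"
    by (intro DERIV_diff DERIV_mult DERIV_cmult D C1_T C1_b C1_alp)
  then have 1: "((\<lambda>z. z * gam z) has_real_derivative (deriv T z * b z + deriv b z * T z) - real k * deriv alp z) (at z)"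
    by (rule has_field_derivative_transform_within_open[where S = "{0<..}"]) (use z gam_split in auto)
  have 2: "((\<lambda>z. z * gam z) has_real_derivative 1 * gam z + deriv gam z * z) (at z)"
    by (intro DERIV_mult DERIV_ident D C1_gam)
  have G: "gam z + deriv gam z * z = (deriv T z * b z + deriv b z * T z) - real k * deriv alp z"
    using DERIV_unique[OF 2 1] by simp
  have "z * ?R = z * (2 * (gam z + deriv gam z * z) + 2 * real k * deriv alp z) + (real p + real k) * (z * gam z)"
    by (simp add: algebra_simps)
  also have "\<dots> = (2 * z * deriv T z) * b z + T z * (2 * z * deriv b z) + (real p + real k) * (T z * b z - real k * alp z)"
    unfolding G gam_split[OF z0] by (simp add: algebra_simps)
  also have "2 * z * deriv T z = T z * (en z + real p * en z * w - real p * mu z * w)" using T_deriv[OF z] by (simp add: w_def)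
  also have "2 * z * deriv b z = - (real k - 1) * b z - (1 + en z) * (b z + real p * (b z - L * a z) * w)" using b_deriv[OF z] by (simp only: w_def)
  also have "(real p + real k) * (T z * b z - real k * alp z) = (real p + real k) * T z * b z - (real p * L) * alp z"
    unfolding pL by (simp add: algebra_simps)
  also have "alp z = a z * (T z * (1 + en z)) * w" by (simp add: alp_def W_def w_def)
  also have "T z * (en z + real p * en z * w - real p * mu z * w) * b z +
      T z * (- (real k - 1) * b z - (1 + en z) * (b z + real p * (b z - L * a z) * w)) +
      ((real p + real k) * T z * b z - real p * L * (a z * (T z * (1 + en z)) * w)) =
      T z * real p * b z * (1 - (w + mu z * w))"
    by (simp add: algebra_simps)
  finally show ?thesis using w z by simp
qed

text \<open>The closed form of \<open>sqrt g * g^ij\<close>. The divergences are computed on the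
  closed forms first, and the identification with \<open>metric_coeff\<close> follows
  afterwards.\<close>

definition "Sij i j x = (if i = j then W (x \<bullet> x) else 0) + B (x \<bullet> x) * hess i j x + C (x \<bullet> x) * (x $ i * x $ j)"
definition "Vf i \<alpha> x = alp (x \<bullet> x) * dP i \<alpha> x + gam (x \<bullet> x) * (x $ i * P \<alpha> x)"
definition "Fmap x = (\<chi> \<alpha>. a (x \<bullet> x) * P \<alpha> x)"

lemma C1_hess: "C1_on X (hess i j)"
  unfolding hess_def[abs_def] by (intro C1_on_sum C1_on_mult polynomial_C1_on polynomial_partial_deriv poly)

lemma C1_Sij: "C1_on X (Sij i j)"
proof (cases "i = j")
  case True
  have "C1_on X (\<lambda>x. W (x \<bullet> x) + B (x \<bullet> x) * hess i j x + C (x \<bullet> x) * (x $ i * x $ j))"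
    by (intro C1_on_add C1_on_mult C1_on_radial_half C1_W C1_B C1_C C1_hess C1_on_coord)
  then show ?thesis using True by (simp add: Sij_def[abs_def])
next
  case False
  have "C1_on X (\<lambda>x. 0 + B (x \<bullet> x) * hess i j x + C (x \<bullet> x) * (x $ i * x $ j))"
    by (intro C1_on_add C1_on_const C1_on_mult C1_on_radial_half C1_B C1_C C1_hess C1_on_coord)
  then show ?thesis using False by (simp add: Sij_def[abs_def])
qed

lemma C1_Vf: "C1_on X (Vf i \<alpha>)"
  unfolding Vf_def[abs_def]
  by (intro C1_on_add C1_on_mult C1_on_radial_half C1_alp C1_gam C1_on_coord polynomial_C1_on polynomial_partial_deriv poly)

lemma hess_differentiable: "hess i j differentiable (at x)"
  using C1_hess[of UNIV i j] by (simp add: C1_on_def)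

lemma partial_Sij:
  fixes x :: "real^'a"
  defines "z \<equiv> x \<bullet> x"
  shows "partial_deriv i (Sij i j) x = (if i = j then 2 * deriv W z * x $ i else 0)
    + (B z * partial_deriv i (hess i j) x + 2 * deriv B z * (hess i j x * x $ i))
    + (C z * (x $ j + (if i = j then x $ i else 0)) + 2 * deriv C z * (x $ i * x $ i * x $ j))"
proof -
  note d = radial_differentiable coord_differentiable hess_differentiable differentiable_mult differentiable_add
  have 1: "partial_deriv i (\<lambda>x. B (x \<bullet> x) * hess i j x) x = B z * partial_deriv i (hess i j) x + 2 * deriv B z * (hess i j x * x $ i)"
    by (subst partial_deriv_mult) (auto intro: d C1_B simp: partial_deriv_radial_half[OF C1_B] z_def)
  have 2: "partial_deriv i (\<lambda>x. C (x \<bullet> x) * (x $ i * x $ j)) x = C z * (x $ j + (if i = j then x $ i else 0)) + 2 * deriv C z * (x $ i * x $ i * x $ j)"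
    by (subst partial_deriv_mult) (auto intro: d C1_C simp: partial_deriv_radial_half[OF C1_C] z_def partial_deriv_mult coord_differentiable partial_deriv_coord)
  have 3: "partial_deriv i (\<lambda>x. if i = j then W (x \<bullet> x) else 0) x = (if i = j then 2 * deriv W z * x $ i else 0)"
    by (cases "i = j") (simp_all add: partial_deriv_radial_half[OF C1_W] z_def partial_deriv_const)
  have dW: "(\<lambda>x::real^'a. if i = j then W (x \<bullet> x) else 0) differentiable (at x)"
    by (cases "i = j") (simp_all add: radial_differentiable[OF C1_W])
  have dB: "(\<lambda>x. B (x \<bullet> x) * hess i j x) differentiable (at x)"
    by (intro differentiable_mult radial_differentiable C1_B hess_differentiable)
  have dC: "(\<lambda>x. C (x \<bullet> x) * (x $ i * x $ j)) differentiable (at x)"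
    by (intro differentiable_mult radial_differentiable C1_C coord_differentiable)
  show ?thesis unfolding Sij_def[abs_def]
    by (simp only: partial_deriv_add[OF differentiable_add[OF dW dB] dC] partial_deriv_add[OF dW dB] 1 2 3)
qed

lemma div_Sij: "(\<Sum>i\<in>UNIV. partial_deriv i (Sij i j) x) = 0"
proof -
  define z where "z = x \<bullet> x"
  have xx: "(\<Sum>i\<in>UNIV. x $ i * x $ i * x $ j) = z * x $ j" by (simp add: z_def inner_vec_def sum_distrib_right)
  have hx: "(\<Sum>i\<in>UNIV. hess i j x * x $ i) = (real k)\<^sup>2 * z ^ (k - 1) * x $ j"
    using hess_x[of j x] by (simp add: hess_sym[of _ j] z_def)
  have "(\<Sum>i\<in>UNIV. partial_deriv i (Sij i j) x) = 2 * deriv W z * x $ j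
    + (B z * (real k * (2 * real k + real p) * (real k - 1) * z ^ (k - 2) * x $ j) + 2 * deriv B z * ((real k)\<^sup>2 * z ^ (k - 1) * x $ j))
    + (C z * (real CARD('a) * x $ j + x $ j) + 2 * deriv C z * (z * x $ j))"
  proof -
    have if1: "(\<Sum>i\<in>UNIV. if i = j then 2 * deriv W z * x $ i else 0) = 2 * deriv W z * x $ j"
      and if2: "(\<Sum>i\<in>UNIV. if i = j then x $ i else 0) = x $ j" by simp_all
    show ?thesis
      unfolding partial_Sij z_def[symmetric] sum.distrib sum_distrib_left[symmetric] if1 if2 xx hx div_hess
      by (simp add: card z_def[symmetric])
  qed
  also have "\<dots> = x $ j * (2 * deriv W z + 2 * (real k)\<^sup>2 * z ^ (k - 1) * deriv B z + 2 * z * deriv C z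
     + B z * real k * (2 * real k + real p) * (real k - 1) * z ^ (k - 2) + (real p + 3) * C z)"
    by (simp add: card algebra_simps)
  also have "\<dots> = 0"
  \<comment> \<open>The coefficient identity is available for \<open>z > 0\<close> only; at the
    origin the factor \<open>x $ j\<close> takes care of it.\<close>
  proof (cases "x = 0")
    case False
    then have "z > 0" by (simp add: z_def)
    from div_S_coeff[OF this] show ?thesis by simp
  qed simp
  finally show ?thesis .
qed

lemma div_Vf: "(\<Sum>i\<in>UNIV. partial_deriv i (Vf i \<alpha>) x) = 0"
proof -
  define z where "z = x \<bullet> x"
  have dA: "(\<lambda>x. alp (x \<bullet> x) * dP i \<alpha> x) differentiable (at x)" for i
    by (intro differentiable_mult radial_differentiable C1_alp diffs)
  have dG: "(\<lambda>x. gam (x \<bullet> x) * (x $ i * P \<alpha> x)) differentiable (at x)" for i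
    by (intro differentiable_mult radial_differentiable C1_gam coord_differentiable diffs)
  have 1: "partial_deriv i (\<lambda>x. alp (x \<bullet> x) * dP i \<alpha> x) x = alp z * partial_deriv i (dP i \<alpha>) x + 2 * deriv alp z * (x $ i * dP i \<alpha> x)" for i
    by (subst partial_deriv_mult) (simp_all add: radial_differentiable[OF C1_alp] partial_deriv_radial_half[OF C1_alp] z_def)
  have 2: "partial_deriv i (\<lambda>x. gam (x \<bullet> x) * (x $ i * P \<alpha> x)) x =
      gam z * (x $ i * dP i \<alpha> x + P \<alpha> x) + 2 * deriv gam z * P \<alpha> x * (x $ i * x $ i)" for i
    by (subst partial_deriv_mult)
       (simp_all add: radial_differentiable[OF C1_gam] partial_deriv_radial_half[OF C1_gam] z_def partial_deriv_mult
         coord_differentiable partial_deriv_coord differentiable_mult)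
  have xx: "(\<Sum>i\<in>UNIV. x $ i * x $ i) = z" by (simp add: z_def inner_vec_def)
  have "(\<Sum>i\<in>UNIV. partial_deriv i (Vf i \<alpha>) x) =
     (alp z * 0 + 2 * deriv alp z * (real k * P \<alpha> x)) +
     (gam z * (real k * P \<alpha> x + real CARD('a) * P \<alpha> x) + 2 * deriv gam z * P \<alpha> x * z)"
    unfolding Vf_def[abs_def] partial_deriv_add[OF dA dG] 1 2 sum.distrib sum_distrib_left[symmetric] harm euler xx
    by simp
  also have "\<dots> = P \<alpha> x * (2 * real k * deriv alp z + 2 * z * deriv gam z + (real p + 2 + real k) * gam z)"
    by (simp add: card algebra_simps)
  also have "\<dots> = 0"
  proof (cases "x = 0")
    case True then show ?thesis by (simp add: zero_at_0)
  next
    case False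
    then have "z > 0" by (simp add: z_def)
    from div_V_coeff[OF this] show ?thesis by simp
  qed
  finally show ?thesis .
qed

lemma Fmap_has_derivative:
  "(Fmap has_derivative (\<lambda>h. \<chi> \<alpha>. frechet_derivative (\<lambda>x. a (x \<bullet> x) * P \<alpha> x) (at x) h)) (at x)"
  unfolding Fmap_def[abs_def]
  by (rule has_derivative_vec_lambda, rule differentiable_has_derivative)
     (intro differentiable_mult radial_differentiable C1_a diffs)

lemma partial_Fmap:
  "partial_deriv i Fmap x $ \<alpha> = a (x \<bullet> x) * dP i \<alpha> x + 2 * deriv a (x \<bullet> x) * (x $ i * P \<alpha> x)"
proof -
  have "partial_deriv i Fmap x $ \<alpha> = partial_deriv i (\<lambda>x. a (x \<bullet> x) * P \<alpha> x) x"
    unfolding partial_deriv_eqI[OF Fmap_has_derivative] by (simp add: partial_deriv_def)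
  also have "\<dots> = a (x \<bullet> x) * dP i \<alpha> x + 2 * deriv a (x \<bullet> x) * (x $ i * P \<alpha> x)"
    by (subst partial_deriv_mult) (simp_all add: radial_differentiable[OF C1_a] partial_deriv_radial_half[OF C1_a])
  finally show ?thesis .
qed

text \<open>By \<open>hess_dP\<close> and \<open>hess_x\<close> the matrix maps the gradient of
  \<open>P \<alpha>\<close> and the vector \<open>x\<close> into their own span, which yields the
  two coefficients \<open>alp\<close> and \<open>gam\<close> of the flux.\<close>

lemma Sij_Fmap: "(\<Sum>j\<in>UNIV. Sij i j x * partial_deriv j Fmap x $ \<alpha>) = Vf i \<alpha> x"
proof -
  define z where "z = x \<bullet> x"
  have z0: "z \<ge> 0" by (simp add: z_def)
  have S1: "(\<Sum>j\<in>UNIV. Sij i j x * v j) = W z * v i + B z * (\<Sum>j\<in>UNIV. hess i j x * v j) + C z * x $ i * (\<Sum>j\<in>UNIV. x $ j * v j)" for v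
  proof -
    have "Sij i j x * v j = (if i = j then W z * v j else 0) + B z * (hess i j x * v j) + C z * x $ i * (x $ j * v j)" for j
      by (simp add: Sij_def z_def distrib_right mult.assoc)
    then show ?thesis by (simp add: sum.distrib sum_distrib_left)
  qed
  have SP: "(\<Sum>j\<in>UNIV. Sij i j x * dP j \<alpha> x) = (W z + L * z ^ (k - 1) * B z) * dP i \<alpha> x
      + real k * (B z * ((real k)\<^sup>2 - L) * z ^ (k - 2) + C z) * (x $ i * P \<alpha> x)"
    unfolding S1 hess_dP euler z_def[symmetric] by (simp add: algebra_simps)
  define r where "r = mu z / (1 + mu z)"
  have "L * z ^ (k - 1) * B z = - (W z * r)" unfolding B_def r_def mu_s[OF z0, symmetric] by simp
  moreover have "1 / (1 + mu z) = 1 - r" using mu_en(3)[OF z0] by (simp add: r_def field_simps)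
  moreover have "W z / (1 + mu z) = W z * (1 / (1 + mu z))" by simp
  ultimately have WB: "W z + L * z ^ (k - 1) * B z = W z / (1 + mu z)" by (simp only: right_diff_distrib)
  have Sx: "(\<Sum>j\<in>UNIV. Sij i j x * x $ j) = T z * x $ i"
  proof -
    have "(\<Sum>j\<in>UNIV. x $ j * x $ j) = z" by (simp add: z_def inner_vec_def)
    then show ?thesis unfolding S1 hess_x z_def[symmetric] T_split[OF z0] by (simp add: algebra_simps)
  qed
  have "(\<Sum>j\<in>UNIV. Sij i j x * partial_deriv j Fmap x $ \<alpha>) =
     a z * (\<Sum>j\<in>UNIV. Sij i j x * dP j \<alpha> x) + 2 * deriv a z * P \<alpha> x * (\<Sum>j\<in>UNIV. Sij i j x * x $ j)"
    unfolding partial_Fmap z_def[symmetric]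
    by (simp add: distrib_left sum.distrib sum_distrib_left mult_ac)
  also have "\<dots> = Vf i \<alpha> x"
    unfolding SP Sx WB Vf_def z_def[symmetric] alp_def gam_def by (simp add: algebra_simps)
  finally show ?thesis .
qed

text \<open>The determinant comes from the eigenvalues. The candidate \<open>N\<close> for the
  inverse is multiplied out with \<open>hess_hess\<close>; the coefficients of the Gram matrix and
  of \<open>x x^T\<close> then vanish separately, which are \<open>coef1\<close> and
  \<open>coef2\<close>.\<close>

lemma metric_coeff_Fmap: "metric_coeff Fmap i j x = Sij i j x"
proof -
  define z where "z = x \<bullet> x"
  have z0: "z \<ge> 0" by (simp add: z_def)
  note pos = mu_en[OF z0]
  define h where "h i j = hess i j x" for i j
  define A where "A = (a z)\<^sup>2"
  \<comment> \<open>The coefficient of \<open>x x^T\<close> in the metric, rewritten through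
    \<open>b\<close>. It is the one for which the radial eigenvalue becomes
    \<open>1 + en z\<close>.\<close>
  define Q where "Q = z ^ (k - 2) * ((b z)\<^sup>2 - (real k)\<^sup>2 * (a z)\<^sup>2)"
  have PP: "(\<Sum>\<alpha>\<in>UNIV. P \<alpha> x * P \<alpha> x) = z ^ k" using nrm[of x] by (simp add: z_def power2_eq_square)
  have G: "graph_metric Fmap x = (\<chi> i j. (if i = j then 1 else 0) + A * hess i j x + Q * x $ i * x $ j)"
  proof -
    have "partial_deriv i Fmap x \<bullet> partial_deriv j Fmap x = A * hess i j x + Q * x $ i * x $ j" for i j
    proof -
      define d where "d = 2 * deriv a z"
      have "partial_deriv i Fmap x \<bullet> partial_deriv j Fmap x =
         (\<Sum>\<alpha>\<in>UNIV. A * (dP i \<alpha> x * dP j \<alpha> x) + a z * d * x $ i * (P \<alpha> x * dP j \<alpha> x) + a z * d * x $ j * (P \<alpha> x * dP i \<alpha> x)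
           + d * d * x $ i * x $ j * (P \<alpha> x * P \<alpha> x))"
      proof -
        have "partial_deriv i Fmap x \<bullet> partial_deriv j Fmap x = (\<Sum>\<alpha>\<in>UNIV. partial_deriv i Fmap x $ \<alpha> * partial_deriv j Fmap x $ \<alpha>)"
          by (simp only: inner_vec_def inner_real_def)
        also have "\<dots> = (\<Sum>\<alpha>\<in>UNIV. A * (dP i \<alpha> x * dP j \<alpha> x) + a z * d * x $ i * (P \<alpha> x * dP j \<alpha> x) + a z * d * x $ j * (P \<alpha> x * dP i \<alpha> x)
           + d * d * x $ i * x $ j * (P \<alpha> x * P \<alpha> x))"
          unfolding partial_Fmap z_def[symmetric] d_def[symmetric] A_def power2_eq_square
          by (intro sum.cong refl) (simp only: distrib_left distrib_right mult_ac add_ac)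
        finally show ?thesis .
      qed
      also have "\<dots> = A * hess i j x + (2 * real k * z ^ (k - 1) * a z * d + d * d * z ^ k) * (x $ i * x $ j)"
        unfolding sum.distrib sum_distrib_left[symmetric] PP P_dP hess_def[symmetric] z_def[symmetric]
        by (simp add: algebra_simps)
      also have "2 * real k * z ^ (k - 1) * a z * d + d * d * z ^ k = Q"
      proof -
        have bz: "b z = real k * a z + z * d" using pf(6)[OF z0] by (simp add: d_def)
        show ?thesis unfolding Q_def bz zk by (simp add: power2_eq_square algebra_simps)
      qed
      finally show ?thesis by (simp add: mult.assoc)
    qed
    then show ?thesis by (simp add: graph_metric_def vec_eq_iff)
  qed
  have eQ: "A * (real k)\<^sup>2 * z ^ (k - 1) + Q * z = en z"
    unfolding A_def Q_def en_def zk by (simp add: algebra_simps)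
  have det: "det (graph_metric Fmap x) = (1 + en z) * (1 + mu z) ^ p"
  proof -
    have "1 + A * (real k)\<^sup>2 * z ^ (k - 1) + Q * z = 1 + en z" using eQ by simp
    moreover have "1 + A * L * z ^ (k - 1) = 1 + mu z" by (simp add: A_def mu_def)
    ultimately show ?thesis using det_rank_structure[OF G] unfolding z_def[symmetric] by simp
  qed
  have sqrt: "sqrt (det (graph_metric Fmap x)) = W z"
  proof -
    \<comment> \<open>Evenness of \<open>p\<close> turns the root of the singular part into a
      power.\<close>
    have "p = 2 * (p div 2)" using p by auto
    then have "(1 + mu z) ^ p = ((1 + mu z) ^ (p div 2))\<^sup>2" by (metis power_mult mult.commute)
    then have "sqrt (det (graph_metric Fmap x)) = sqrt (1 + en z) * (1 + mu z) ^ (p div 2)"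
      unfolding det using pos by (simp add: real_sqrt_mult)
    also have "\<dots> = W z"
    proof -
      define Y where "Y = sqrt (1 + en z)"
      have Y: "Y > 0" "1 + en z = Y * Y" using pos by (simp_all add: Y_def)
      show ?thesis unfolding W_def T_def Y_def[symmetric] unfolding Y(2) using Y(1) by simp
    qed
    finally show ?thesis .
  qed
  define N :: "real^'a^'a" where "N = (\<chi> i j. (if i = j then 1 else 0) - s z * hess i j x + c z * (x $ i * x $ j))"
  have hx: "(\<Sum>j\<in>UNIV. h i j * x $ j) = (real k)\<^sup>2 * z ^ (k - 1) * x $ i" for i
    using hess_x[of i x] by (simp add: h_def z_def)
  have xh: "(\<Sum>j\<in>UNIV. x $ j * h j l) = (real k)\<^sup>2 * z ^ (k - 1) * x $ l" for l
    using hx[of l] hess_sym[of _ l x] by (simp add: h_def mult.commute)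
  have hh: "(\<Sum>j\<in>UNIV. h i j * h j l) = L * z ^ (k - 1) * h i l + (real k)\<^sup>2 * ((real k)\<^sup>2 - L) * z ^ (k - 2) * z ^ (k - 1) * x $ i * x $ l" for i l
    using hess_hess[of i x l] by (simp add: h_def z_def)
  have xx: "(\<Sum>j\<in>UNIV. x $ j * x $ j) = z" by (simp add: z_def inner_vec_def)
  have coef1: "A - s z - A * s z * (L * z ^ (k - 1)) = 0"
  proof -
    have "A = s z * (1 + mu z)" using pos(3) by (simp add: s_def A_def)
    then show ?thesis by (simp add: mu_def A_def algebra_simps)
  qed
  have coef2: "c z * (1 + A * ((real k)\<^sup>2 * z ^ (k - 1)) + Q * z) + Q - Q * s z * ((real k)\<^sup>2 * z ^ (k - 1))
      - A * s z * ((real k)\<^sup>2 * ((real k)\<^sup>2 - L) * z ^ (k - 2) * z ^ (k - 1)) = 0"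
  proof -
    have "c z * (1 + A * ((real k)\<^sup>2 * z ^ (k - 1)) + Q * z) = c z * (1 + en z)"
      unfolding eQ[symmetric] by (simp add: algebra_simps)
    also have "\<dots> = z ^ (k - 2) * ((real k)\<^sup>2 * s z * (1 + en z) - (b z)\<^sup>2)"
      using pos(4) by (simp add: c_def left_diff_distrib mult.assoc)
    finally have "c z * (1 + A * ((real k)\<^sup>2 * z ^ (k - 1)) + Q * z) + Q - Q * s z * ((real k)\<^sup>2 * z ^ (k - 1))
      - A * s z * ((real k)\<^sup>2 * ((real k)\<^sup>2 - L) * z ^ (k - 2) * z ^ (k - 1)) =
      - (z ^ (k - 2) * (real k)\<^sup>2) * (A - s z - A * s z * (L * z ^ (k - 1)))"
      unfolding Q_def A_def en_def by (simp add: algebra_simps power2_eq_square)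
    then show ?thesis unfolding coef1 by simp
  qed
  have "graph_metric Fmap x ** N = mat 1"
  proof -
    have "(\<Sum>j\<in>UNIV. ((if i = j then 1 else 0) + A * h i j + Q * x $ i * x $ j) * ((if j = l then 1 else 0) - s z * h j l + c z * (x $ j * x $ l)))
       = (if i = l then 1 else 0)" for i l
    proof -
      have "((if i = j then 1 else 0) + A * h i j + Q * x $ i * x $ j) * ((if j = l then 1 else 0) - s z * h j l + c z * (x $ j * x $ l)) =
        (if i = j then (if j = l then 1 else 0) - s z * h j l + c z * (x $ j * x $ l) else 0)
        + (if j = l then A * h i j + Q * x $ i * x $ j else 0)
        - A * s z * (h i j * h j l) + A * c z * x $ l * (h i j * x $ j) - Q * s z * x $ i * (x $ j * h j l) + Q * c z * x $ i * x $ l * (x $ j * x $ j)" for j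
        by (auto simp: algebra_simps)
      then have "(\<Sum>j\<in>UNIV. ((if i = j then 1 else 0) + A * h i j + Q * x $ i * x $ j) * ((if j = l then 1 else 0) - s z * h j l + c z * (x $ j * x $ l))) =
        ((if i = l then 1 else 0) - s z * h i l + c z * (x $ i * x $ l)) + (A * h i l + Q * x $ i * x $ l)
        - A * s z * (\<Sum>j\<in>UNIV. h i j * h j l) + A * c z * x $ l * (\<Sum>j\<in>UNIV. h i j * x $ j) - Q * s z * x $ i * (\<Sum>j\<in>UNIV. x $ j * h j l)
        + Q * c z * x $ i * x $ l * (\<Sum>j\<in>UNIV. x $ j * x $ j)"
        by (simp add: sum.distrib sum_subtractf sum_distrib_left)
      also have "\<dots> = (if i = l then 1 else 0) + (A - s z - A * s z * (L * z ^ (k - 1))) * h i l +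
        (c z * (1 + A * ((real k)\<^sup>2 * z ^ (k - 1)) + Q * z) + Q - Q * s z * ((real k)\<^sup>2 * z ^ (k - 1))
      - A * s z * ((real k)\<^sup>2 * ((real k)\<^sup>2 - L) * z ^ (k - 2) * z ^ (k - 1))) * (x $ i * x $ l)"
        unfolding hh hx xh xx by (simp add: algebra_simps)
      finally show ?thesis unfolding coef1 coef2 by simp
    qed
    then show ?thesis unfolding G N_def by (simp add: vec_eq_iff matrix_matrix_mult_def mat_def h_def)
  qed
  then have inv: "matrix_inv (graph_metric Fmap x) = N" by (rule matrix_inv_eqI)
  show ?thesis unfolding metric_coeff_def sqrt inv N_def
    by (simp add: Sij_def z_def[symmetric] B_def C_def algebra_simps)
qed

lemma weak_solution:
  assumes F: "\<And>x. x \<in> ball 0 1 \<Longrightarrow> F x = Fmap x"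
  shows "weak_minimal_surface_system (ball 0 1) F"
proof -
  have pd: "partial_deriv i F x = partial_deriv i Fmap x" if x: "x \<in> ball 0 1" for i x
  proof -
    have "(F has_derivative (\<lambda>h. \<chi> \<alpha>. frechet_derivative (\<lambda>x. a (x \<bullet> x) * P \<alpha> x) (at x) h)) (at x)"
      by (rule has_derivative_transform_within_open[OF Fmap_has_derivative open_ball x]) (simp add: F)
    from partial_deriv_eqI[OF this] partial_deriv_eqI[OF Fmap_has_derivative] show ?thesis by simp
  qed
  have mc: "metric_coeff F i j x = Sij i j x" if x: "x \<in> ball 0 1" for i j x
    unfolding metric_coeff_Fmap[symmetric] metric_coeff_def graph_metric_def pd[OF x] ..
  show ?thesis unfolding weak_minimal_surface_system_def
  proof (intro allI impI conjI)
    fix \<eta> :: "real^'a \<Rightarrow> real" and j assume test: "test_function (ball 0 1) \<eta>"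
    have "has_bochner_integral (lebesgue_on (ball 0 1)) (\<lambda>x. \<Sum>i\<in>UNIV. Sij i j x * partial_deriv i \<eta> x) 0"
      by (rule weak_divergence_free[OF open_ball C1_Sij div_Sij test])
    then show "has_bochner_integral (lebesgue_on (ball 0 1)) (\<lambda>x. \<Sum>i\<in>UNIV. metric_coeff F i j x * partial_deriv i \<eta> x) 0"
      by (rule has_bochner_integral_cong[THEN iffD1, rotated 3]) (simp_all add: mc)
  next
    fix \<eta> :: "real^'a \<Rightarrow> real" and \<alpha> assume test: "test_function (ball 0 1) \<eta>"
    have "has_bochner_integral (lebesgue_on (ball 0 1)) (\<lambda>x. \<Sum>i\<in>UNIV. Vf i \<alpha> x * partial_deriv i \<eta> x) 0"
      by (rule weak_divergence_free[OF open_ball C1_Vf div_Vf test])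
    moreover have "(\<Sum>i\<in>UNIV. \<Sum>j\<in>UNIV. metric_coeff F i j x * (partial_deriv j F x $ \<alpha>) * partial_deriv i \<eta> x) =
       (\<Sum>i\<in>UNIV. Vf i \<alpha> x * partial_deriv i \<eta> x)" if "x \<in> ball 0 1" for x
      unfolding mc[OF that] pd[OF that] Sij_Fmap[symmetric] sum_distrib_right ..
    ultimately show "has_bochner_integral (lebesgue_on (ball 0 1))
       (\<lambda>x. \<Sum>i\<in>UNIV. \<Sum>j\<in>UNIV. metric_coeff F i j x * (partial_deriv j F x $ \<alpha>) * partial_deriv i \<eta> x) 0"
      by (subst has_bochner_integral_cong) simp_all
  qed
qed

end

section \<open>Real analyticity\<close>

definition mono_deg :: "('a::finite \<Rightarrow> nat) \<Rightarrow> nat" where "mono_deg \<nu> = (\<Sum>i\<in>UNIV. \<nu> i)"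

definition monomial :: "real^'a::finite \<Rightarrow> ('a \<Rightarrow> nat) \<Rightarrow> real" where
  "monomial y \<nu> = (\<Prod>i\<in>UNIV. (y $ i) ^ \<nu> i)"

text \<open>Convergence on a closed cube together with a bound \<open>M\<close> for the absolute
  sum. Sums and products act on \<open>M\<close> as in a normed algebra, and composition only has to
  compare \<open>M\<close> with a radius of convergence.\<close>

definition multi_series ::
    "real^'a::finite \<Rightarrow> real \<Rightarrow> real \<Rightarrow> (real^'a \<Rightarrow> real) \<Rightarrow> (('a \<Rightarrow> nat) \<Rightarrow> real) \<Rightarrow> bool" where
  "multi_series x0 r M u c \<longleftrightarrow>
     (\<exists>S\<le>M. ((\<lambda>\<nu>. \<bar>c \<nu>\<bar> * r ^ mono_deg \<nu>) has_sum S) UNIV) \<and>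
     (\<forall>y. (\<forall>i. \<bar>y $ i\<bar> \<le> r) \<longrightarrow> ((\<lambda>\<nu>. monomial y \<nu> * c \<nu>) has_sum u (x0 + y)) UNIV)"

lemma mono_deg_add: "mono_deg (\<lambda>i. \<nu> i + \<mu> i) = mono_deg \<nu> + mono_deg \<mu>"
  by (simp add: mono_deg_def sum.distrib)

lemma monomial_add: "monomial y (\<lambda>i. \<nu> i + \<mu> i) = monomial y \<nu> * monomial y \<mu>"
  by (simp add: monomial_def power_add prod.distrib)

lemma abs_monomial_le: "(\<forall>i. \<bar>y $ i\<bar> \<le> r) \<Longrightarrow> \<bar>monomial y \<nu>\<bar> \<le> r ^ mono_deg \<nu>"
  unfolding monomial_def mono_deg_def abs_prod power_sum power_abs
  by (intro prod_mono) (auto intro: power_mono)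

lemma summable_on_abs_bound:
  fixes f :: "'c \<Rightarrow> real"
  assumes "g summable_on A" "\<And>x. x \<in> A \<Longrightarrow> \<bar>f x\<bar> \<le> g x" shows "f summable_on A"
proof -
  have "(\<lambda>x. norm (f x)) summable_on A"
    by (rule Infinite_Sum.abs_summable_on_comparison_test'[OF assms(1)]) (use assms(2) in simp)
  then show ?thesis by (rule Infinite_Sum.abs_summable_summable)
qed

lemma has_sum_abs_le:
  fixes f :: "'c \<Rightarrow> real"
  assumes g: "(g has_sum S) A" and f: "(f has_sum s) A" and le: "\<And>x. x \<in> A \<Longrightarrow> \<bar>f x\<bar> \<le> g x"
  shows "\<bar>s\<bar> \<le> S"
proof -
  have "s \<le> S" by (rule has_sum_mono[OF f g]) (use le in \<open>force simp: abs_le_iff\<close>)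
  moreover have "((\<lambda>x. - f x) has_sum - s) A" using f by (simp add: has_sum_uminus)
  then have "- s \<le> S" by (rule has_sum_mono[OF _ g]) (use le in \<open>force simp: abs_le_iff\<close>)
  ultimately show ?thesis by simp
qed

text \<open>A sum of monomial terms over an arbitrary index set becomes a power series by collecting the
  terms with the same exponents.\<close>

lemma multi_series_collect:
  fixes \<nu> :: "'w \<Rightarrow> 'a::finite \<Rightarrow> nat" and K :: "'w \<Rightarrow> real"
  assumes r: "r > 0" and abs: "((\<lambda>\<omega>. \<bar>K \<omega>\<bar> * r ^ mono_deg (\<nu> \<omega>)) has_sum S) \<Omega>" and S: "S \<le> M"
    and u: "\<And>y. \<forall>i. \<bar>y $ i\<bar> \<le> r \<Longrightarrow> ((\<lambda>\<omega>. monomial y (\<nu> \<omega>) * K \<omega>) has_sum u (x0 + y)) \<Omega>"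
  shows "\<exists>c. multi_series x0 r M u c"
proof -
  define fib where "fib \<kappa> = {\<omega> \<in> \<Omega>. \<nu> \<omega> = \<kappa>}" for \<kappa>
  have bij: "bij_betw snd (Sigma UNIV fib) \<Omega>"
    by (rule bij_betw_byWitness[where f' = "\<lambda>\<omega>. (\<nu> \<omega>, \<omega>)"]) (auto simp: fib_def)
  have toSigma: "((\<lambda>(\<kappa>, \<omega>). f \<omega>) has_sum s) (Sigma UNIV fib)" if "(f has_sum s) \<Omega>" for f :: "'w \<Rightarrow> real" and s
    using that has_sum_reindex_bij_betw[OF bij, of f s] by (simp add: case_prod_unfold)
  have absfib: "(\<lambda>\<omega>. \<bar>K \<omega>\<bar>) summable_on fib \<kappa>" for \<kappa>
  proof -
    have "(\<lambda>\<omega>. \<bar>K \<omega>\<bar> * r ^ mono_deg (\<nu> \<omega>)) summable_on fib \<kappa>"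
      by (rule summable_on_subset_banach[of _ \<Omega>]) (use abs in \<open>auto simp: fib_def summable_on_def\<close>)
    then have "(\<lambda>\<omega>. \<bar>K \<omega>\<bar> * r ^ mono_deg \<kappa>) summable_on fib \<kappa>"
      by (rule summable_on_cong[THEN iffD1, rotated]) (simp add: fib_def)
    then have "(\<lambda>\<omega>. (\<bar>K \<omega>\<bar> * r ^ mono_deg \<kappa>) * (1 / r ^ mono_deg \<kappa>)) summable_on fib \<kappa>"
      by (rule summable_on_cmult_left)
    then show ?thesis using r by simp
  qed
  define c where "c \<kappa> = infsum K (fib \<kappa>)" for \<kappa>
  define g where "g \<kappa> = infsum (\<lambda>\<omega>. \<bar>K \<omega>\<bar>) (fib \<kappa>)" for \<kappa>
  have Ksum: "K summable_on fib \<kappa>" for \<kappa>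
    by (rule summable_on_abs_bound[OF absfib]) simp
  have cg: "\<bar>c \<kappa>\<bar> \<le> g \<kappa>" for \<kappa>
    unfolding c_def g_def using norm_infsum_bound[of K "fib \<kappa>"] absfib by simp
  have "((\<lambda>\<kappa>. g \<kappa> * r ^ mono_deg \<kappa>) has_sum S) UNIV"
  proof (rule has_sum_SigmaD[OF toSigma[OF abs]])
    fix \<kappa>
    have "((\<lambda>\<omega>. \<bar>K \<omega>\<bar> * r ^ mono_deg \<kappa>) has_sum g \<kappa> * r ^ mono_deg \<kappa>) (fib \<kappa>)"
      unfolding g_def by (rule has_sum_cmult_left[OF has_sum_infsum[OF absfib]])
    then show "((\<lambda>\<omega>. case (\<kappa>, \<omega>) of (\<kappa>, \<omega>) \<Rightarrow> \<bar>K \<omega>\<bar> * r ^ mono_deg (\<nu> \<omega>)) has_sum g \<kappa> * r ^ mono_deg \<kappa>) (fib \<kappa>)"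
      by (rule has_sum_cong[THEN iffD1, rotated]) (simp add: fib_def)
  qed
  then have gs: "(\<lambda>\<kappa>. g \<kappa> * r ^ mono_deg \<kappa>) summable_on UNIV" "infsum (\<lambda>\<kappa>. g \<kappa> * r ^ mono_deg \<kappa>) UNIV = S"
    by (auto simp: summable_on_def infsumI)
  have le: "\<bar>c \<kappa>\<bar> * r ^ mono_deg \<kappa> \<le> g \<kappa> * r ^ mono_deg \<kappa>" for \<kappa>
    using cg r by (intro mult_right_mono) auto
  have cs: "(\<lambda>\<kappa>. \<bar>c \<kappa>\<bar> * r ^ mono_deg \<kappa>) summable_on UNIV"
    by (rule summable_on_abs_bound[OF gs(1)]) (use le r in \<open>simp add: abs_mult\<close>)
  have "infsum (\<lambda>\<kappa>. \<bar>c \<kappa>\<bar> * r ^ mono_deg \<kappa>) UNIV \<le> M"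
    using infsum_mono[OF cs gs(1)] le gs(2) S by force
  then have 1: "\<exists>S\<le>M. ((\<lambda>\<kappa>. \<bar>c \<kappa>\<bar> * r ^ mono_deg \<kappa>) has_sum S) UNIV"
    using has_sum_infsum[OF cs] by blast
  have 2: "((\<lambda>\<kappa>. monomial y \<kappa> * c \<kappa>) has_sum u (x0 + y)) UNIV" if y: "\<forall>i. \<bar>y $ i\<bar> \<le> r" for y
  proof (rule has_sum_SigmaD[OF toSigma[OF u[OF y]]])
    fix \<kappa>
    have "((\<lambda>\<omega>. monomial y \<kappa> * K \<omega>) has_sum monomial y \<kappa> * c \<kappa>) (fib \<kappa>)"
      unfolding c_def by (rule has_sum_cmult_right[OF has_sum_infsum[OF Ksum]])
    then show "((\<lambda>\<omega>. case (\<kappa>, \<omega>) of (\<kappa>, \<omega>) \<Rightarrow> monomial y (\<nu> \<omega>) * K \<omega>) has_sum monomial y \<kappa> * c \<kappa>) (fib \<kappa>)"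
      by (rule has_sum_cong[THEN iffD1, rotated]) (simp add: fib_def)
  qed
  from 1 2 show ?thesis unfolding multi_series_def by blast
qed

lemma multi_series_single:
  assumes r: "r > 0" and u: "\<And>y. u (x0 + y) = monomial y \<kappa> * k" and M: "\<bar>k\<bar> * r ^ mono_deg \<kappa> \<le> M"
  shows "\<exists>c. multi_series x0 r M u c"
proof (rule multi_series_collect[where \<Omega> = "{()}" and K = "\<lambda>_. k" and \<nu> = "\<lambda>_. \<kappa>", OF r _ M])
  show "((\<lambda>\<omega>::unit. \<bar>k\<bar> * r ^ mono_deg \<kappa>) has_sum \<bar>k\<bar> * r ^ mono_deg \<kappa>) {()}"
    by (rule has_sum_finiteI) auto
  show "((\<lambda>\<omega>::unit. monomial y \<kappa> * k) has_sum u (x0 + y)) {()}" for y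
    by (rule has_sum_finiteI) (auto simp: u)
qed

lemma multi_series_const: "r > 0 \<Longrightarrow> \<exists>c. multi_series x0 r \<bar>k\<bar> (\<lambda>x. k) c"
  by (rule multi_series_single[where \<kappa> = "\<lambda>_. 0"]) (auto simp: monomial_def mono_deg_def)

lemma multi_series_coord: "r > 0 \<Longrightarrow> \<exists>c. multi_series x0 r r (\<lambda>x. x $ i - x0 $ i) c"
proof (rule multi_series_single[where \<kappa> = "\<lambda>j. if j = i then 1 else 0" and k = 1])
  fix y :: "real^'a"
  have "(\<Prod>j\<in>UNIV. (y $ j) ^ (if j = i then 1 else 0)) = (\<Prod>j\<in>UNIV. if j = i then y $ j else 1)"
    by (intro prod.cong) auto
  then show "(x0 + y) $ i - x0 $ i = monomial y (\<lambda>j. if j = i then 1 else 0) * 1"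
    by (simp add: monomial_def)
qed (auto simp: mono_deg_def)

lemma multi_series_mono:
  assumes "multi_series x0 r M u c" "M \<le> N" "\<And>x. u x = v x" shows "multi_series x0 r N v c"
proof -
  have "u = v" using assms(3) by (rule ext)
  moreover have "\<exists>S\<le>N. ((\<lambda>\<nu>. \<bar>c \<nu>\<bar> * r ^ mono_deg \<nu>) has_sum S) UNIV"
    using assms(1,2) unfolding multi_series_def by (blast intro: order_trans)
  ultimately show ?thesis using assms(1) unfolding multi_series_def by simp
qed

lemma multi_series_add:
  assumes "multi_series x0 r M u c" "multi_series x0 r N v d" "r > 0"
  shows "\<exists>e. multi_series x0 r (M + N) (\<lambda>x. u x + v x) e"
proof -
  obtain S1 S2 where S: "S1 \<le> M" "S2 \<le> N" "((\<lambda>\<nu>. \<bar>c \<nu>\<bar> * r ^ mono_deg \<nu>) has_sum S1) UNIV" "((\<lambda>\<nu>. \<bar>d \<nu>\<bar> * r ^ mono_deg \<nu>) has_sum S2) UNIV"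
    using assms(1,2) unfolding multi_series_def by blast
  note add = has_sum_add[OF S(3,4)]
  then have sm: "(\<lambda>\<nu>. \<bar>c \<nu>\<bar> * r ^ mono_deg \<nu> + \<bar>d \<nu>\<bar> * r ^ mono_deg \<nu>) summable_on UNIV" by (auto simp: summable_on_def)
  have le: "\<bar>c \<nu> + d \<nu>\<bar> * r ^ mono_deg \<nu> \<le> \<bar>c \<nu>\<bar> * r ^ mono_deg \<nu> + \<bar>d \<nu>\<bar> * r ^ mono_deg \<nu>" for \<nu>
    unfolding distrib_right[symmetric] using assms(3) by (intro mult_right_mono) auto
  have s2: "(\<lambda>\<nu>. \<bar>c \<nu> + d \<nu>\<bar> * r ^ mono_deg \<nu>) summable_on UNIV"
    by (rule summable_on_abs_bound[OF sm]) (use le assms(3) in \<open>simp add: abs_mult\<close>)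
  have "infsum (\<lambda>\<nu>. \<bar>c \<nu> + d \<nu>\<bar> * r ^ mono_deg \<nu>) UNIV \<le> S1 + S2"
    using infsum_mono[OF s2 sm] le infsumI[OF add] by force
  then have "\<exists>S\<le>M + N. ((\<lambda>\<nu>. \<bar>c \<nu> + d \<nu>\<bar> * r ^ mono_deg \<nu>) has_sum S) UNIV"
    using has_sum_infsum[OF s2] S by (intro exI[of _ "infsum (\<lambda>\<nu>. \<bar>c \<nu> + d \<nu>\<bar> * r ^ mono_deg \<nu>) UNIV"]) auto
  moreover have "((\<lambda>\<nu>. monomial y \<nu> * (c \<nu> + d \<nu>)) has_sum u (x0 + y) + v (x0 + y)) UNIV" if "\<forall>i. \<bar>y $ i\<bar> \<le> r" for y
    unfolding distrib_left using assms(1,2) that by (intro has_sum_add) (auto simp: multi_series_def)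
  ultimately show ?thesis unfolding multi_series_def by (intro exI[of _ "\<lambda>\<nu>. c \<nu> + d \<nu>"]) blast
qed

text \<open>Fubini for unordered sums: the majorant \<open>F\<close> is summable in iterated form,
  which makes the sum over pairs exist and agree with the iterated one.\<close>

lemma has_sum_Sigma_abs:
  fixes f :: "'c \<times> 'd \<Rightarrow> real"
  assumes abs: "\<And>x. x \<in> A \<Longrightarrow> ((\<lambda>y. F (x, y)) has_sum G x) (B x)" "(G has_sum S) A"
    and F: "\<And>x y. x \<in> A \<Longrightarrow> y \<in> B x \<Longrightarrow> \<bar>f (x, y)\<bar> \<le> F (x, y)"
    and f: "\<And>x. x \<in> A \<Longrightarrow> ((\<lambda>y. f (x, y)) has_sum g x) (B x)" "(g has_sum s) A"
  shows "(F has_sum S) (Sigma A B)" "(f has_sum s) (Sigma A B)"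
proof -
  have sF: "F summable_on Sigma A B"
    by (rule summable_on_SigmaI[OF abs(1)]) (use abs(2) F in \<open>auto simp: summable_on_def intro: order_trans[OF abs_ge_zero]\<close>)
  show "(F has_sum S) (Sigma A B)" by (rule has_sum_SigmaI[where g = G]) (use abs sF in auto)
  have sf: "f summable_on Sigma A B" by (rule summable_on_abs_bound[OF sF]) (use F in auto)
  show "(f has_sum s) (Sigma A B)" by (rule has_sum_SigmaI[where g = g]) (use f sf in auto)
qed

text \<open>The Cauchy product is a sum over pairs of multi-indices, which is then collected by the
  sum of the exponents.\<close>

lemma multi_series_mult:
  assumes u: "multi_series x0 r M u c" and v: "multi_series x0 r N v d" and r: "r > 0"
  shows "\<exists>e. multi_series x0 r (M * N) (\<lambda>x. u x * v x) e"
proof -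
  obtain S1 S2 where S: "S1 \<le> M" "S2 \<le> N" "((\<lambda>\<nu>. \<bar>c \<nu>\<bar> * r ^ mono_deg \<nu>) has_sum S1) UNIV" "((\<lambda>\<nu>. \<bar>d \<nu>\<bar> * r ^ mono_deg \<nu>) has_sum S2) UNIV"
    using u v unfolding multi_series_def by blast
  have S0: "0 \<le> S1" "0 \<le> S2" using has_sum_nonneg[OF S(3)] has_sum_nonneg[OF S(4)] r by simp_all
  define K where "K = (\<lambda>(\<nu>, \<mu>). c \<nu> * d \<mu>)"
  define F where "F = (\<lambda>(\<nu>, \<mu>). (\<bar>c \<nu>\<bar> * r ^ mono_deg \<nu>) * (\<bar>d \<mu>\<bar> * r ^ mono_deg \<mu>))"
  have F: "((\<lambda>\<mu>. F (\<nu>, \<mu>)) has_sum (\<bar>c \<nu>\<bar> * r ^ mono_deg \<nu>) * S2) UNIV" for \<nu>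
    unfolding F_def by (simp, rule has_sum_cmult_right[OF S(4)])
  have FS: "((\<lambda>\<nu>. (\<bar>c \<nu>\<bar> * r ^ mono_deg \<nu>) * S2) has_sum S1 * S2) UNIV" by (rule has_sum_cmult_left[OF S(3)])
  show ?thesis
  proof (rule multi_series_collect[where \<Omega> = "UNIV \<times> UNIV" and K = K and \<nu> = "\<lambda>(\<nu>, \<mu>). (\<lambda>i. \<nu> i + \<mu> i)", OF r])
    have "(F has_sum S1 * S2) (UNIV \<times> UNIV)"
      by (rule has_sum_Sigma_abs(1)[where f = "\<lambda>_. 0" and g = "\<lambda>_. 0" and s = 0, OF F FS]) (use r in \<open>auto simp: F_def\<close>)
    then show "((\<lambda>\<omega>. \<bar>K \<omega>\<bar> * r ^ mono_deg (case \<omega> of (\<nu>, \<mu>) \<Rightarrow> \<lambda>i. \<nu> i + \<mu> i)) has_sum S1 * S2) (UNIV \<times> UNIV)"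
      by (rule has_sum_cong[THEN iffD1, rotated]) (auto simp: F_def K_def mono_deg_add power_add abs_mult)
    show "S1 * S2 \<le> M * N" using S S0 by (intro mult_mono) auto
    fix y :: "real^'a" assume y: "\<forall>i. \<bar>y $ i\<bar> \<le> r"
    define f where "f = (\<lambda>(\<nu>, \<mu>). (monomial y \<nu> * c \<nu>) * (monomial y \<mu> * d \<mu>))"
    have hu: "((\<lambda>\<nu>. monomial y \<nu> * c \<nu>) has_sum u (x0 + y)) UNIV" and hv: "((\<lambda>\<nu>. monomial y \<nu> * d \<nu>) has_sum v (x0 + y)) UNIV"
      using u v y by (auto simp: multi_series_def)
    have "(f has_sum u (x0 + y) * v (x0 + y)) (UNIV \<times> UNIV)"
    proof (rule has_sum_Sigma_abs(2)[OF F FS])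
      show "((\<lambda>\<mu>. f (\<nu>, \<mu>)) has_sum (monomial y \<nu> * c \<nu>) * v (x0 + y)) UNIV" for \<nu>
        unfolding f_def by (simp, rule has_sum_cmult_right[OF hv])
      show "((\<lambda>\<nu>. (monomial y \<nu> * c \<nu>) * v (x0 + y)) has_sum u (x0 + y) * v (x0 + y)) UNIV" by (rule has_sum_cmult_left[OF hu])
      show "\<bar>f (\<nu>, \<mu>)\<bar> \<le> F (\<nu>, \<mu>)" for \<nu> \<mu>
        unfolding f_def F_def using abs_monomial_le[OF y, of \<nu>] abs_monomial_le[OF y, of \<mu>] r
        by (simp add: abs_mult mult.commute[of "\<bar>c \<nu>\<bar>"] mult.commute[of "\<bar>d \<mu>\<bar>"]) (intro mult_mono mult_right_mono; simp)
    qed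
    then show "((\<lambda>\<omega>. monomial y (case \<omega> of (\<nu>, \<mu>) \<Rightarrow> \<lambda>i. \<nu> i + \<mu> i) * K \<omega>) has_sum u (x0 + y) * v (x0 + y)) (UNIV \<times> UNIV)"
      by (rule has_sum_cong[THEN iffD1, rotated]) (auto simp: f_def K_def monomial_add mult_ac)
  qed
qed

lemma multi_series_power:
  assumes "multi_series x0 r M u c" "r > 0" shows "\<exists>d. multi_series x0 r (M ^ j) (\<lambda>x. u x ^ j) d"
proof (induction j)
  case 0 then show ?case using multi_series_const[OF assms(2), of x0 1] by simp
next
  case (Suc j) then show ?case using multi_series_mult[OF assms(1) _ assms(2)] by auto
qed

text \<open>The expansion runs over pairs of a power and a multi-index. The absolute sum for
  \<open>q ^ j\<close> is at most \<open>M ^ j\<close>, so absolute convergence of the outer series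
  at \<open>M\<close> controls the whole double sum.\<close>

lemma multi_series_compose:
  assumes q: "multi_series x0 r M q c" and r: "r > 0"
    and A: "\<And>t. \<bar>t\<bar> < \<rho> \<Longrightarrow> (\<lambda>j. A j * t ^ j) sums U t" and M: "M < \<rho>"
  shows "\<exists>N d. multi_series x0 r N (\<lambda>x. U (q x)) d"
proof -
  have "\<forall>j. \<exists>d. multi_series x0 r (M ^ j) (\<lambda>x. q x ^ j) d" using multi_series_power[OF q r] by blast
  then obtain D where D: "\<And>j. multi_series x0 r (M ^ j) (\<lambda>x. q x ^ j) (D j)" by metis
  then have "\<forall>j. \<exists>S\<le>M ^ j. ((\<lambda>\<nu>. \<bar>D j \<nu>\<bar> * r ^ mono_deg \<nu>) has_sum S) UNIV"
    unfolding multi_series_def by blast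
  then obtain S where S: "\<And>j. S j \<le> M ^ j" "\<And>j. ((\<lambda>\<nu>. \<bar>D j \<nu>\<bar> * r ^ mono_deg \<nu>) has_sum S j) UNIV" by metis
  have S0: "0 \<le> S j" for j using has_sum_nonneg[OF S(2)[of j]] r by simp
  obtain S1 where S1: "S1 \<le> M" "((\<lambda>\<nu>. \<bar>c \<nu>\<bar> * r ^ mono_deg \<nu>) has_sum S1) UNIV" using q unfolding multi_series_def by blast
  have M0: "0 \<le> M" using has_sum_nonneg[OF S1(2)] r S1(1) by simp
  \<comment> \<open>Convergence at a point strictly beyond \<open>M\<close> yields absolute
    convergence at \<open>M\<close>.\<close>
  define M' where "M' = (M + \<rho>) / 2"
  have M': "M < M'" "M' < \<rho>" using M by (auto simp: M'_def)
  have sm: "summable (\<lambda>j. norm (A j * M ^ j))"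
    by (rule powser_insidea[of A M']) (use A[of M'] M' M0 in \<open>auto simp: sums_iff\<close>)
  have sm2: "summable (\<lambda>j. norm (\<bar>A j\<bar> * S j))"
    by (rule summable_comparison_test'[OF sm, of 0])
       (use S S0 M0 in \<open>auto simp: abs_mult intro!: mult_left_mono\<close>)
  obtain N where N: "((\<lambda>j. \<bar>A j\<bar> * S j) has_sum N) UNIV"
    using norm_summable_imp_has_sum[OF sm2 summable_sums[OF summable_norm_cancel[OF sm2]]] by blast
  define K where "K = (\<lambda>(j, \<nu>). A j * D j \<nu>)"
  define F where "F = (\<lambda>(j, \<nu>). \<bar>A j\<bar> * (\<bar>D j \<nu>\<bar> * r ^ mono_deg \<nu>))"
  have F: "((\<lambda>\<nu>. F (j, \<nu>)) has_sum \<bar>A j\<bar> * S j) UNIV" for j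
    unfolding F_def by (simp, rule has_sum_cmult_right[OF S(2)])
  have "\<exists>d. multi_series x0 r N (\<lambda>x. U (q x)) d"
  proof (rule multi_series_collect[where \<Omega> = "UNIV \<times> UNIV" and K = K and \<nu> = snd and S = N, OF r])
    have "(F has_sum N) (UNIV \<times> UNIV)"
      by (rule has_sum_Sigma_abs(1)[where f = "\<lambda>_. 0" and g = "\<lambda>_. 0" and s = 0, OF F N]) (use r in \<open>auto simp: F_def\<close>)
    then show "((\<lambda>\<omega>. \<bar>K \<omega>\<bar> * r ^ mono_deg (snd \<omega>)) has_sum N) (UNIV \<times> UNIV)"
      by (rule has_sum_cong[THEN iffD1, rotated]) (auto simp: F_def K_def abs_mult)
    fix y :: "real^'a" assume y: "\<forall>i. \<bar>y $ i\<bar> \<le> r"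
    define f where "f = (\<lambda>(j, \<nu>). A j * (monomial y \<nu> * D j \<nu>))"
    have hq: "((\<lambda>\<nu>. monomial y \<nu> * D j \<nu>) has_sum q (x0 + y) ^ j) UNIV" for j
      using D y by (auto simp: multi_series_def)
    have qM: "\<bar>q (x0 + y)\<bar> \<le> M"
    proof -
      have "((\<lambda>\<nu>. monomial y \<nu> * c \<nu>) has_sum q (x0 + y)) UNIV" using q y by (simp add: multi_series_def)
      then have "\<bar>q (x0 + y)\<bar> \<le> S1" by (rule has_sum_abs_le[OF S1(2)]) (use abs_monomial_le[OF y] in \<open>auto simp: abs_mult mult.commute intro: mult_left_mono\<close>)
      then show ?thesis using S1 by simp
    qed
    have "(f has_sum U (q (x0 + y))) (UNIV \<times> UNIV)"
    proof (rule has_sum_Sigma_abs(2)[OF F N])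
      show "((\<lambda>\<nu>. f (j, \<nu>)) has_sum A j * q (x0 + y) ^ j) UNIV" for j
        unfolding f_def by (simp, rule has_sum_cmult_right[OF hq])
      have "summable (\<lambda>j. norm (A j * q (x0 + y) ^ j))"
        by (rule powser_insidea[of A M']) (use A[of M'] M' M0 qM in \<open>auto simp: sums_iff\<close>)
      then show "((\<lambda>j. A j * q (x0 + y) ^ j) has_sum U (q (x0 + y))) UNIV"
        by (rule norm_summable_imp_has_sum) (rule A, use qM M in linarith)
      show "\<bar>f (j, \<nu>)\<bar> \<le> F (j, \<nu>)" for j \<nu>
        unfolding f_def F_def using abs_monomial_le[OF y, of \<nu>] r
        by (simp add: abs_mult mult.commute[of "\<bar>D j \<nu>\<bar>"]) (intro mult_left_mono mult_right_mono; simp)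
    qed
    then show "((\<lambda>\<omega>. monomial y (snd \<omega>) * K \<omega>) has_sum U (q (x0 + y))) (UNIV \<times> UNIV)"
      by (rule has_sum_cong[THEN iffD1, rotated]) (auto simp: f_def K_def mult_ac)
  qed simp
  then show ?thesis by blast
qed

lemma multi_series_sum:
  assumes r: "r > 0" and "finite I" and "\<And>j. j \<in> I \<Longrightarrow> \<exists>c. multi_series x0 r (M j) (u j) c"
  shows "\<exists>c. multi_series x0 r (\<Sum>j\<in>I. M j) (\<lambda>x. \<Sum>j\<in>I. u j x) c"
  using assms(2,3)
proof (induction I)
  case empty then show ?case using multi_series_const[OF r, of x0 0] by simp
next
  case (insert j I)
  then obtain c d where "multi_series x0 r (M j) (u j) c" "multi_series x0 r (\<Sum>j\<in>I. M j) (\<lambda>x. \<Sum>j\<in>I. u j x) d" by blast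
  from multi_series_add[OF this r] insert(1,2) show ?case by simp
qed

lemma multi_series_polynomial:
  fixes q :: "real^'a::finite \<Rightarrow> real"
  assumes "real_polynomial_function q" "r > 0" shows "\<exists>M c. multi_series x0 r M q c"
  using assms(1)
proof induction
  case (linear f)
  have lin: "linear f" using linear by (rule bounded_linear.linear)
  have "\<exists>c. multi_series x0 r (\<bar>f (axis i 1)\<bar> * r) (\<lambda>x. f (axis i 1) * (x $ i - x0 $ i)) c" for i
  proof -
    obtain c d where "multi_series x0 r \<bar>f (axis i 1)\<bar> (\<lambda>x. f (axis i 1)) c" "multi_series x0 r r (\<lambda>x. x $ i - x0 $ i) d"
      using multi_series_const[OF assms(2)] multi_series_coord[OF assms(2)] by blast
    from multi_series_mult[OF this assms(2)] show ?thesis .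
  qed
  from multi_series_sum[where I = UNIV and u = "\<lambda>i x. f (axis i 1) * (x $ i - x0 $ i)", OF assms(2) finite this]
  obtain c where c: "multi_series x0 r (\<Sum>i\<in>UNIV. \<bar>f (axis i 1)\<bar> * r) (\<lambda>x. \<Sum>i\<in>UNIV. f (axis i 1) * (x $ i - x0 $ i)) c" by blast
  obtain d where "multi_series x0 r \<bar>f x0\<bar> (\<lambda>x. f x0) d" using multi_series_const[OF assms(2)] by blast
  from multi_series_add[OF c this assms(2)]
  obtain e M where e: "multi_series x0 r M (\<lambda>x. (\<Sum>i\<in>UNIV. f (axis i 1) * (x $ i - x0 $ i)) + f x0) e" by blast
  have "(\<Sum>i\<in>UNIV. f (axis i 1) * (x $ i - x0 $ i)) + f x0 = f x" for x
  proof -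
    have "f (x - x0) = f (\<Sum>i\<in>UNIV. (x - x0) $ i *\<^sub>R axis i 1)"
      using basis_expansion[of "x - x0"] by (simp add: scalar_mult_eq_scaleR)
    also have "\<dots> = (\<Sum>i\<in>UNIV. f (axis i 1) * (x $ i - x0 $ i))"
      by (simp add: linear_sum[OF lin] linear_cmul[OF lin] mult.commute)
    finally show ?thesis by (simp add: linear_diff[OF lin])
  qed
  then show ?case using e by auto
next
  case (const k) then show ?case using multi_series_const[OF assms(2)] by blast
next
  case (add f g) then show ?case using multi_series_add[OF _ _ assms(2)] by blast
next
  case (mult f g) then show ?case using multi_series_mult[OF _ _ assms(2)] by blast
qed

text \<open>Around \<open>x0\<close> the difference is a polynomial without constant term, so its
  absolute sum on a small cube is as small as desired. This supplies the condition
  \<open>M < \<rho>\<close> for composition with the profile.\<close>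

lemma multi_series_sqnorm:
  fixes x0 :: "real^'a::finite"
  assumes e: "e > 0"
  shows "\<exists>r>0. \<exists>c. multi_series x0 r e (\<lambda>x. x \<bullet> x - x0 \<bullet> x0) c"
proof -
  define R where "R = (\<Sum>i\<in>UNIV. 2 * \<bar>x0 $ i\<bar> + 1)"
  have R: "R > 0" unfolding R_def by (intro sum_pos) auto
  define r where "r = min 1 (e / R)"
  have r: "0 < r" "r \<le> 1" "r * R \<le> e" using e R by (auto simp: r_def min_def field_simps)
  have "\<exists>c. multi_series x0 r (r * (2 * \<bar>x0 $ i\<bar> + 1)) (\<lambda>x. (x $ i - x0 $ i) * (2 * x0 $ i + (x $ i - x0 $ i))) c" for i
  proof -
    obtain c d where c: "multi_series x0 r r (\<lambda>x. x $ i - x0 $ i) c" and d: "multi_series x0 r \<bar>2 * x0 $ i\<bar> (\<lambda>x. 2 * x0 $ i) d"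
      using multi_series_const[OF r(1)] multi_series_coord[OF r(1)] by blast
    obtain e where e: "multi_series x0 r (\<bar>2 * x0 $ i\<bar> + r) (\<lambda>x. 2 * x0 $ i + (x $ i - x0 $ i)) e"
      using multi_series_add[OF d c r(1)] by blast
    have "multi_series x0 r (2 * \<bar>x0 $ i\<bar> + 1) (\<lambda>x. 2 * x0 $ i + (x $ i - x0 $ i)) e"
      by (rule multi_series_mono[OF e]) (use r(2) in \<open>simp_all add: abs_mult\<close>)
    from multi_series_mult[OF c this r(1)] show ?thesis .
  qed
  from multi_series_sum[where I = UNIV and u = "\<lambda>i x. (x $ i - x0 $ i) * (2 * x0 $ i + (x $ i - x0 $ i))", OF r(1) finite this]
  obtain c where c: "multi_series x0 r (\<Sum>i\<in>UNIV. r * (2 * \<bar>x0 $ i\<bar> + 1)) (\<lambda>x. \<Sum>i\<in>UNIV. (x $ i - x0 $ i) * (2 * x0 $ i + (x $ i - x0 $ i))) c" by blast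
  have "(\<Sum>i\<in>UNIV. (x $ i - x0 $ i) * (2 * x0 $ i + (x $ i - x0 $ i))) = x \<bullet> x - x0 \<bullet> x0" for x
    unfolding inner_vec_def sum_subtractf[symmetric] by (intro sum.cong) (simp_all add: algebra_simps)
  moreover have "(\<Sum>i\<in>UNIV. r * (2 * \<bar>x0 $ i\<bar> + 1)) \<le> e"
    unfolding sum_distrib_left[symmetric] R_def[symmetric] by (rule r(3))
  ultimately have "multi_series x0 r e (\<lambda>x. x \<bullet> x - x0 \<bullet> x0) c"
    by (intro multi_series_mono[OF c]) auto
  then show ?thesis using r(1) by blast
qed

lemma has_sum_vec_lambda:
  fixes f :: "'b::finite \<Rightarrow> 'c \<Rightarrow> real"
  assumes "\<And>\<alpha>. (f \<alpha> has_sum s \<alpha>) A" shows "((\<lambda>x. \<chi> \<alpha>. f \<alpha> x) has_sum (\<chi> \<alpha>. s \<alpha>)) A"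
  using assms unfolding has_sum_def by (intro vec_tendstoI) simp

lemma multi_series_shrink:
  assumes "multi_series x0 r M u c" "0 < r'" "r' \<le> r" shows "multi_series x0 r' M u c"
proof -
  obtain S where S: "S \<le> M" "((\<lambda>\<nu>. \<bar>c \<nu>\<bar> * r ^ mono_deg \<nu>) has_sum S) UNIV" using assms(1) unfolding multi_series_def by blast
  then have sm: "(\<lambda>\<nu>. \<bar>c \<nu>\<bar> * r ^ mono_deg \<nu>) summable_on UNIV" "infsum (\<lambda>\<nu>. \<bar>c \<nu>\<bar> * r ^ mono_deg \<nu>) UNIV = S"
    by (auto simp: summable_on_def infsumI)
  have le: "\<bar>c \<nu>\<bar> * r' ^ mono_deg \<nu> \<le> \<bar>c \<nu>\<bar> * r ^ mono_deg \<nu>" for \<nu>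
    using assms by (intro mult_left_mono power_mono) auto
  have s2: "(\<lambda>\<nu>. \<bar>c \<nu>\<bar> * r' ^ mono_deg \<nu>) summable_on UNIV"
    by (rule summable_on_abs_bound[OF sm(1)]) (use le assms in \<open>simp add: abs_mult\<close>)
  have "infsum (\<lambda>\<nu>. \<bar>c \<nu>\<bar> * r' ^ mono_deg \<nu>) UNIV \<le> infsum (\<lambda>\<nu>. \<bar>c \<nu>\<bar> * r ^ mono_deg \<nu>) UNIV"
    by (rule infsum_mono[OF s2 sm(1)]) (rule le)
  also have "\<dots> \<le> M" using sm(2) S(1) by simp
  finally have "\<exists>S\<le>M. ((\<lambda>\<nu>. \<bar>c \<nu>\<bar> * r' ^ mono_deg \<nu>) has_sum S) UNIV"
    by (intro exI[of _ "infsum (\<lambda>\<nu>. \<bar>c \<nu>\<bar> * r' ^ mono_deg \<nu>) UNIV"] conjI has_sum_infsum[OF s2])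
  moreover have "((\<lambda>\<nu>. monomial y \<nu> * c \<nu>) has_sum u (x0 + y)) UNIV" if "\<forall>i. \<bar>y $ i\<bar> \<le> r'" for y
  proof -
    have "\<forall>i. \<bar>y $ i\<bar> \<le> r" using order_trans[OF _ assms(3)] that by blast
    then show ?thesis using assms(1) by (simp add: multi_series_def)
  qed
  ultimately show ?thesis by (simp add: multi_series_def)
qed

text \<open>The profile is expanded at \<open>x0 \<bullet> x0\<close> in the variable
  \<open>x \<bullet> x - x0 \<bullet> x0\<close>. The origin is no exception, because the profile is
  analytic at \<open>z = 0\<close>.\<close>

lemma real_analytic_radial_times_polynomial:
  fixes P :: "'b::finite \<Rightarrow> real^'a::finite \<Rightarrow> real"
  assumes a: "\<And>z. z \<ge> 0 \<Longrightarrow> \<exists>c r. power_series_at a z c r" and P: "\<And>\<alpha>. real_polynomial_function (P \<alpha>)"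
    and F: "\<And>x. x \<in> ball 0 1 \<Longrightarrow> F x = (\<chi> \<alpha>. a (x \<bullet> x) * P \<alpha> x)"
  shows "real_analytic_on (ball 0 1) F"
  unfolding real_analytic_on_def
proof
  fix x0 :: "real^'a" assume x0: "x0 \<in> ball 0 1"
  obtain A \<rho> where A: "power_series_at a (x0 \<bullet> x0) A \<rho>" using a[of "x0 \<bullet> x0"] by auto
  then have \<rho>: "\<rho> > 0" by (simp add: power_series_at_def)
  obtain r0 c0 where r0: "r0 > 0" and c0: "multi_series x0 r0 (\<rho> / 2) (\<lambda>x. x \<bullet> x - x0 \<bullet> x0) c0"
    using multi_series_sqnorm[of "\<rho> / 2" x0] \<rho> by auto
  \<comment> \<open>The second bound keeps the ball about \<open>x0\<close> inside the unit ball,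
    where \<open>F\<close> has the given form.\<close>
  define r where "r = min r0 (1 - norm x0)"
  have r: "0 < r" "r \<le> r0" "r \<le> 1 - norm x0" using r0 x0 by (auto simp: r_def)
  have c: "multi_series x0 r (\<rho> / 2) (\<lambda>x. x \<bullet> x - x0 \<bullet> x0) c0" by (rule multi_series_shrink[OF c0 r(1,2)])
  obtain N d where d: "multi_series x0 r N (\<lambda>x. a (x0 \<bullet> x0 + (x \<bullet> x - x0 \<bullet> x0))) d"
    using multi_series_compose[OF c r(1), of \<rho> A "\<lambda>t. a (x0 \<bullet> x0 + t)"] A \<rho> by (auto simp: power_series_at_def)
  have "\<exists>e. \<exists>M. multi_series x0 r M (\<lambda>x. a (x \<bullet> x) * P \<alpha> x) e" for \<alpha>
  proof -
    obtain M e where "multi_series x0 r M (P \<alpha>) e" using multi_series_polynomial[OF P r(1)] by blast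
    from multi_series_mult[OF d this r(1)] show ?thesis by auto
  qed
  then obtain e where e: "\<And>\<alpha>. \<exists>M. multi_series x0 r M (\<lambda>x. a (x \<bullet> x) * P \<alpha> x) (e \<alpha>)" by metis
  show "\<exists>r>0. \<exists>c :: ('a \<Rightarrow> nat) \<Rightarrow> real^'b. \<forall>x\<in>ball x0 r.
        ((\<lambda>\<nu>. (\<Prod>i\<in>UNIV. (x $ i - x0 $ i) ^ \<nu> i) *\<^sub>R c \<nu>) has_sum F x) UNIV"
  proof (intro exI[of _ r] conjI exI[of _ "\<lambda>\<nu>. \<chi> \<alpha>. e \<alpha> \<nu>"] ballI)
    fix x assume x: "x \<in> ball x0 r"
    define y where "y = x - x0"
    have nx: "norm y < r" using x by (simp add: y_def dist_norm norm_minus_commute)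
    have "norm x \<le> norm y + norm x0" unfolding y_def using norm_triangle_ineq[of "x - x0" x0] by simp
    then have "x \<in> ball 0 1" using nx r by simp
    then have Fx: "F x = (\<chi> \<alpha>. a (x \<bullet> x) * P \<alpha> x)" by (rule F)
    have yi: "\<forall>i. \<bar>y $ i\<bar> \<le> r" using order_trans[OF component_le_norm_cart less_imp_le[OF nx]] by blast
    have "((\<lambda>\<nu>. monomial y \<nu> * e \<alpha> \<nu>) has_sum a (x \<bullet> x) * P \<alpha> x) UNIV" for \<alpha>
    proof -
      have "((\<lambda>\<nu>. monomial y \<nu> * e \<alpha> \<nu>) has_sum a ((x0 + y) \<bullet> (x0 + y)) * P \<alpha> (x0 + y)) UNIV"
        using e[of \<alpha>] yi by (auto simp: multi_series_def)
      then show ?thesis by (simp add: y_def)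
    qed
    then have "((\<lambda>\<nu>. \<chi> \<alpha>. monomial y \<nu> * e \<alpha> \<nu>) has_sum F x) UNIV" unfolding Fx by (rule has_sum_vec_lambda)
    moreover have "(\<chi> \<alpha>. monomial y \<nu> * e \<alpha> \<nu>) = (\<Prod>i\<in>UNIV. (x $ i - x0 $ i) ^ \<nu> i) *\<^sub>R (\<chi> \<alpha>. e \<alpha> \<nu>)" for \<nu>
      by (simp add: vec_eq_iff monomial_def y_def)
    ultimately show "((\<lambda>\<nu>. (\<Prod>i\<in>UNIV. (x $ i - x0 $ i) ^ \<nu> i) *\<^sub>R (\<chi> \<alpha>. e \<alpha> \<nu>)) has_sum F x) UNIV" by simp
  qed (rule r)
qed

section \<open>The Dirichlet problem\<close>

text \<open>Compactness of the closed ball bounds the partial derivatives, and convexity of the open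
  ball permits the mean value inequality.\<close>

lemma C1_on_lipschitz_ball:
  fixes f :: "real^'a::finite \<Rightarrow> real"
  assumes f: "C1_on UNIV f" shows "\<exists>K\<ge>0. \<forall>x\<in>ball 0 1. \<forall>y\<in>ball 0 1. \<bar>f x - f y\<bar> \<le> K * norm (x - y)"
proof -
  have cont: "continuous_on UNIV (partial_deriv i f)" and diff: "f differentiable (at x)" for i x
    using f by (simp_all add: C1_on_def)
  have "\<exists>K. \<forall>x\<in>cball 0 1. \<bar>partial_deriv i f x\<bar> \<le> K" for i
  proof -
    have "compact (partial_deriv i f ` cball 0 1)"
      by (rule compact_continuous_image[OF continuous_on_subset[OF cont] compact_cball]) simp
    then show ?thesis unfolding bounded_iff[symmetric] using compact_imp_bounded by (fastforce simp: bounded_iff)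
  qed
  then obtain K where K: "\<And>i x. x \<in> cball 0 1 \<Longrightarrow> \<bar>partial_deriv i f x\<bar> \<le> K i" by metis
  have K0: "0 \<le> K i" for i using K[of 0 i] by simp
  have "\<bar>f x - f y\<bar> \<le> (\<Sum>i\<in>UNIV. K i) * norm (x - y)" if xy: "x \<in> ball 0 1" "y \<in> ball 0 1" for x y
  proof -
    have "norm (f x - f y) \<le> (\<Sum>i\<in>UNIV. K i) * norm (x - y)"
    proof (rule differentiable_bound[OF convex_ball _ _ xy])
      fix z :: "real^'a" assume z: "z \<in> ball 0 1"
      have d: "(f has_derivative frechet_derivative f (at z)) (at z)" by (rule differentiable_has_derivative[OF diff])
      then show "(f has_derivative frechet_derivative f (at z)) (at z within ball 0 1)" by (rule has_derivative_at_withinI)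
      have lin: "linear (frechet_derivative f (at z))" using d by (rule has_derivative_linear)
      show "onorm (frechet_derivative f (at z)) \<le> (\<Sum>i\<in>UNIV. K i)"
      proof (rule onorm_le)
        fix h :: "real^'a"
        have "frechet_derivative f (at z) h = frechet_derivative f (at z) (\<Sum>i\<in>UNIV. h $ i *\<^sub>R axis i 1)"
          using basis_expansion[of h] by (simp add: scalar_mult_eq_scaleR)
        also have "\<dots> = (\<Sum>i\<in>UNIV. h $ i * partial_deriv i f z)"
          by (simp add: linear_sum[OF lin] linear_cmul[OF lin] partial_deriv_def)
        finally have "norm (frechet_derivative f (at z) h) \<le> (\<Sum>i\<in>UNIV. \<bar>h $ i * partial_deriv i f z\<bar>)"
          by simp
        also have "\<dots> \<le> (\<Sum>i\<in>UNIV. K i * norm h)"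
        proof (rule sum_mono)
          fix i
          have "\<bar>partial_deriv i f z\<bar> * \<bar>h $ i\<bar> \<le> K i * norm h"
            using K[of z i] z component_le_norm_cart[of h i] K0 by (intro mult_mono) auto
          then show "\<bar>h $ i * partial_deriv i f z\<bar> \<le> K i * norm h" by (simp add: abs_mult mult.commute)
        qed
        finally show "norm (frechet_derivative f (at z) h) \<le> (\<Sum>i\<in>UNIV. K i) * norm h" by (simp add: sum_distrib_right)
      qed
    qed
    then show ?thesis by simp
  qed
  moreover have "0 \<le> (\<Sum>i\<in>UNIV. K i)" by (intro sum_nonneg K0)
  ultimately show ?thesis by blast
qed

lemma C1_on_vec_lipschitz_ball:
  fixes f :: "'b::finite \<Rightarrow> real^'a::finite \<Rightarrow> real"
  assumes "\<And>\<alpha>. C1_on UNIV (f \<alpha>)" shows "\<exists>K. K-lipschitz_on (ball 0 1) (\<lambda>x. \<chi> \<alpha>. f \<alpha> x)"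
proof -
  from C1_on_lipschitz_ball[OF assms] have "\<forall>\<alpha>. \<exists>K\<ge>0. \<forall>x\<in>ball 0 1. \<forall>y\<in>ball 0 1. \<bar>f \<alpha> x - f \<alpha> y\<bar> \<le> K * norm (x - y)"
    by blast
  from choice[OF this] obtain K where K: "\<And>\<alpha>. 0 \<le> K \<alpha>"
    "\<And>\<alpha> x y. x \<in> ball 0 1 \<Longrightarrow> y \<in> ball 0 1 \<Longrightarrow> \<bar>f \<alpha> x - f \<alpha> y\<bar> \<le> K \<alpha> * norm (x - y)" by blast
  have "(\<Sum>\<alpha>\<in>UNIV. K \<alpha>)-lipschitz_on (ball 0 1) (\<lambda>x. \<chi> \<alpha>. f \<alpha> x)"
  proof (rule lipschitz_onI)
    fix x y :: "real^'a" assume xy: "x \<in> ball 0 1" "y \<in> ball 0 1"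
    have "norm ((\<chi> \<alpha>. f \<alpha> x) - (\<chi> \<alpha>. f \<alpha> y)) \<le> (\<Sum>\<alpha>\<in>UNIV. \<bar>f \<alpha> x - f \<alpha> y\<bar>)"
      using norm_le_l1_cart[of "(\<chi> \<alpha>. f \<alpha> x) - (\<chi> \<alpha>. f \<alpha> y)"] by simp
    also have "\<dots> \<le> (\<Sum>\<alpha>\<in>UNIV. K \<alpha> * norm (x - y))" by (intro sum_mono K(2) xy)
    finally show "dist (\<chi> \<alpha>. f \<alpha> x) (\<chi> \<alpha>. f \<alpha> y) \<le> (\<Sum>\<alpha>\<in>UNIV. K \<alpha>) * dist x y"
      by (simp add: dist_norm sum_distrib_right)
  qed (intro sum_nonneg K(1))
  then show ?thesis by blast
qed

section \<open>Solutions of the Dirichlet problem attached to profiles\<close>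

context lo_profile begin

lemma C1_on_Fmap: "C1_on UNIV (\<lambda>x. a (x \<bullet> x) * P \<alpha> x)"
proof (rule C1_on_mult[OF C1_on_radial polynomial_C1_on[OF poly]])
  show "(a has_real_derivative deriv a z) (at z)" if "z \<ge> 0" for z using pf(1)[OF that] .
  show "continuous_on {0..} (deriv a)" by (rule C1_half_continuous[OF C1_da])
qed

lemma Fmap_dirichlet_solution:
  assumes f: "\<And>x \<alpha>. norm x = 1 \<Longrightarrow> f x $ \<alpha> = P \<alpha> x"
  shows "dirichlet_solution (ball 0 1) (\<lambda>x. a 1 *\<^sub>R f x) (restrict Fmap (cball 0 1))"
proof -
  have Fm: "Fmap = (\<lambda>x. \<chi> \<alpha>. a (x \<bullet> x) * P \<alpha> x)" by (rule ext) (simp add: Fmap_def)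
  have "continuous_on UNIV (\<lambda>x. a (x \<bullet> x) * P \<alpha> x)" for \<alpha> by (rule C1_on_continuous[OF C1_on_Fmap])
  then have "continuous_on UNIV Fmap" unfolding Fm by (intro continuous_on_vec_lambda)
  then have 1: "continuous_on (cball 0 1) Fmap" by (rule continuous_on_subset) simp
  obtain K where K: "K-lipschitz_on (ball 0 1) Fmap"
    using C1_on_vec_lipschitz_ball[where f = "\<lambda>\<alpha> x. a (x \<bullet> x) * P \<alpha> x", OF C1_on_Fmap] unfolding Fm by blast
  have "K-lipschitz_on (ball 0 1) (restrict Fmap (cball 0 1))"
    using K by (rule lipschitz_on_transform) simp
  moreover have "continuous_on (cball 0 1) (restrict Fmap (cball 0 1))"
    using 1 by (rule continuous_on_eq) simp
  moreover have "weak_minimal_surface_system (ball 0 1) (restrict Fmap (cball 0 1))"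
    by (rule weak_solution) simp
  moreover have "restrict Fmap (cball 0 1) x = a 1 *\<^sub>R f x" if "x \<in> sphere 0 1" for x
    using that f[of x] by (auto simp: Fmap_def vec_eq_iff dot_square_norm)
  ultimately show ?thesis unfolding dirichlet_solution_def by auto
qed

lemma Fmap_real_analytic: "real_analytic_on (ball 0 1) (restrict Fmap (cball 0 1))"
proof (rule real_analytic_radial_times_polynomial[of a P])
  show "\<exists>c r. power_series_at a z c r" if "z \<ge> 0" for z
    using prof that by (auto simp: profile_def analytic_at_point_def)
qed (auto simp: Fmap_def poly)

end

context lawson_osserman begin

text \<open>Since the squares of the components add up to 1 on the sphere, some component is nonzero
  along a given ray. There the map determines the profile on \<open>(0, 1)\<close>, and continuity
  gives the initial value, by which solutions are distinguished.\<close>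

lemma profile_determined:
  assumes ab: "profile a b" and ab': "profile a' b'"
    and eq: "\<And>x. x \<in> cball 0 1 \<Longrightarrow> (\<chi> \<alpha>. a (x \<bullet> x) * P \<alpha> x) = (\<chi> \<alpha>. a' (x \<bullet> x) * P \<alpha> x)"
  shows "a 0 = a' 0"
proof -
  define u :: "real^'a" where "u = axis undefined 1"
  have u: "norm u = 1" by (simp add: u_def)
  have "(\<Sum>\<alpha>\<in>UNIV. (P \<alpha> u)\<^sup>2) = 1" using nrm[of u] u by (simp add: dot_square_norm)
  then obtain \<alpha> where \<alpha>: "P \<alpha> u \<noteq> 0" by force
  have eq': "a z = a' z" if z: "0 < z" "z < 1" for z
  proof -
    have n: "(sqrt z *\<^sub>R u) \<bullet> (sqrt z *\<^sub>R u) = z" using u z by (simp add: dot_square_norm)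
    have "sqrt z *\<^sub>R u \<in> cball 0 1" using u z by simp
    from arg_cong[OF eq[OF this], of "\<lambda>v. v $ \<alpha>"]
    have "a z * P \<alpha> (sqrt z *\<^sub>R u) = a' z * P \<alpha> (sqrt z *\<^sub>R u)" unfolding n by simp
    then show ?thesis using \<alpha> z by (simp add: hom)
  qed
  have lim: "(v \<longlongrightarrow> v 0) (at_right 0)" if "profile v w" for v w :: "real \<Rightarrow> real"
    using DERIV_isCont[OF profile_facts(1)[OF that order_refl]] by (auto simp: isCont_def intro: filterlim_at_split[THEN iffD1, THEN conjunct2])
  have "eventually (\<lambda>z. a z = a' z) (at_right 0)"
    using eventually_at_right_less[of 0] eventually_at_right_real[of 0 1] by (auto elim!: eventually_mono intro: eq')
  then have "(a' \<longlongrightarrow> a 0) (at_right 0)" by (rule tendsto_cong[THEN iffD1, OF _ lim[OF ab]])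
  from tendsto_unique[OF _ this lim[OF ab']] show ?thesis by simp
qed

lemma infinitely_many_solutions:
  assumes f: "\<And>x \<alpha>. norm x = 1 \<Longrightarrow> f x $ \<alpha> = P \<alpha> x"
  shows "infinite {F. dirichlet_solution (ball 0 1) (\<lambda>x. level *\<^sub>R f x) F \<and> real_analytic_on (ball 0 1) F}"
proof -
  define S where "S = {c. \<exists>a b. profile a b \<and> a 0 = c \<and> a 1 = level}"
  have "\<forall>c\<in>S. \<exists>ab. profile (fst ab) (snd ab) \<and> fst ab 0 = c \<and> fst ab 1 = level" by (auto simp: S_def)
  from bchoice[OF this] obtain ab where ab: "\<And>c. c \<in> S \<Longrightarrow> profile (fst (ab c)) (snd (ab c))"
    "\<And>c. c \<in> S \<Longrightarrow> fst (ab c) 0 = c" "\<And>c. c \<in> S \<Longrightarrow> fst (ab c) 1 = level" by blast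
  \<comment> \<open>Restriction to the closed ball gives the extensional representative, so distinct
    initial values lead to distinct functions.\<close>
  define \<Phi> where "\<Phi> c = restrict (\<lambda>x. \<chi> \<alpha>. fst (ab c) (x \<bullet> x) * P \<alpha> x) (cball 0 1)" for c
  have "inj_on \<Phi> S"
  proof (rule inj_onI)
    fix c d assume cd: "c \<in> S" "d \<in> S" "\<Phi> c = \<Phi> d"
    have "fst (ab c) 0 = fst (ab d) 0"
    proof (rule profile_determined[OF ab(1)[OF cd(1)] ab(1)[OF cd(2)]])
      fix x :: "real^'a" assume "x \<in> cball 0 1"
      then show "(\<chi> \<alpha>. fst (ab c) (x \<bullet> x) * P \<alpha> x) = (\<chi> \<alpha>. fst (ab d) (x \<bullet> x) * P \<alpha> x)"
        using fun_cong[OF cd(3), of x] by (simp add: \<Phi>_def)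
    qed
    then show "c = d" using ab(2) cd by simp
  qed
  moreover have "infinite S" unfolding S_def by (rule infinitely_many_profiles)
  ultimately have "infinite (\<Phi> ` S)" by (simp add: finite_image_iff)
  moreover have "\<Phi> ` S \<subseteq> {F. dirichlet_solution (ball 0 1) (\<lambda>x. level *\<^sub>R f x) F \<and> real_analytic_on (ball 0 1) F}"
  proof (rule image_subsetI)
    fix c assume c: "c \<in> S"
    interpret lo_profile p k L P "fst (ab c)" "snd (ab c)" by unfold_locales (rule ab(1)[OF c])
    have "\<Phi> c = restrict Fmap (cball 0 1)" by (rule ext) (simp add: \<Phi>_def Fmap_def restrict_def)
    then show "\<Phi> c \<in> {F. dirichlet_solution (ball 0 1) (\<lambda>x. level *\<^sub>R f x) F \<and> real_analytic_on (ball 0 1) F}"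
      using Fmap_dirichlet_solution[OF f] Fmap_real_analytic by (simp add: ab(3)[OF c])
  qed
  ultimately show ?thesis by (rule infinite_super[rotated])
qed

end

text \<open>The harmonic polynomials behind the components are homogeneous, so the equation for the
  norm on the sphere extends to all \<open>x\<close> with the factor
  \<open>(x \<bullet> x) ^ k\<close>.\<close>

lemma harmonic_sphere_map_exists:
  fixes f :: "real^'a::finite \<Rightarrow> real^'b::finite"
  assumes harm: "\<And>\<alpha>. spherical_harmonic k (\<lambda>x. f x $ \<alpha>)" and im: "f ` sphere 0 1 \<subseteq> sphere 0 1" and k: "4 \<le> k"
  shows "\<exists>P. harmonic_sphere_map P k \<and> (\<forall>x \<alpha>. norm x = 1 \<longrightarrow> f x $ \<alpha> = P \<alpha> x)"
proof -
  have "\<forall>\<alpha>. \<exists>P. real_polynomial_function P \<and> (\<forall>s x. P (s *\<^sub>R x) = s ^ k * P x) \<and>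
        (\<forall>x. laplacian P x = 0) \<and> (\<forall>x. norm x = 1 \<longrightarrow> f x $ \<alpha> = P x)"
    using harm by (simp add: spherical_harmonic_def Ball_def)
  from choice[OF this] obtain P where P: "\<And>\<alpha>. real_polynomial_function (P \<alpha>)"
    "\<And>\<alpha> s x. P \<alpha> (s *\<^sub>R x) = s ^ k * P \<alpha> x" "\<And>\<alpha> x. laplacian (P \<alpha>) x = 0"
    "\<And>\<alpha> x. norm x = 1 \<Longrightarrow> f x $ \<alpha> = P \<alpha> x" by blast
  have "(\<Sum>\<alpha>\<in>UNIV. (P \<alpha> x)\<^sup>2) = (x \<bullet> x) ^ k" for x
  proof (cases "x = 0")
    case True
    have "P \<alpha> 0 = 0" for \<alpha> using P(2)[of \<alpha> 0 0] k by (simp add: power_0_left)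
    then show ?thesis using True k by (simp add: power_0_left)
  next
    case False
    then have n: "norm (sgn x) = 1" by (simp add: norm_sgn)
    have "f (sgn x) \<in> sphere 0 1" using im n by (metis dist_0_norm image_subset_iff mem_sphere)
    then have "f (sgn x) \<bullet> f (sgn x) = 1" by (simp add: dot_square_norm)
    then have 1: "(\<Sum>\<alpha>\<in>UNIV. (P \<alpha> (sgn x))\<^sup>2) = 1" using P(4)[OF n] by (simp add: inner_vec_def power2_eq_square)
    have "P \<alpha> x = norm x ^ k * P \<alpha> (sgn x)" for \<alpha>
      using P(2)[of \<alpha> "norm x" "sgn x"] False by (simp add: sgn_div_norm)
    then have "(\<Sum>\<alpha>\<in>UNIV. (P \<alpha> x)\<^sup>2) = (norm x ^ k)\<^sup>2 * (\<Sum>\<alpha>\<in>UNIV. (P \<alpha> (sgn x))\<^sup>2)"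
      by (simp add: power_mult_distrib sum_distrib_left)
    then show ?thesis using 1 by (simp add: dot_square_norm power_mult[symmetric] mult.commute)
  qed
  then have "harmonic_sphere_map P k"
    using P(1-3) k by unfold_locales (auto simp: laplacian_partial)
  then show ?thesis using P(4) by blast
qed

text \<open>The trace of the Gram matrix at \<open>u\<close> is computed twice, from its eigenvalues
  and from harmonicity. With \<open>CARD('a) = n + 1\<close> the comparison forces
  \<open>p * L = k * (k + n - 1)\<close>, which is the value of the singular value.\<close>

lemma (in harmonic_sphere_map) adapted_frame_trace:
  assumes af: "adapted_frame P L p u \<beta> i0 I" and u: "norm u = 1"
  shows "(real k)\<^sup>2 + real p * L = real k * (2 * real k + real CARD('a) - 2)"
proof -
  define G :: "real^'a^'a" where "G = (\<chi> i j. hess i j u)"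
  have fr: "orthonormal_frame \<beta>" "\<beta> i0 = u" "i0 \<notin> I" "card I = p" using af by (simp_all add: adapted_frame_def)
  have uu: "u \<bullet> u = 1" using u by (simp add: dot_square_norm)
  have n: "\<beta> l \<bullet> \<beta> l = 1" for l using fr(1) by (simp add: orthonormal_frame_def)
  have G0: "G *v \<beta> i0 = (real k)\<^sup>2 *\<^sub>R \<beta> i0"
    using hess_x[of _ u] by (simp add: G_def matrix_vector_mult_def vec_eq_iff fr(2) uu)
  have G1: "G *v \<beta> l = L *\<^sub>R \<beta> l" if "l \<in> I" for l
    using af that by (simp add: G_def matrix_vector_mult_def vec_eq_iff adapted_frame_def)
  have G2: "G *v \<beta> l = 0" if l: "l \<notin> I" "l \<noteq> i0" for l
  proof -
    have "(\<Sum>i\<in>UNIV. hess j i u * \<beta> l $ i) = (\<Sum>\<alpha>\<in>UNIV. dP j \<alpha> u * (\<Sum>i\<in>UNIV. \<beta> l $ i * dP i \<alpha> u))" for j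
      unfolding hess_def sum_distrib_right sum_distrib_left by (subst sum.swap) (simp add: mult_ac)
    then show ?thesis using af l by (simp add: G_def matrix_vector_mult_def vec_eq_iff adapted_frame_def)
  qed
  have "(\<Sum>l\<in>UNIV. \<beta> l \<bullet> (G *v \<beta> l)) = (\<Sum>l\<in>insert i0 I. \<beta> l \<bullet> (G *v \<beta> l))"
    by (rule sum.mono_neutral_right) (auto simp: G2)
  also have "\<dots> = (real k)\<^sup>2 + (\<Sum>l\<in>I. \<beta> l \<bullet> (G *v \<beta> l))"
    using fr(3) by (simp add: G0 n)
  also have "(\<Sum>l\<in>I. \<beta> l \<bullet> (G *v \<beta> l)) = (\<Sum>l\<in>I. L)" by (rule sum.cong) (simp_all add: G1 n)
  finally have "trace G = (real k)\<^sup>2 + real p * L" using frame_trace[OF fr(1), of G] fr(4) by simp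
  moreover have "trace G = (\<Sum>i\<in>UNIV. hess i i u)" by (simp add: trace_def G_def)
  ultimately show ?thesis using trace_hess[of u] uu by simp
qed

lemma lawson_osserman_of_LOMSE:
  fixes f :: "real^'a::finite \<Rightarrow> real^'b::finite"
  assumes card: "CARD('a) = n + 1" and f: "LOMSE_of_type n p k f"
    and type: "(n = 3 \<and> p = 2 \<and> k \<ge> 4) \<or> (n = 5 \<and> p = 4 \<and> k \<ge> 6)"
  shows "\<exists>L P. lawson_osserman p k L P \<and> (\<forall>x \<alpha>. norm x = 1 \<longrightarrow> f x $ \<alpha> = P \<alpha> x)"
proof -
  have n: "n = p + 1" and k: "4 \<le> k" and p: "p = 2 \<or> p = 4" using type by auto
  have im: "f ` sphere 0 1 \<subseteq> sphere 0 1"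
    using f by (simp add: LOMSE_of_type_def LOMSE_def LOM_def smooth_sphere_map_def)
  have sh: "spherical_harmonic k (\<lambda>x. f x $ \<alpha>)" for \<alpha> using f by (simp add: LOMSE_of_type_def)
  obtain P where hs: "harmonic_sphere_map P k" and P: "\<And>x \<alpha>. norm x = 1 \<Longrightarrow> f x $ \<alpha> = P \<alpha> x"
    using harmonic_sphere_map_exists[OF sh im k] by blast
  interpret harmonic_sphere_map P k by (rule hs)
  obtain \<sigma> where \<sigma>: "\<And>x. norm x = 1 \<Longrightarrow> singular_values f x - {0} = {\<sigma>}"
      "\<And>x. norm x = 1 \<Longrightarrow> dim (singular_space f x \<sigma>) = p"
    using f by (auto simp: LOMSE_of_type_def)
  define L where "L = \<sigma>\<^sup>2"
  have frame: "\<exists>\<beta> i0 I. adapted_frame P L p u \<beta> i0 I" if "norm u = 1" for u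
    using adapted_frame_exists[OF P that \<sigma>(1)[OF that]] \<sigma>(2)[OF that] by (simp add: L_def)
  define u :: "real^'a" where "u = axis undefined 1"
  have u: "norm u = 1" by (simp add: u_def)
  obtain \<beta> i0 I where "adapted_frame P L p u \<beta> i0 I" using frame[OF u] by blast
  from adapted_frame_trace[OF this u] have pL: "real p * L = real k * (real k + real p)"
    unfolding card n by (simp add: algebra_simps power2_eq_square)
  \<comment> \<open>For \<open>p = 2\<close> the inequality means \<open>p * L > 9\<close>, for
    \<open>p = 4\<close> it means \<open>p * L > 50\<close>. By \<open>pL\<close> the hypotheses on
    \<open>k\<close> make \<open>p * L\<close> at least 24 and 60, respectively.\<close>
  have disc: "(real p + 2)\<^sup>2 < 8 * (real p + 1) * (1 - (real p + 1) / (real p * L))"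
    using type
  proof (elim disjE conjE)
    assume h: "p = 2" "k \<ge> 4"
    have "4 * 6 \<le> real k * (real k + real p)" using h by (intro mult_mono) auto
    then show ?thesis unfolding pL using h by (simp add: field_simps)
  next
    assume h: "p = 4" "k \<ge> 6"
    have "6 * 10 \<le> real k * (real k + real p)" using h by (intro mult_mono) auto
    then show ?thesis unfolding pL using h by (simp add: field_simps)
  qed
  have "lawson_osserman p k L P"
    using p k pL disc frame card n by unfold_locales auto
  then show ?thesis using P by blast
qed

theorem corollary3p6:
  fixes f :: "real^'a::finite \<Rightarrow> real^'b::finite"
    and n m p k :: nat
    and lam phi0 :: real
  assumes dim_domain: "CARD('a) = n + 1"
    and dim_codomain: "CARD('b) = m + 1"
    and LOMSE: "LOMSE_of_type n p k f"
    and type: "(n = 3 \<and> p = 2 \<and> k \<ge> 4) \<or> (n = 5 \<and> p = 4 \<and> k \<ge> 6)"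
    and lam: "lam = sqrt (real k * (real k + real n - 1) / real p)"
    and phi0: "phi0 = sqrt ((real p - real n * lam powi (-2)) / (real n - real p))"
  shows "infinite {F. dirichlet_solution (ball 0 1) (\<lambda>x. phi0 *\<^sub>R f x) F \<and>
                      real_analytic_on (ball 0 1) F}"
proof -
  obtain L P where lo: "lawson_osserman p k L P" and P: "\<And>x \<alpha>. norm x = 1 \<Longrightarrow> f x $ \<alpha> = P \<alpha> x"
    using lawson_osserman_of_LOMSE[OF dim_domain LOMSE type] by blast
  interpret lawson_osserman p k L P by (rule lo)
  have n: "real n = real p + 1" using type by auto
  \<comment> \<open>The constant \<open>L\<close> found from the singular values is
    \<open>lam\<^sup>2\<close> by \<open>pL\<close>; as \<open>n - p = 1\<close>, the formula for
    \<open>phi0\<close> becomes that of \<open>level\<close>.\<close>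
  have "lam = sqrt L" using pL p_pos unfolding lam n by (simp add: field_simps)
  then have "lam powi (-2) = 1 / L" using L_ge by (simp add: power_int_def inverse_eq_divide power_one_over)
  then have "phi0 = level" unfolding phi0 n level_def by simp
  then show ?thesis using infinitely_many_solutions[OF P] by simp
qed

end
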